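(* Let $1 < q < \infty$, $q \neq 2$, $s \in \mathbb{R}$, $0 \leq \delta \leq \rho \leq 1$, $0 \leq \delta, \alpha < 1$ and $\alpha \leq \rho$. Then all pseudodifferential operators with symbols in $S_{\rho,\delta}^0$ are bounded on $M_{2,q}^{s,\alpha}(\mathbb{R}^n)$ if and only if $\delta \leq \alpha$.
   Context: Notation: $\langle x\rangle = 1+|x|$ for $x\in\mathbb{R}^n$. $\mathcal{S}=\mathcal{S}(\mathbb{R}^n)$ is the Schwartz space, $\mathcal{S}'=\mathcal{S}'(\mathbb{R}^n)$ the space of tempered distributions; $\mathcal{F}f(\xi)=\widehat f(\xi)=\int_{\mathbb{R}^n} e^{-i\xi\cdot x}f(x)\,dx$ and $\mathcal{F}^{-1}f(x)=(2\pi)^{-n}\int_{\mathbb{R}^n}e^{ix\cdot\xi}f(\xi)\,d\xi$. For a function $m$, the Fourier multiplier is $m(D)f=\mathcal{F}^{-1}[m\cdot\mathcal{F}f]$. Symbol class: for $b\in\mathbb{R}$ and $0\le\delta\le\rho\le1$, $S^b_{\rho,\delta}$ is the set of all $\sigma\in C^\infty(\mathbb{R}^n\times\mathbb{R}^n)$ such that for all multi-indices $\beta,\gamma\in\mathbb{Z}_+^n$ there is a constant $C_{\beta,\gamma}$ with $|\partial_x^\beta\partial_\xi^\gamma\sigma(x,\xi)|\le C_{\beta,\gamma}\langle\xi\rangle^{b+\delta|\beta|-\rho|\gamma|}$ for all $x,\xi$. The pseudodifferential operator with symbol $\sigma$ is $\sigma(X,D)f(x)=(2\pi)^{-n}\int_{\mathbb{R}^n}e^{ix\cdot\xi}\sigma(x,\xi)\widehat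 f(\xi)\,d\xi$ for $f\in\mathcal{S}(\mathbb{R}^n)$. $\alpha$-modulation spaces ($0\le\alpha<1$): let $C>1$ be a suitable constant depending on $n$ and $\alpha$, and let $\{\eta_k^\alpha\}_{k\in\mathbb{Z}^n}$ be a sequence of Schwartz functions such that (i) $\mathrm{supp}\,\eta_k^\alpha\subset\{\xi\in\mathbb{R}^n:|\xi-\langle k\rangle^{\alpha/(1-\alpha)}k|\le C\langle k\rangle^{\alpha/(1-\alpha)}\}$; (ii) for every multi-index $\beta$ there is a constant $C'_\beta$ with $|\partial_\xi^\beta\eta_k^\alpha(\xi)|\le C'_\beta\langle k\rangle^{-|\beta|\alpha/(1-\alpha)}$ for all $k,\xi$; (iii) $\sum_{k\in\mathbb{Z}^n}\eta_k^\alpha(\xi)=1$ for all $\xi\in\mathbb{R}^n$. For $0<p,q\le\infty$ and $s\in\mathbb{R}$, $M_{p,q}^{s,\alpha}(\mathbb{R}^n)$ is the set of $f\in\mathcal{S}'(\mathbb{R}^n)$ with $\|f\|_{M_{p,q}^{s,\alpha}}=\big\|\langle k\rangle^{s/(1-\alpha)}\|\eta_k^\alpha(D)f\|_{L^p}\big\|_{\ell^q(\mathbb{Z}^n_k)}<\infty$. Different admissible choices of $\{\eta_k^\alpha\}$ give equivalent (quasi-)norms. Boundedness convention: $\sigma(X,D)$ is said to be bounded on $M_{p,q}^{s,\alpha}$ if there is a constant $C_\sigma$ such that $\|\sigma(X,D)f\|_{M_{p,q}^{s,\alpha}}\le C_\sigma\|f\|_{M_{p,q}^{s,\alpha}}$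 for all $f\in\mathcal{S}(\mathbb{R}^n)$. *)

theory Defs
  imports "HOL-Probability.Essential_Supremum"
begin

definition bracket :: "real ^ 'n \<Rightarrow> real"  (* 1 + |x|, not the square root of 1 + |x|^2 *)
  where "bracket x = 1 + norm x"

definition int_vec :: "int ^ 'n \<Rightarrow> real ^ 'n"
  where "int_vec k = (\<chi> i. real_of_int (k $ i))"


subsection \<open>Smooth functions and multi-index derivatives\<close>

definition dir_deriv ::
    "'a::real_normed_vector \<Rightarrow> ('a \<Rightarrow> 'b::real_normed_vector) \<Rightarrow> 'a \<Rightarrow> 'b"
  where "dir_deriv v f = (\<lambda>x. frechet_derivative f (at x) v)"

primrec C_k :: "nat \<Rightarrow> ('a::euclidean_space \<Rightarrow> 'b::real_normed_vector) \<Rightarrow> bool" where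
  "C_k 0 f \<longleftrightarrow> continuous_on UNIV f"
| "C_k (Suc m) f \<longleftrightarrow> f differentiable_on UNIV \<and> (\<forall>b\<in>Basis. C_k m (dir_deriv b f))"

definition smooth :: "('a::euclidean_space \<Rightarrow> 'b::real_normed_vector) \<Rightarrow> bool"
  where "smooth f \<longleftrightarrow> (\<forall>m. C_k m f)"

text \<open>
  Partial derivatives of a multi-index are taken in the order of an arbitrary but fixed
  enumeration of the coordinates; for smooth functions this order is immaterial.
\<close>

definition index_list :: "'n::finite list"
  where "index_list = (SOME xs. distinct xs \<and> set xs = UNIV)"

lemma index_list: "distinct (index_list :: 'n::finite list)" "set (index_list :: 'n list) = UNIV"
proof -
  have "\<exists>xs :: 'n list. distinct xs \<and> set xs = UNIV"
    using finite_distinct_list[of "UNIV :: 'n set"] by auto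
  then have "distinct (index_list :: 'n list) \<and> set (index_list :: 'n list) = UNIV"
    unfolding index_list_def by (rule someI_ex)
  then show "distinct (index_list :: 'n list)" "set (index_list :: 'n list) = UNIV"
    by auto
qed

definition multi_size :: "nat ^ 'n \<Rightarrow> nat"
  where "multi_size \<beta> = (\<Sum>i\<in>UNIV. \<beta> $ i)"

text \<open>The \<open>i\<close>-th coordinate direction is \<open>e i\<close>, so that the derivatives in only one of the two
  variables of a function on a product space are covered as well.\<close>

definition multi_deriv ::
    "('n::finite \<Rightarrow> 'a::real_normed_vector) \<Rightarrow> nat ^ 'n \<Rightarrow> ('a \<Rightarrow> complex) \<Rightarrow> 'a \<Rightarrow> complex"
  where "multi_deriv e \<beta> f = foldr (\<lambda>i. dir_deriv (e i) ^^ (\<beta> $ i)) index_list f"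

definition pderivs :: "nat ^ 'n \<Rightarrow> (real ^ 'n \<Rightarrow> complex) \<Rightarrow> real ^ 'n \<Rightarrow> complex"
  where "pderivs = multi_deriv (\<lambda>i. axis i 1)"

definition pderivs_fst ::
    "nat ^ 'n \<Rightarrow> ((real ^ 'n) \<times> (real ^ 'n) \<Rightarrow> complex) \<Rightarrow> (real ^ 'n) \<times> (real ^ 'n) \<Rightarrow> complex"
  where "pderivs_fst = multi_deriv (\<lambda>i. (axis i 1, 0))"

definition pderivs_snd ::
    "nat ^ 'n \<Rightarrow> ((real ^ 'n) \<times> (real ^ 'n) \<Rightarrow> complex) \<Rightarrow> (real ^ 'n) \<times> (real ^ 'n) \<Rightarrow> complex"
  where "pderivs_snd = multi_deriv (\<lambda>i. (0, axis i 1))"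


subsection \<open>Schwartz functions and tempered distributions\<close>

definition schwartz :: "(real ^ 'n \<Rightarrow> complex) set"
  where "schwartz = {f. smooth f \<and>
    (\<forall>(N::nat) \<beta>. \<exists>C. \<forall>x. bracket x ^ N * norm (pderivs \<beta> f x) \<le> C)}"

definition schwartz_seminorm :: "nat \<Rightarrow> nat ^ 'n \<Rightarrow> (real ^ 'n \<Rightarrow> complex) \<Rightarrow> real"
  where "schwartz_seminorm N \<beta> f = (SUP x. bracket x ^ N * norm (pderivs \<beta> f x))"

text \<open>
  A distribution is a functional on all functions of which only the values on Schwartz functions
  matter. The topology of the Schwartz space is metrizable, so continuity of a linear functional
  is sequential continuity at 0.
\<close>

type_synonym 'n distribution = "(real ^ 'n \<Rightarrow> complex) \<Rightarrow> complex"

definition tempered :: "'n::finite distribution set"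
  where "tempered = {u.
    (\<forall>\<phi>\<in>schwartz. \<forall>\<psi>\<in>schwartz. u (\<lambda>x. \<phi> x + \<psi> x) = u \<phi> + u \<psi>) \<and>
    (\<forall>\<phi>\<in>schwartz. \<forall>c. u (\<lambda>x. c * \<phi> x) = c * u \<phi>) \<and>
    (\<forall>\<phi>::nat \<Rightarrow> real ^ 'n \<Rightarrow> complex. (\<forall>j. \<phi> j \<in> schwartz) \<longrightarrow>
       (\<forall>N \<beta>. (\<lambda>j. schwartz_seminorm N \<beta> (\<phi> j)) \<longlonglongrightarrow> 0) \<longrightarrow>
       (\<lambda>j. u (\<phi> j)) \<longlonglongrightarrow> 0)}"

definition distr_of :: "(real ^ 'n \<Rightarrow> complex) \<Rightarrow> 'n::finite distribution"
  where "distr_of g = (\<lambda>\<phi>. \<integral>x. g x * \<phi> x \<partial>lborel)"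

definition represents :: "(real ^ 'n \<Rightarrow> complex) \<Rightarrow> 'n::finite distribution \<Rightarrow> bool"
  where "represents g u \<longleftrightarrow> g \<in> borel_measurable lborel \<and>
    (\<forall>\<phi>\<in>schwartz. integrable lborel (\<lambda>x. g x * \<phi> x) \<and> u \<phi> = distr_of g \<phi>)"


subsection \<open>Fourier transform, multipliers and pseudodifferential operators\<close>

definition fourier :: "(real ^ 'n::finite \<Rightarrow> complex) \<Rightarrow> real ^ 'n \<Rightarrow> complex"
  where "fourier f \<xi> = (\<integral>x. exp (- \<i> * complex_of_real (\<xi> \<bullet> x)) * f x \<partial>lborel)"

definition inv_fourier :: "(real ^ 'n::finite \<Rightarrow> complex) \<Rightarrow> real ^ 'n \<Rightarrow> complex"
  where "inv_fourier f x = complex_of_real (1 / (2 * pi) ^ CARD('n)) *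
    (\<integral>\<xi>. exp (\<i> * complex_of_real (x \<bullet> \<xi>)) * f \<xi> \<partial>lborel)"

definition fourier_distr :: "'n::finite distribution \<Rightarrow> 'n distribution"
  where "fourier_distr u = (\<lambda>\<phi>. u (fourier \<phi>))"

definition inv_fourier_distr :: "'n::finite distribution \<Rightarrow> 'n distribution"
  where "inv_fourier_distr u = (\<lambda>\<phi>. u (inv_fourier \<phi>))"

definition mult_distr ::
    "(real ^ 'n \<Rightarrow> complex) \<Rightarrow> 'n::finite distribution \<Rightarrow> 'n distribution"
  where "mult_distr m u = (\<lambda>\<phi>. u (\<lambda>x. m x * \<phi> x))"

definition multiplier ::
    "(real ^ 'n \<Rightarrow> complex) \<Rightarrow> 'n::finite distribution \<Rightarrow> 'n distribution"
  where "multiplier m u = inv_fourier_distr (mult_distr m (fourier_distr u))"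

definition symbol_class ::
    "real \<Rightarrow> real \<Rightarrow> real \<Rightarrow> ((real ^ 'n) \<times> (real ^ 'n) \<Rightarrow> complex) set"
  where "symbol_class b \<rho> \<delta> = {\<sigma>. smooth \<sigma> \<and>
    (\<forall>\<beta> \<gamma>. \<exists>C. \<forall>x \<xi>. norm (pderivs_fst \<beta> (pderivs_snd \<gamma> \<sigma>) (x, \<xi>))
       \<le> C * bracket \<xi> powr (b + \<delta> * real (multi_size \<beta>) - \<rho> * real (multi_size \<gamma>)))}"

definition pdo ::
    "((real ^ 'n) \<times> (real ^ 'n) \<Rightarrow> complex) \<Rightarrow> (real ^ 'n::finite \<Rightarrow> complex) \<Rightarrow> real ^ 'n \<Rightarrow> complex"
  where "pdo \<sigma> f x = complex_of_real (1 / (2 * pi) ^ CARD('n)) *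
    (\<integral>\<xi>. exp (\<i> * complex_of_real (x \<bullet> \<xi>)) * \<sigma> (x, \<xi>) * fourier f \<xi> \<partial>lborel)"


subsection \<open>\<open>\<alpha>\<close>-modulation spaces\<close>

definition ennreal_powr :: "ennreal \<Rightarrow> real \<Rightarrow> ennreal"  (* used for positive exponents only *)
  where "ennreal_powr x r = (if x = \<infinity> then \<infinity> else ennreal (enn2real x powr r))"

text \<open>Over a counting measure this is the \<open>\<ell>\<^sup>p\<close> (quasi-)norm.\<close>

definition Lp_norm :: "'a measure \<Rightarrow> ennreal \<Rightarrow> ('a \<Rightarrow> ennreal) \<Rightarrow> ennreal"
  where "Lp_norm M p g =
    (if p = \<infinity> then esssup M g
     else ennreal_powr (\<integral>\<^sup>+x. ennreal_powr (g x) (enn2real p) \<partial>M) (1 / enn2real p))"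

text \<open>The representing function is unique almost everywhere, so that the infimum is merely
  the norm of that function; it is \<open>\<infinity>\<close> if the distribution is not a function.\<close>

definition distr_Lp_norm :: "ennreal \<Rightarrow> 'n::finite distribution \<Rightarrow> ennreal"
  where "distr_Lp_norm p u = (INF g\<in>{g. represents g u}. Lp_norm lborel p (\<lambda>x. ennreal (norm (g x))))"

definition alpha_partition ::
    "real \<Rightarrow> real \<Rightarrow> (int ^ 'n::finite \<Rightarrow> real ^ 'n \<Rightarrow> complex) \<Rightarrow> bool"
  where "alpha_partition \<alpha> C \<eta> \<longleftrightarrow>
    (\<forall>k. \<eta> k \<in> schwartz) \<and>
    (\<forall>k. closure {\<xi>. \<eta> k \<xi> \<noteq> 0} \<subseteq>
       {\<xi>. norm (\<xi> - bracket (int_vec k) powr (\<alpha> / (1 - \<alpha>)) *\<^sub>R int_vec k)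
            \<le> C * bracket (int_vec k) powr (\<alpha> / (1 - \<alpha>))}) \<and>
    (\<forall>\<beta>. \<exists>C'. \<forall>k \<xi>. norm (pderivs \<beta> (\<eta> k) \<xi>)
       \<le> C' * bracket (int_vec k) powr (- real (multi_size \<beta>) * \<alpha> / (1 - \<alpha>))) \<and>
    (\<forall>\<xi>. ((\<lambda>k. \<eta> k \<xi>) has_sum 1) UNIV)"

text \<open>
  The (quasi-)norm of the \<open>\<alpha>\<close>-modulation space computed with the partition \<open>\<eta>\<close>. The space itself
  consists of the distributions of finite norm, whence the value \<open>\<infinity>\<close> off the tempered ones.
\<close>

definition alpha_mod_norm ::
    "(int ^ 'n \<Rightarrow> real ^ 'n \<Rightarrow> complex) \<Rightarrow> real \<Rightarrow> ennreal \<Rightarrow> ennreal \<Rightarrow> real \<Rightarrow>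
     'n::finite distribution \<Rightarrow> ennreal"
  where "alpha_mod_norm \<eta> \<alpha> p q s u =
    (if u \<in> tempered then
       Lp_norm (count_space UNIV) q
         (\<lambda>k. ennreal (bracket (int_vec k) powr (s / (1 - \<alpha>))) * distr_Lp_norm p (multiplier (\<eta> k) u))
     else \<infinity>)"

definition pdo_bounded ::
    "(int ^ 'n \<Rightarrow> real ^ 'n \<Rightarrow> complex) \<Rightarrow> real \<Rightarrow> ennreal \<Rightarrow> ennreal \<Rightarrow> real \<Rightarrow>
     ((real ^ 'n) \<times> (real ^ 'n::finite) \<Rightarrow> complex) \<Rightarrow> bool"
  where "pdo_bounded \<eta> \<alpha> p q s \<sigma> \<longleftrightarrow>
    (\<exists>C::real. \<forall>f\<in>schwartz. alpha_mod_norm \<eta> \<alpha> p q s (distr_of (pdo \<sigma> f))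
       \<le> ennreal C * alpha_mod_norm \<eta> \<alpha> p q s (distr_of f))"

end

theory Submission
  imports Defs "HOL-Probability.Characteristic_Functions" "HOL-Analysis.Ball_Volume"
begin

text \<open>
  \<^emph>\<open>Sufficiency.\<close> For \<open>\<delta> \<le> \<alpha> \<le> \<rho>\<close> a symbol localised by \<open>\<eta>\<^sub>j\<close> has derivative bounds at the scale of the
  radius \<open>r\<^sub>j\<close> of the \<open>j\<close>-th ball of the covering: a derivative in \<open>x\<close> costs \<open>r\<^sub>j\<close> and one in \<open>\<xi>\<close> gains
  \<open>r\<^sub>j\<close>. Its kernel is therefore dominated by a function with integral independent of \<open>j\<close>, which gives
  uniform boundedness on \<open>L\<^sup>2\<close>; the bounds in \<open>x\<close> moreover confine the Fourier transform of the output to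
  a neighbourhood of the \<open>j\<close>-th ball. Hence the pieces are mapped almost diagonally, with a decay
  faster than any power of \<open>|k - j|\<close>, and Young's inequality on the weighted \<open>\<ell>\<^sup>q\<close> space applies.

  \<^emph>\<open>Necessity.\<close> If \<open>\<alpha> < \<delta>\<close>, take a symbol that near the frequency \<open>R\<^sub>l = 4\<^sup>l\<^sup>+\<^sup>l\<^sup>0\<close> is the multiplication
  by a normalised Rudin--Shapiro polynomial with \<open>M \<approx> R\<^sub>l\<^sup>\<delta>\<^sup>-\<^sup>\<alpha>\<close> frequencies at distance \<open>\<kappa> R\<^sub>l\<^sup>\<alpha>\<close>. It is
  bounded uniformly in \<open>M\<close>, and it turns one bump into \<open>M\<close> bumps of size \<open>M\<^sup>-\<^sup>1\<^sup>/\<^sup>2\<close> that lie in different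
  balls, so that the norm grows by the factor \<open>M\<^sup>1\<^sup>/\<^sup>q\<^sup>-\<^sup>1\<^sup>/\<^sup>2\<close>, which is unbounded for \<open>q < 2\<close>. For \<open>q > 2\<close>
  the complex conjugate of the polynomial reassembles the \<open>M\<close> bumps into one.
\<close>

subsection \<open>Smooth functions\<close>

text \<open>A bound may depend on the symbol, so separate bad symbols for each M would still call
  for a uniform boundedness principle. Instead one symbol carries every scale: the frequencies R_l
  are so sparse that the pieces have disjoint frequency supports, and a single constant has to serve
  all M. The Rudin-Shapiro coefficients all have modulus M^(-1/2), yet the polynomial stays bounded,
  and a derivative costs no more than its highest frequency M \<kappa> R^\<alpha>, which is of the
  size R^\<delta>; this is the loss that the symbol class permits in x. For large R the spread
  R^\<delta> fits into a ball about R e of radius proportional to R, because \<delta> < 1.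

  In the positive direction the obstacle is that the image of a Schwartz function is at first only a
  bounded function. Finite sums of localised operators do map into the Schwartz space, where
  Plancherel's theorem is available; their estimates do not depend on the number of terms and pass
  to the limit by Fatou's lemma. All bounds must be uniform over infinitely many balls or scales, so
  they are stated for families with a common constant.\<close>

lemma C_k_Suc_imp: "C_k (Suc m) f \<Longrightarrow> C_k m f"
proof (induction m arbitrary: f)
  case 0
  then show ?case by (simp add: differentiable_imp_continuous_on)
next
  case (Suc m)
  then show ?case by (metis C_k.simps(2))
qed

lemma smooth_iff: "smooth f \<longleftrightarrow> f differentiable_on UNIV \<and> (\<forall>b\<in>Basis. smooth (dir_deriv b f))"
proof
  assume f: "smooth f"
  then have "C_k (Suc m) f" for m unfolding smooth_def by blast
  then show "f differentiable_on UNIV \<and> (\<forall>b\<in>Basis. smooth (dir_deriv b f))"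
    unfolding smooth_def by simp
next
  assume f: "f differentiable_on UNIV \<and> (\<forall>b\<in>Basis. smooth (dir_deriv b f))"
  have "C_k m f" for m
  proof (cases m)
    case 0
    then show ?thesis using f by (simp add: differentiable_imp_continuous_on)
  next
    case (Suc n)
    then show ?thesis using f by (simp add: smooth_def)
  qed
  then show "smooth f" unfolding smooth_def by blast
qed

lemma smooth_coinduct:
  assumes "f \<in> X"
    and "\<And>f. f \<in> X \<Longrightarrow> f differentiable_on UNIV"
    and "\<And>f b. f \<in> X \<Longrightarrow> b \<in> Basis \<Longrightarrow> dir_deriv b f \<in> X"
  shows "smooth f"
proof -
  have "\<forall>f\<in>X. C_k m f" for m
  proof (induction m)
    case 0
    then show ?case using assms(2) by (auto intro: differentiable_imp_continuous_on)
  next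
    case (Suc m)
    then show ?case using assms(2,3) by auto
  qed
  then show ?thesis using assms(1) unfolding smooth_def by blast
qed

lemma smooth_differentiable: "smooth f \<Longrightarrow> f differentiable (at x)"
  using smooth_iff differentiable_on_def by (metis UNIV_I)

lemma smooth_continuous: "smooth f \<Longrightarrow> continuous_on S f"
  using smooth_iff differentiable_imp_continuous_on continuous_on_subset by blast

lemma has_dir_deriv: "(f has_derivative f') (at x) \<Longrightarrow> dir_deriv v f x = f' v"
  unfolding dir_deriv_def by (metis frechet_derivative_at)

lemma smooth_has_derivative:
  "smooth f \<Longrightarrow> (f has_derivative (\<lambda>v. dir_deriv v f x)) (at x)"
  using smooth_differentiable[of f x] unfolding dir_deriv_def by (simp add: frechet_derivative_works)

lemma diff_has_derivative:
  "f differentiable_on UNIV \<Longrightarrow> (f has_derivative (\<lambda>v. dir_deriv v f x)) (at x)"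
  unfolding dir_deriv_def differentiable_on_def by (simp add: frechet_derivative_works)

lemma dir_deriv_eqI:
  assumes "\<And>x. (f has_derivative f' x) (at x)"
  shows "dir_deriv v f = (\<lambda>x. f' x v)"
  using has_dir_deriv[OF assms] by auto

lemma differentiable_onI: "(\<And>x. (f has_derivative f' x) (at x)) \<Longrightarrow> f differentiable_on UNIV"
  unfolding differentiable_on_def differentiable_def by auto

lemma C_k_differentiable: "C_k (Suc m) f \<Longrightarrow> (f has_derivative (\<lambda>v. dir_deriv v f x)) (at x)"
  using diff_has_derivative by auto

lemma C_k_const: "C_k m (\<lambda>x. c)"
proof (induction m arbitrary: c)
  case (Suc m)
  have "dir_deriv b (\<lambda>x. c) = (\<lambda>x. 0)" for b :: 'a
    by (rule dir_deriv_eqI) (auto intro: derivative_eq_intros)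
  then show ?case using Suc by simp
qed auto

lemma C_k_add: "C_k m f \<Longrightarrow> C_k m g \<Longrightarrow> C_k m (\<lambda>x. f x + g x)"
proof (induction m arbitrary: f g)
  case (Suc m)
  have d: "((\<lambda>x. f x + g x) has_derivative (\<lambda>v. dir_deriv v f x + dir_deriv v g x)) (at x)" for x
    using Suc.prems by (intro has_derivative_add C_k_differentiable)
  have "dir_deriv b (\<lambda>x. f x + g x) = (\<lambda>x. dir_deriv b f x + dir_deriv b g x)" for b
    by (rule dir_deriv_eqI[OF d])
  then show ?case using Suc differentiable_onI[OF d] by simp
qed (auto intro: continuous_intros)

lemma C_k_bounded_linear:
  assumes "bounded_linear h"
  shows "C_k m f \<Longrightarrow> C_k m (\<lambda>x. h (f x))"
proof (induction m arbitrary: f)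
  case 0
  then show ?case using assms bounded_linear.continuous_on by auto
next
  case (Suc m)
  have d: "((\<lambda>x. h (f x)) has_derivative (\<lambda>v. h (dir_deriv v f x))) (at x)" for x
    using Suc.prems by (intro bounded_linear.has_derivative[OF assms] C_k_differentiable)
  have "dir_deriv b (\<lambda>x. h (f x)) = (\<lambda>x. h (dir_deriv b f x))" for b
    by (rule dir_deriv_eqI[OF d])
  then show ?case using Suc differentiable_onI[OF d] by simp
qed

lemma C_k_mult:
  fixes f g :: "'a::euclidean_space \<Rightarrow> complex"
  shows "C_k m f \<Longrightarrow> C_k m g \<Longrightarrow> C_k m (\<lambda>x. f x * g x)"
proof (induction m arbitrary: f g)
  case (Suc m)
  have d: "((\<lambda>x. f x * g x) has_derivative (\<lambda>v. f x * dir_deriv v g x + dir_deriv v f x * g x)) (at x)" for x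
    using Suc.prems by (intro has_derivative_mult C_k_differentiable)
  have "dir_deriv b (\<lambda>x. f x * g x) = (\<lambda>x. f x * dir_deriv b g x + dir_deriv b f x * g x)" for b
    by (rule dir_deriv_eqI[OF d])
  moreover have "C_k m (\<lambda>x. f x * dir_deriv b g x + dir_deriv b f x * g x)" if "b \<in> Basis" for b
  proof (intro C_k_add Suc.IH)
    show "C_k m f" "C_k m g" by (rule C_k_Suc_imp, rule Suc.prems)+
  qed (use Suc.prems that in auto)
  ultimately show ?case using differentiable_onI[OF d] by simp
qed (auto intro: continuous_intros)

lemma C_k_sum: "finite I \<Longrightarrow> (\<And>i. i \<in> I \<Longrightarrow> C_k m (f i)) \<Longrightarrow> C_k m (\<lambda>x. \<Sum>i\<in>I. f i x)"
  by (induction I rule: finite_induct) (auto intro: C_k_add C_k_const)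

lemma C_k_affine:
  fixes f :: "'a::euclidean_space \<Rightarrow> 'b::real_normed_vector" and L :: "'c::euclidean_space \<Rightarrow> 'a"
  assumes L: "linear L"
  shows "C_k m f \<Longrightarrow> C_k m (\<lambda>x. f (L x + c))"
proof (induction m arbitrary: f)
  case 0
  then show ?case
    using L linear_continuous_on linear_conv_bounded_linear
    by (auto intro!: continuous_intros continuous_on_compose2[of UNIV f])
next
  case (Suc m)
  have lin: "linear (\<lambda>v. dir_deriv v f x)" for x
    using C_k_differentiable[OF Suc.prems] has_derivative_linear by blast
  have d: "((\<lambda>x. f (L x + c)) has_derivative (\<lambda>v. dir_deriv (L v) f (L x + c))) (at x)" for x
  proof -
    have "((\<lambda>x. L x + c) has_derivative L) (at x)"
      using has_derivative_add_const[OF linear_imp_has_derivative[OF L]] .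
    from has_derivative_compose[OF this C_k_differentiable[OF Suc.prems]] show ?thesis by simp
  qed
  \<comment> \<open>\<open>C_k\<close> speaks of basis directions only, and \<open>L b\<close> need
    not be one; so the direction is expanded in the basis.\<close>
  have "dir_deriv b (\<lambda>x. f (L x + c)) = (\<lambda>x. \<Sum>i\<in>Basis. (L b \<bullet> i) *\<^sub>R dir_deriv i f (L x + c))" for b
  proof -
    have "dir_deriv b (\<lambda>x. f (L x + c)) = (\<lambda>x. dir_deriv (L b) f (L x + c))"
      by (rule dir_deriv_eqI[OF d])
    also have "\<dots> = (\<lambda>x. \<Sum>i\<in>Basis. (L b \<bullet> i) *\<^sub>R dir_deriv i f (L x + c))"
    proof
      fix x
      have "dir_deriv (L b) f (L x + c) = dir_deriv (\<Sum>i\<in>Basis. (L b \<bullet> i) *\<^sub>R i) f (L x + c)"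
        by (simp add: euclidean_representation)
      also have "\<dots> = (\<Sum>i\<in>Basis. (L b \<bullet> i) *\<^sub>R dir_deriv i f (L x + c))"
        by (simp only: linear_sum[OF lin] linear_scale[OF lin])
      finally show "dir_deriv (L b) f (L x + c) = (\<Sum>i\<in>Basis. (L b \<bullet> i) *\<^sub>R dir_deriv i f (L x + c))" .
    qed
    finally show ?thesis .
  qed
  moreover have "C_k m (\<lambda>x. \<Sum>i\<in>Basis. (L b \<bullet> i) *\<^sub>R dir_deriv i f (L x + c))" for b
    using Suc by (intro C_k_sum C_k_bounded_linear[OF bounded_linear_scaleR_right]) auto
  ultimately show ?case using differentiable_onI[OF d] by simp
qed

lemma smooth_const: "smooth (\<lambda>x. c)"
  and smooth_add: "smooth f \<Longrightarrow> smooth g \<Longrightarrow> smooth (\<lambda>x. f x + g x)"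
  and smooth_bounded_linear: "bounded_linear h \<Longrightarrow> smooth f \<Longrightarrow> smooth (\<lambda>x. h (f x))"
  and smooth_sum: "finite I \<Longrightarrow> (\<And>i. i \<in> I \<Longrightarrow> smooth (F i)) \<Longrightarrow> smooth (\<lambda>x. \<Sum>i\<in>I. F i x)"
  and smooth_affine: "linear L \<Longrightarrow> smooth f \<Longrightarrow> smooth (\<lambda>x. f (L x + c'))"
  unfolding smooth_def by (auto intro: C_k_const C_k_add C_k_bounded_linear C_k_sum C_k_affine)

lemma smooth_mult:
  fixes f g :: "'a::euclidean_space \<Rightarrow> complex"
  shows "smooth f \<Longrightarrow> smooth g \<Longrightarrow> smooth (\<lambda>x. f x * g x)"
  unfolding smooth_def by (auto intro: C_k_mult)

lemma smooth_cmult: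
  fixes f :: "'a::euclidean_space \<Rightarrow> complex"
  shows "smooth f \<Longrightarrow> smooth (\<lambda>x. c * f x)"
  by (intro smooth_mult smooth_const)

lemma smooth_inner: "smooth (\<lambda>x::'a::euclidean_space. complex_of_real (x \<bullet> u - c))"
proof (rule smooth_coinduct[where X = "{\<lambda>x::'a. complex_of_real (x \<bullet> u - c)} \<union> range (\<lambda>c x. c)"])
  fix f :: "'a \<Rightarrow> complex" and b :: 'a
  assume f: "f \<in> {\<lambda>x. complex_of_real (x \<bullet> u - c)} \<union> range (\<lambda>c x. c)"
  have d: "((\<lambda>x. complex_of_real (x \<bullet> u - c)) has_derivative (\<lambda>v. complex_of_real (v \<bullet> u))) (at x)" for x
    by (auto intro!: derivative_eq_intros)
  have d': "((\<lambda>x. k) has_derivative (\<lambda>v. 0)) (at x)" for x :: 'a and k :: complex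
    by (auto intro!: derivative_eq_intros)
  show "f differentiable_on UNIV" using f differentiable_onI[OF d] by auto
  show "dir_deriv b f \<in> {\<lambda>x. complex_of_real (x \<bullet> u - c)} \<union> range (\<lambda>c x. c)"
    using f dir_deriv_eqI[OF d] dir_deriv_eqI[OF d'] by auto
qed auto

lemma has_derivative_cis_inner:
  "((\<lambda>x::'a::euclidean_space. exp (\<i> * complex_of_real (x \<bullet> u))) has_derivative
     (\<lambda>v. \<i> * complex_of_real (v \<bullet> u) * exp (\<i> * complex_of_real (x \<bullet> u)))) (at x)"
proof -
  have "((\<lambda>x::'a. \<i> * complex_of_real (x \<bullet> u)) has_derivative (\<lambda>v. \<i> * complex_of_real (v \<bullet> u))) (at x)"
    by (auto intro!: derivative_eq_intros)
  from has_derivative_compose[OF this DERIV_exp[THEN has_field_derivative_imp_has_derivative]]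
  show ?thesis by (simp add: mult.commute)
qed

lemma smooth_cis_inner: "smooth (\<lambda>x::'a::euclidean_space. exp (\<i> * complex_of_real (x \<bullet> u)))"
proof (rule smooth_coinduct[where X = "range (\<lambda>k (x::'a). k * exp (\<i> * complex_of_real (x \<bullet> u)))"])
  fix f :: "'a \<Rightarrow> complex" and b :: 'a
  assume "f \<in> range (\<lambda>k (x::'a). k * exp (\<i> * complex_of_real (x \<bullet> u)))"
  then obtain k where f: "f = (\<lambda>x. k * exp (\<i> * complex_of_real (x \<bullet> u)))" by auto
  have d: "(f has_derivative (\<lambda>v. k * (\<i> * complex_of_real (v \<bullet> u) * exp (\<i> * complex_of_real (x \<bullet> u))))) (at x)" for x
    unfolding f by (intro has_derivative_mult_right has_derivative_cis_inner)
  show "f differentiable_on UNIV" using differentiable_onI[OF d] .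
  show "dir_deriv b f \<in> range (\<lambda>k (x::'a). k * exp (\<i> * complex_of_real (x \<bullet> u)))"
    unfolding dir_deriv_eqI[OF d] by (rule range_eqI[of _ _ "k * (\<i> * complex_of_real (b \<bullet> u))"]) auto
next
  show "(\<lambda>x. exp (\<i> * complex_of_real (x \<bullet> u))) \<in> range (\<lambda>k (x::'a). k * exp (\<i> * complex_of_real (x \<bullet> u)))"
    by (rule range_eqI[of _ _ 1]) auto
qed

lemma dir_deriv_smooth_linear:
  assumes "smooth f"
  shows "dir_deriv v f = (\<lambda>x. \<Sum>i\<in>Basis. (v \<bullet> i) *\<^sub>R dir_deriv i f x)"
proof
  fix x
  have lin: "linear (\<lambda>v. dir_deriv v f x)"
    using smooth_has_derivative[OF assms] has_derivative_linear by blast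
  have "dir_deriv v f x = dir_deriv (\<Sum>i\<in>Basis. (v \<bullet> i) *\<^sub>R i) f x"
    by (simp add: euclidean_representation)
  also have "\<dots> = (\<Sum>i\<in>Basis. (v \<bullet> i) *\<^sub>R dir_deriv i f x)"
    by (simp only: linear_sum[OF lin] linear_scale[OF lin])
  finally show "dir_deriv v f x = (\<Sum>i\<in>Basis. (v \<bullet> i) *\<^sub>R dir_deriv i f x)" .
qed

lemma smooth_dir_deriv:
  assumes "smooth f"
  shows "smooth (dir_deriv v f)"
proof -
  have "smooth (\<lambda>x. \<Sum>i\<in>Basis. (v \<bullet> i) *\<^sub>R dir_deriv i f x)"
    using assms by (intro smooth_sum smooth_bounded_linear[OF bounded_linear_scaleR_right])
      (auto simp: smooth_iff[of f])
  then show ?thesis by (subst dir_deriv_smooth_linear[OF assms])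
qed

lemma dir_deriv_add: "smooth f \<Longrightarrow> smooth g \<Longrightarrow> dir_deriv v (\<lambda>x. f x + g x) = (\<lambda>x. dir_deriv v f x + dir_deriv v g x)"
  by (rule dir_deriv_eqI) (intro has_derivative_add smooth_has_derivative)

lemma dir_deriv_mult:
  fixes f g :: "'a::euclidean_space \<Rightarrow> complex"
  shows "smooth f \<Longrightarrow> smooth g \<Longrightarrow>
    dir_deriv v (\<lambda>x. f x * g x) = (\<lambda>x. f x * dir_deriv v g x + dir_deriv v f x * g x)"
  by (rule dir_deriv_eqI) (intro has_derivative_mult smooth_has_derivative)

lemma dir_deriv_cmult:
  fixes f :: "'a::euclidean_space \<Rightarrow> complex"
  shows "smooth f \<Longrightarrow> dir_deriv v (\<lambda>x. c * f x) = (\<lambda>x. c * dir_deriv v f x)"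
  by (rule dir_deriv_eqI) (intro has_derivative_mult_right smooth_has_derivative)

lemma dir_deriv_bounded_linear:
  shows "bounded_linear h \<Longrightarrow> smooth f \<Longrightarrow> dir_deriv v (\<lambda>x. h (f x)) = (\<lambda>x. h (dir_deriv v f x))"
  by (rule dir_deriv_eqI) (erule bounded_linear.has_derivative, erule smooth_has_derivative)

lemma dir_deriv_const: "dir_deriv v (\<lambda>x. c) = (\<lambda>x. 0)"
  by (rule dir_deriv_eqI) (auto intro: derivative_eq_intros)

lemma dir_deriv_inner:
  "dir_deriv v (\<lambda>x. complex_of_real (x \<bullet> u - c)) = (\<lambda>x. complex_of_real (v \<bullet> u))"
  by (rule dir_deriv_eqI) (auto intro!: derivative_eq_intros)

lemma dir_deriv_cis_inner:
  "dir_deriv v (\<lambda>x::'a::euclidean_space. exp (\<i> * complex_of_real (x \<bullet> u)))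
     = (\<lambda>x. \<i> * complex_of_real (v \<bullet> u) * exp (\<i> * complex_of_real (x \<bullet> u)))"
  by (rule dir_deriv_eqI) (rule has_derivative_cis_inner)

lemma dir_deriv_affine:
  fixes L :: "'c::euclidean_space \<Rightarrow> 'a::euclidean_space" and f :: "'a \<Rightarrow> 'b::real_normed_vector"
  assumes "linear L" "smooth f"
  shows "dir_deriv v (\<lambda>x. f (L x + c)) = (\<lambda>x. dir_deriv (L v) f (L x + c))"
proof (rule dir_deriv_eqI)
  fix x
  have "((\<lambda>x. L x + c) has_derivative L) (at x)"
    using has_derivative_add_const[OF linear_imp_has_derivative[OF assms(1)]] .
  from has_derivative_compose[OF this smooth_has_derivative[OF assms(2)]]
  show "((\<lambda>x. f (L x + c)) has_derivative (\<lambda>v. dir_deriv (L v) f (L x + c))) (at x)" by simp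
qed

subsection \<open>Symmetry of mixed derivatives\<close>

text \<open>The mean value theorem is applied along v to the difference of g along u, and then along
  u. The left-hand side is symmetric in u and v, and this symmetry is what makes mixed derivatives
  commute.\<close>

lemma mixed_difference_mvt:
  fixes g gv guv :: "'a::real_normed_vector \<Rightarrow> real"
  assumes gv: "\<And>x. ((\<lambda>t. g (x + t *\<^sub>R v)) has_real_derivative gv x) (at 0)"
    and guv: "\<And>x. ((\<lambda>t. gv (x + t *\<^sub>R u)) has_real_derivative guv x) (at 0)"
    and h: "h > 0"
  shows "\<exists>s\<in>{0..h}. \<exists>t\<in>{0..h}. g (x + h *\<^sub>R u + h *\<^sub>R v) - g (x + h *\<^sub>R u) - g (x + h *\<^sub>R v) + g x
           = h * h * guv (x + s *\<^sub>R u + t *\<^sub>R v)"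
proof -
  have shift: "((\<lambda>t. f (y + t *\<^sub>R w)) has_real_derivative fw (y + t *\<^sub>R w)) (at t)"
    if "\<And>x. ((\<lambda>t. f (x + t *\<^sub>R w)) has_real_derivative fw x) (at 0)"
    for f fw :: "'a \<Rightarrow> real" and w y t
  proof -
    have d: "((\<lambda>\<tau>. \<tau> - t) has_real_derivative 1) (at t)" by (auto intro!: derivative_eq_intros)
    have "((\<lambda>\<tau>. f ((y + t *\<^sub>R w) + (\<tau> - t) *\<^sub>R w)) has_real_derivative fw (y + t *\<^sub>R w)) (at t)"
      using DERIV_chain2[where f="\<lambda>\<tau>. f ((y + t *\<^sub>R w) + \<tau> *\<^sub>R w)" and g="\<lambda>\<tau>. \<tau> - t" and x=t and Da="fw (y + t *\<^sub>R w)" and Db=1 and s=UNIV]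
        that[of "y + t *\<^sub>R w"] d by simp
    then show ?thesis by (simp add: algebra_simps)
  qed
  define \<phi> where "\<phi> \<tau> = g (x + h *\<^sub>R u + \<tau> *\<^sub>R v) - g (x + \<tau> *\<^sub>R v)" for \<tau>
  have "(\<phi> has_real_derivative gv (x + h *\<^sub>R u + \<tau> *\<^sub>R v) - gv (x + \<tau> *\<^sub>R v)) (at \<tau>)" for \<tau>
    unfolding \<phi>_def by (rule DERIV_diff; rule shift, rule gv)
  from MVT2[OF h this] obtain t where t: "0 < t" "t < h"
    "\<phi> h - \<phi> 0 = h * (gv (x + h *\<^sub>R u + t *\<^sub>R v) - gv (x + t *\<^sub>R v))" by auto
  have "((\<lambda>\<sigma>. gv (x + t *\<^sub>R v + \<sigma> *\<^sub>R u)) has_real_derivative guv (x + t *\<^sub>R v + \<sigma> *\<^sub>R u)) (at \<sigma>)" for \<sigma>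
    by (rule shift, rule guv)
  from MVT2[OF h this] obtain s where s: "0 < s" "s < h"
    "gv (x + t *\<^sub>R v + h *\<^sub>R u) - gv (x + t *\<^sub>R v + 0 *\<^sub>R u) = h * guv (x + t *\<^sub>R v + s *\<^sub>R u)" by auto
  show ?thesis
    using s t by (intro bexI[of _ s] bexI[of _ t]) (auto simp: \<phi>_def algebra_simps)
qed

text \<open>Both mixed derivatives, taken at points that tend to x with h, equal the same second
  difference divided by h^2. Continuity at x then identifies the limits.\<close>

lemma mixed_derivatives_real:
  fixes g :: "'a::real_normed_vector \<Rightarrow> real"
  assumes gv: "\<And>x. ((\<lambda>t. g (x + t *\<^sub>R v)) has_real_derivative gv x) (at 0)"
    and guv: "\<And>x. ((\<lambda>t. gv (x + t *\<^sub>R u)) has_real_derivative guv x) (at 0)"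
    and gu: "\<And>x. ((\<lambda>t. g (x + t *\<^sub>R u)) has_real_derivative gu x) (at 0)"
    and gvu: "\<And>x. ((\<lambda>t. gu (x + t *\<^sub>R v)) has_real_derivative gvu x) (at 0)"
    and cont: "isCont guv x" "isCont gvu x"
  shows "guv x = gvu x"
proof -
  define h where "h n = inverse (real (Suc n))" for n
  have h: "h n > 0" for n by (simp add: h_def)
  have h0: "h \<longlonglongrightarrow> 0" unfolding h_def by (rule LIMSEQ_inverse_real_of_nat)
  from mixed_difference_mvt[OF gv guv h, of _ x]
  have "\<forall>n. \<exists>s t. s \<in> {0..h n} \<and> t \<in> {0..h n} \<and>
     g (x + h n *\<^sub>R u + h n *\<^sub>R v) - g (x + h n *\<^sub>R u) - g (x + h n *\<^sub>R v) + g x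
           = h n * h n * guv (x + s *\<^sub>R u + t *\<^sub>R v)" by blast
  then obtain s t where st: "\<And>n. s n \<in> {0..h n}" "\<And>n. t n \<in> {0..h n}"
    "\<And>n. g (x + h n *\<^sub>R u + h n *\<^sub>R v) - g (x + h n *\<^sub>R u) - g (x + h n *\<^sub>R v) + g x
           = h n * h n * guv (x + s n *\<^sub>R u + t n *\<^sub>R v)" by metis
  from mixed_difference_mvt[OF gu gvu h, of _ x]
  have "\<forall>n. \<exists>s t. s \<in> {0..h n} \<and> t \<in> {0..h n} \<and>
     g (x + h n *\<^sub>R v + h n *\<^sub>R u) - g (x + h n *\<^sub>R v) - g (x + h n *\<^sub>R u) + g x
           = h n * h n * gvu (x + s *\<^sub>R v + t *\<^sub>R u)" by blast
  then obtain s' t' where st': "\<And>n. s' n \<in> {0..h n}" "\<And>n. t' n \<in> {0..h n}"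
    "\<And>n. g (x + h n *\<^sub>R v + h n *\<^sub>R u) - g (x + h n *\<^sub>R v) - g (x + h n *\<^sub>R u) + g x
           = h n * h n * gvu (x + s' n *\<^sub>R v + t' n *\<^sub>R u)" by metis
  have lim: "(\<lambda>n. x + a n *\<^sub>R p + b n *\<^sub>R q) \<longlonglongrightarrow> x"
    if "\<And>n. a n \<in> {0..h n}" "\<And>n. b n \<in> {0..h n}" for a b p q
  proof -
    have "a \<longlonglongrightarrow> 0" "b \<longlonglongrightarrow> 0"
      using that by (auto intro!: tendsto_sandwich[OF _ _ tendsto_const h0] always_eventually)
    then have "(\<lambda>n. x + a n *\<^sub>R p + b n *\<^sub>R q) \<longlonglongrightarrow> x + 0 *\<^sub>R p + 0 *\<^sub>R q"
      by (intro tendsto_intros)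
    then show ?thesis by simp
  qed
  have eq: "guv (x + s n *\<^sub>R u + t n *\<^sub>R v) = gvu (x + s' n *\<^sub>R v + t' n *\<^sub>R u)" for n
  proof -
    have "h n * h n * guv (x + s n *\<^sub>R u + t n *\<^sub>R v) = h n * h n * gvu (x + s' n *\<^sub>R v + t' n *\<^sub>R u)"
      unfolding st(3)[symmetric] st'(3)[symmetric] by (simp add: algebra_simps)
    then show ?thesis using h[of n] by simp
  qed
  have "(\<lambda>n. guv (x + s n *\<^sub>R u + t n *\<^sub>R v)) \<longlonglongrightarrow> guv x"
    by (rule isCont_tendsto_compose[OF cont(1) lim[OF st(1,2)]])
  moreover have "(\<lambda>n. gvu (x + s' n *\<^sub>R v + t' n *\<^sub>R u)) \<longlonglongrightarrow> gvu x"
    by (rule isCont_tendsto_compose[OF cont(2) lim[OF st'(1,2)]])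
  ultimately show ?thesis unfolding eq using LIMSEQ_unique by blast
qed

lemma smooth_line_derivative:
  assumes "smooth f"
  shows "((\<lambda>t. f (x + t *\<^sub>R v)) has_vector_derivative dir_deriv v f (x + t *\<^sub>R v)) (at t within S)"
proof -
  have "((\<lambda>t. x + t *\<^sub>R v) has_derivative (\<lambda>s. s *\<^sub>R v)) (at t within S)"
    by (auto intro!: derivative_eq_intros)
  from has_derivative_compose[OF this smooth_has_derivative[OF assms]]
  have "((\<lambda>t. f (x + t *\<^sub>R v)) has_derivative (\<lambda>s. dir_deriv (s *\<^sub>R v) f (x + t *\<^sub>R v))) (at t within S)" .
  moreover have "dir_deriv (s *\<^sub>R v) f (x + t *\<^sub>R v) = s *\<^sub>R dir_deriv v f (x + t *\<^sub>R v)" for s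
    using linear_scale[OF has_derivative_linear[OF smooth_has_derivative[OF assms]]] .
  ultimately show ?thesis unfolding has_vector_derivative_def by simp
qed

lemma dir_deriv_commute:
  fixes f :: "'a::euclidean_space \<Rightarrow> complex"
  assumes f: "smooth f"
  shows "dir_deriv u (dir_deriv v f) = dir_deriv v (dir_deriv u f)"
proof
  fix x
  note s = smooth_dir_deriv
  have line: "((\<lambda>t. h (F (x + t *\<^sub>R v))) has_real_derivative h (dir_deriv v F x)) (at 0)"
    if "bounded_linear h" "smooth F" for F :: "'a \<Rightarrow> complex" and v x h
    using bounded_linear.has_vector_derivative[OF that(1) smooth_line_derivative[OF that(2), of x v 0 UNIV]]
    by (simp add: has_real_derivative_iff_has_vector_derivative)
  \<comment> \<open>The mean value theorem needs real values, so the real and the imaginary part are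
    treated separately; h stands for either.\<close>
  have "h (dir_deriv u (dir_deriv v f) x) = h (dir_deriv v (dir_deriv u f) x)"
    if h: "bounded_linear h" for h :: "complex \<Rightarrow> real"
  proof (rule mixed_derivatives_real[where g="\<lambda>x. h (f x)" and u=u and v=v
        and gu="\<lambda>x. h (dir_deriv u f x)" and gv="\<lambda>x. h (dir_deriv v f x)"])
    have "isCont (\<lambda>x. h (F x)) x" if "smooth F" for F :: "'a \<Rightarrow> complex" and x
    proof (rule bounded_linear.isCont[OF h])
      show "isCont F x"
        using smooth_continuous[OF that, of UNIV] by (simp add: continuous_on_eq_continuous_at)
    qed
    then show "isCont (\<lambda>x. h (dir_deriv u (dir_deriv v f) x)) x" "isCont (\<lambda>x. h (dir_deriv v (dir_deriv u f) x)) x"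
      using f s by blast+
  qed (intro line[OF h] f s)+
  from this[OF bounded_linear_Re] this[OF bounded_linear_Im]
  show "dir_deriv u (dir_deriv v f) x = dir_deriv v (dir_deriv u f) x"
    by (simp add: complex_eq_iff)
qed

section \<open>Iterated derivatives along lists of directions\<close>

definition iD :: "'a::real_normed_vector list \<Rightarrow> ('a \<Rightarrow> 'b::real_normed_vector) \<Rightarrow> 'a \<Rightarrow> 'b" where
  "iD l f = foldr dir_deriv l f"

lemma iD_Nil [simp]: "iD [] f = f"
  and iD_Cons: "iD (v # l) f = dir_deriv v (iD l f)"
  and iD_append: "iD (l @ l') f = iD l (iD l' f)"
  and iD_snoc: "iD (l @ [v]) f = iD l (dir_deriv v f)"
  by (simp_all add: iD_def)

lemma smooth_iD: "smooth f \<Longrightarrow> smooth (iD l f)"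
  by (induction l) (auto simp: iD_Cons smooth_dir_deriv)

lemma iD_add: "smooth f \<Longrightarrow> smooth g \<Longrightarrow> iD l (\<lambda>x. f x + g x) = (\<lambda>x. iD l f x + iD l g x)"
  by (induction l) (auto simp: iD_Cons dir_deriv_add smooth_iD)

lemma iD_bounded_linear: "bounded_linear h \<Longrightarrow> smooth f \<Longrightarrow> iD l (\<lambda>x. h (f x)) = (\<lambda>x. h (iD l f x))"
  by (induction l) (auto simp: iD_Cons dir_deriv_bounded_linear smooth_iD)

lemma iD_zero: "iD l (\<lambda>x. 0) = (\<lambda>x. 0)"
  by (induction l) (auto simp: iD_Cons dir_deriv_const)

lemma iD_swap:
  fixes f :: "'a::euclidean_space \<Rightarrow> complex"
  assumes f: "smooth f"
  shows "iD (xs @ v # ys) f = iD (v # xs @ ys) f"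
proof (induction xs)
  case (Cons u xs)
  have "iD ((u # xs) @ v # ys) f = dir_deriv u (iD (v # xs @ ys) f)"
    using Cons by (simp add: iD_Cons)
  also have "\<dots> = dir_deriv v (dir_deriv u (iD (xs @ ys) f))"
    unfolding iD_Cons by (rule dir_deriv_commute[OF smooth_iD[OF f]])
  finally show ?case by (simp add: iD_Cons)
qed simp

text \<open>Only the multiset of directions matters. This is the bridge between multi-indices, which
  prescribe an order, and lists, over which the inductions run.\<close>

lemma iD_mset:
  fixes f :: "'a::euclidean_space \<Rightarrow> complex"
  assumes f: "smooth f" and "mset l = mset l'"
  shows "iD l f = iD l' f"
  using assms(2)
proof (induction l arbitrary: l')
  case (Cons v l)
  then have "v \<in> set l'" by (metis list.set_intros(1) mset_eq_setD)
  then obtain xs ys where l': "l' = xs @ v # ys" by (meson split_list)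
  then have "mset l = mset (xs @ ys)" using Cons.prems by simp
  from Cons.IH[OF this] show ?case unfolding l' iD_swap[OF f] by (simp add: iD_Cons)
qed simp

lemma iD_local:
  assumes "open U" "\<And>x. x \<in> U \<Longrightarrow> f x = g x" "x \<in> U"
  shows "iD l f x = iD l g x"
  using assms(3)
proof (induction l arbitrary: x)
  case (Cons v l)
  \<comment> \<open>Functions with the same germ have the same candidates for a derivative, and
    hence the same value of the choice operator behind \<open>frechet_derivative\<close>. So the
    argument covers points of non-differentiability as well.\<close>
  have "(iD l f has_derivative F) (at x) \<longleftrightarrow> (iD l g has_derivative F) (at x)" for F
    using has_derivative_transform_within_open[of "iD l f" F x UNIV U "iD l g"]
      has_derivative_transform_within_open[of "iD l g" F x UNIV U "iD l f"] Cons assms(1) by auto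
  then show ?case by (simp add: iD_Cons dir_deriv_def frechet_derivative_def)
qed (use assms in auto)

lemma smooth_iff_iD:
  fixes f :: "'a::euclidean_space \<Rightarrow> 'b::real_normed_vector"
  shows "smooth f \<longleftrightarrow> (\<forall>l\<in>lists Basis. iD l f differentiable_on UNIV)"
proof
  show "smooth f \<Longrightarrow> \<forall>l\<in>lists Basis. iD l f differentiable_on UNIV"
    using smooth_iD smooth_iff by blast
  assume *: "\<forall>l\<in>lists Basis. iD l f differentiable_on UNIV"
  show "smooth f"
  proof (rule smooth_coinduct[where X="{iD l f |l. l \<in> lists Basis}"])
    show "f \<in> {iD l f |l. l \<in> lists Basis}" by (auto intro: exI[of _ "[]"])
    show "dir_deriv b g \<in> {iD l f |l. l \<in> lists Basis}"
      if "g \<in> {iD l f |l. l \<in> lists Basis}" "b \<in> Basis" for g b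
    proof -
      obtain l where "g = iD l f" "l \<in> lists Basis" using \<open>g \<in> _\<close> by blast
      then show ?thesis using that(2) by (auto simp: iD_Cons intro!: exI[of _ "b # l"])
    qed
  qed (use * in auto)
qed

lemma smooth_local:
  assumes "\<And>x. \<exists>U g. open U \<and> x \<in> U \<and> smooth g \<and> (\<forall>y\<in>U. f y = g y)"
  shows "smooth f"
  unfolding smooth_iff_iD differentiable_on_def
proof (intro ballI)
  fix l :: "'a list" and x assume l: "l \<in> lists Basis"
  from assms[of x] obtain U g where U: "open U" "x \<in> U" "smooth g" "\<And>y. y \<in> U \<Longrightarrow> f y = g y" by auto
  have "(iD l g has_derivative (\<lambda>v. dir_deriv v (iD l g) x)) (at x)"
    using U(3) by (intro smooth_has_derivative smooth_iD)
  then have "(iD l f has_derivative (\<lambda>v. dir_deriv v (iD l g) x)) (at x)"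
    by (rule has_derivative_transform_within_open[OF _ U(1,2)]) (use iD_local[of U f g] U in auto)
  then show "iD l f differentiable (at x)" unfolding differentiable_def by blast
qed

subsection \<open>Families with uniform derivative bounds\<close>

text \<open>In \<open>Fam w m a\<close> the weight \<open>w\<close> bounds the functions themselves and every derivative in the
  direction \<open>b\<close> costs a factor \<open>m b\<close>, uniformly in the index of the family. Symbol classes, the
  Schwartz space and the partitions of \<open>\<alpha>\<close>-modulation spaces are all of this form; an indicator
  function in \<open>w\<close> records a support.\<close>

definition Fam ::
  "('j \<Rightarrow> 'a \<Rightarrow> real) \<Rightarrow> ('a \<Rightarrow> 'j \<Rightarrow> 'a \<Rightarrow> real) \<Rightarrow> ('j \<Rightarrow> 'a::euclidean_space \<Rightarrow> complex) \<Rightarrow> bool" where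
  "Fam w m a \<longleftrightarrow> (\<forall>j. smooth (a j)) \<and>
     (\<forall>l\<in>lists Basis. \<exists>C\<ge>0. \<forall>j z. norm (iD l (a j) z) \<le> C * (w j z * prod_list (map (\<lambda>v. m v j z) l)))"

lemma Fam_smooth: "Fam w m a \<Longrightarrow> smooth (a j)"
  unfolding Fam_def by blast

lemma Fam_bound_iD:
  assumes "Fam w m a" "l \<in> lists Basis"
  obtains C where "C \<ge> 0" "\<And>j z. norm (iD l (a j) z) \<le> C * (w j z * prod_list (map (\<lambda>v. m v j z) l))"
  using assms unfolding Fam_def by blast

lemma Fam_bound:
  assumes "Fam w m a"
  obtains C where "C \<ge> 0" "\<And>j z. norm (a j z) \<le> C * w j z"
  using Fam_bound_iD[OF assms, of "[]"] by auto

lemma FamI: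
  assumes "\<And>j. smooth (a j)"
    and "\<And>l. l \<in> lists Basis \<Longrightarrow> \<exists>C\<ge>0. \<forall>j z. norm (iD l (a j) z) \<le> C * (w j z * prod_list (map (\<lambda>v. m v j z) l))"
  shows "Fam w m a"
  unfolding Fam_def using assms by blast

lemma Fam_deriv:
  assumes "Fam w m a" "b \<in> Basis"
  shows "Fam (\<lambda>j z. w j z * m b j z) m (\<lambda>j. dir_deriv b (a j))"
proof (rule FamI)
  show "smooth (dir_deriv b (a j))" for j
    using Fam_smooth[OF assms(1)] smooth_dir_deriv by blast
next
  fix l assume "l \<in> lists (Basis :: 'b set)"
  then have "l @ [b] \<in> lists Basis" using assms(2) by auto
  from Fam_bound_iD[OF assms(1) this] obtain C where
    "C \<ge> 0" "\<And>j z. norm (iD (l @ [b]) (a j) z) \<le> C * (w j z * prod_list (map (\<lambda>v. m v j z) (l @ [b])))"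
    by blast
  then show "\<exists>C\<ge>0. \<forall>j z. norm (iD l (dir_deriv b (a j)) z) \<le> C * (w j z * m b j z * prod_list (map (\<lambda>v. m v j z) l))"
    by (intro exI[of _ C]) (simp add: iD_snoc mult_ac)
qed

lemma Fam_step:
  assumes sm: "\<And>j. smooth (a j)"
    and bd: "\<exists>C\<ge>0. \<forall>j z. norm (a j z) \<le> C * w j z"
    and D: "\<And>b. b \<in> Basis \<Longrightarrow> Fam (\<lambda>j z. w j z * m b j z) m (\<lambda>j. dir_deriv b (a j))"
  shows "Fam w m a"
proof (rule FamI)
  fix l assume l: "l \<in> lists (Basis :: 'b set)"
  show "\<exists>C\<ge>0. \<forall>j z. norm (iD l (a j) z) \<le> C * (w j z * prod_list (map (\<lambda>v. m v j z) l))"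
  proof (cases l rule: rev_cases)
    case Nil
    then show ?thesis using bd by simp
  next
    case (snoc l' b)
    then have "l' \<in> lists Basis" "b \<in> Basis" using l by auto
    from Fam_bound_iD[OF D[OF this(2)] this(1)] obtain C where
      "C \<ge> 0" "\<And>j z. norm (iD l' (dir_deriv b (a j)) z) \<le> C * (w j z * m b j z * prod_list (map (\<lambda>v. m v j z) l'))"
      by blast
    then show ?thesis unfolding snoc by (intro exI[of _ C]) (simp add: iD_snoc mult_ac)
  qed
qed (rule sm)

text \<open>The weights are compared only where w does not vanish. An indicator function inside w
  thus confines the comparison to the support, where brackets and radii are comparable; outside it
  the derivatives vanish anyway.\<close>

lemma Fam_mono:
  assumes "Fam w m a"
    and nn: "\<And>j z. 0 \<le> w' j z" "\<And>b j z. b \<in> Basis \<Longrightarrow> 0 \<le> m' b j z"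
    "\<And>j z. 0 \<le> w j z" "\<And>b j z. b \<in> Basis \<Longrightarrow> 0 \<le> m b j z"
    and le: "\<And>j z. w j z \<noteq> 0 \<Longrightarrow> w j z \<le> K * w' j z"
    "\<And>b j z. w j z \<noteq> 0 \<Longrightarrow> b \<in> Basis \<Longrightarrow> m b j z \<le> K * m' b j z"
  shows "Fam w' m' a"
proof (rule FamI)
  show "smooth (a j)" for j by (rule Fam_smooth[OF assms(1)])
  fix l assume l: "l \<in> lists (Basis :: 'b set)"
  from Fam_bound_iD[OF assms(1) l] obtain C where
    C: "C \<ge> 0" "\<And>j z. norm (iD l (a j) z) \<le> C * (w j z * prod_list (map (\<lambda>v. m v j z) l))" by blast
  define K' where "K' = max 0 K"
  have K': "K' \<ge> 0" by (simp add: K'_def)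
  have "w j z * prod_list (map (\<lambda>v. m v j z) l) \<le> K' ^ Suc (length l) * (w' j z * prod_list (map (\<lambda>v. m' v j z) l))" for j z
  proof (cases "w j z = 0")
    case True
    moreover have "prod_list (map (\<lambda>v. m' v j z) l) \<ge> 0"
      using l by (induction l) (auto simp: nn)
    ultimately show ?thesis using nn K' by simp
  next
    case False
    have *: "0 \<le> prod_list (map (\<lambda>v. m v j z) l) \<and>
        prod_list (map (\<lambda>v. m v j z) l) \<le> K' ^ length l * prod_list (map (\<lambda>v. m' v j z) l)"
      using l
    proof (induction l)
      case (Cons b l)
      then have b: "b \<in> Basis" by auto
      have "m b j z \<le> K' * m' b j z"
        using le(2)[OF False b] nn(2)[OF b] by (smt (verit) K'_def mult_right_mono)
      with Cons b nn(2,4)[OF b] K' have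
        "m b j z * prod_list (map (\<lambda>v. m v j z) l) \<le> (K' * m' b j z) * (K' ^ length l * prod_list (map (\<lambda>v. m' v j z) l))"
        by (intro mult_mono) auto
      then show ?case using Cons b nn(4)[OF b] by (simp add: mult_ac)
    qed simp
    have "w j z \<le> K' * w' j z"
      using le(1)[OF False] nn(1) by (smt (verit) K'_def mult_right_mono)
    with * nn K' have "w j z * prod_list (map (\<lambda>v. m v j z) l) \<le> (K' * w' j z) * (K' ^ length l * prod_list (map (\<lambda>v. m' v j z) l))"
      by (intro mult_mono) auto
    then show ?thesis by (simp add: mult_ac)
  qed
  then have "norm (iD l (a j) z) \<le> C * (K' ^ Suc (length l) * (w' j z * prod_list (map (\<lambda>v. m' v j z) l)))" for j z
    using C order_trans mult_left_mono by meson
  then show "\<exists>C\<ge>0. \<forall>j z. norm (iD l (a j) z) \<le> C * (w' j z * prod_list (map (\<lambda>v. m' v j z) l))"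
    using C(1) K' by (intro exI[of _ "C * K' ^ Suc (length l)"]) (simp add: mult_ac)
qed

lemma Fam_add:
  assumes "Fam w m a" "Fam w m a'"
  shows "Fam w m (\<lambda>j z. a j z + a' j z)"
proof (rule FamI)
  show "smooth (\<lambda>z. a j z + a' j z)" for j
    by (rule smooth_add[OF Fam_smooth[OF assms(1)] Fam_smooth[OF assms(2)]])
  fix l assume l: "l \<in> lists (Basis :: 'b set)"
  from Fam_bound_iD[OF assms(1) l] obtain C where
    C: "C \<ge> 0" "\<And>j z. norm (iD l (a j) z) \<le> C * (w j z * prod_list (map (\<lambda>v. m v j z) l))" by blast
  from Fam_bound_iD[OF assms(2) l] obtain C' where
    C': "C' \<ge> 0" "\<And>j z. norm (iD l (a' j) z) \<le> C' * (w j z * prod_list (map (\<lambda>v. m v j z) l))" by blast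
  have "norm (iD l (\<lambda>z. a j z + a' j z) z) \<le> (C + C') * (w j z * prod_list (map (\<lambda>v. m v j z) l))" for j z
    unfolding iD_add[OF Fam_smooth[OF assms(1)] Fam_smooth[OF assms(2)]] distrib_right
    by (rule order_trans[OF norm_triangle_ineq add_mono[OF C(2) C'(2)]])
  then show "\<exists>C\<ge>0. \<forall>j z. norm (iD l (\<lambda>z. a j z + a' j z) z) \<le> C * (w j z * prod_list (map (\<lambda>v. m v j z) l))"
    using C C' by (intro exI[of _ "C + C'"]) simp
qed

lemma Fam_zero:
  assumes "\<And>j z. 0 \<le> w j z" "\<And>b j z. b \<in> Basis \<Longrightarrow> 0 \<le> m b j z"
  shows "Fam w m (\<lambda>(j::'j) (z::'b::euclidean_space). 0)"
proof (rule FamI)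
  fix l assume l: "l \<in> lists (Basis :: 'b set)"
  have "0 \<le> prod_list (map (\<lambda>v. m v j z) l)" for j z
    using l by (induction l) (auto simp: assms)
  then show "\<exists>C\<ge>0. \<forall>j z. norm (iD l (\<lambda>z. 0::complex) z) \<le> C * (w j z * prod_list (map (\<lambda>v. m v j z) l))"
    by (intro exI[of _ 0]) (simp add: iD_zero)
qed (rule smooth_const)

lemma Fam_mult:
  assumes "Fam w m a" "Fam w' m a'"
    and nn: "\<And>j z. 0 \<le> w j z" "\<And>j z. 0 \<le> w' j z" "\<And>b j z. b \<in> Basis \<Longrightarrow> 0 \<le> m b j z"
  shows "Fam (\<lambda>j z. w j z * w' j z) m (\<lambda>j z. a j z * a' j z)"
proof (rule FamI)
  show "smooth (\<lambda>z. a j z * a' j z)" for j by (intro smooth_mult Fam_smooth[OF assms(1)] Fam_smooth[OF assms(2)])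
  \<comment> \<open>The Leibniz rule produces two products in which one factor has been
    differentiated. Quantifying over weights and families lets the induction hypothesis treat a
    derivative as a new family with the weight \<open>w * m b\<close>.\<close>
  have "\<forall>w w' a a'. Fam w m a \<longrightarrow> Fam w' m a' \<longrightarrow> (\<forall>j z. 0 \<le> w j z) \<longrightarrow> (\<forall>j z. 0 \<le> w' j z) \<longrightarrow>
    (\<exists>C\<ge>0. \<forall>j z. norm (iD l (\<lambda>z. a j z * a' j z) z) \<le> C * (w j z * w' j z * prod_list (map (\<lambda>v. m v j z) l)))"
    if "l \<in> lists Basis" for l
    using that
  proof (induction l rule: rev_induct)
    case Nil
    show ?case
    proof (intro allI impI)
      fix w w' and a a' :: "'a \<Rightarrow> 'b \<Rightarrow> complex"
      assume *: "Fam w m a" "Fam w' m a'" and w: "\<forall>j z. 0 \<le> w j z" "\<forall>j z. 0 \<le> w' j z"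
      from Fam_bound[OF *(1)] obtain C where C: "C \<ge> 0" "\<And>j z. norm (a j z) \<le> C * w j z" by blast
      from Fam_bound[OF *(2)] obtain C' where C': "C' \<ge> 0" "\<And>j z. norm (a' j z) \<le> C' * w' j z" by blast
      have "norm (a j z * a' j z) \<le> (C * C') * (w j z * w' j z)" for j z
        using mult_mono[OF C(2)[of j z] C'(2)[of j z]] C(1) w by (simp add: norm_mult mult_ac)
      then show "\<exists>C\<ge>0. \<forall>j z. norm (iD [] (\<lambda>z. a j z * a' j z) z) \<le> C * (w j z * w' j z * prod_list (map (\<lambda>v. m v j z) []))"
        using C C' by (intro exI[of _ "C * C'"]) simp
    qed
  next
    case (snoc b l)
    then have b: "b \<in> Basis" and l: "l \<in> lists Basis" by auto
    show ?case
    proof (intro allI impI)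
      fix w w' and a a' :: "'a \<Rightarrow> 'b \<Rightarrow> complex"
      assume *: "Fam w m a" "Fam w' m a'" and w: "\<forall>j z. 0 \<le> w j z" "\<forall>j z. 0 \<le> w' j z"
      let ?p = "\<lambda>l j z. prod_list (map (\<lambda>v. m v j z) l)"
      have n: "\<forall>j z. 0 \<le> w j z * m b j z" "\<forall>j z. 0 \<le> w' j z * m b j z" using w nn(3)[OF b] by auto
      from snoc.IH[OF l, THEN spec[of _ w], THEN spec[of _ "\<lambda>j z. w' j z * m b j z"], THEN spec[of _ a],
          THEN spec[of _ "\<lambda>j. dir_deriv b (a' j)"]] *(1) Fam_deriv[OF *(2) b] w(1) n(2) obtain C where
        C: "C \<ge> 0" "\<And>j z. norm (iD l (\<lambda>z. a j z * dir_deriv b (a' j) z) z) \<le> C * (w j z * (w' j z * m b j z) * ?p l j z)"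
        by blast
      from snoc.IH[OF l, THEN spec[of _ "\<lambda>j z. w j z * m b j z"], THEN spec[of _ w'],
          THEN spec[of _ "\<lambda>j. dir_deriv b (a j)"], THEN spec[of _ a']] Fam_deriv[OF *(1) b] *(2) w(2) n(1) obtain C' where
        C': "C' \<ge> 0" "\<And>j z. norm (iD l (\<lambda>z. dir_deriv b (a j) z * a' j z) z) \<le> C' * (w j z * m b j z * w' j z * ?p l j z)"
        by blast
      have "norm (iD (l @ [b]) (\<lambda>z. a j z * a' j z) z) \<le> (C + C') * (w j z * w' j z * ?p (l @ [b]) j z)" for j z
      proof -
        have "iD (l @ [b]) (\<lambda>z. a j z * a' j z) z =
          iD l (\<lambda>z. a j z * dir_deriv b (a' j) z) z + iD l (\<lambda>z. dir_deriv b (a j) z * a' j z) z"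
          unfolding iD_snoc dir_deriv_mult[OF Fam_smooth[OF *(1)] Fam_smooth[OF *(2)]]
          by (rule fun_cong[OF iD_add[OF smooth_mult[OF Fam_smooth[OF *(1)] smooth_dir_deriv[OF Fam_smooth[OF *(2)]]]
                smooth_mult[OF smooth_dir_deriv[OF Fam_smooth[OF *(1)]] Fam_smooth[OF *(2)]]]])
        also have "norm \<dots> \<le> C * (w j z * (w' j z * m b j z) * ?p l j z) + C' * (w j z * m b j z * w' j z * ?p l j z)"
          by (rule order_trans[OF norm_triangle_ineq add_mono[OF C(2) C'(2)]])
        finally show ?thesis by (simp add: algebra_simps)
      qed
      then show "\<exists>C\<ge>0. \<forall>j z. norm (iD (l @ [b]) (\<lambda>z. a j z * a' j z) z) \<le> C * (w j z * w' j z * ?p (l @ [b]) j z)"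
        using C C' by (intro exI[of _ "C + C'"]) simp
    qed
  qed
  then show "l \<in> lists Basis \<Longrightarrow> \<exists>C\<ge>0. \<forall>j z. norm (iD l (\<lambda>z. a j z * a' j z) z) \<le> C * (w j z * w' j z * prod_list (map (\<lambda>v. m v j z) l))" for l
    using assms(1,2) nn(1,2) by blast
qed

lemma Fam_const:
  assumes "\<And>b j z. b \<in> Basis \<Longrightarrow> 0 \<le> m b j z"
  shows "Fam (\<lambda>j z. norm (c j)) m (\<lambda>j z. c j)"
proof (rule Fam_step)
  show "\<exists>C\<ge>0. \<forall>j z. norm (c j) \<le> C * norm (c j)" by (intro exI[of _ 1]) simp
  show "Fam (\<lambda>j z. norm (c j) * m b j z) m (\<lambda>j. dir_deriv b (\<lambda>z. c j))" if "b \<in> Basis" for b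
    unfolding dir_deriv_const using assms that by (intro Fam_zero) auto
qed (rule smooth_const)

lemma Fam_cmult:
  assumes "Fam w m a" and nn: "\<And>j z. 0 \<le> w j z" "\<And>b j z. b \<in> Basis \<Longrightarrow> 0 \<le> m b j z"
  shows "Fam (\<lambda>j z. norm (c j) * w j z) m (\<lambda>j z. c j * a j z)"
  by (rule Fam_mult[OF Fam_const assms(1)]) (auto simp: nn)

lemma Fam_cmult1:
  assumes "Fam w m a" and nn: "\<And>j z. 0 \<le> w j z" "\<And>b j z. b \<in> Basis \<Longrightarrow> 0 \<le> m b j z"
  shows "Fam w m (\<lambda>j z. c * a j z)"
  by (rule Fam_mono[OF Fam_cmult[OF assms, of "\<lambda>_. c"], where K="max 1 (norm c)"])
    (auto simp: nn mult_right_mono intro: order_trans[OF _ mult_right_mono[of 1]])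

lemma Fam_bounded_linear:
  assumes "Fam w m a" "bounded_linear h" and nn: "\<And>j z. 0 \<le> w j z" "\<And>b j z. b \<in> Basis \<Longrightarrow> 0 \<le> m b j z"
  shows "Fam w m (\<lambda>j z. h (a j z))"
proof (rule FamI)
  show "smooth (\<lambda>z. h (a j z))" for j
    by (rule smooth_bounded_linear[OF assms(2) Fam_smooth[OF assms(1)]])
  fix l assume l: "l \<in> lists (Basis :: 'b set)"
  from Fam_bound_iD[OF assms(1) l] obtain C where
    C: "C \<ge> 0" "\<And>j z. norm (iD l (a j) z) \<le> C * (w j z * prod_list (map (\<lambda>v. m v j z) l))" by blast
  from bounded_linear.nonneg_bounded[OF assms(2)] obtain K where K: "K \<ge> 0" "\<And>x. norm (h x) \<le> norm x * K" by blast
  have "norm (iD l (\<lambda>z. h (a j z)) z) \<le> (C * K) * (w j z * prod_list (map (\<lambda>v. m v j z) l))" for j z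
    using order_trans[OF K(2) mult_right_mono[OF C(2)[of j z] K(1)]]
    by (simp add: iD_bounded_linear[OF assms(2) Fam_smooth[OF assms(1)]] mult_ac)
  then show "\<exists>C\<ge>0. \<forall>j z. norm (iD l (\<lambda>z. h (a j z)) z) \<le> C * (w j z * prod_list (map (\<lambda>v. m v j z) l))"
    using C K by (intro exI[of _ "C * K"]) simp
qed

lemma Fam_reindex: "Fam w m a \<Longrightarrow> Fam (\<lambda>i. w (g i)) (\<lambda>b i. m b (g i)) (\<lambda>i. a (g i))"
  unfolding Fam_def by blast

lemma iD_scaled:
  fixes f :: "'a::euclidean_space \<Rightarrow> complex"
  assumes "smooth f"
  shows "iD l (\<lambda>x. f (c *\<^sub>R x + p)) = (\<lambda>x. c ^ length l *\<^sub>R iD l f (c *\<^sub>R x + p))"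
proof (induction l)
  case (Cons v l)
  have s: "smooth (\<lambda>x. c ^ length l *\<^sub>R iD l f x)"
    by (intro smooth_bounded_linear[OF bounded_linear_scaleR_right] smooth_iD assms)
  have "iD (v # l) (\<lambda>x. f (c *\<^sub>R x + p)) = dir_deriv v (\<lambda>x. c ^ length l *\<^sub>R iD l f (c *\<^sub>R x + p))"
    using Cons by (simp add: iD_Cons)
  also have "\<dots> = (\<lambda>x. dir_deriv (c *\<^sub>R v) (\<lambda>x. c ^ length l *\<^sub>R iD l f x) (c *\<^sub>R x + p))"
    by (rule dir_deriv_affine[OF _ s]) simp
  also have "\<dots> = (\<lambda>x. c *\<^sub>R dir_deriv v (\<lambda>x. c ^ length l *\<^sub>R iD l f x) (c *\<^sub>R x + p))"
    using linear_scale[OF has_derivative_linear[OF smooth_has_derivative[OF s]]] by auto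
  also have "\<dots> = (\<lambda>x. c ^ length (v # l) *\<^sub>R iD (v # l) f (c *\<^sub>R x + p))"
    by (simp add: iD_Cons dir_deriv_bounded_linear[OF bounded_linear_scaleR_right smooth_iD[OF assms]])
  finally show ?case .
qed simp

lemma prod_list_const: "prod_list (map (\<lambda>v. c) l) = (c::'a::comm_monoid_mult) ^ length l"
  by (induction l) auto

lemma Fam_scaled:
  assumes "Fam (\<lambda>_::unit. w) (\<lambda>_ _ _. 1) (\<lambda>_. f)"
  shows "Fam (\<lambda>j z. w (c j *\<^sub>R z + p j)) (\<lambda>_ j _. \<bar>c j\<bar>) (\<lambda>j z. f (c j *\<^sub>R z + p j))"
proof (rule FamI)
  have sm: "smooth f" using Fam_smooth[OF assms] .
  show "smooth (\<lambda>z. f (c j *\<^sub>R z + p j))" for j by (rule smooth_affine[OF _ sm]) simp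
  fix l assume l: "l \<in> lists (Basis :: 'a set)"
  from Fam_bound_iD[OF assms l] obtain C where
    C: "C \<ge> 0" "\<And>z. norm (iD l f z) \<le> C * w z" by (auto simp: prod_list_const)
  have "norm (iD l (\<lambda>z. f (c j *\<^sub>R z + p j)) z) \<le> C * (w (c j *\<^sub>R z + p j) * prod_list (map (\<lambda>v. \<bar>c j\<bar>) l))" for j z
    using mult_left_mono[OF C(2)[of "c j *\<^sub>R z + p j"], of "\<bar>c j\<bar> ^ length l"]
    by (simp add: iD_scaled[OF sm] prod_list_const power_abs mult_ac)
  then show "\<exists>C\<ge>0. \<forall>j z. norm (iD l (\<lambda>z. f (c j *\<^sub>R z + p j)) z) \<le> C * (w (c j *\<^sub>R z + p j) * prod_list (map (\<lambda>v. \<bar>c j\<bar>) l))"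
    using C(1) by blast
qed

text \<open>Exactly one component of a basis vector of the product space is nonzero, so
  \<open>snd b = 0\<close> singles out the x-directions. They cost \<open>mx\<close>, the frequency
  directions \<open>m\<xi>\<close>.\<close>

definition xw :: "('j \<Rightarrow> 'a \<times> 'a \<Rightarrow> real) \<Rightarrow> ('j \<Rightarrow> 'a \<times> 'a \<Rightarrow> real) \<Rightarrow> 'a::euclidean_space \<times> 'a \<Rightarrow> 'j \<Rightarrow> 'a \<times> 'a \<Rightarrow> real" where
  "xw mx m\<xi> b j z = (if snd b = 0 then mx j z else m\<xi> j z)"

lemma Basis_prod_cases:
  assumes "b \<in> (Basis :: ('a::euclidean_space \<times> 'a) set)"
  obtains u where "b = (u, 0)" "u \<in> Basis" | v where "b = (0, v)" "v \<in> Basis" "v \<noteq> 0"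
  using assms by (auto simp: Basis_prod_def)

lemma dir_deriv_fst:
  fixes f :: "'a::euclidean_space \<Rightarrow> complex"
  assumes "smooth f"
  shows "dir_deriv (u, v) (\<lambda>z::'a \<times> 'a. f (fst z)) = (\<lambda>z. dir_deriv u f (fst z))"
  using dir_deriv_affine[of "fst :: 'a \<times> 'a \<Rightarrow> 'a" f "(u, v)" 0] assms linear_fst by simp

lemma dir_deriv_snd:
  fixes f :: "'a::euclidean_space \<Rightarrow> complex"
  assumes "smooth f"
  shows "dir_deriv (u, v) (\<lambda>z::'a \<times> 'a. f (snd z)) = (\<lambda>z. dir_deriv v f (snd z))"
  using dir_deriv_affine[of "snd :: 'a \<times> 'a \<Rightarrow> 'a" f "(u, v)" 0] assms linear_snd by simp

lemma smooth_fst: "smooth f \<Longrightarrow> smooth (\<lambda>z::'a::euclidean_space \<times> 'a. f (fst z) :: complex)"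
  using smooth_affine[of "fst :: 'a \<times> 'a \<Rightarrow> 'a" f 0] linear_fst by simp

lemma smooth_snd: "smooth f \<Longrightarrow> smooth (\<lambda>z::'a::euclidean_space \<times> 'a. f (snd z) :: complex)"
  using smooth_affine[of "snd :: 'a \<times> 'a \<Rightarrow> 'a" f 0] linear_snd by simp

lemma dir_deriv_zero: "smooth f \<Longrightarrow> dir_deriv 0 f = (\<lambda>x. 0)"
  using linear_0[OF has_derivative_linear[OF smooth_has_derivative]] by auto

text \<open>Derivatives in the frequency vanish, so their cost \<open>m\<xi>\<close> can be
  prescribed at will. This is how factors depending on x alone and on \<xi> alone receive the common
  cost that \<open>Fam_mult\<close> asks for.\<close>

lemma Fam_fst:
  fixes a :: "'j \<Rightarrow> 'a::euclidean_space \<Rightarrow> complex"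
  assumes "Fam w (\<lambda>_. mx) a" and nn: "\<And>j z. 0 \<le> w j z" "\<And>j z. 0 \<le> mx j z" "\<And>j z. 0 \<le> m\<xi> j z"
  shows "Fam (\<lambda>j z. w j (fst z)) (xw (\<lambda>j z. mx j (fst z)) m\<xi>) (\<lambda>j z. a j (fst z))"
proof (rule FamI)
  show "smooth (\<lambda>z::'a \<times> 'a. a j (fst z))" for j by (rule smooth_fst[OF Fam_smooth[OF assms(1)]])
  have "\<forall>w a. Fam w (\<lambda>_. mx) a \<longrightarrow> (\<forall>j z. 0 \<le> w j z) \<longrightarrow>
    (\<exists>C\<ge>0. \<forall>j z. norm (iD l (\<lambda>z::'a \<times> 'a. a j (fst z)) z) \<le> C * (w j (fst z) * prod_list (map (\<lambda>v. xw (\<lambda>j z. mx j (fst z)) m\<xi> v j z) l)))"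
    if "l \<in> lists Basis" for l :: "('a \<times> 'a) list"
    using that
  proof (induction l rule: rev_induct)
    case Nil
    then show ?case by (auto elim!: Fam_bound)
  next
    case (snoc b l)
    then have b: "b \<in> Basis" and l: "l \<in> lists Basis" by auto
    let ?p = "\<lambda>l j z. prod_list (map (\<lambda>v. xw (\<lambda>j z. mx j (fst z)) m\<xi> v j z) l)"
    have p: "0 \<le> ?p l j z" for l :: "('a \<times> 'a) list" and j z by (induction l) (auto simp: xw_def nn)
    show ?case
    proof (intro allI impI)
      fix w and a :: "'j \<Rightarrow> 'a \<Rightarrow> complex" assume *: "Fam w (\<lambda>_. mx) a" and w: "\<forall>j z. 0 \<le> w j z"
      show "\<exists>C\<ge>0. \<forall>j z. norm (iD (l @ [b]) (\<lambda>z::'a \<times> 'a. a j (fst z)) z) \<le> C * (w j (fst z) * ?p (l @ [b]) j z)"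
        using b
      proof (cases rule: Basis_prod_cases)
        case (1 u)
        have "\<forall>j z. 0 \<le> w j z * mx j z" using w nn(2) by simp
        with snoc.IH[OF l, THEN spec[of _ "\<lambda>j z. w j z * mx j z"], THEN spec[of _ "\<lambda>j. dir_deriv u (a j)"]] Fam_deriv[OF * 1(2)] obtain C where
          C: "C \<ge> 0" "\<And>j z. norm (iD l (\<lambda>z. dir_deriv u (a j) (fst z)) z) \<le> C * (w j (fst z) * mx j (fst z) * ?p l j z)"
          by blast
        then show ?thesis
          unfolding 1 iD_snoc dir_deriv_fst[OF Fam_smooth[OF *]]
          by (intro exI[of _ C]) (auto simp: xw_def mult_ac)
      next
        case (2 v)
        show ?thesis
          unfolding 2 iD_snoc dir_deriv_fst[OF Fam_smooth[OF *]] dir_deriv_zero[OF Fam_smooth[OF *]]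
          using p[where l="l @ [(0, v)]"] w by (intro exI[of _ 0]) (auto simp: iD_zero)
      qed
    qed
  qed
  then show "l \<in> lists Basis \<Longrightarrow> \<exists>C\<ge>0. \<forall>j z. norm (iD l (\<lambda>z::'a \<times> 'a. a j (fst z)) z) \<le> C * (w j (fst z) * prod_list (map (\<lambda>v. xw (\<lambda>j z. mx j (fst z)) m\<xi> v j z) l))" for l
    using assms(1) nn(1) by blast
qed

lemma Fam_snd:
  fixes a :: "'j \<Rightarrow> 'a::euclidean_space \<Rightarrow> complex"
  assumes "Fam w (\<lambda>_. m\<xi>) a" and nn: "\<And>j z. 0 \<le> w j z" "\<And>j z. 0 \<le> mx j z" "\<And>j z. 0 \<le> m\<xi> j z"
  shows "Fam (\<lambda>j z. w j (snd z)) (xw mx (\<lambda>j z. m\<xi> j (snd z))) (\<lambda>j z. a j (snd z))"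
proof (rule FamI)
  show "smooth (\<lambda>z::'a \<times> 'a. a j (snd z))" for j by (rule smooth_snd[OF Fam_smooth[OF assms(1)]])
  have "\<forall>w a. Fam w (\<lambda>_. m\<xi>) a \<longrightarrow> (\<forall>j z. 0 \<le> w j z) \<longrightarrow>
    (\<exists>C\<ge>0. \<forall>j z. norm (iD l (\<lambda>z::'a \<times> 'a. a j (snd z)) z) \<le> C * (w j (snd z) * prod_list (map (\<lambda>v. xw mx (\<lambda>j z. m\<xi> j (snd z)) v j z) l)))"
    if "l \<in> lists Basis" for l :: "('a \<times> 'a) list"
    using that
  proof (induction l rule: rev_induct)
    case Nil
    then show ?case by (auto elim!: Fam_bound)
  next
    case (snoc b l)
    then have b: "b \<in> Basis" and l: "l \<in> lists Basis" by auto
    let ?p = "\<lambda>l j z. prod_list (map (\<lambda>v. xw mx (\<lambda>j z. m\<xi> j (snd z)) v j z) l)"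
    have p: "0 \<le> ?p l j z" for l :: "('a \<times> 'a) list" and j z by (induction l) (auto simp: xw_def nn)
    show ?case
    proof (intro allI impI)
      fix w and a :: "'j \<Rightarrow> 'a \<Rightarrow> complex" assume *: "Fam w (\<lambda>_. m\<xi>) a" and w: "\<forall>j z. 0 \<le> w j z"
      show "\<exists>C\<ge>0. \<forall>j z. norm (iD (l @ [b]) (\<lambda>z::'a \<times> 'a. a j (snd z)) z) \<le> C * (w j (snd z) * ?p (l @ [b]) j z)"
        using b
      proof (cases rule: Basis_prod_cases)
        case (2 v)
        have "\<forall>j z. 0 \<le> w j z * m\<xi> j z" using w nn(3) by simp
        with snoc.IH[OF l, THEN spec[of _ "\<lambda>j z. w j z * m\<xi> j z"], THEN spec[of _ "\<lambda>j. dir_deriv v (a j)"]] Fam_deriv[OF * 2(2)] obtain C where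
          C: "C \<ge> 0" "\<And>j z. norm (iD l (\<lambda>z. dir_deriv v (a j) (snd z)) z) \<le> C * (w j (snd z) * m\<xi> j (snd z) * ?p l j z)"
          by blast
        then show ?thesis
          unfolding 2 iD_snoc dir_deriv_snd[OF Fam_smooth[OF *]] using 2(3)
          by (intro exI[of _ C]) (auto simp: xw_def mult_ac)
      next
        case (1 u)
        show ?thesis
          unfolding 1 iD_snoc dir_deriv_snd[OF Fam_smooth[OF *]] dir_deriv_zero[OF Fam_smooth[OF *]]
          using p[where l="l @ [(u, 0)]"] w by (intro exI[of _ 0]) (auto simp: iD_zero)
      qed
    qed
  qed
  then show "l \<in> lists Basis \<Longrightarrow> \<exists>C\<ge>0. \<forall>j z. norm (iD l (\<lambda>z::'a \<times> 'a. a j (snd z)) z) \<le> C * (w j (snd z) * prod_list (map (\<lambda>v. xw mx (\<lambda>j z. m\<xi> j (snd z)) v j z) l))" for l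
    using assms(1) nn(1) by blast
qed

subsection \<open>Multi-index derivatives\<close>

definition mlist :: "('n::finite \<Rightarrow> 'a) \<Rightarrow> nat ^ 'n \<Rightarrow> 'a list" where
  "mlist e \<beta> = concat (map (\<lambda>i. replicate (\<beta> $ i) (e i)) index_list)"

lemma funpow_dir_deriv_iD: "(dir_deriv v ^^ k) f = iD (replicate k v) f"
  by (induction k) (auto simp: iD_Cons)

lemma multi_deriv_iD: "multi_deriv e \<beta> f = iD (mlist e \<beta>) f"
proof -
  have "foldr (\<lambda>i. dir_deriv (e i) ^^ (\<beta> $ i)) xs f = iD (concat (map (\<lambda>i. replicate (\<beta> $ i) (e i)) xs)) f" for xs
    by (induction xs) (auto simp: iD_append funpow_dir_deriv_iD)
  then show ?thesis unfolding multi_deriv_def mlist_def .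
qed

lemma length_mlist:
  fixes e :: "'n::finite \<Rightarrow> 'a"
  shows "length (mlist e \<beta>) = multi_size \<beta>"
proof -
  have "length (mlist e \<beta>) = sum_list (map (\<lambda>i. \<beta> $ i) (index_list :: 'n list))"
    unfolding mlist_def by (simp add: length_concat comp_def)
  also have "\<dots> = (\<Sum>i\<in>set (index_list :: 'n list). \<beta> $ i)"
    using index_list(1) by (subst sum_list_distinct_conv_sum_set) auto
  finally show ?thesis by (simp add: index_list(2) multi_size_def)
qed

lemma set_mlist: "set (mlist e \<beta>) \<subseteq> range e"
  unfolding mlist_def by auto

lemma count_mlist:
  fixes e :: "'n::finite \<Rightarrow> 'a"
  assumes "inj e"
  shows "count (mset (mlist e \<beta>)) v = (if v \<in> range e then \<beta> $ (inv e v) else 0)"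
proof (cases "v \<in> range e")
  case False
  then show ?thesis using set_mlist[of e \<beta>] by (auto simp: count_eq_zero_iff)
next
  case True
  then obtain i where v: "v = e i" by auto
  have "count (mset (concat (map (\<lambda>j. replicate (\<beta> $ j) (e j)) xs))) (e i) = (if i \<in> set xs then \<beta> $ i else 0)"
    if "distinct xs" for xs
    using that by (induction xs) (auto simp: inj_eq[OF assms])
  from this[OF index_list(1)] show ?thesis
    using True by (simp add: v mlist_def index_list(2) inv_f_f[OF assms])
qed

lemma ex_mlist:
  fixes e :: "'n::finite \<Rightarrow> 'a"
  assumes "inj e" "set l \<subseteq> range e"
  shows "\<exists>\<beta>. mset (mlist e \<beta>) = mset l"
proof (intro exI[of _ "\<chi> i. count (mset l) (e i)"] multiset_eqI)
  fix v
  show "count (mset (mlist e (\<chi> i. count (mset l) (e i)))) v = count (mset l) v"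
    unfolding count_mlist[OF assms(1)] using assms
    by (auto simp: f_inv_into_f count_eq_zero_iff)
qed

lemma inj_axis: "inj (\<lambda>i. axis i (1::real))"
  by (auto simp: inj_def axis_eq_axis)

lemma Basis_vec: "(Basis :: (real ^ 'n) set) = range (\<lambda>i. axis i 1)"
  by (auto simp: Basis_vec_def)

lemma iD_pderivs:
  fixes f :: "real ^ 'n::finite \<Rightarrow> complex"
  assumes "smooth f" "l \<in> lists Basis"
  obtains \<beta> where "iD l f = pderivs \<beta> f" "multi_size \<beta> = length l"
proof -
  obtain \<beta> where \<beta>: "mset (mlist (\<lambda>i. axis i (1::real)) \<beta>) = mset l"
    using ex_mlist[OF inj_axis, of l] assms(2) by (auto simp: Basis_vec)
  have "iD l f = pderivs \<beta> f"
    unfolding pderivs_def multi_deriv_iD by (rule iD_mset[OF assms(1) \<beta>[symmetric]])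
  moreover have "multi_size \<beta> = length l"
    using length_mlist[of "\<lambda>i. axis i (1::real)" \<beta>] mset_eq_length[OF \<beta>] by simp
  ultimately show ?thesis using that by blast
qed

lemma pderivs_iD:
  fixes f :: "real ^ 'n::finite \<Rightarrow> complex"
  obtains l where "pderivs \<beta> f = iD l f" "multi_size \<beta> = length l" "l \<in> lists Basis"
  using set_mlist[of "\<lambda>i. axis i (1::real)" \<beta>] length_mlist[of "\<lambda>i. axis i (1::real)" \<beta>] that
  unfolding pderivs_def multi_deriv_iD by (metis Basis_vec in_lists_conv_set subsetD)

lemma bracket_ge1: "1 \<le> bracket x"
  and bracket_pos: "0 < bracket x"
  by (auto simp: bracket_def add_pos_nonneg)

lemma schwartz_iff:
  "f \<in> schwartz \<longleftrightarrow> (\<forall>N::nat. Fam (\<lambda>_::unit. \<lambda>x. 1 / bracket x ^ N) (\<lambda>_ _ _. 1) (\<lambda>_. f))"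
proof (intro iffI allI)
  fix N assume f: "f \<in> schwartz"
  then have sm: "smooth f" by (simp add: schwartz_def)
  show "Fam (\<lambda>_::unit. \<lambda>x. 1 / bracket x ^ N) (\<lambda>_ _ _. 1) (\<lambda>_. f)"
  proof (rule FamI)
    fix l assume "l \<in> lists (Basis :: (real ^ 'a) set)"
    then obtain \<beta> where "iD l f = pderivs \<beta> f" using iD_pderivs[OF sm] by metis
    moreover obtain C where "\<And>x. bracket x ^ N * norm (pderivs \<beta> f x) \<le> C"
      using f unfolding schwartz_def by blast
    ultimately have "norm (iD l f x) \<le> max 0 C * (1 / bracket x ^ N)" for x
      using bracket_pos[of x] by (auto simp: field_simps intro: le_max_iff_disj[THEN iffD2])
    then show "\<exists>C\<ge>0. \<forall>(j::unit) z. norm (iD l f z) \<le> C * (1 / bracket z ^ N * prod_list (map (\<lambda>v. 1) l))"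
      by (intro exI[of _ "max 0 C"]) (simp add: prod_list_const)
  qed (rule sm)
next
  assume *: "\<forall>N::nat. Fam (\<lambda>_::unit. \<lambda>x. 1 / bracket x ^ N) (\<lambda>_ _ _. 1) (\<lambda>_. f)"
  have "\<exists>C. \<forall>x. bracket x ^ N * norm (pderivs \<beta> f x) \<le> C" for N \<beta>
  proof -
    obtain l where l: "pderivs \<beta> f = iD l f" "l \<in> lists Basis" by (rule pderivs_iD)
    from Fam_bound_iD[OF *[rule_format, of N] l(2)] obtain C where
      "\<And>z. norm (iD l f z) \<le> C * (1 / bracket z ^ N)" by (auto simp: prod_list_const)
    then show ?thesis unfolding l
      by (intro exI[of _ C] allI) (simp add: pos_le_divide_eq bracket_pos mult.commute)
  qed
  then show "f \<in> schwartz" using Fam_smooth[OF *[rule_format]] unfolding schwartz_def by blast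
qed

text \<open>The symbol class takes all frequency derivatives first and the x-derivatives afterwards,
  whereas a family bounds derivatives in every order. A list is sorted into its x-part and its
  frequency part, and \<open>iD_mset\<close> shows that nothing changes.\<close>

lemma symbol_class_Fam:
  fixes \<sigma> :: "(real ^ 'n::finite) \<times> (real ^ 'n) \<Rightarrow> complex"
  shows "\<sigma> \<in> symbol_class b \<rho> \<delta> \<longleftrightarrow>
    Fam (\<lambda>_::unit. \<lambda>z. bracket (snd z) powr b)
      (xw (\<lambda>_ z. bracket (snd z) powr \<delta>) (\<lambda>_ z. bracket (snd z) powr (- \<rho>))) (\<lambda>_. \<sigma>)"
proof -
  let ?e = "\<lambda>i::'n. (axis i 1, 0) :: (real ^ 'n) \<times> (real ^ 'n)"
  let ?e' = "\<lambda>i::'n. (0, axis i 1) :: (real ^ 'n) \<times> (real ^ 'n)"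
  let ?m = "xw (\<lambda>_::unit. \<lambda>z::(real ^ 'n) \<times> (real ^ 'n). bracket (snd z) powr \<delta>) (\<lambda>_ z. bracket (snd z) powr (- \<rho>))"
  have inj: "inj ?e" "inj ?e'" by (auto simp: inj_def axis_eq_axis)
  have ax: "axis i (1::real) \<noteq> 0" for i :: 'n by simp
  have weight: "bracket \<xi> powr (b + \<delta> * real (multi_size \<beta>) - \<rho> * real (multi_size \<gamma>)) =
      bracket \<xi> powr b * prod_list (map (\<lambda>v. ?m v () (x, \<xi>)) (mlist ?e \<beta> @ mlist ?e' \<gamma>))" for \<beta> \<gamma> and x \<xi> :: "real ^ 'n"
  proof -
    have c: "map (\<lambda>v. ?m v () (x, \<xi>)) (mlist ?e \<beta>) = map (\<lambda>v. bracket \<xi> powr \<delta>) (mlist ?e \<beta>)"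
      "map (\<lambda>v. ?m v () (x, \<xi>)) (mlist ?e' \<gamma>) = map (\<lambda>v. bracket \<xi> powr (- \<rho>)) (mlist ?e' \<gamma>)"
      using set_mlist[of ?e \<beta>] set_mlist[of ?e' \<gamma>] ax by (auto simp: xw_def)
    have "bracket \<xi> powr (b + \<delta> * real (multi_size \<beta>) - \<rho> * real (multi_size \<gamma>)) =
      bracket \<xi> powr b * ((bracket \<xi> powr \<delta>) ^ multi_size \<beta> * (bracket \<xi> powr (- \<rho>)) ^ multi_size \<gamma>)"
      using bracket_pos[of \<xi>] by (simp add: powr_realpow[symmetric] powr_powr powr_add[symmetric] add_diff_eq)
    then show ?thesis
      unfolding map_append prod_list.append c prod_list_const length_mlist .
  qed
  have pd: "pderivs_fst \<beta> (pderivs_snd \<gamma> \<sigma>) = iD (mlist ?e \<beta> @ mlist ?e' \<gamma>) \<sigma>" for \<beta> \<gamma>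
    unfolding pderivs_fst_def pderivs_snd_def multi_deriv_iD iD_append ..
  show ?thesis
  proof
    assume \<sigma>: "\<sigma> \<in> symbol_class b \<rho> \<delta>"
    then have sm: "smooth \<sigma>" by (simp add: symbol_class_def)
    show "Fam (\<lambda>_::unit. \<lambda>z. bracket (snd z) powr b) ?m (\<lambda>_. \<sigma>)"
    proof (rule FamI)
      fix l assume l: "l \<in> lists (Basis :: ((real ^ 'n) \<times> (real ^ 'n)) set)"
      let ?l1 = "filter (\<lambda>v. snd v = 0) l" and ?l2 = "filter (\<lambda>v. snd v \<noteq> 0) l"
      have "set ?l1 \<subseteq> range ?e" "set ?l2 \<subseteq> range ?e'"
        using l by (auto simp: Basis_prod_def Basis_vec in_lists_conv_set)
      then obtain \<beta> \<gamma> where bg: "mset (mlist ?e \<beta>) = mset ?l1" "mset (mlist ?e' \<gamma>) = mset ?l2"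
        using ex_mlist[OF inj(1)] ex_mlist[OF inj(2)] by metis
      then have ms: "mset l = mset (mlist ?e \<beta> @ mlist ?e' \<gamma>)"
        by (simp add: mset_filter multiset_partition)
      obtain C where C: "\<And>x \<xi>. norm (pderivs_fst \<beta> (pderivs_snd \<gamma> \<sigma>) (x, \<xi>))
         \<le> C * bracket \<xi> powr (b + \<delta> * real (multi_size \<beta>) - \<rho> * real (multi_size \<gamma>))"
        using \<sigma> unfolding symbol_class_def by blast
      have pm: "prod_list (map (\<lambda>v. ?m v () z) (mlist ?e \<beta> @ mlist ?e' \<gamma>)) = prod_list (map (\<lambda>v. ?m v () z) l)" for z
        unfolding prod_mset_prod_list[symmetric] mset_map ms ..
      have "norm (iD l \<sigma> z) \<le> max 0 C * (bracket (snd z) powr b * prod_list (map (\<lambda>v. ?m v () z) l))" for z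
      proof -
        have "norm (iD l \<sigma> z) \<le> C * bracket (snd z) powr (b + \<delta> * real (multi_size \<beta>) - \<rho> * real (multi_size \<gamma>))"
          using C[of "fst z" "snd z"] unfolding pd iD_mset[OF sm ms] by simp
        also have "\<dots> \<le> max 0 C * bracket (snd z) powr (b + \<delta> * real (multi_size \<beta>) - \<rho> * real (multi_size \<gamma>))"
          by (intro mult_right_mono) auto
        finally show ?thesis unfolding weight[of "snd z" \<beta> \<gamma> "fst z"] prod.collapse pm .
      qed
      then show "\<exists>C\<ge>0. \<forall>(j::unit) z. norm (iD l \<sigma> z) \<le> C * (bracket (snd z) powr b * prod_list (map (\<lambda>v. ?m v j z) l))"
        by (intro exI[of _ "max 0 C"]) simp
    qed (rule sm)
  next
    assume F: "Fam (\<lambda>_::unit. \<lambda>z. bracket (snd z) powr b) ?m (\<lambda>_. \<sigma>)"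
    have "\<exists>C. \<forall>x \<xi>. norm (pderivs_fst \<beta> (pderivs_snd \<gamma> \<sigma>) (x, \<xi>))
       \<le> C * bracket \<xi> powr (b + \<delta> * real (multi_size \<beta>) - \<rho> * real (multi_size \<gamma>))" for \<beta> \<gamma>
    proof -
      have L: "mlist ?e \<beta> @ mlist ?e' \<gamma> \<in> lists Basis"
        using set_mlist[of ?e \<beta>] set_mlist[of ?e' \<gamma>] by (auto simp: Basis_prod_def Basis_vec)
      obtain C where
        "C \<ge> 0" and C: "\<And>(j::unit) z. norm (iD (mlist ?e \<beta> @ mlist ?e' \<gamma>) \<sigma> z) \<le> C * (bracket (snd z) powr b * prod_list (map (\<lambda>v. ?m v j z) (mlist ?e \<beta> @ mlist ?e' \<gamma>)))"
        by (rule Fam_bound_iD[OF F L]) (rule that)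
      have "norm (iD (mlist ?e \<beta> @ mlist ?e' \<gamma>) \<sigma> (x, \<xi>)) \<le> C * (bracket \<xi> powr b * prod_list (map (\<lambda>v. ?m v () (x, \<xi>)) (mlist ?e \<beta> @ mlist ?e' \<gamma>)))" for x \<xi>
        using C[of "(x, \<xi>)" "()"] unfolding snd_conv .
      then show ?thesis unfolding pd weight[symmetric] by blast
    qed
    then show "\<sigma> \<in> symbol_class b \<rho> \<delta>"
      unfolding symbol_class_def using Fam_smooth[OF F] by blast
  qed
qed

subsection \<open>Lebesgue integration\<close>

lemma nn_integral_lborel_affine:
  fixes f :: "'a::euclidean_space \<Rightarrow> ennreal"
  assumes [measurable]: "f \<in> borel_measurable borel" and c: "c \<noteq> 0"
  shows "(\<integral>\<^sup>+x. f x \<partial>lborel) = ennreal (\<bar>c\<bar> ^ DIM('a)) * (\<integral>\<^sup>+x. f (t + c *\<^sub>R x) \<partial>lborel)"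
  by (subst lborel_affine[OF c, of t])
     (simp add: nn_integral_density nn_integral_distr nn_integral_cmult)

lemma integrable_lborel_affine:
  fixes f :: "'a::euclidean_space \<Rightarrow> complex"
  assumes f: "integrable lborel f" and c: "c \<noteq> 0"
  shows "integrable lborel (\<lambda>x. f (t + c *\<^sub>R x))"
proof -
  have m [measurable]: "f \<in> borel_measurable borel" using borel_measurable_integrable[OF f] by simp
  have "ennreal (\<bar>c\<bar> ^ DIM('a)) * (\<integral>\<^sup>+x. ennreal (norm (f (t + c *\<^sub>R x))) \<partial>lborel) < \<infinity>"
    using nn_integral_lborel_affine[OF _ c, of "\<lambda>x. ennreal (norm (f x))" t] f
    by (simp add: integrable_iff_bounded)
  then have "(\<integral>\<^sup>+x. ennreal (norm (f (t + c *\<^sub>R x))) \<partial>lborel) < \<infinity>"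
    using c by (auto simp: ennreal_mult_less_top)
  then show ?thesis by (intro integrableI_bounded) auto
qed

lemma integral_lborel_affine:
  fixes f :: "'a::euclidean_space \<Rightarrow> 'b::{banach, second_countable_topology}"
  assumes [measurable]: "f \<in> borel_measurable borel" and c: "c \<noteq> 0"
  shows "(\<integral>x. f x \<partial>lborel) = (\<bar>c\<bar> ^ DIM('a)) *\<^sub>R (\<integral>x. f (t + c *\<^sub>R x) \<partial>lborel)"
  by (subst lborel_affine[OF c, of t])
     (simp add: integral_density integral_distr)

lemma integral_lborel_shift:
  fixes f :: "'a::euclidean_space \<Rightarrow> 'b::{banach, second_countable_topology}"
  assumes "f \<in> borel_measurable borel"
  shows "(\<integral>x. f (x + t) \<partial>lborel) = (\<integral>x. f x \<partial>lborel)"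
  using integral_lborel_affine[OF assms, of 1 t] by (simp add: add.commute)

lemma integral_lborel_uminus:
  fixes f :: "'a::euclidean_space \<Rightarrow> complex"
  assumes "f \<in> borel_measurable borel"
  shows "(\<integral>x. f (- x) \<partial>lborel) = (\<integral>x. f x \<partial>lborel)"
  using integral_lborel_affine[OF assms, of "-1" 0] by simp

lemma nn_integral_lborel_reflect:
  fixes f :: "'a::euclidean_space \<Rightarrow> ennreal"
  assumes "f \<in> borel_measurable borel"
  shows "(\<integral>\<^sup>+x. f (t - x) \<partial>lborel) = (\<integral>\<^sup>+x. f x \<partial>lborel)"
  using nn_integral_lborel_affine[OF assms, of "-1" t] by simp

lemma nn_integral_lborel_shift:
  fixes f :: "'a::euclidean_space \<Rightarrow> ennreal"
  assumes "f \<in> borel_measurable borel"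
  shows "(\<integral>\<^sup>+x. f (x - t) \<partial>lborel) = (\<integral>\<^sup>+x. f x \<partial>lborel)"
  using nn_integral_lborel_affine[OF assms, of 1 "-t"] by simp

lemma nn_integral_inverse_quadratic: "(\<integral>\<^sup>+(x::real). ennreal (1 / (1 + x\<^sup>2)) \<partial>lborel) < \<infinity>"
proof -
  have *: "(\<integral>\<^sup>+x. ennreal (1 / (1 + x\<^sup>2)) * indicator {0 ..} x \<partial>lborel) = ennreal (pi / 2 - arctan 0)"
    by (rule nn_integral_FTC_atLeast)
      (auto intro!: derivative_eq_intros tendsto_arctan_at_top simp: add_nonneg_eq_0_iff field_simps)
  have "(\<integral>\<^sup>+(x::real). ennreal (1 / (1 + x\<^sup>2)) \<partial>lborel) \<le>
      (\<integral>\<^sup>+x. ennreal (1 / (1 + x\<^sup>2)) * indicator {0 ..} x + ennreal (1 / (1 + (-x)\<^sup>2)) * indicator {0 ..} (-x) \<partial>lborel)"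
    by (intro nn_integral_mono) (auto simp: indicator_def)
  also have "\<dots> = ennreal (pi / 2) + ennreal (pi / 2)"
    using nn_integral_lborel_reflect[of "\<lambda>x::real. ennreal (1 / (1 + x\<^sup>2)) * indicator {0 ..} x" 0] *
    by (subst nn_integral_add) auto
  finally show ?thesis by (rule order_le_less_trans) (simp add: ennreal_plus[symmetric] del: ennreal_plus)
qed

lemma continuous_bracket [continuous_intros]: "continuous_on S (bracket :: real ^ 'n \<Rightarrow> real)"
  unfolding bracket_def by (intro continuous_intros)

lemma borel_measurable_bracket [measurable]: "(bracket :: real ^ 'n \<Rightarrow> real) \<in> borel_measurable borel"
  using continuous_bracket by (rule borel_measurable_continuous_onI)

text \<open>Each factor 1 + (x . b)^2 is at most the square of the bracket, so 2n powers dominate a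
  product of one-dimensional functions and the integral factorises. The exponent is crude, but decay
  of every order is at hand wherever this is applied.\<close>

lemma nn_integral_bracket:
  assumes N: "N \<ge> 2 * CARD('n)"
  shows "(\<integral>\<^sup>+(x::real ^ 'n::finite). ennreal (1 / bracket x ^ N) \<partial>lborel) < \<infinity>"
proof -
  have le: "1 / bracket x ^ N \<le> (\<Prod>b\<in>Basis. 1 / (1 + (x \<bullet> b)\<^sup>2))" for x :: "real ^ 'n"
  proof -
    have "(\<Prod>b\<in>(Basis :: (real ^ 'n) set). 1 + (x \<bullet> b)\<^sup>2) \<le> (\<Prod>b\<in>(Basis :: (real ^ 'n) set). (bracket x)\<^sup>2)"
    proof (intro prod_mono conjI)
      fix b :: "real ^ 'n" assume "b \<in> Basis"
      then have "\<bar>x \<bullet> b\<bar> \<le> norm x" by (rule Basis_le_norm)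
      then have "(x \<bullet> b)\<^sup>2 \<le> (norm x)\<^sup>2" by (metis abs_ge_zero power2_abs power_mono)
      then show "1 + (x \<bullet> b)\<^sup>2 \<le> (bracket x)\<^sup>2"
      proof -
        have "(bracket x)\<^sup>2 = (norm x)\<^sup>2 + 2 * norm x + 1"
          by (simp add: bracket_def power2_eq_square algebra_simps)
        with \<open>(x \<bullet> b)\<^sup>2 \<le> (norm x)\<^sup>2\<close> norm_ge_zero[of x] show ?thesis by linarith
      qed
    qed (auto simp: add_nonneg_nonneg)
    also have "\<dots> = bracket x ^ (2 * CARD('n))" by (simp add: power_mult)
    also have "\<dots> \<le> bracket x ^ N" by (rule power_increasing[OF N bracket_ge1])
    finally have "(\<Prod>b\<in>(Basis :: (real ^ 'n) set). 1 + (x \<bullet> b)\<^sup>2) \<le> bracket x ^ N" .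
    moreover have "0 < (\<Prod>b\<in>(Basis :: (real ^ 'n) set). 1 + (x \<bullet> b)\<^sup>2)"
      by (intro prod_pos) (auto simp: add_pos_nonneg)
    ultimately show ?thesis
      by (simp add: prod_dividef frac_le)
  qed
  have "(\<integral>\<^sup>+(x::real ^ 'n). ennreal (1 / bracket x ^ N) \<partial>lborel) \<le>
      (\<integral>\<^sup>+(x::real ^ 'n). (\<Prod>b\<in>Basis. ennreal (1 / (1 + (x \<bullet> b)\<^sup>2))) \<partial>lborel)"
    by (intro nn_integral_mono) (use le in \<open>auto simp: prod_ennreal ennreal_leI\<close>)
  also have "\<dots> = (\<Prod>b\<in>(Basis :: (real ^ 'n) set). \<integral>\<^sup>+x. ennreal (1 / (1 + x\<^sup>2)) \<partial>lborel)"
    by (rule nn_integral_lborel_prod) auto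
  also have "\<dots> < \<infinity>"
    using nn_integral_inverse_quadratic by (simp add: power_less_top_ennreal)
  finally show ?thesis .
qed

lemma integrable_bracket:
  assumes N: "N \<ge> 2 * CARD('n)"
  shows "integrable lborel (\<lambda>x::real ^ 'n::finite. 1 / bracket x ^ N)"
  using nn_integral_bracket[OF N]
  by (intro integrableI_bounded) (auto simp: abs_of_pos bracket_pos)

lemma integrable_bound_bracket:
  fixes f :: "real ^ 'n::finite \<Rightarrow> complex"
  assumes "f \<in> borel_measurable borel" "N \<ge> 2 * CARD('n)" "\<And>x. norm (f x) \<le> C * (1 / bracket x ^ N)"
  shows "integrable lborel f"
proof (rule Bochner_Integration.integrable_bound[OF integrable_mult_right[OF integrable_bracket[OF assms(2)], of C]])
  show "AE x in lborel. norm (f x) \<le> norm (C * (1 / bracket x ^ N))"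
    using assms(3) by (intro AE_I2) (metis order_trans abs_ge_self real_norm_def)
qed (use assms in auto)

text \<open>The fundamental theorem on a unit segment writes f(x + v) - f(x) as an average of
  translates of the derivative. Integration in x and Fubini's theorem give the integral of the
  derivative on one side and, by translation invariance, 0 on the other. No boundary terms have to
  be controlled.\<close>

lemma integral_dir_deriv_zero:
  fixes f :: "'a::euclidean_space \<Rightarrow> complex"
  assumes sm: "smooth f" and int: "integrable lborel f" "integrable lborel (dir_deriv v f)"
  shows "(\<integral>x. dir_deriv v f x \<partial>lborel) = 0"
proof -
  let ?d = "dir_deriv v f"
  have [measurable]: "f \<in> borel_measurable borel" "?d \<in> borel_measurable borel"
    using int by (auto dest: borel_measurable_integrable)
  have ftc: "(\<integral>t. indicator {0..1} t *\<^sub>R ?d (x + t *\<^sub>R v) \<partial>lborel) = f (x + v) - f x" for x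
  proof -
    have "(\<integral>t. indicator {0..1} t *\<^sub>R ?d (x + t *\<^sub>R v) \<partial>lborel) = f (x + 1 *\<^sub>R v) - f (x + 0 *\<^sub>R v)"
    proof (rule integral_FTC_Icc)
      show "((\<lambda>t. f (x + t *\<^sub>R v)) has_vector_derivative ?d (x + t *\<^sub>R v)) (at t within {0..1})" for t
        by (rule smooth_line_derivative[OF sm])
      show "continuous_on {0..1} (\<lambda>t. ?d (x + t *\<^sub>R v))"
        by (rule continuous_on_compose2[where g="dir_deriv v f" and t=UNIV])
          (intro smooth_continuous smooth_dir_deriv sm, auto intro!: continuous_intros)
    qed simp
    then show ?thesis by simp
  qed
  have nrm: "(\<integral>x. norm (?d (x + t *\<^sub>R v)) \<partial>lborel) = (\<integral>x. norm (?d x) \<partial>lborel)" for t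
    using integral_lborel_shift[of "\<lambda>x. complex_of_real (norm (?d x))" "t *\<^sub>R v"] by simp
  have sh: "integrable lborel (\<lambda>x. ?d (x + t *\<^sub>R v))" for t
    using integrable_lborel_affine[OF int(2), of 1 "t *\<^sub>R v"] by (simp add: add.commute)
  have I: "integrable (lborel \<Otimes>\<^sub>M lborel) (\<lambda>(t, x). indicator {0..1::real} t *\<^sub>R ?d (x + t *\<^sub>R v))"
  proof (rule lborel_pair.Fubini_integrable)
    show "integrable lborel (\<lambda>t. \<integral>x. norm (case (t, x) of (t, x) \<Rightarrow> indicator {0..1::real} t *\<^sub>R ?d (x + t *\<^sub>R v)) \<partial>lborel)"
      by (simp add: nrm)
    show "AE t in lborel. integrable lborel (\<lambda>x. case (t, x) of (t, x) \<Rightarrow> indicator {0..1::real} t *\<^sub>R ?d (x + t *\<^sub>R v))"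
      using sh by (intro AE_I2) simp
  qed measurable
  have "(\<integral>x. (f (x + v) - f x) \<partial>lborel) = (\<integral>x. \<integral>t. indicator {0..1::real} t *\<^sub>R ?d (x + t *\<^sub>R v) \<partial>lborel \<partial>lborel)"
    by (simp add: ftc)
  also have "\<dots> = (\<integral>t. \<integral>x. indicator {0..1::real} t *\<^sub>R ?d (x + t *\<^sub>R v) \<partial>lborel \<partial>lborel)"
    by (rule lborel_pair.Fubini_integral[OF I])
  also have "\<dots> = (\<integral>t. indicator {0..1::real} t *\<^sub>R (\<integral>x. ?d x \<partial>lborel) \<partial>lborel)"
    by (simp add: integral_lborel_shift)
  also have "\<dots> = (\<integral>x. ?d x \<partial>lborel)" by simp
  finally have "(\<integral>x. ?d x \<partial>lborel) = (\<integral>x. (f (x + v) - f x) \<partial>lborel)" by simp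
  also have "\<dots> = 0"
    using integrable_lborel_affine[OF int(1), of 1 v] int(1)
    by (subst Bochner_Integration.integral_diff) (auto simp: add.commute[of v] integral_lborel_shift)
  finally show ?thesis .
qed

lemma has_derivative_integral:
  fixes g :: "'a::euclidean_space \<Rightarrow> 'b \<Rightarrow> complex"
  assumes der: "\<And>x y. ((\<lambda>x. g x y) has_derivative g' x y) (at x)"
    and int: "\<And>x. integrable M (g x)"
    and meas: "\<And>x v. (\<lambda>y. g' x y v) \<in> borel_measurable M"
    and bd: "\<And>x y v. norm (g' x y v) \<le> H y * norm v"
    and H: "integrable M H"
  shows "((\<lambda>x. \<integral>y. g x y \<partial>M) has_derivative (\<lambda>v. \<integral>y. g' x y v \<partial>M)) (at x)"
proof -
  have lin: "linear (g' x y)" for x y using has_derivative_linear[OF der] .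
  have int': "integrable M (\<lambda>y. g' x y v)" for x v
    by (rule Bochner_Integration.integrable_bound[OF integrable_mult_left[OF H, of "norm v"]])
      (use meas order_trans[OF bd abs_ge_self] in auto)
  have lipschitz: "norm (g z y - g x y) \<le> H y * norm (z - x)" for z y
  proof (rule differentiable_bound[of UNIV "\<lambda>x. g x y" "\<lambda>x. g' x y"])
    show "onorm (g' x y) \<le> H y" for x
    proof (rule onorm_bound)
      have "0 \<le> H y * norm (One :: 'a)" using bd[of x y One] norm_ge_zero order_trans by blast
      moreover have "(One :: 'a) \<noteq> 0" by simp
      ultimately show "0 \<le> H y" by (simp add: zero_le_mult_iff)
    qed (use bd in simp)
  qed (use der in auto)
  have bl: "bounded_linear (\<lambda>v. \<integral>y. g' x y v \<partial>M)"
  proof (rule linear_conv_bounded_linear[THEN iffD1], rule linearI)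
    show "(\<integral>y. g' x y (u + v) \<partial>M) = (\<integral>y. g' x y u \<partial>M) + (\<integral>y. g' x y v \<partial>M)" for u v
      by (subst Bochner_Integration.integral_add[OF int' int', symmetric]) (simp add: linear_add[OF lin])
    show "(\<integral>y. g' x y (c *\<^sub>R v) \<partial>M) = c *\<^sub>R (\<integral>y. g' x y v \<partial>M)" for c v
      by (simp add: linear_scale[OF lin])
  qed
  have "((\<lambda>z. ((\<integral>y. g z y \<partial>M) - (\<integral>y. g x y \<partial>M) - (\<integral>y. g' x y (z - x) \<partial>M)) /\<^sub>R norm (z - x)) \<longlongrightarrow> 0) (at x)"
  proof (subst tendsto_at_iff_sequentially, intro allI impI)
    fix X assume X: "\<forall>i. X i \<in> UNIV - {x}" "X \<longlonglongrightarrow> x"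
    let ?q = "\<lambda>i y. (g (X i) y - g x y - g' x y (X i - x)) /\<^sub>R norm (X i - x)"
    have lim: "(\<lambda>i. \<integral>y. ?q i y \<partial>M) \<longlonglongrightarrow> (\<integral>y. 0 \<partial>M)"
    \<comment> \<open>One H dominates the increment, by the mean value inequality, and the other the
      linear part.\<close>
    proof (rule integral_dominated_convergence[where w="\<lambda>y. 2 * H y"])
      show "?q i \<in> borel_measurable M" for i
        using int[THEN borel_measurable_integrable] meas by measurable
      show "AE y in M. (\<lambda>i. ?q i y) \<longlonglongrightarrow> 0"
      proof (rule AE_I2)
        fix y
        have "((\<lambda>z. (g z y - g x y - g' x y (z - x)) /\<^sub>R norm (z - x)) \<longlongrightarrow> 0) (at x)"
          using der[of y x] unfolding has_derivative_at_within by (simp add: divide_inverse_commute)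
        then show "(\<lambda>i. ?q i y) \<longlonglongrightarrow> 0"
          using X unfolding tendsto_at_iff_sequentially comp_def by blast
      qed
      show "AE y in M. norm (?q i y) \<le> 2 * H y" for i
      proof (rule AE_I2)
        fix y
        have pos: "norm (X i - x) > 0" using X(1) by simp
        have "norm (g (X i) y - g x y - g' x y (X i - x)) \<le> 2 * H y * norm (X i - x)"
          using norm_triangle_ineq4[of "g (X i) y - g x y" "g' x y (X i - x)"] lipschitz[of "X i" y] bd[of x y "X i - x"] by linarith
        moreover have "norm (?q i y) = norm (g (X i) y - g x y - g' x y (X i - x)) / norm (X i - x)"
          by (simp add: divide_inverse_commute)
        ultimately show "norm (?q i y) \<le> 2 * H y" using pos by (simp add: pos_divide_le_eq)
      qed
    qed (use H in auto)
    have eq: "(\<integral>y. ?q i y \<partial>M) = ((\<integral>y. g (X i) y \<partial>M) - (\<integral>y. g x y \<partial>M) - (\<integral>y. g' x y (X i - x) \<partial>M)) /\<^sub>R norm (X i - x)" for i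
      using int int' by simp
    show "((\<lambda>z. ((\<integral>y. g z y \<partial>M) - (\<integral>y. g x y \<partial>M) - (\<integral>y. g' x y (z - x) \<partial>M)) /\<^sub>R norm (z - x)) \<circ> X) \<longlonglongrightarrow> 0"
      using lim[unfolded eq] by (simp add: comp_def)
  qed
  with bl show ?thesis unfolding has_derivative_at_within by (simp add: divide_inverse_commute)
qed

text \<open>Cauchy-Schwarz with respect to the weight \<Phi>(x - y) dy, whose total mass is the same
  for every x, followed by Tonelli's theorem.\<close>

lemma young_L2:
  fixes \<Phi> :: "'a::euclidean_space \<Rightarrow> real" and g :: "'a \<Rightarrow> ennreal"
  assumes [measurable]: "\<Phi> \<in> borel_measurable borel" "g \<in> borel_measurable borel" and nn: "\<And>x. 0 \<le> \<Phi> x"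
  shows "(\<integral>\<^sup>+x. (\<integral>\<^sup>+y. ennreal (\<Phi> (x - y)) * g y \<partial>lborel)\<^sup>2 \<partial>lborel)
    \<le> (\<integral>\<^sup>+x. ennreal (\<Phi> x) \<partial>lborel)\<^sup>2 * (\<integral>\<^sup>+x. (g x)\<^sup>2 \<partial>lborel)"
proof -
  let ?A = "\<integral>\<^sup>+x. ennreal (\<Phi> x) \<partial>lborel"
  have cs: "(\<integral>\<^sup>+y. ennreal (\<Phi> (x - y)) * g y \<partial>lborel)\<^sup>2 \<le> ?A * (\<integral>\<^sup>+y. ennreal (\<Phi> (x - y)) * (g y)\<^sup>2 \<partial>lborel)" for x
  proof -
    have sq: "(ennreal (sqrt (\<Phi> z)))\<^sup>2 = ennreal (\<Phi> z)" for z
      using nn by (simp add: ennreal_power)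
    have "(\<integral>\<^sup>+y. ennreal (sqrt (\<Phi> (x - y))) * (ennreal (sqrt (\<Phi> (x - y))) * g y) \<partial>lborel)\<^sup>2
      \<le> (\<integral>\<^sup>+y. (ennreal (sqrt (\<Phi> (x - y))))\<^sup>2 \<partial>lborel) * (\<integral>\<^sup>+y. (ennreal (sqrt (\<Phi> (x - y))) * g y)\<^sup>2 \<partial>lborel)"
      by (rule Cauchy_Schwarz_nn_integral) measurable
    then show ?thesis
      unfolding mult.assoc[symmetric] power2_eq_square[symmetric] power_mult_distrib sq
      using nn_integral_lborel_reflect[of "\<lambda>x. ennreal (\<Phi> x)" x] by simp
  qed
  have "(\<integral>\<^sup>+x. (\<integral>\<^sup>+y. ennreal (\<Phi> (x - y)) * g y \<partial>lborel)\<^sup>2 \<partial>lborel) \<le> (\<integral>\<^sup>+x. ?A * (\<integral>\<^sup>+y. ennreal (\<Phi> (x - y)) * (g y)\<^sup>2 \<partial>lborel) \<partial>lborel)"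
    by (intro nn_integral_mono cs)
  also have "\<dots> = ?A * (\<integral>\<^sup>+x. \<integral>\<^sup>+y. ennreal (\<Phi> (x - y)) * (g y)\<^sup>2 \<partial>lborel \<partial>lborel)"
    by (subst nn_integral_cmult) auto
  also have "(\<integral>\<^sup>+x. \<integral>\<^sup>+y. ennreal (\<Phi> (x - y)) * (g y)\<^sup>2 \<partial>lborel \<partial>lborel) = (\<integral>\<^sup>+y. \<integral>\<^sup>+x. ennreal (\<Phi> (x - y)) * (g y)\<^sup>2 \<partial>lborel \<partial>lborel)"
    by (rule lborel_pair.Fubini') measurable
  also have "\<dots> = (\<integral>\<^sup>+y. ?A * (g y)\<^sup>2 \<partial>lborel)"
    by (intro nn_integral_cong) (simp add: nn_integral_multc nn_integral_lborel_shift[of "\<lambda>x. ennreal (\<Phi> x)"])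
  also have "\<dots> = ?A * (\<integral>\<^sup>+y. (g y)\<^sup>2 \<partial>lborel)"
    by (subst nn_integral_cmult) auto
  finally show ?thesis by (simp add: power2_eq_square mult.assoc)
qed

lemma sum_le_nn_integral_count_space:
  assumes "finite A"
  shows "(\<Sum>k\<in>A. f k) \<le> (\<integral>\<^sup>+k. f k \<partial>count_space UNIV)"
proof -
  have "(\<Sum>k\<in>A. f k) = (\<integral>\<^sup>+k. f k * indicator A k \<partial>count_space UNIV)"
    using assms by (subst nn_integral_count_space'[of A]) (auto simp: indicator_def)
  also have "\<dots> \<le> (\<integral>\<^sup>+k. f k \<partial>count_space UNIV)" by (intro nn_integral_mono) (auto simp: indicator_def)
  finally show ?thesis .
qed

subsection \<open>Schwartz functions\<close>

declare bracket_pos [simp]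

lemma bracket_nonneg [simp]: "0 \<le> bracket x"
  by (simp add: less_imp_le)

lemma bracket_nonzero [simp]: "bracket x \<noteq> 0"
  using bracket_pos[of x] by linarith

abbreviation rapid :: "nat \<Rightarrow> unit \<Rightarrow> real ^ 'n \<Rightarrow> real" where
  "rapid N \<equiv> \<lambda>_ x. 1 / bracket x ^ N"

lemma schwartz_smooth: "f \<in> schwartz \<Longrightarrow> smooth f"
  by (simp add: schwartz_def)

lemma schwartz_Fam: "f \<in> schwartz \<Longrightarrow> Fam (rapid N) (\<lambda>_ _ _. 1) (\<lambda>_. f)"
  by (simp add: schwartz_iff)

lemma schwartz_bound:
  assumes "f \<in> schwartz"
  obtains C where "C \<ge> 0" "\<And>x. norm (f x) \<le> C * (1 / bracket x ^ N)"
  using Fam_bound[OF schwartz_Fam[OF assms, of N]] by metis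

lemma smooth_measurable: "smooth f \<Longrightarrow> f \<in> borel_measurable borel"
  by (intro borel_measurable_continuous_onI smooth_continuous)

lemma schwartz_measurable: "f \<in> schwartz \<Longrightarrow> f \<in> borel_measurable borel"
  by (intro smooth_measurable schwartz_smooth)

lemma schwartz_integrable: "f \<in> schwartz \<Longrightarrow> integrable lborel f"
  by (metis integrable_bound_bracket schwartz_bound schwartz_measurable order_refl)

lemma schwartz_bounded:
  assumes "f \<in> schwartz"
  obtains C where "C \<ge> 0" "\<And>x. norm (f x) \<le> C"
  using schwartz_bound[OF assms, of 0] by auto

lemma schwartz_dir_deriv: "f \<in> schwartz \<Longrightarrow> b \<in> Basis \<Longrightarrow> dir_deriv b f \<in> schwartz"
  using Fam_deriv[OF schwartz_Fam] unfolding schwartz_iff by fastforce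

lemma schwartz_add: "f \<in> schwartz \<Longrightarrow> g \<in> schwartz \<Longrightarrow> (\<lambda>x. f x + g x) \<in> schwartz"
  unfolding schwartz_iff using Fam_add by blast

lemma rapid_nonneg: "0 \<le> rapid N j x"
  using bracket_pos[of x] by (simp add: less_imp_le)

lemma schwartz_mult_bounded:
  assumes f: "f \<in> schwartz" and g: "Fam (\<lambda>_::unit. \<lambda>x. bracket x ^ K) (\<lambda>_ _ _. 1) (\<lambda>_. g)"
  shows "(\<lambda>x. g x * f x) \<in> schwartz"
  unfolding schwartz_iff
proof
  fix N
  \<comment> \<open>K further powers of the decay of f pay for the growth of g.\<close>
  have "Fam (\<lambda>_ x. bracket x ^ K * (1 / bracket x ^ (K + N))) (\<lambda>_ _ _. 1) (\<lambda>(_::unit) x. g x * f x)"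
    by (rule Fam_mult[OF g schwartz_Fam[OF f]]) auto
  moreover have "bracket x ^ K * (1 / bracket x ^ (K + N)) = 1 / bracket x ^ N" for x :: "real ^ 'a"
    using bracket_pos[of x] by (simp add: power_add)
  ultimately show "Fam (rapid N) (\<lambda>_ _ _. 1) (\<lambda>_::unit. \<lambda>x. g x * f x)" by simp
qed

lemma Fam_1I:
  assumes "Fam (rapid 0) (\<lambda>_ _ _. 1) (\<lambda>_. g)"
  shows "Fam (\<lambda>_::unit. \<lambda>x. bracket x ^ 0) (\<lambda>_ _ _. 1) (\<lambda>_. g)"
  using assms by simp

lemma schwartz_mult: "f \<in> schwartz \<Longrightarrow> g \<in> schwartz \<Longrightarrow> (\<lambda>x. f x * g x) \<in> schwartz"
  by (rule schwartz_mult_bounded[OF _ Fam_1I[OF schwartz_Fam]])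

lemma schwartz_cmult: "f \<in> schwartz \<Longrightarrow> (\<lambda>x. c * f x) \<in> schwartz"
  unfolding schwartz_iff using Fam_cmult1[OF _ rapid_nonneg] by fastforce

lemma schwartz_zero: "(\<lambda>x. 0) \<in> schwartz"
  unfolding schwartz_iff by (intro allI Fam_zero) (auto simp: rapid_nonneg)

lemma schwartz_sum: "finite I \<Longrightarrow> (\<And>i. i \<in> I \<Longrightarrow> f i \<in> schwartz) \<Longrightarrow> (\<lambda>x. \<Sum>i\<in>I. f i x) \<in> schwartz"
  by (induction I rule: finite_induct) (auto intro: schwartz_add schwartz_zero)

lemma schwartz_cnj: "f \<in> schwartz \<Longrightarrow> (\<lambda>x. cnj (f x)) \<in> schwartz"
  unfolding schwartz_iff using Fam_bounded_linear[OF _ bounded_linear_cnj rapid_nonneg] by fastforce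

lemma Fam_inner:
  fixes u :: "real ^ 'n::finite"
  shows "Fam (\<lambda>_::unit. bracket) (\<lambda>_ _ _. 1) (\<lambda>_ x. complex_of_real (x \<bullet> u - c))"
proof (rule Fam_step)
  show "smooth (\<lambda>x::real ^ 'n. complex_of_real (x \<bullet> u - c))" by (rule smooth_inner)
  have "\<bar>x \<bullet> u - c\<bar> \<le> (norm u + \<bar>c\<bar>) * bracket x" for x :: "real ^ 'n"
  proof -
    have "\<bar>x \<bullet> u - c\<bar> \<le> norm x * norm u + \<bar>c\<bar>" using Cauchy_Schwarz_ineq2[of x u] by linarith
    also have "\<dots> \<le> (norm u + \<bar>c\<bar>) * bracket x" by (simp add: bracket_def algebra_simps)
    finally show ?thesis .
  qed
  then show "\<exists>C\<ge>0. \<forall>(j::unit) x. norm (complex_of_real (x \<bullet> u - c)) \<le> C * bracket x"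
    by (intro exI[of _ "norm u + \<bar>c\<bar>"]) (auto simp del: of_real_diff)
  show "Fam (\<lambda>j x. bracket x * 1) (\<lambda>_ _ _. 1) (\<lambda>(j::unit). dir_deriv b (\<lambda>x. complex_of_real (x \<bullet> u - c)))" for b :: "real ^ 'n"
    unfolding dir_deriv_inner
    by (rule Fam_mono[OF Fam_const[of "\<lambda>_ _ _. 1" "\<lambda>_. complex_of_real (b \<bullet> u)"], where K="max 1 \<bar>b \<bullet> u\<bar>"])
      (use mult_mono[OF max.cobounded2[of "\<bar>b \<bullet> u\<bar>" 1] bracket_ge1[of "_ :: real ^ 'n"]] in auto)
qed

lemma schwartz_scaled:
  fixes f :: "real ^ 'n::finite \<Rightarrow> complex"
  assumes f: "f \<in> schwartz" and c: "c \<noteq> 0"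
  shows "(\<lambda>x. f (c *\<^sub>R x + p)) \<in> schwartz"
  unfolding schwartz_iff
proof
  fix N
  \<comment> \<open>\<open>Fam_mono\<close> admits a single constant; here it has to bound both the
    cost of a derivative and the ratio of the two weights.\<close>
  define K where "K = max \<bar>c\<bar> (((1 + norm p) / \<bar>c\<bar> + 1) ^ N)"
  have "1 / bracket (c *\<^sub>R x + p) ^ N \<le> K * (1 / bracket x ^ N)" for x
  proof -
    have "\<bar>c\<bar> * norm x \<le> norm (c *\<^sub>R x + p) + norm p"
      using norm_triangle_ineq4[of "c *\<^sub>R x + p" p] by simp
    then have "norm x \<le> (norm (c *\<^sub>R x + p) + norm p) / \<bar>c\<bar>" using c by (simp add: field_simps)
    also have "\<dots> \<le> ((1 + norm p) * bracket (c *\<^sub>R x + p)) / \<bar>c\<bar>"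
      by (intro divide_right_mono) (auto simp: bracket_def algebra_simps add_nonneg_nonneg)
    finally have "bracket x \<le> ((1 + norm p) / \<bar>c\<bar> + 1) * bracket (c *\<^sub>R x + p)"
      using bracket_ge1[of "c *\<^sub>R x + p"] by (simp add: bracket_def[of x] algebra_simps)
    then have "bracket x ^ N \<le> ((1 + norm p) / \<bar>c\<bar> + 1) ^ N * bracket (c *\<^sub>R x + p) ^ N"
      using bracket_pos[of x] by (metis less_imp_le power_mono power_mult_distrib)
    also have "\<dots> \<le> K * bracket (c *\<^sub>R x + p) ^ N"
      by (intro mult_right_mono) (auto simp: K_def)
    finally show ?thesis using bracket_pos[of x] bracket_pos[of "c *\<^sub>R x + p"]
      by (simp add: field_simps)
  qed
  then show "Fam (rapid N) (\<lambda>_ _ _. 1) (\<lambda>_::unit. \<lambda>x. f (c *\<^sub>R x + p))"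
    by (intro Fam_mono[OF Fam_scaled[OF schwartz_Fam[OF f, of N], of "\<lambda>_. c" "\<lambda>_. p"], where K=K])
      (auto simp: rapid_nonneg K_def)
qed

lemma schwartz_uminus: "f \<in> schwartz \<Longrightarrow> (\<lambda>x. f (- x)) \<in> schwartz"
  using schwartz_scaled[of f "-1" 0] by simp

lemma schwartz_shift: "f \<in> schwartz \<Longrightarrow> (\<lambda>x. f (x - p)) \<in> schwartz"
  using schwartz_scaled[of f 1 "-p"] by simp

lemma norm_le_sum_Basis: "norm x \<le> (\<Sum>b\<in>Basis. \<bar>x \<bullet> b\<bar>)"
  by (rule norm_le_l1)

text \<open>Boundedness suffices if the class is also closed under multiplication by coordinates: a
  bracket is at most 1 plus the sum of the absolute coordinates, so every such closure step yields
  one more power of decay.\<close>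

lemma schwartz_coinduct:
  fixes f :: "real ^ 'n::finite \<Rightarrow> complex"
  assumes fX: "f \<in> X"
    and diff: "\<And>f. f \<in> X \<Longrightarrow> f differentiable_on UNIV"
    and D: "\<And>f b. f \<in> X \<Longrightarrow> b \<in> Basis \<Longrightarrow> dir_deriv b f \<in> X"
    and M: "\<And>f b. f \<in> X \<Longrightarrow> b \<in> Basis \<Longrightarrow> (\<lambda>x. complex_of_real (x \<bullet> b) * f x) \<in> X"
    and bd: "\<And>f. f \<in> X \<Longrightarrow> \<exists>C. \<forall>x. norm (f x) \<le> C"
  shows "f \<in> schwartz"
proof -
  have rd: "\<forall>f\<in>X. \<exists>C. \<forall>x. bracket x ^ N * norm (f x) \<le> C" for N
  proof (induction N)
    case 0
    then show ?case using bd by auto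
  next
    case (Suc N)
    show ?case
    proof
      fix f assume f: "f \<in> X"
      obtain C where C: "\<And>x. bracket x ^ N * norm (f x) \<le> C" using Suc f by blast
      have "\<forall>b\<in>Basis. \<exists>C. \<forall>x. bracket x ^ N * norm (complex_of_real (x \<bullet> b) * f x) \<le> C"
      proof
        fix b :: "real ^ 'n" assume "b \<in> Basis"
        from Suc[THEN bspec, OF M[OF f this]]
        show "\<exists>C. \<forall>x. bracket x ^ N * norm (complex_of_real (x \<bullet> b) * f x) \<le> C" .
      qed
      then obtain C' where C': "\<And>b x. b \<in> Basis \<Longrightarrow> bracket x ^ N * norm (complex_of_real (x \<bullet> b) * f x) \<le> C' b"
        by metis
      have "bracket x ^ Suc N * norm (f x) \<le> C + (\<Sum>b\<in>Basis. C' b)" for x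
      proof -
        have "bracket x ^ Suc N * norm (f x) \<le> (1 + (\<Sum>b\<in>Basis. \<bar>x \<bullet> b\<bar>)) * (bracket x ^ N * norm (f x))"
          using norm_le_sum_Basis[of x] bracket_pos[of x]
          by (simp add: bracket_def[of x] mult_right_mono mult.assoc)
        also have "\<dots> = bracket x ^ N * norm (f x) + (\<Sum>b\<in>Basis. bracket x ^ N * norm (complex_of_real (x \<bullet> b) * f x))"
          by (simp add: distrib_left distrib_right sum_distrib_right sum_distrib_left norm_mult mult_ac)
        also have "\<dots> \<le> C + (\<Sum>b\<in>Basis. C' b)"
          using C C' by (intro add_mono sum_mono) auto
        finally show ?thesis .
      qed
      then show "\<exists>C. \<forall>x. bracket x ^ Suc N * norm (f x) \<le> C" by blast
    qed
  qed
  have iDX: "l \<in> lists Basis \<Longrightarrow> iD l f \<in> X" for l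
    by (induction l) (auto simp: fX iD_Cons D)
  have sm: "smooth f" by (rule smooth_coinduct[OF fX diff D])
  show ?thesis unfolding schwartz_def
    using sm rd iDX by (auto intro: pderivs_iD) (metis pderivs_iD)
qed

subsection \<open>Oscillatory integrals with rapidly decreasing amplitude\<close>

text \<open>Rapid decay is required in the frequency only; in x all derivatives are merely bounded.
  Differentiating \<open>osc\<close> and multiplying it by a coordinate both lead back to this
  class.\<close>

definition amplitude :: "((real ^ 'n::finite) \<times> (real ^ 'n) \<Rightarrow> complex) \<Rightarrow> bool" where
  "amplitude b \<longleftrightarrow> (\<forall>N::nat. Fam (\<lambda>_::unit. \<lambda>z. 1 / bracket (snd z) ^ N) (\<lambda>_ _ _. 1) (\<lambda>_. b))"

definition osc :: "((real ^ 'n::finite) \<times> (real ^ 'n) \<Rightarrow> complex) \<Rightarrow> real ^ 'n \<Rightarrow> complex" where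
  "osc b x = (\<integral>\<xi>. exp (\<i> * complex_of_real (x \<bullet> \<xi>)) * b (x, \<xi>) \<partial>lborel)"

lemma xw_1: "xw (\<lambda>_ _. 1) (\<lambda>_ _. 1) = (\<lambda>_ _ _. 1)"
  by (auto simp: xw_def fun_eq_iff)

lemma amplitude_smooth: "amplitude b \<Longrightarrow> smooth b"
  unfolding amplitude_def by (drule spec[of _ 0], drule Fam_smooth)

lemma amplitude_bound:
  assumes "amplitude b"
  obtains C where "C \<ge> 0" "\<And>x \<xi>. norm (b (x, \<xi>)) \<le> C * (1 / bracket \<xi> ^ N)"
proof -
  from assms have "Fam (\<lambda>_::unit. \<lambda>z. 1 / bracket (snd z) ^ N) (\<lambda>_ _ _. 1) (\<lambda>_. b)"
    unfolding amplitude_def by blast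
  from Fam_bound[OF this] obtain C where C: "C \<ge> 0" "\<And>(j::unit) z. norm (b z) \<le> C * (1 / bracket (snd z) ^ N)"
    by blast
  show ?thesis by (rule that[OF C(1)]) (use C(2)[of "(_, _)"] in simp)
qed

lemma amplitude_snd:
  fixes f :: "real ^ 'n::finite \<Rightarrow> complex"
  assumes f: "f \<in> schwartz"
  shows "amplitude (\<lambda>z. f (snd z))"
  unfolding amplitude_def
proof
  fix N
  have "Fam (\<lambda>j z. rapid N j (snd z)) (xw (\<lambda>_ _. 1) (\<lambda>_ _. 1)) (\<lambda>(_::unit) (z :: (real ^ 'n) \<times> (real ^ 'n)). f (snd z))"
    by (rule Fam_snd[OF schwartz_Fam[OF f]]) (auto simp: rapid_nonneg)
  then show "Fam (\<lambda>(_::unit) z. 1 / bracket (snd z) ^ N) (\<lambda>_ _ _. 1) (\<lambda>(_::unit) (z :: (real ^ 'n) \<times> (real ^ 'n)). f (snd z))"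
    unfolding xw_1 .
qed

lemma amplitude_add: "amplitude b \<Longrightarrow> amplitude b' \<Longrightarrow> amplitude (\<lambda>z. b z + b' z)"
  unfolding amplitude_def using Fam_add by blast

lemma amplitude_cmult: "amplitude b \<Longrightarrow> amplitude (\<lambda>z. c * b z)"
  unfolding amplitude_def using Fam_cmult1[where w="\<lambda>_ z. 1 / bracket (snd z) ^ _"] rapid_nonneg by fastforce

lemma amplitude_dir_deriv: "amplitude b \<Longrightarrow> v \<in> Basis \<Longrightarrow> amplitude (dir_deriv v b)"
  unfolding amplitude_def using Fam_deriv by fastforce

lemma amplitude_inner:
  fixes b :: "(real ^ 'n::finite) \<times> (real ^ 'n) \<Rightarrow> complex"
  assumes "amplitude b"
  shows "amplitude (\<lambda>z. complex_of_real (snd z \<bullet> v - c) * b z)"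
  unfolding amplitude_def
proof
  fix N
  have "Fam (\<lambda>(_::unit) z. bracket (snd z) * (1 / bracket (snd z) ^ (Suc N))) (\<lambda>_ _ _. 1) (\<lambda>_ z. complex_of_real (snd z \<bullet> v - c) * b z)"
    using Fam_mult[OF Fam_snd[OF Fam_inner[of v c], of "\<lambda>_ _. 1", unfolded xw_1] assms[unfolded amplitude_def, rule_format, of "Suc N"]]
    by (simp add: bracket_pos less_imp_le)
  moreover have "bracket \<xi> * (1 / bracket \<xi> ^ (Suc N)) = 1 / bracket \<xi> ^ N" for \<xi> :: "real ^ 'n"
    using bracket_pos[of \<xi>] by simp
  ultimately show "Fam (\<lambda>(_::unit) z. 1 / bracket (snd z) ^ N) (\<lambda>_ _ _. 1) (\<lambda>_ z. complex_of_real (snd z \<bullet> v - c) * b z)"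
    by simp
qed

lemma smooth_slice:
  fixes b :: "'a::euclidean_space \<times> 'a \<Rightarrow> complex"
  assumes "smooth b"
  shows "smooth (\<lambda>\<xi>. b (x, \<xi>))" "dir_deriv v (\<lambda>\<xi>. b (x, \<xi>)) = (\<lambda>\<xi>. dir_deriv (0, v) b (x, \<xi>))"
    "smooth (\<lambda>x. b (x, \<xi>))" "dir_deriv v (\<lambda>x. b (x, \<xi>)) = (\<lambda>x. dir_deriv (v, 0) b (x, \<xi>))"
proof -
  have l: "linear (\<lambda>\<xi>::'a. (0::'a, \<xi>))" "linear (\<lambda>\<xi>::'a. (\<xi>, 0::'a))" by (auto intro!: linearI)
  show "smooth (\<lambda>\<xi>. b (x, \<xi>))" "dir_deriv v (\<lambda>\<xi>. b (x, \<xi>)) = (\<lambda>\<xi>. dir_deriv (0, v) b (x, \<xi>))"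
    using smooth_affine[OF l(1) assms, of "(x, 0)"] dir_deriv_affine[OF l(1) assms, of v "(x, 0)"] by simp_all
  show "smooth (\<lambda>x. b (x, \<xi>))" "dir_deriv v (\<lambda>x. b (x, \<xi>)) = (\<lambda>x. dir_deriv (v, 0) b (x, \<xi>))"
    using smooth_affine[OF l(2) assms, of "(0, \<xi>)"] dir_deriv_affine[OF l(2) assms, of v "(0, \<xi>)"] by simp_all
qed

lemma norm_cis_inner [simp]: "norm (exp (\<i> * complex_of_real t)) = 1" "norm (exp (- \<i> * complex_of_real t)) = 1"
  "norm (exp (- (\<i> * complex_of_real t))) = 1"
  by (simp_all add: norm_exp_eq_Re)

lemma osc_integrable:
  fixes b :: "(real ^ 'n::finite) \<times> (real ^ 'n) \<Rightarrow> complex"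
  assumes "amplitude b"
  shows "integrable lborel (\<lambda>\<xi>. exp (\<i> * complex_of_real (y \<bullet> \<xi>)) * b (x, \<xi>))"
proof -
  obtain C where C: "\<And>x \<xi>. norm (b (x, \<xi>)) \<le> C * (1 / bracket \<xi> ^ (2 * CARD('n)))"
    by (rule amplitude_bound[OF assms, where N="2 * CARD('n)"]) (rule that)
  have [measurable]: "(\<lambda>\<xi>. b (x, \<xi>)) \<in> borel_measurable borel"
    by (intro smooth_measurable smooth_slice amplitude_smooth assms)
  show ?thesis
    by (rule integrable_bound_bracket[OF _ order_refl, where C=C]) (use C in \<open>auto simp: norm_mult\<close>)
qed

lemma osc_bounded:
  fixes b :: "(real ^ 'n::finite) \<times> (real ^ 'n) \<Rightarrow> complex"
  assumes "amplitude b"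
  shows "\<exists>C. \<forall>x. norm (osc b x) \<le> C"
proof -
  obtain C where C: "\<And>x \<xi>. norm (b (x, \<xi>)) \<le> C * (1 / bracket \<xi> ^ (2 * CARD('n)))"
    by (rule amplitude_bound[OF assms, where N="2 * CARD('n)"]) (rule that)
  have "norm (osc b x) \<le> (\<integral>\<xi>. C * (1 / bracket (\<xi> :: real ^ 'n) ^ (2 * CARD('n))) \<partial>lborel)" for x
    unfolding osc_def
    by (rule Bochner_Integration.integral_norm_bound_integral[OF osc_integrable[OF assms] integrable_mult_right[OF integrable_bracket]])
      (use C in \<open>auto simp: norm_mult\<close>)
  then show ?thesis by blast
qed

lemma osc_has_derivative:
  fixes b :: "(real ^ 'n::finite) \<times> (real ^ 'n) \<Rightarrow> complex"
  assumes b: "amplitude b"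
  shows "(osc b has_derivative (\<lambda>v. osc (\<lambda>z. \<i> * (complex_of_real (snd z \<bullet> v) * b z) + dir_deriv (v, 0) b z) x)) (at x)"
proof -
  note sm = amplitude_smooth[OF b]
  define E where "E x \<xi> = exp (\<i> * complex_of_real (x \<bullet> \<xi>))" for x \<xi> :: "real ^ 'n"
  have meas: "(\<lambda>\<xi>. f (x, \<xi>)) \<in> borel_measurable borel" if "smooth f" for f :: "(real ^ 'n) \<times> (real ^ 'n) \<Rightarrow> complex" and x
    by (intro smooth_measurable smooth_slice that)
  have "((\<lambda>x. \<integral>\<xi>. E x \<xi> * b (x, \<xi>) \<partial>lborel) has_derivative
    (\<lambda>v. \<integral>\<xi>. E x \<xi> * (\<i> * (complex_of_real (\<xi> \<bullet> v) * b (x, \<xi>)) + dir_deriv (v, 0) b (x, \<xi>)) \<partial>lborel)) (at x)"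
  proof -
    let ?N = "2 * CARD('n)"
    \<comment> \<open>One power of decay more than integrability requires, because the derivative of
      the exponential brings down a factor \<xi>.\<close>
    obtain C where C: "\<And>x \<xi>. norm (b (x, \<xi>)) \<le> C * (1 / bracket \<xi> ^ Suc ?N)"
      by (rule amplitude_bound[OF b, where N="Suc ?N"]) (rule that)
    have "\<exists>K. \<forall>x \<xi>. norm (dir_deriv (u, 0) b (x, \<xi>)) \<le> K * (1 / bracket \<xi> ^ ?N)" if "u \<in> Basis" for u
      using amplitude_bound[OF amplitude_dir_deriv[OF b, of "(u, 0)"]] that by (auto simp: Basis_prod_def) metis
    then obtain K where K: "\<And>u x \<xi>. u \<in> Basis \<Longrightarrow> norm (dir_deriv (u, 0) b (x, \<xi>)) \<le> K u * (1 / bracket \<xi> ^ ?N)" by metis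
    define H where "H \<xi> = (C + (\<Sum>u\<in>Basis. K u)) * (1 / bracket \<xi> ^ ?N)" for \<xi> :: "real ^ 'n"
    show ?thesis
    proof (rule has_derivative_integral[where H=H])
      fix x \<xi> :: "real ^ 'n"
      have "((\<lambda>x. E x \<xi> * b (x, \<xi>)) has_derivative (\<lambda>v. E x \<xi> * dir_deriv v (\<lambda>x. b (x, \<xi>)) x
          + \<i> * complex_of_real (v \<bullet> \<xi>) * E x \<xi> * b (x, \<xi>))) (at x)"
        unfolding E_def
        by (intro has_derivative_mult has_derivative_cis_inner smooth_has_derivative smooth_slice sm)
      then show "((\<lambda>x. E x \<xi> * b (x, \<xi>)) has_derivative
        (\<lambda>v. E x \<xi> * (\<i> * (complex_of_real (\<xi> \<bullet> v) * b (x, \<xi>)) + dir_deriv (v, 0) b (x, \<xi>)))) (at x)"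
        by (simp add: smooth_slice(4)[OF sm] algebra_simps inner_commute)
    next
      fix x show "integrable lborel (\<lambda>\<xi>. E x \<xi> * b (x, \<xi>))"
        unfolding E_def by (rule osc_integrable[OF b])
    next
      fix x v show "(\<lambda>\<xi>. E x \<xi> * (\<i> * (complex_of_real (\<xi> \<bullet> v) * b (x, \<xi>)) + dir_deriv (v, 0) b (x, \<xi>))) \<in> borel_measurable lborel"
        unfolding E_def using meas[OF sm] meas[OF smooth_dir_deriv[OF sm]] by measurable
    next
      fix x \<xi> v :: "real ^ 'n"
      have n: "0 \<le> C * (1 / bracket \<xi> ^ Suc ?N)" using C[of x \<xi>] norm_ge_zero order_trans by blast
      have "norm (complex_of_real (\<xi> \<bullet> v) * b (x, \<xi>)) \<le> (bracket \<xi> * norm v) * (C * (1 / bracket \<xi> ^ Suc ?N))"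
        unfolding norm_mult norm_of_real
      proof (intro mult_mono C)
        have "\<bar>\<xi> \<bullet> v\<bar> \<le> norm \<xi> * norm v" by (rule Cauchy_Schwarz_ineq2)
        also have "\<dots> \<le> bracket \<xi> * norm v" by (intro mult_right_mono) (auto simp: bracket_def)
        finally show "\<bar>\<xi> \<bullet> v\<bar> \<le> bracket \<xi> * norm v" .
      qed (use n bracket_pos[of \<xi>] in auto)
      also have "\<dots> = C * (1 / bracket \<xi> ^ ?N) * norm v" using bracket_pos[of \<xi>] by simp
      finally have 1: "norm (complex_of_real (\<xi> \<bullet> v) * b (x, \<xi>)) \<le> C * (1 / bracket \<xi> ^ ?N) * norm v" .
      have lin: "linear (\<lambda>v. dir_deriv v b (x, \<xi>))"
        using has_derivative_linear[OF smooth_has_derivative[OF sm]] .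
      have "(v, 0) = (\<Sum>u\<in>Basis. (v \<bullet> u) *\<^sub>R (u, 0 :: real ^ 'n))"
        by (simp add: prod_eq_iff fst_sum snd_sum euclidean_representation)
      then have "dir_deriv (v, 0) b (x, \<xi>) = (\<Sum>u\<in>Basis. (v \<bullet> u) *\<^sub>R dir_deriv (u, 0) b (x, \<xi>))"
        by (simp only: linear_sum[OF lin] linear_scale[OF lin])
      also have "norm \<dots> \<le> (\<Sum>u\<in>Basis. norm v * (K u * (1 / bracket \<xi> ^ ?N)))"
        by (rule order_trans[OF norm_sum sum_mono])
          (unfold norm_scaleR, intro mult_mono K Basis_le_norm, auto)
      finally have 2: "norm (dir_deriv (v, 0) b (x, \<xi>)) \<le> (\<Sum>u\<in>Basis. K u) * (1 / bracket \<xi> ^ ?N) * norm v"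
        by (simp add: sum_distrib_left sum_distrib_right sum_divide_distrib mult_ac)
      have "norm (\<i> * (complex_of_real (\<xi> \<bullet> v) * b (x, \<xi>)) + dir_deriv (v, 0) b (x, \<xi>)) \<le> H \<xi> * norm v"
        unfolding H_def distrib_right
        by (rule order_trans[OF norm_triangle_ineq add_mono]) (use 1 2 in \<open>simp_all add: norm_mult\<close>)
      then show "norm (E x \<xi> * (\<i> * (complex_of_real (\<xi> \<bullet> v) * b (x, \<xi>)) + dir_deriv (v, 0) b (x, \<xi>))) \<le> H \<xi> * norm v"
        by (simp add: norm_mult E_def)
    next
      show "integrable lborel H" unfolding H_def by (intro integrable_mult_right integrable_bracket) simp
    qed
  qed
  then show ?thesis unfolding osc_def[abs_def] E_def by simp
qed

lemma osc_dir_deriv: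
  assumes "amplitude b"
  shows "dir_deriv v (osc b) = osc (\<lambda>z. \<i> * (complex_of_real (snd z \<bullet> v) * b z) + dir_deriv (v, 0) b z)"
  using dir_deriv_eqI[OF osc_has_derivative[OF assms]] by simp

text \<open>Integration by parts in the frequency: the total derivative of the integrand has
  integral 0.\<close>

lemma osc_inner_mult:
  fixes b :: "(real ^ 'n::finite) \<times> (real ^ 'n) \<Rightarrow> complex"
  assumes b: "amplitude b" and v: "v \<in> Basis"
  shows "complex_of_real (x \<bullet> v) * osc b x = osc (\<lambda>z. \<i> * dir_deriv (0, v) b z) x"
proof -
  note sm = amplitude_smooth[OF b]
  let ?E = "\<lambda>\<xi>::real ^ 'n. exp (\<i> * complex_of_real (\<xi> \<bullet> x))"
  have bd: "amplitude (dir_deriv (0, v) b)" by (rule amplitude_dir_deriv[OF b]) (use v in \<open>auto simp: Basis_prod_def\<close>)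
  have d: "dir_deriv v (\<lambda>\<xi>. ?E \<xi> * b (x, \<xi>)) =
      (\<lambda>\<xi>. ?E \<xi> * dir_deriv (0, v) b (x, \<xi>) + \<i> * complex_of_real (x \<bullet> v) * (?E \<xi> * b (x, \<xi>)))"
    by (subst dir_deriv_mult[OF smooth_cis_inner smooth_slice(1)[OF sm]])
      (simp add: dir_deriv_cis_inner smooth_slice(2)[OF sm] mult_ac inner_commute)
  note int = osc_integrable[OF b, of x x] osc_integrable[OF bd, of x x]
  have "(\<integral>\<xi>. dir_deriv v (\<lambda>\<xi>. ?E \<xi> * b (x, \<xi>)) \<xi> \<partial>lborel) = 0"
    by (rule integral_dir_deriv_zero)
      (use int in \<open>auto simp: d inner_commute intro!: smooth_mult smooth_cis_inner smooth_slice sm\<close>)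
  then have "osc (dir_deriv (0, v) b) x + \<i> * complex_of_real (x \<bullet> v) * osc b x = 0"
    unfolding d osc_def using int by (simp add: inner_commute)
  moreover have "osc (\<lambda>z. \<i> * dir_deriv (0, v) b z) x = \<i> * osc (dir_deriv (0, v) b) x"
    unfolding osc_def by (simp add: mult.left_commute)
  ultimately have "osc (\<lambda>z. \<i> * dir_deriv (0, v) b z) x = \<i> * (- (\<i> * complex_of_real (x \<bullet> v) * osc b x))"
    by (metis eq_neg_iff_add_eq_0)
  then show ?thesis by (simp flip: mult.assoc)
qed

text \<open>The amplitude need not decay in x; the decay of the integral comes from integration by
  parts in the frequency.\<close>

lemma osc_schwartz:
  fixes b :: "(real ^ 'n::finite) \<times> (real ^ 'n) \<Rightarrow> complex"
  assumes b: "amplitude b"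
  shows "osc b \<in> schwartz"
proof (rule schwartz_coinduct[where X="osc ` Collect amplitude"])
  show "osc b \<in> osc ` Collect amplitude" using b by simp
  fix f assume "f \<in> osc ` Collect (amplitude :: ((real ^ 'n) \<times> (real ^ 'n) \<Rightarrow> complex) \<Rightarrow> bool)"
  then obtain b where f: "f = osc b" and b: "amplitude b" by auto
  show "f differentiable_on UNIV" unfolding f by (rule differentiable_onI[OF osc_has_derivative[OF b]])
  show "\<exists>C. \<forall>x. norm (f x) \<le> C" unfolding f by (rule osc_bounded[OF b])
  fix v :: "real ^ 'n" assume v: "v \<in> Basis"
  have B: "(v, 0) \<in> Basis" "(0, v) \<in> Basis" using v by (auto simp: Basis_prod_def)
  show "dir_deriv v f \<in> osc ` Collect amplitude"
    unfolding f osc_dir_deriv[OF b]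
    using amplitude_inner[OF b, of v 0] amplitude_dir_deriv[OF b B(1)]
    by (intro imageI CollectI amplitude_add amplitude_cmult) auto
  show "(\<lambda>x. complex_of_real (x \<bullet> v) * f x) \<in> osc ` Collect amplitude"
    unfolding f osc_inner_mult[OF b v]
    by (rule image_eqI[of _ _ "\<lambda>z. \<i> * dir_deriv (0, v) b z"]) (auto intro: amplitude_cmult amplitude_dir_deriv b B)
qed

subsection \<open>The Fourier transform on the Schwartz space\<close>

lemma fourier_osc: "fourier f \<xi> = osc (\<lambda>z. f (snd z)) (- \<xi>)"
  by (simp add: fourier_def osc_def)

lemma inv_fourier_osc:
  "inv_fourier (f :: real ^ 'n::finite \<Rightarrow> complex) x = complex_of_real (1 / (2 * pi) ^ CARD('n)) * osc (\<lambda>z. f (snd z)) x"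
  by (simp add: inv_fourier_def osc_def)

lemma inv_fourier_eq_fourier:
  "inv_fourier (f :: real ^ 'n::finite \<Rightarrow> complex) x = complex_of_real (1 / (2 * pi) ^ CARD('n)) * fourier f (- x)"
  by (simp add: fourier_osc inv_fourier_osc)

lemma fourier_schwartz: "f \<in> schwartz \<Longrightarrow> fourier f \<in> schwartz"
  using schwartz_uminus[OF osc_schwartz[OF amplitude_snd]] by (simp add: fourier_osc[abs_def])

lemma inv_fourier_schwartz: "f \<in> schwartz \<Longrightarrow> inv_fourier f \<in> schwartz"
  unfolding inv_fourier_osc[abs_def] by (intro schwartz_cmult osc_schwartz amplitude_snd)

lemma integrable_prod_bound:
  fixes k :: "'a::euclidean_space \<Rightarrow> 'a \<Rightarrow> complex" and f g :: "'a \<Rightarrow> complex"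
  assumes f: "integrable lborel f" and g: "integrable lborel g"
    and k: "(\<lambda>(x, y). k x y) \<in> borel_measurable (lborel \<Otimes>\<^sub>M lborel)"
    and le: "\<And>x y. norm (k x y) \<le> norm (f x) * norm (g y)"
  shows "integrable (lborel \<Otimes>\<^sub>M lborel) (\<lambda>(x, y). k x y)"
proof -
  have [measurable]: "f \<in> borel_measurable borel" "g \<in> borel_measurable borel"
    using f g by (auto dest: borel_measurable_integrable)
  have "integrable (lborel \<Otimes>\<^sub>M lborel) (\<lambda>(x, y). f x * g y)"
  proof (rule lborel_pair.Fubini_integrable)
    show "integrable lborel (\<lambda>x. \<integral>y. norm (case (x, y) of (x, y) \<Rightarrow> f x * g y) \<partial>lborel)"
      using f by (simp add: norm_mult)
    show "AE x in lborel. integrable lborel (\<lambda>y. case (x, y) of (x, y) \<Rightarrow> f x * g y)"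
      using g by simp
  qed measurable
  from this k show ?thesis
    by (rule Bochner_Integration.integrable_bound) (use le in \<open>auto simp: norm_mult\<close>)
qed

lemma cis_inner_pair_measurable [measurable]:
  "(\<lambda>z::(real ^ 'n) \<times> (real ^ 'n). exp (\<i> * complex_of_real (fst z \<bullet> snd z))) \<in> borel_measurable borel"
  "(\<lambda>z::(real ^ 'n) \<times> (real ^ 'n). exp (- \<i> * complex_of_real (fst z \<bullet> snd z))) \<in> borel_measurable borel"
  by (auto intro!: borel_measurable_continuous_onI continuous_intros)

lemma fubini_kernel:
  fixes f g :: "real ^ 'n::finite \<Rightarrow> complex"
  assumes f: "integrable lborel f" and g: "integrable lborel g"
    and k: "k \<in> borel_measurable borel" and le: "\<And>z. norm (k z) \<le> B"
  shows "(\<integral>x. f x * (\<integral>y. k (x, y) * g y \<partial>lborel) \<partial>lborel) = (\<integral>y. g y * (\<integral>x. k (x, y) * f x \<partial>lborel) \<partial>lborel)"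
proof -
  have [measurable]: "f \<in> borel_measurable borel" "g \<in> borel_measurable borel"
    "k \<in> borel_measurable (borel \<Otimes>\<^sub>M borel)"
    using f g k by (auto dest: borel_measurable_integrable simp: borel_prod)
  have B: "0 \<le> B" using le norm_ge_zero order_trans by blast
  have I: "integrable (lborel \<Otimes>\<^sub>M lborel) (\<lambda>(x, y). f x * (k (x, y) * g y))"
  proof (rule integrable_prod_bound[OF f integrable_mult_right[OF g, of "complex_of_real B"]])
    show "norm (f x * (k (x, y) * g y)) \<le> norm (f x) * norm (complex_of_real B * g y)" for x y
      unfolding norm_mult using B le[of "(x, y)"] by (intro mult_mono) auto
  qed measurable
  have "(\<integral>x. f x * (\<integral>y. k (x, y) * g y \<partial>lborel) \<partial>lborel) = (\<integral>x. \<integral>y. f x * (k (x, y) * g y) \<partial>lborel \<partial>lborel)"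
    by simp
  also have "\<dots> = (\<integral>y. \<integral>x. f x * (k (x, y) * g y) \<partial>lborel \<partial>lborel)"
    by (rule lborel_pair.Fubini_integral[OF I, symmetric])
  also have "\<dots> = (\<integral>y. \<integral>x. g y * (k (x, y) * f x) \<partial>lborel \<partial>lborel)"
    by (simp add: mult_ac)
  finally show ?thesis by simp
qed

lemma gaussian_1d:
  "(\<integral>w. exp (\<i> * complex_of_real (t * w)) * complex_of_real (exp (- w\<^sup>2 / 2)) \<partial>lborel)
    = complex_of_real (sqrt (2 * pi) * exp (- t\<^sup>2 / 2))"
proof -
  have "complex_of_real (exp (- t\<^sup>2 / 2)) = (\<integral>w. iexp (t * w) \<partial>std_normal_distribution)"
    using char_std_normal_distribution by (metis char_def)
  also have "\<dots> = (\<integral>w. std_normal_density w *\<^sub>R iexp (t * w) \<partial>lborel)"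
    by (rule integral_density) (auto simp: normal_density_nonneg)
  also have "\<dots> = (\<integral>w. complex_of_real (1 / sqrt (2 * pi)) * (iexp (t * w) * complex_of_real (exp (- w\<^sup>2 / 2))) \<partial>lborel)"
    unfolding std_normal_density_def by (simp add: scaleR_conv_of_real mult_ac)
  also have "\<dots> = complex_of_real (1 / sqrt (2 * pi)) * (\<integral>w. iexp (t * w) * complex_of_real (exp (- w\<^sup>2 / 2)) \<partial>lborel)"
    by (rule integral_mult_right_zero)
  finally show ?thesis by (simp add: field_simps)
qed

text \<open>The Bochner integral of a non-integrable function is 0 by convention, whereas
  \<open>gaussian_1d\<close> gives a nonzero value.\<close>

lemma gaussian_1d_integrable:
  "integrable lborel (\<lambda>w. exp (\<i> * complex_of_real (t * w)) * complex_of_real (exp (- w\<^sup>2 / 2)))"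
  using gaussian_1d[of t] not_integrable_integral_eq by fastforce

abbreviation gaussian :: "real ^ 'n::finite \<Rightarrow> complex" where
  "gaussian w \<equiv> complex_of_real (exp (- (norm w)\<^sup>2 / 2))"

lemma fourier_gaussian:
  fixes z :: "real ^ 'n::finite"
  shows "(\<integral>w. exp (\<i> * complex_of_real (z \<bullet> w)) * gaussian w \<partial>lborel)
    = complex_of_real (sqrt (2 * pi) ^ CARD('n)) * gaussian z"
proof -
  let ?B = "Basis :: (real ^ 'n) set"
  interpret product_sigma_finite "\<lambda>b :: real ^ 'n. lborel :: real measure" ..
  let ?h = "\<lambda>w::real ^ 'n. exp (\<i> * complex_of_real (z \<bullet> w)) * gaussian w"
  have [measurable]: "?h \<in> borel_measurable borel"
    by (intro borel_measurable_continuous_onI continuous_intros) auto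
  have split: "?h (\<Sum>b\<in>?B. f b *\<^sub>R b) = (\<Prod>b\<in>?B. exp (\<i> * complex_of_real ((z \<bullet> b) * f b)) * complex_of_real (exp (- (f b)\<^sup>2 / 2)))" for f
  proof -
    let ?w = "\<Sum>b\<in>?B. f b *\<^sub>R b"
    have c: "?w \<bullet> b = f b" if "b \<in> ?B" for b
      using that by (rule inner_sum_left_Basis)
    have "z \<bullet> ?w = (\<Sum>b\<in>?B. (z \<bullet> b) * f b)"
      by (subst euclidean_inner) (simp add: c)
    moreover have "(norm ?w)\<^sup>2 = (\<Sum>b\<in>?B. (f b)\<^sup>2)"
      unfolding power2_norm_eq_inner by (subst euclidean_inner) (simp add: c power2_eq_square)
    moreover have "exp (\<i> * complex_of_real (\<Sum>b\<in>?B. g b)) = (\<Prod>b\<in>?B. exp (\<i> * complex_of_real (g b)))" for g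
      by (simp add: sum_distrib_left exp_sum)
    moreover have "exp (- (\<Sum>b\<in>?B. g b) / 2) = (\<Prod>b\<in>?B. exp (- g b / 2))" for g :: "real ^ 'n \<Rightarrow> real"
      unfolding exp_sum[OF finite_Basis, symmetric] by (simp add: sum_negf sum_divide_distrib)
    ultimately show ?thesis by (simp only: prod.distrib of_real_prod)
  qed
  have "(\<integral>w. ?h w \<partial>lborel) = (\<integral>f. ?h (\<Sum>b\<in>?B. f b *\<^sub>R b) \<partial>(\<Pi>\<^sub>M b\<in>?B. lborel))"
    by (subst lborel_eq, rule integral_distr) measurable
  also have "\<dots> = (\<Prod>b\<in>?B. \<integral>w. exp (\<i> * complex_of_real ((z \<bullet> b) * w)) * complex_of_real (exp (- w\<^sup>2 / 2)) \<partial>lborel)"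
    unfolding split by (rule product_integral_prod) (rule finite_Basis, rule gaussian_1d_integrable)
  also have "\<dots> = complex_of_real (\<Prod>b\<in>?B. sqrt (2 * pi) * exp (- (z \<bullet> b)\<^sup>2 / 2))"
    unfolding gaussian_1d by simp
  also have "(\<Prod>b\<in>?B. sqrt (2 * pi) * exp (- (z \<bullet> b)\<^sup>2 / 2)) = sqrt (2 * pi) ^ CARD('n) * exp (- (norm z)\<^sup>2 / 2)"
  proof -
    have "(norm z)\<^sup>2 = (\<Sum>b\<in>?B. (z \<bullet> b)\<^sup>2)"
      unfolding power2_norm_eq_inner by (subst euclidean_inner) (simp add: power2_eq_square)
    then show ?thesis
      by (simp add: prod.distrib exp_sum[symmetric] sum_negf sum_divide_distrib[symmetric])
  qed
  finally show ?thesis by simp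
qed

lemma gaussian_integrable: "integrable lborel (gaussian :: real ^ 'n::finite \<Rightarrow> complex)"
  using fourier_gaussian[of "0 :: real ^ 'n"] not_integrable_integral_eq by fastforce

text \<open>Gaussian summation: the factor \<open>gaussian (e m *\<^sub>R \<xi>)\<close> makes the
  double integral absolutely convergent, and dominated convergence removes it on both sides.\<close>

theorem inv_fourier_fourier:
  fixes f :: "real ^ 'n::finite \<Rightarrow> complex"
  assumes f: "f \<in> schwartz"
  shows "inv_fourier (fourier f) x = f x"
proof -
  let ?n = "CARD('n)"
  let ?E = "\<lambda>z \<xi>::real ^ 'n. exp (\<i> * complex_of_real (z \<bullet> \<xi>))"
  note fi = schwartz_integrable[OF f] and Fi = schwartz_integrable[OF fourier_schwartz[OF f]]
  have [measurable]: "f \<in> borel_measurable borel" "fourier f \<in> borel_measurable borel"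
    using f fourier_schwartz by (auto intro: schwartz_measurable)
  define e where "e m = inverse (real (Suc m))" for m
  have e: "e m > 0" for m by (simp add: e_def)
  have e0: "e \<longlonglongrightarrow> 0" unfolding e_def by (rule LIMSEQ_inverse_real_of_nat)
  have "continuous_on UNIV (gaussian :: real ^ 'n \<Rightarrow> complex)"
    by (intro continuous_intros) auto
  then have cg: "isCont (gaussian :: real ^ 'n \<Rightarrow> complex) y" for y
    by (simp add: continuous_on_eq_continuous_at)
  have cf: "isCont f y" for y
    using smooth_continuous[OF schwartz_smooth[OF f], of UNIV] by (simp add: continuous_on_eq_continuous_at)
  define J where "J m = (\<integral>\<xi>. fourier f \<xi> * (?E x \<xi> * gaussian (e m *\<^sub>R \<xi>)) \<partial>lborel)" for m
  have J1: "J \<longlonglongrightarrow> (\<integral>\<xi>. fourier f \<xi> * ?E x \<xi> \<partial>lborel)"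
    unfolding J_def
  proof (rule integral_dominated_convergence[where w="\<lambda>\<xi>. norm (fourier f \<xi>)"])
    show "AE \<xi> in lborel. (\<lambda>m. fourier f \<xi> * (?E x \<xi> * gaussian (e m *\<^sub>R \<xi>))) \<longlonglongrightarrow> fourier f \<xi> * ?E x \<xi>"
    proof (rule AE_I2)
      fix \<xi> :: "real ^ 'n"
      have "(\<lambda>m. e m *\<^sub>R \<xi>) \<longlonglongrightarrow> 0 *\<^sub>R \<xi>" by (intro tendsto_intros e0)
      then have "(\<lambda>m. gaussian (e m *\<^sub>R \<xi>)) \<longlonglongrightarrow> gaussian (0 *\<^sub>R \<xi>)"
        by (rule isCont_tendsto_compose[OF cg])
      then have "(\<lambda>m. fourier f \<xi> * (?E x \<xi> * gaussian (e m *\<^sub>R \<xi>))) \<longlonglongrightarrow> fourier f \<xi> * (?E x \<xi> * gaussian (0 *\<^sub>R \<xi>))"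
        by (intro tendsto_mult[OF tendsto_const tendsto_mult[OF tendsto_const]])
      then show "(\<lambda>m. fourier f \<xi> * (?E x \<xi> * gaussian (e m *\<^sub>R \<xi>))) \<longlonglongrightarrow> fourier f \<xi> * ?E x \<xi>" by simp
    qed
    show "AE \<xi> in lborel. norm (fourier f \<xi> * (?E x \<xi> * gaussian (e m *\<^sub>R \<xi>))) \<le> norm (fourier f \<xi>)" for m
      by (intro AE_I2) (auto simp: norm_mult mult_left_le)
  qed (use Fi in auto)
  \<comment> \<open>Fubini's theorem and the transform of the Gaussian, followed by the substitution
    y = x + e m w, turn J m into an average of f about x at the scale e m.\<close>
  have J2: "J m = (\<integral>w. complex_of_real (sqrt (2 * pi) ^ ?n) * (f (x + e m *\<^sub>R w) * gaussian w) \<partial>lborel)" for m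
  proof -
    have gi: "integrable lborel (\<lambda>\<xi>. ?E x \<xi> * gaussian (e m *\<^sub>R \<xi>))"
    proof (rule Bochner_Integration.integrable_bound)
      show "integrable lborel (\<lambda>\<xi>::real ^ 'n. gaussian (e m *\<^sub>R \<xi>))"
        using integrable_lborel_affine[OF gaussian_integrable, of "e m" 0] e[of m] by simp
    qed (auto simp: norm_mult)
    have "J m = (\<integral>\<xi>. (?E x \<xi> * gaussian (e m *\<^sub>R \<xi>)) * (\<integral>y. exp (- \<i> * complex_of_real (\<xi> \<bullet> y)) * f y \<partial>lborel) \<partial>lborel)"
      unfolding J_def fourier_def by (simp add: mult_ac)
    also have "\<dots> = (\<integral>y. f y * (\<integral>\<xi>. exp (- \<i> * complex_of_real (\<xi> \<bullet> y)) * (?E x \<xi> * gaussian (e m *\<^sub>R \<xi>)) \<partial>lborel) \<partial>lborel)"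
      using fubini_kernel[OF gi fi cis_inner_pair_measurable(2), of 1] by simp
    also have "\<dots> = (\<integral>y. f y * ((1 / e m) ^ ?n *\<^sub>R (complex_of_real (sqrt (2 * pi) ^ ?n) * gaussian ((1 / e m) *\<^sub>R (x - y)))) \<partial>lborel)"
    proof (intro Bochner_Integration.integral_cong refl arg_cong2[where f="(*)"])
      fix y
      have "(\<integral>\<xi>. exp (- \<i> * complex_of_real (\<xi> \<bullet> y)) * (?E x \<xi> * gaussian (e m *\<^sub>R \<xi>)) \<partial>lborel)
        = (\<integral>\<xi>. ?E (x - y) \<xi> * gaussian (e m *\<^sub>R \<xi>) \<partial>lborel)"
        by (intro Bochner_Integration.integral_cong refl)
          (simp add: mult.assoc[symmetric] exp_add[symmetric] inner_diff_left inner_commute[of y] algebra_simps)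
      also have "\<dots> = (\<bar>1 / e m\<bar> ^ DIM(real ^ 'n)) *\<^sub>R (\<integral>w. ?E (x - y) (0 + (1 / e m) *\<^sub>R w) * gaussian (e m *\<^sub>R (0 + (1 / e m) *\<^sub>R w)) \<partial>lborel)"
        using e[of m] by (intro integral_lborel_affine) auto
      also have "\<dots> = (1 / e m) ^ ?n *\<^sub>R (\<integral>w. ?E ((1 / e m) *\<^sub>R (x - y)) w * gaussian w \<partial>lborel)"
        using e[of m] by simp
      also have "\<dots> = (1 / e m) ^ ?n *\<^sub>R (complex_of_real (sqrt (2 * pi) ^ ?n) * gaussian ((1 / e m) *\<^sub>R (x - y)))"
        unfolding fourier_gaussian ..
      finally show "(\<integral>\<xi>. exp (- \<i> * complex_of_real (\<xi> \<bullet> y)) * (?E x \<xi> * gaussian (e m *\<^sub>R \<xi>)) \<partial>lborel) = \<dots>" .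
    qed
    also have "\<dots> = (\<bar>e m\<bar> ^ DIM(real ^ 'n)) *\<^sub>R (\<integral>w. f (x + e m *\<^sub>R w) *
        ((1 / e m) ^ ?n *\<^sub>R (complex_of_real (sqrt (2 * pi) ^ ?n) * gaussian ((1 / e m) *\<^sub>R (x - (x + e m *\<^sub>R w))))) \<partial>lborel)"
      using e[of m] by (intro integral_lborel_affine) auto
    also have "\<dots> = (\<integral>w. complex_of_real (sqrt (2 * pi) ^ ?n) * (f (x + e m *\<^sub>R w) * gaussian w) \<partial>lborel)"
    proof -
      have g: "gaussian ((1 / e m) *\<^sub>R (x - (x + e m *\<^sub>R w))) = gaussian w" for w
        using e[of m] by simp
      have s: "\<bar>e m\<bar> ^ DIM(real ^ 'n) *\<^sub>R (a * ((1 / e m) ^ ?n *\<^sub>R (c * b))) = c * (a * b)" for a b c :: complex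
        using e[of m] by (simp add: scaleR_conv_of_real power_one_over)
      show ?thesis unfolding g integral_scaleR_right[symmetric] s ..
    qed
    finally show ?thesis .
  qed
  have J3: "(\<lambda>m. \<integral>w. complex_of_real (sqrt (2 * pi) ^ ?n) * (f (x + e m *\<^sub>R w) * gaussian w) \<partial>lborel)
     \<longlonglongrightarrow> (\<integral>(w::real ^ 'n). complex_of_real (sqrt (2 * pi) ^ ?n) * (f x * gaussian w) \<partial>lborel)"
  proof -
    obtain C where C0: "C \<ge> 0" and C: "\<And>x. norm (f x) \<le> C" by (rule schwartz_bounded[OF f]) (rule that)
    show ?thesis
    proof (rule integral_dominated_convergence[where w="\<lambda>w::real ^ 'n. sqrt (2 * pi) ^ ?n * (C * norm (gaussian w))"])
      show "AE w in lborel. (\<lambda>m. complex_of_real (sqrt (2 * pi) ^ ?n) * (f (x + e m *\<^sub>R w) * gaussian w)) \<longlonglongrightarrow>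
          complex_of_real (sqrt (2 * pi) ^ ?n) * (f x * gaussian w)"
      proof (rule AE_I2)
        fix w :: "real ^ 'n"
        have "(\<lambda>m. x + e m *\<^sub>R w) \<longlonglongrightarrow> x + 0 *\<^sub>R w" by (intro tendsto_intros e0)
        then have "(\<lambda>m. x + e m *\<^sub>R w) \<longlonglongrightarrow> x" by simp
        from isCont_tendsto_compose[OF cf this]
        show "(\<lambda>m. complex_of_real (sqrt (2 * pi) ^ ?n) * (f (x + e m *\<^sub>R w) * gaussian w)) \<longlonglongrightarrow>
          complex_of_real (sqrt (2 * pi) ^ ?n) * (f x * gaussian w)" by (intro tendsto_intros)
      qed
      show "integrable lborel (\<lambda>w::real ^ 'n. sqrt (2 * pi) ^ ?n * (C * norm (gaussian w)))"
        using gaussian_integrable by (intro integrable_mult_right integrable_norm)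
      show "AE w in lborel. norm (complex_of_real (sqrt (2 * pi) ^ ?n) * (f (x + e m *\<^sub>R w) * gaussian w))
          \<le> sqrt (2 * pi) ^ ?n * (C * norm (gaussian w))" for m
        unfolding norm_mult norm_of_real using C0 by (intro AE_I2 mult_mono C) auto
    qed measurable
  qed
  have "(\<integral>\<xi>. fourier f \<xi> * ?E x \<xi> \<partial>lborel) = (\<integral>(w::real ^ 'n). complex_of_real (sqrt (2 * pi) ^ ?n) * (f x * gaussian w) \<partial>lborel)"
    by (rule LIMSEQ_unique[OF J1 J3[folded J2]])
  also have "\<dots> = complex_of_real (sqrt (2 * pi) ^ ?n) * f x * complex_of_real (sqrt (2 * pi) ^ ?n)"
    using fourier_gaussian[of "0 :: real ^ 'n"] by (simp add: mult.assoc)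
  also have "\<dots> = complex_of_real ((2 * pi) ^ ?n) * f x"
  proof -
    have "sqrt (2 * pi) ^ ?n * sqrt (2 * pi) ^ ?n = (2 * pi) ^ ?n"
      unfolding power_mult_distrib[symmetric] real_sqrt_mult_self by simp
    moreover have "complex_of_real a * f x * complex_of_real a = complex_of_real (a * a) * f x" for a
      by simp
    ultimately show ?thesis by (simp only:)
  qed
  finally show ?thesis
    unfolding inv_fourier_def by (simp add: mult.commute)
qed

lemma fourier_inv_fourier:
  fixes f :: "real ^ 'n::finite \<Rightarrow> complex"
  assumes f: "f \<in> schwartz"
  shows "fourier (inv_fourier f) x = f x"
proof -
  have [measurable]: "inv_fourier f \<in> borel_measurable borel"
    using f by (intro schwartz_measurable inv_fourier_schwartz)
  have "fourier (inv_fourier f) x = (\<integral>y. exp (- \<i> * complex_of_real (x \<bullet> - y)) * inv_fourier f (- y) \<partial>lborel)"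
    unfolding fourier_def by (subst integral_lborel_uminus) simp_all
  also have "\<dots> = inv_fourier (fourier f) x"
    unfolding inv_fourier_def[of "fourier f"] inv_fourier_eq_fourier[of f]
    by (simp add: mult.left_commute flip: integral_mult_right_zero)
  finally show ?thesis using inv_fourier_fourier[OF f] by simp
qed

lemma fourier_swap:
  assumes f: "f \<in> schwartz" and g: "g \<in> schwartz"
  shows "(\<integral>x. fourier f x * g x \<partial>lborel) = (\<integral>x. f x * fourier g x \<partial>lborel)"
  using fubini_kernel[OF schwartz_integrable[OF g] schwartz_integrable[OF f] cis_inner_pair_measurable(2), of 1]
  by (simp add: fourier_def mult.commute inner_commute)

lemma cnj_fourier:
  fixes f :: "real ^ 'n::finite \<Rightarrow> complex"
  shows "cnj (fourier f x) = complex_of_real ((2 * pi) ^ CARD('n)) * inv_fourier (\<lambda>x. cnj (f x)) x"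
  unfolding fourier_def inv_fourier_def Bochner_Integration.integral_cnj[symmetric]
  by (simp add: exp_cnj)

theorem plancherel_cnj:
  fixes f g :: "real ^ 'n::finite \<Rightarrow> complex"
  assumes f: "f \<in> schwartz" and g: "g \<in> schwartz"
  shows "(\<integral>x. fourier f x * cnj (fourier g x) \<partial>lborel) = complex_of_real ((2 * pi) ^ CARD('n)) * (\<integral>x. f x * cnj (g x) \<partial>lborel)"
proof -
  have "(\<integral>x. fourier f x * cnj (fourier g x) \<partial>lborel)
    = complex_of_real ((2 * pi) ^ CARD('n)) * (\<integral>x. fourier f x * inv_fourier (\<lambda>x. cnj (g x)) x \<partial>lborel)"
    unfolding cnj_fourier by (simp only: mult.left_commute[of "fourier f _"] integral_mult_right_zero)
  also have "(\<integral>x. fourier f x * inv_fourier (\<lambda>x. cnj (g x)) x \<partial>lborel) = (\<integral>x. f x * cnj (g x) \<partial>lborel)"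
    by (subst fourier_swap[OF f inv_fourier_schwartz[OF schwartz_cnj[OF g]]])
      (simp add: fourier_inv_fourier[OF schwartz_cnj[OF g]])
  finally show ?thesis .
qed

lemma fourier_dir_deriv:
  fixes f :: "real ^ 'n::finite \<Rightarrow> complex"
  assumes f: "f \<in> schwartz" and b: "b \<in> Basis"
  shows "fourier (dir_deriv b f) \<xi> = \<i> * complex_of_real (\<xi> \<bullet> b) * fourier f \<xi>"
proof -
  have sm: "smooth f" using f by (rule schwartz_smooth)
  have "complex_of_real ((- \<xi>) \<bullet> b) * osc (\<lambda>z. f (snd z)) (- \<xi>) = osc (\<lambda>z. \<i> * dir_deriv (0, b) (\<lambda>z. f (snd z)) z) (- \<xi>)"
    by (rule osc_inner_mult[OF amplitude_snd[OF f] b])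
  also have "\<dots> = \<i> * fourier (dir_deriv b f) \<xi>"
    unfolding dir_deriv_snd[OF sm] fourier_osc by (simp add: osc_def mult.left_commute)
  finally have "\<i> * fourier (dir_deriv b f) \<xi> = - (complex_of_real (\<xi> \<bullet> b) * fourier f \<xi>)"
    by (simp add: fourier_osc)
  then have "\<i> * (\<i> * fourier (dir_deriv b f) \<xi>) = - (\<i> * complex_of_real (\<xi> \<bullet> b) * fourier f \<xi>)"
    by simp
  then show ?thesis by (simp flip: mult.assoc)
qed

lemma fourier_add:
  assumes "f \<in> schwartz" "g \<in> schwartz"
  shows "fourier (\<lambda>x. f x + g x) \<xi> = fourier f \<xi> + fourier g \<xi>"
proof -
  have i: "integrable lborel (\<lambda>x. exp (- \<i> * complex_of_real (\<xi> \<bullet> x)) * f x)" if "f \<in> schwartz" for f :: "real ^ 'a \<Rightarrow> complex"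
    using osc_integrable[OF amplitude_snd[OF that], of "- \<xi>"] by simp
  show ?thesis unfolding fourier_def distrib_left by (rule Bochner_Integration.integral_add[OF i[OF assms(1)] i[OF assms(2)]])
qed

lemma fourier_cmult: "fourier (\<lambda>x. c * f x) \<xi> = c * fourier f \<xi>"
  unfolding fourier_def mult.left_commute[of _ c] integral_mult_right_zero ..

lemma fourier_sum:
  assumes "finite I" "\<And>i. i \<in> I \<Longrightarrow> f i \<in> schwartz"
  shows "fourier (\<lambda>x. \<Sum>i\<in>I. f i x) \<xi> = (\<Sum>i\<in>I. fourier (f i) \<xi>)"
  using assms
proof (induction I rule: finite_induct)
  case empty
  then show ?case by (simp add: fourier_def)
next
  case (insert i I)
  then show ?case by (simp add: fourier_add schwartz_sum)
qed

subsection \<open>The \<open>L\<^sup>2\<close> norm\<close>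

text \<open>The integral of a function that is not square integrable defaults to 0, so the
  inequalities below are stated for Schwartz functions. Being real-valued, the norm stays clear of
  extended arithmetic.\<close>

definition l2 :: "(real ^ 'n::finite \<Rightarrow> complex) \<Rightarrow> real" where
  "l2 f = sqrt (\<integral>x. (norm (f x))\<^sup>2 \<partial>lborel)"

lemma l2_nonneg [simp]: "0 \<le> l2 f"
  unfolding l2_def by (intro real_sqrt_ge_zero integral_nonneg) auto

lemma l2_sq: "(l2 f)\<^sup>2 = (\<integral>x. (norm (f x))\<^sup>2 \<partial>lborel)"
  unfolding l2_def by (subst real_sqrt_pow2) (auto intro: integral_nonneg)

lemma schwartz_sq_integrable:
  fixes f :: "real ^ 'n::finite \<Rightarrow> complex"
  assumes f: "f \<in> schwartz" and g: "g \<in> schwartz"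
  shows "integrable lborel (\<lambda>x. norm (f x) * norm (g x))"
  using schwartz_integrable[OF schwartz_mult[OF f g], THEN integrable_norm] by (simp add: norm_mult)

lemma nn_l2:
  assumes "f \<in> schwartz"
  shows "(\<integral>\<^sup>+x. ennreal ((norm (f x))\<^sup>2) \<partial>lborel) = ennreal ((l2 f)\<^sup>2)"
  unfolding l2_sq using schwartz_sq_integrable[OF assms assms]
  by (intro nn_integral_eq_integral) (auto simp: power2_eq_square)

lemma l2_cauchy_schwarz:
  fixes f :: "real ^ 'n::finite \<Rightarrow> complex"
  assumes f: "f \<in> schwartz" and g: "g \<in> schwartz"
  shows "(\<integral>x. norm (f x) * norm (g x) \<partial>lborel) \<le> l2 f * l2 g"
proof -
  have [measurable]: "f \<in> borel_measurable borel" "g \<in> borel_measurable borel"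
    using f g by (auto intro: schwartz_measurable)
  have "(ennreal (\<integral>x. norm (f x) * norm (g x) \<partial>lborel))\<^sup>2 = (\<integral>\<^sup>+x. ennreal (norm (f x)) * ennreal (norm (g x)) \<partial>lborel)\<^sup>2"
    by (subst nn_integral_eq_integral[symmetric]) (auto simp: schwartz_sq_integrable[OF f g] ennreal_mult)
  also have "\<dots> \<le> (\<integral>\<^sup>+x. (ennreal (norm (f x)))\<^sup>2 \<partial>lborel) * (\<integral>\<^sup>+x. (ennreal (norm (g x)))\<^sup>2 \<partial>lborel)"
    by (rule Cauchy_Schwarz_nn_integral) measurable
  also have "\<dots> = ennreal ((l2 f * l2 g)\<^sup>2)"
    using nn_l2[OF f] nn_l2[OF g] by (simp add: ennreal_power ennreal_mult power_mult_distrib)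
  finally have "(\<integral>x. norm (f x) * norm (g x) \<partial>lborel)\<^sup>2 \<le> (l2 f * l2 g)\<^sup>2"
    by (simp add: ennreal_power)
  then show ?thesis by (rule power2_le_imp_le) simp
qed

lemma l2_triangle:
  assumes f: "f \<in> schwartz" and g: "g \<in> schwartz"
  shows "l2 (\<lambda>x. f x + g x) \<le> l2 f + l2 g"
proof (rule power2_le_imp_le)
  have int: "integrable lborel (\<lambda>x. (norm (f x))\<^sup>2)" "integrable lborel (\<lambda>x. (norm (g x))\<^sup>2)"
    "integrable lborel (\<lambda>x. (norm (f x + g x))\<^sup>2)"
    using schwartz_sq_integrable[OF f f] schwartz_sq_integrable[OF g g]
      schwartz_sq_integrable[OF schwartz_add[OF f g] schwartz_add[OF f g]] by (simp_all add: power2_eq_square)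
  have "(l2 (\<lambda>x. f x + g x))\<^sup>2 \<le> (\<integral>x. (norm (f x))\<^sup>2 + (norm (g x))\<^sup>2 + 2 * (norm (f x) * norm (g x)) \<partial>lborel)"
    unfolding l2_sq
  proof (intro integral_mono)
    show "(norm (f x + g x))\<^sup>2 \<le> (norm (f x))\<^sup>2 + (norm (g x))\<^sup>2 + 2 * (norm (f x) * norm (g x))" for x
      using power_mono[OF norm_triangle_ineq[of "f x" "g x"], of 2] by (simp add: power2_sum mult.assoc)
  qed (use int schwartz_sq_integrable[OF f g] in auto)
  also have "\<dots> = (l2 f)\<^sup>2 + (l2 g)\<^sup>2 + 2 * (\<integral>x. norm (f x) * norm (g x) \<partial>lborel)"
    unfolding l2_sq using int schwartz_sq_integrable[OF f g] by simp
  also have "\<dots> \<le> (l2 f + l2 g)\<^sup>2"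
    using l2_cauchy_schwarz[OF f g] by (simp add: power2_sum)
  finally show "(l2 (\<lambda>x. f x + g x))\<^sup>2 \<le> (l2 f + l2 g)\<^sup>2" .
qed simp

lemma l2_sum:
  assumes "finite I" "\<And>i. i \<in> I \<Longrightarrow> f i \<in> schwartz"
  shows "l2 (\<lambda>x. \<Sum>i\<in>I. f i x) \<le> (\<Sum>i\<in>I. l2 (f i))"
  using assms
proof (induction I rule: finite_induct)
  case empty
  then show ?case by (simp add: l2_def)
next
  case (insert i I)
  have "l2 (\<lambda>x. f i x + (\<Sum>i\<in>I. f i x)) \<le> l2 (f i) + l2 (\<lambda>x. \<Sum>i\<in>I. f i x)"
    using insert by (intro l2_triangle schwartz_sum) auto
  then show ?case using insert by force
qed

lemma l2_cmult: "l2 (\<lambda>x. c * f x) = norm c * l2 f"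
proof -
  have "(\<integral>x. (norm (c * f x))\<^sup>2 \<partial>lborel) = (norm c)\<^sup>2 * (\<integral>x. (norm (f x))\<^sup>2 \<partial>lborel)"
    by (simp add: norm_mult power_mult_distrib)
  then show ?thesis unfolding l2_def by (simp add: real_sqrt_mult)
qed

lemma l2_mono:
  assumes "f \<in> schwartz" "g \<in> schwartz" "\<And>x. norm (f x) \<le> norm (g x)"
  shows "l2 f \<le> l2 g"
  unfolding l2_def
  by (intro real_sqrt_le_mono integral_mono power_mono assms)
    (use schwartz_sq_integrable[OF assms(1,1)] schwartz_sq_integrable[OF assms(2,2)] in \<open>simp_all add: power2_eq_square\<close>)

lemma l2_mono_cmult:
  assumes "f \<in> schwartz" "g \<in> schwartz" "\<And>x. norm (f x) \<le> K * norm (g x)" "0 \<le> K"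
  shows "l2 f \<le> K * l2 g"
  using l2_mono[OF assms(1) schwartz_cmult[OF assms(2), of "complex_of_real K"]] assms(3,4)
  by (simp add: norm_mult l2_cmult)

lemma plancherel_l2:
  fixes f :: "real ^ 'n::finite \<Rightarrow> complex"
  assumes f: "f \<in> schwartz"
  shows "l2 (fourier f) = sqrt ((2 * pi) ^ CARD('n)) * l2 f"
proof -
  have r: "(\<integral>x. h x * cnj (h x) \<partial>lborel) = complex_of_real ((l2 h)\<^sup>2)" for h :: "real ^ 'n \<Rightarrow> complex"
    unfolding l2_sq complex_norm_square[symmetric] by (simp add: integral_complex_of_real[symmetric] del: integral_complex_of_real of_real_power)
  have "complex_of_real ((l2 (fourier f))\<^sup>2) = complex_of_real ((2 * pi) ^ CARD('n) * (l2 f)\<^sup>2)"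
    using plancherel_cnj[OF f f] unfolding r by simp
  then have "(l2 (fourier f))\<^sup>2 = (2 * pi) ^ CARD('n) * (l2 f)\<^sup>2" by (simp only: of_real_eq_iff)
  then have "sqrt ((l2 (fourier f))\<^sup>2) = sqrt ((2 * pi) ^ CARD('n) * (l2 f)\<^sup>2)" by simp
  then show ?thesis by (simp add: real_sqrt_mult)
qed

text \<open>The factor by which the inverse Fourier transform changes the L^2 norm. The type
  argument carries the dimension.\<close>

definition pl :: "'n::finite itself \<Rightarrow> real" where
  "pl _ = 1 / sqrt ((2 * pi) ^ CARD('n))"

lemma pl_pos [simp]: "0 < pl TYPE('n::finite)"
  by (simp add: pl_def)

lemma l2_inv_fourier:
  fixes f :: "real ^ 'n::finite \<Rightarrow> complex"
  assumes f: "f \<in> schwartz"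
  shows "l2 (inv_fourier f) = pl TYPE('n) * l2 f"
proof -
  have "fourier (inv_fourier f) = f" using fourier_inv_fourier[OF f] by auto
  then have "l2 f = sqrt ((2 * pi) ^ CARD('n)) * l2 (inv_fourier f)"
    using plancherel_l2[OF inv_fourier_schwartz[OF f]] by simp
  then show ?thesis by (simp add: pl_def field_simps)
qed

text \<open>The functions |g i| need not be smooth, so \<open>l2_sum\<close> does not apply to the
  dominating sum. Its square is expanded and Cauchy-Schwarz is used on each product.\<close>

lemma l2_dominated_sum:
  fixes h :: "real ^ 'n::finite \<Rightarrow> complex"
  assumes I: "finite I" and h: "h \<in> schwartz" and g: "\<And>i. i \<in> I \<Longrightarrow> g i \<in> schwartz"
    and le: "\<And>x. norm (h x) \<le> (\<Sum>i\<in>I. norm (g i x))"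
  shows "l2 h \<le> (\<Sum>i\<in>I. l2 (g i))"
proof (rule power2_le_imp_le)
  have int: "integrable lborel (\<lambda>x. \<Sum>i\<in>I. \<Sum>j\<in>I. norm (g i x) * norm (g j x))"
    by (intro Bochner_Integration.integrable_sum schwartz_sq_integrable g)
  have "(l2 h)\<^sup>2 \<le> (\<integral>x. (\<Sum>i\<in>I. \<Sum>j\<in>I. norm (g i x) * norm (g j x)) \<partial>lborel)"
    unfolding l2_sq
  proof (rule integral_mono[OF _ int])
    show "integrable lborel (\<lambda>x. (norm (h x))\<^sup>2)" using schwartz_sq_integrable[OF h h] by (simp add: power2_eq_square)
    show "(norm (h x))\<^sup>2 \<le> (\<Sum>i\<in>I. \<Sum>j\<in>I. norm (g i x) * norm (g j x))" for x
      using power_mono[OF le norm_ge_zero, of x 2] by (simp add: power2_eq_square sum_product)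
  qed
  also have "\<dots> = (\<Sum>i\<in>I. \<Sum>j\<in>I. \<integral>x. norm (g i x) * norm (g j x) \<partial>lborel)"
    by (subst Bochner_Integration.integral_sum)
      (auto intro!: sum.cong Bochner_Integration.integral_sum Bochner_Integration.integrable_sum schwartz_sq_integrable g)
  also have "\<dots> \<le> (\<Sum>i\<in>I. \<Sum>j\<in>I. l2 (g i) * l2 (g j))"
    by (intro sum_mono l2_cauchy_schwarz g)
  also have "\<dots> = (\<Sum>i\<in>I. l2 (g i))\<^sup>2"
    by (simp add: power2_eq_square sum_product)
  finally show "(l2 h)\<^sup>2 \<le> (\<Sum>i\<in>I. l2 (g i))\<^sup>2" .
qed (simp add: sum_nonneg)

lemma l2_shift: "f \<in> schwartz \<Longrightarrow> l2 (\<lambda>x. f (x - p)) = l2 f"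
  unfolding l2_def using integral_lborel_shift[where f="\<lambda>x. (norm (f x))\<^sup>2" and t="- p"] by (auto dest: schwartz_measurable)

lemma l2_pos:
  fixes f :: "real ^ 'n::finite \<Rightarrow> complex"
  assumes f: "f \<in> schwartz" and \<epsilon>: "0 < \<epsilon>" and one: "\<And>x. norm x \<le> \<epsilon> \<Longrightarrow> f x = 1"
  shows "0 < l2 f"
proof -
  have "0 < measure lborel (cball (0 :: real ^ 'n) \<epsilon>)" using content_cball_pos[OF \<epsilon>] .
  also have "\<dots> = (\<integral>x. indicat_real (cball 0 \<epsilon>) x \<partial>(lborel :: (real ^ 'n) measure))" by simp
  also have "\<dots> \<le> (\<integral>x. (norm (f x))\<^sup>2 \<partial>lborel)"
  proof (rule integral_mono)
    show "integrable lborel (indicat_real (cball (0 :: real ^ 'n) \<epsilon>))"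
      by (rule integrable_real_indicator) (use emeasure_bounded_finite[OF bounded_cball, of "0 :: real ^ 'n" \<epsilon>] in simp_all)
    show "integrable lborel (\<lambda>x. (norm (f x))\<^sup>2)"
      using schwartz_sq_integrable[OF f f] by (simp add: power2_eq_square)
    show "indicat_real (cball 0 \<epsilon>) x \<le> (norm (f x))\<^sup>2" for x
      using one[of x] by (cases "norm x \<le> \<epsilon>") (auto simp: indicator_def)
  qed
  finally show ?thesis by (simp add: l2_def)
qed

lemma Lp_norm_2: "Lp_norm M 2 g = ennreal_powr (\<integral>\<^sup>+x. ennreal_powr (g x) 2 \<partial>M) (1 / 2)"
  unfolding Lp_norm_def by simp

lemma ennreal_powr_ennreal: "0 \<le> x \<Longrightarrow> ennreal_powr (ennreal x) r = ennreal (x powr r)"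
  by (simp add: ennreal_powr_def)

lemma ennreal_powr_mono: "x \<le> y \<Longrightarrow> 0 \<le> r \<Longrightarrow> ennreal_powr x r \<le> ennreal_powr y r"
  unfolding ennreal_powr_def
  by (auto simp: top_unique intro!: ennreal_leI powr_mono2 enn2real_mono simp: less_top)

lemma Lp_norm_2_bound:
  fixes g :: "real ^ 'n::finite \<Rightarrow> complex"
  assumes "(\<integral>\<^sup>+x. ennreal ((norm (g x))\<^sup>2) \<partial>lborel) \<le> ennreal (B\<^sup>2)" "0 \<le> B"
  shows "Lp_norm lborel 2 (\<lambda>x. ennreal (norm (g x))) \<le> ennreal B"
proof -
  have "Lp_norm lborel 2 (\<lambda>x. ennreal (norm (g x))) \<le> ennreal_powr (ennreal (B\<^sup>2)) (1 / 2)"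
    unfolding Lp_norm_2 using assms(1) by (intro ennreal_powr_mono) (auto simp: ennreal_powr_ennreal)
  also have "\<dots> = ennreal B"
    using assms(2) by (simp add: ennreal_powr_ennreal powr_half_sqrt)
  finally show ?thesis .
qed

lemma Lp_norm_2_lower:
  fixes g :: "real ^ 'n::finite \<Rightarrow> complex"
  assumes "ennreal (B\<^sup>2) \<le> (\<integral>\<^sup>+x. ennreal ((norm (g x))\<^sup>2) \<partial>lborel)" "0 \<le> B"
  shows "ennreal B \<le> Lp_norm lborel 2 (\<lambda>x. ennreal (norm (g x)))"
proof -
  have "ennreal_powr (ennreal (B\<^sup>2)) (1 / 2) \<le> Lp_norm lborel 2 (\<lambda>x. ennreal (norm (g x)))"
    unfolding Lp_norm_2 using assms(1) by (intro ennreal_powr_mono) (auto simp: ennreal_powr_ennreal)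
  moreover have "ennreal_powr (ennreal (B\<^sup>2)) (1 / 2) = ennreal B"
    using assms(2) by (simp add: ennreal_powr_ennreal powr_half_sqrt)
  ultimately show ?thesis by simp
qed

text \<open>Testing a representing function against the conjugate of a Schwartz representative gives the
  lower bound by Cauchy-Schwarz, so that no uniqueness of representing functions is needed.\<close>

lemma distr_Lp_norm_schwartz:
  assumes f: "f \<in> schwartz" and u: "represents f u"
  shows "distr_Lp_norm 2 u = ennreal (l2 f)"
  unfolding distr_Lp_norm_def
proof (rule antisym)
  have "(INF g\<in>{g. represents g u}. Lp_norm lborel 2 (\<lambda>x. ennreal (norm (g x)))) \<le> Lp_norm lborel 2 (\<lambda>x. ennreal (norm (f x)))"
    using u by (intro INF_lower) auto
  also have "\<dots> \<le> ennreal (l2 f)"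
    by (rule Lp_norm_2_bound) (auto simp: nn_l2[OF f])
  finally show "(INF g\<in>{g. represents g u}. Lp_norm lborel 2 (\<lambda>x. ennreal (norm (g x)))) \<le> ennreal (l2 f)" .
next
  show "ennreal (l2 f) \<le> (INF g\<in>{g. represents g u}. Lp_norm lborel 2 (\<lambda>x. ennreal (norm (g x))))"
  proof (rule INF_greatest)
    fix g assume "g \<in> {g. represents g u}"
    then have g: "represents g u" by simp
    then have [measurable]: "g \<in> borel_measurable borel" by (simp add: represents_def)
    have [measurable]: "f \<in> borel_measurable borel" by (rule schwartz_measurable[OF f])
    note cf = schwartz_cnj[OF f]
    have "(\<integral>x. g x * cnj (f x) \<partial>lborel) = (\<integral>x. f x * cnj (f x) \<partial>lborel)"
      using g u cf by (auto simp: represents_def distr_of_def)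
    also have "\<dots> = complex_of_real ((l2 f)\<^sup>2)"
      unfolding l2_sq complex_norm_square[symmetric] by (simp add: integral_complex_of_real[symmetric] del: integral_complex_of_real of_real_power)
    finally have eq: "(\<integral>x. g x * cnj (f x) \<partial>lborel) = complex_of_real ((l2 f)\<^sup>2)" .
    have int: "integrable lborel (\<lambda>x. g x * cnj (f x))" using g cf by (auto simp: represents_def)
    have "ennreal ((l2 f)\<^sup>2) = ennreal (norm (\<integral>x. g x * cnj (f x) \<partial>lborel))"
      unfolding eq norm_of_real by simp
    also have "\<dots> \<le> (\<integral>\<^sup>+x. ennreal (norm (g x)) * ennreal (norm (f x)) \<partial>lborel)"
      using integral_norm_bound_ennreal[OF int] by (simp add: norm_mult ennreal_mult)
    finally have "(ennreal ((l2 f)\<^sup>2))\<^sup>2 \<le> (\<integral>\<^sup>+x. ennreal (norm (g x)) * ennreal (norm (f x)) \<partial>lborel)\<^sup>2"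
      by (intro power_mono) auto
    also have "\<dots> \<le> (\<integral>\<^sup>+x. (ennreal (norm (g x)))\<^sup>2 \<partial>lborel) * (\<integral>\<^sup>+x. (ennreal (norm (f x)))\<^sup>2 \<partial>lborel)"
      by (rule Cauchy_Schwarz_nn_integral) measurable
    also have "\<dots> = (\<integral>\<^sup>+x. ennreal ((norm (g x))\<^sup>2) \<partial>lborel) * ennreal ((l2 f)\<^sup>2)"
      using nn_l2[OF f] by (simp add: ennreal_power)
    finally have *: "ennreal ((l2 f)\<^sup>2) * ennreal ((l2 f)\<^sup>2) \<le> (\<integral>\<^sup>+x. ennreal ((norm (g x))\<^sup>2) \<partial>lborel) * ennreal ((l2 f)\<^sup>2)"
      by (simp add: power2_eq_square)
    show "ennreal (l2 f) \<le> Lp_norm lborel 2 (\<lambda>x. ennreal (norm (g x)))"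
    proof (cases "l2 f = 0")
      case False
      then have "ennreal ((l2 f)\<^sup>2) \<le> (\<integral>\<^sup>+x. ennreal ((norm (g x))\<^sup>2) \<partial>lborel)"
        using * by (subst (asm) (1 2) mult.commute, subst (asm) ennreal_mult_le_mult_iff) auto
      then show ?thesis by (rule Lp_norm_2_lower) simp
    qed simp
  qed
qed

lemma Lp_norm_2_bound_ennreal:
  fixes g :: "real ^ 'n::finite \<Rightarrow> complex"
  assumes "(\<integral>\<^sup>+x. ennreal ((norm (g x))\<^sup>2) \<partial>lborel) \<le> T\<^sup>2"
  shows "Lp_norm lborel 2 (\<lambda>x. ennreal (norm (g x))) \<le> T"
proof (cases T)
  case (real t)
  then show ?thesis using assms by (auto simp: ennreal_power intro: Lp_norm_2_bound)
qed simp

lemma ennreal_powr_cmult: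
  assumes "0 < A" "0 < q"
  shows "ennreal_powr (ennreal (A powr q) * V) (1 / q) = ennreal A * ennreal_powr V (1 / q)"
proof (cases V)
  case (real v)
  then show ?thesis using assms
    by (simp add: ennreal_mult[symmetric] ennreal_powr_ennreal powr_mult powr_powr)
next
  case top
  then show ?thesis using assms by (simp add: ennreal_powr_def ennreal_mult_top)
qed

lemma Lp_norm_real:
  assumes "0 < q"
  shows "Lp_norm M (ennreal q) g = ennreal_powr (\<integral>\<^sup>+x. ennreal_powr (g x) q \<partial>M) (1 / q)"
  using assms by (simp add: Lp_norm_def)

subsection \<open>Multipliers\<close>

lemma bounded_times_schwartz_integrable:
  fixes g :: "real ^ 'n::finite \<Rightarrow> complex"
  assumes g: "g \<in> borel_measurable borel" "\<And>x. norm (g x) \<le> B" and f: "f \<in> schwartz"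
  shows "integrable lborel (\<lambda>x. g x * f x)"
proof (rule Bochner_Integration.integrable_bound[OF integrable_mult_right[OF schwartz_integrable[OF f], of "complex_of_real B"]])
  show "(\<lambda>x. g x * f x) \<in> borel_measurable lborel"
    using g schwartz_measurable[OF f] by auto
  show "AE x in lborel. norm (g x * f x) \<le> norm (complex_of_real B * f x)"
    using order_trans[OF g(2) abs_ge_self] by (auto simp: norm_mult intro!: mult_right_mono)
qed

lemma represents_bounded:
  fixes g :: "real ^ 'n::finite \<Rightarrow> complex"
  assumes "g \<in> borel_measurable borel" "\<And>x. norm (g x) \<le> B"
  shows "represents g (distr_of g)"
  unfolding represents_def using bounded_times_schwartz_integrable[OF assms] assms(1) by auto

lemma multi_size_0: "multi_size 0 = 0"
  by (simp add: multi_size_def)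

lemma pderivs_0: "pderivs 0 f = f"
proof -
  have "mlist (\<lambda>i. axis i (1::real)) (0 :: nat ^ 'a) = []"
    using length_mlist[of "\<lambda>i. axis i (1::real)" 0] by (simp add: multi_size_0)
  then show ?thesis unfolding pderivs_def multi_deriv_iD by simp
qed

lemma schwartz_seminorm_bound:
  assumes "f \<in> schwartz"
  shows "bracket x ^ N * norm (f x) \<le> schwartz_seminorm N 0 f"
proof -
  obtain C where C: "C \<ge> 0" "\<And>x. norm (f x) \<le> C * (1 / bracket x ^ N)"
    by (rule schwartz_bound[OF assms, where N=N]) (rule that)
  have "bdd_above (range (\<lambda>x. bracket x ^ N * norm (pderivs 0 f x)))"
    using C by (intro bdd_aboveI[of _ C]) (auto simp: pderivs_0 field_simps)
  then show ?thesis unfolding schwartz_seminorm_def using cSUP_upper[of x UNIV] by (force simp: pderivs_0)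
qed

lemma tempered_bounded:
  fixes g :: "real ^ 'n::finite \<Rightarrow> complex"
  assumes g: "g \<in> borel_measurable borel" "\<And>x. norm (g x) \<le> B"
  shows "distr_of g \<in> tempered"
proof -
  note int = bounded_times_schwartz_integrable[OF g]
  have B: "0 \<le> B" using g(2) norm_ge_zero order_trans by blast
  let ?N = "2 * CARD('n)"
  have lim: "(\<lambda>j. distr_of g (\<phi> j)) \<longlonglongrightarrow> 0"
    if \<phi>: "\<And>j. \<phi> j \<in> schwartz" and z: "\<And>N \<beta>. (\<lambda>j. schwartz_seminorm N \<beta> (\<phi> j)) \<longlonglongrightarrow> 0" for \<phi> :: "nat \<Rightarrow> _"
  proof (rule Lim_null_comparison)
    let ?I = "\<integral>x. 1 / bracket (x :: real ^ 'n) ^ ?N \<partial>lborel"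
    show "\<forall>\<^sub>F j in sequentially. norm (distr_of g (\<phi> j)) \<le> B * schwartz_seminorm ?N 0 (\<phi> j) * ?I"
    proof (rule always_eventually, rule allI)
      fix j
      have "norm (distr_of g (\<phi> j)) \<le> (\<integral>x. B * schwartz_seminorm ?N 0 (\<phi> j) * (1 / bracket (x :: real ^ 'n) ^ ?N) \<partial>lborel)"
        unfolding distr_of_def
      proof (rule Bochner_Integration.integral_norm_bound_integral[OF int[OF \<phi>] integrable_mult_right[OF integrable_bracket]])
        fix x
        have "norm (\<phi> j x) \<le> schwartz_seminorm ?N 0 (\<phi> j) * (1 / bracket x ^ ?N)"
          using schwartz_seminorm_bound[OF \<phi>, of x ?N j] by (simp add: field_simps)
        then have "norm (g x) * norm (\<phi> j x) \<le> B * (schwartz_seminorm ?N 0 (\<phi> j) * (1 / bracket x ^ ?N))"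
          using g(2) B by (intro mult_mono) auto
        then show "norm (g x * \<phi> j x) \<le> B * schwartz_seminorm ?N 0 (\<phi> j) * (1 / bracket x ^ ?N)"
          by (simp add: norm_mult mult.assoc)
      qed simp
      then show "norm (distr_of g (\<phi> j)) \<le> B * schwartz_seminorm ?N 0 (\<phi> j) * ?I"
        unfolding integral_mult_right_zero .
    qed
    have "(\<lambda>j. B * schwartz_seminorm ?N 0 (\<phi> j) * ?I) \<longlonglongrightarrow> B * 0 * ?I"
      by (intro tendsto_mult tendsto_const z)
    then show "(\<lambda>j. B * schwartz_seminorm ?N 0 (\<phi> j) * ?I) \<longlonglongrightarrow> 0" by simp
  qed
  have "distr_of g (\<lambda>x. \<phi> x + \<psi> x) = distr_of g \<phi> + distr_of g \<psi>" if "\<phi> \<in> schwartz" "\<psi> \<in> schwartz" for \<phi> \<psi>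
    unfolding distr_of_def using int that by (simp add: distrib_left)
  moreover have "distr_of g (\<lambda>x. c * \<phi> x) = c * distr_of g \<phi>" for \<phi> c
    unfolding distr_of_def by (simp add: mult.left_commute)
  ultimately show ?thesis unfolding tempered_def using lim by blast
qed

lemma tempered_schwartz: "f \<in> schwartz \<Longrightarrow> distr_of f \<in> tempered"
  by (metis schwartz_bounded schwartz_measurable tempered_bounded)

text \<open>A multiplier acts on distributions through its transpose on test functions. That
  transpose is an integral operator with a reflected convolution kernel, so the multiplier itself
  becomes a convolution.\<close>

lemma inv_fourier_kernel:
  fixes \<eta> :: "real ^ 'n::finite \<Rightarrow> complex"
  assumes \<eta>: "\<eta> \<in> schwartz" and \<phi>: "\<phi> \<in> schwartz"
  shows "fourier (\<lambda>\<xi>. \<eta> \<xi> * inv_fourier \<phi> \<xi>) x = (\<integral>y. inv_fourier \<eta> (y - x) * \<phi> y \<partial>lborel)"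
proof -
  let ?c = "complex_of_real (1 / (2 * pi) ^ CARD('n))"
  let ?E = "\<lambda>z \<xi>::real ^ 'n. exp (\<i> * complex_of_real (z \<bullet> \<xi>))"
  have h: "integrable lborel (\<lambda>\<xi>. ?E (- x) \<xi> * \<eta> \<xi>)"
    using osc_integrable[OF amplitude_snd[OF \<eta>], of "- x"] by simp
  have "fourier (\<lambda>\<xi>. \<eta> \<xi> * inv_fourier \<phi> \<xi>) x = ?c * (\<integral>\<xi>. (?E (- x) \<xi> * \<eta> \<xi>) * (\<integral>y. ?E \<xi> y * \<phi> y \<partial>lborel) \<partial>lborel)"
  proof -
    have pt: "exp (- \<i> * complex_of_real (x \<bullet> \<xi>)) * (a * (?c * J)) = ?c * ((?E (- x) \<xi> * a) * J)" for \<xi> a J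
      by simp
    show ?thesis unfolding fourier_def inv_fourier_def pt integral_mult_right_zero ..
  qed
  also have "\<dots> = ?c * (\<integral>y. \<phi> y * (\<integral>\<xi>. ?E \<xi> y * (?E (- x) \<xi> * \<eta> \<xi>) \<partial>lborel) \<partial>lborel)"
    using fubini_kernel[OF h schwartz_integrable[OF \<phi>] cis_inner_pair_measurable(1), of 1] by simp
  also have "\<dots> = (\<integral>y. \<phi> y * (?c * (\<integral>\<xi>. ?E (y - x) \<xi> * \<eta> \<xi> \<partial>lborel)) \<partial>lborel)"
  proof -
    have "?E \<xi> y * (?E (- x) \<xi> * \<eta> \<xi>) = ?E (y - x) \<xi> * \<eta> \<xi>" for \<xi> y
    proof -
      have "\<i> * complex_of_real (\<xi> \<bullet> y) + \<i> * complex_of_real (- x \<bullet> \<xi>) = \<i> * complex_of_real ((y - x) \<bullet> \<xi>)"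
        by (simp add: inner_diff_left inner_commute[of \<xi> y] right_diff_distrib)
      then show ?thesis unfolding mult.assoc[symmetric] exp_add[symmetric] by simp
    qed
    then show ?thesis unfolding mult.left_commute[of _ ?c] integral_mult_right_zero by (simp only:)
  qed
  finally show ?thesis unfolding inv_fourier_def by (simp add: mult.commute)
qed

lemma multiplier_schwartz:
  fixes \<eta> :: "real ^ 'n::finite \<Rightarrow> complex"
  assumes \<eta>: "\<eta> \<in> schwartz" and f: "f \<in> schwartz"
  shows "represents (inv_fourier (\<lambda>\<xi>. \<eta> \<xi> * fourier f \<xi>)) (multiplier \<eta> (distr_of f))"
proof -
  note Ff = fourier_schwartz[OF f]
  let ?g = "inv_fourier (\<lambda>\<xi>. \<eta> \<xi> * fourier f \<xi>)"
  have g: "?g \<in> schwartz" by (intro inv_fourier_schwartz schwartz_mult \<eta> Ff)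
  have "multiplier \<eta> (distr_of f) \<phi> = distr_of ?g \<phi>" if \<phi>: "\<phi> \<in> schwartz" for \<phi>
  proof -
    have "multiplier \<eta> (distr_of f) \<phi> = (\<integral>x. f x * fourier (\<lambda>\<xi>. \<eta> \<xi> * inv_fourier \<phi> \<xi>) x \<partial>lborel)"
      by (simp add: multiplier_def inv_fourier_distr_def mult_distr_def fourier_distr_def distr_of_def)
    also have "\<dots> = (\<integral>x. fourier f x * (\<eta> x * inv_fourier \<phi> x) \<partial>lborel)"
      by (rule fourier_swap[OF f, symmetric]) (intro schwartz_mult \<eta> inv_fourier_schwartz \<phi>)
    also have "\<dots> = (\<integral>x. fourier ?g x * inv_fourier \<phi> x \<partial>lborel)"
      using fourier_inv_fourier[OF schwartz_mult[OF \<eta> Ff]] by (simp add: mult_ac)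
    also have "\<dots> = (\<integral>x. ?g x * fourier (inv_fourier \<phi>) x \<partial>lborel)"
      by (rule fourier_swap[OF g inv_fourier_schwartz[OF \<phi>]])
    finally show ?thesis using fourier_inv_fourier[OF \<phi>] by (simp add: distr_of_def)
  qed
  moreover have "integrable lborel (\<lambda>x. ?g x * \<phi> x)" if "\<phi> \<in> schwartz" for \<phi>
    using schwartz_integrable[OF schwartz_mult[OF g that]] .
  ultimately show ?thesis unfolding represents_def using schwartz_measurable[OF g] by simp
qed

lemma distr_Lp_norm_multiplier:
  fixes \<eta> :: "real ^ 'n::finite \<Rightarrow> complex"
  assumes \<eta>: "\<eta> \<in> schwartz" and f: "f \<in> schwartz"
  shows "distr_Lp_norm 2 (multiplier \<eta> (distr_of f)) = ennreal (pl TYPE('n) * l2 (\<lambda>\<xi>. \<eta> \<xi> * fourier f \<xi>))"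
proof -
  have s: "(\<lambda>\<xi>. \<eta> \<xi> * fourier f \<xi>) \<in> schwartz" by (intro schwartz_mult \<eta> fourier_schwartz f)
  show ?thesis
    using distr_Lp_norm_schwartz[OF inv_fourier_schwartz[OF s] multiplier_schwartz[OF \<eta> f]]
    by (simp add: l2_inv_fourier[OF s])
qed

section \<open>Multipliers as convolutions\<close>

definition conv :: "(real ^ 'n::finite \<Rightarrow> complex) \<Rightarrow> (real ^ 'n \<Rightarrow> complex) \<Rightarrow> real ^ 'n \<Rightarrow> complex" where
  "conv K g y = (\<integral>x. K (y - x) * g x \<partial>lborel)"

lemma conv_integrable:
  fixes K :: "real ^ 'n::finite \<Rightarrow> complex"
  assumes K: "K \<in> schwartz" and g: "g \<in> borel_measurable borel" "\<And>x. norm (g x) \<le> B"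
  shows "integrable lborel (\<lambda>x. K (y - x) * g x)"
proof -
  have "(\<lambda>x. K (y - x)) \<in> schwartz" using schwartz_scaled[OF K, of "-1" y] by simp
  from bounded_times_schwartz_integrable[OF g this] show ?thesis by (simp add: mult.commute)
qed

lemma conv_bounded:
  fixes K :: "real ^ 'n::finite \<Rightarrow> complex"
  assumes K: "K \<in> schwartz" and g: "g \<in> borel_measurable borel" "\<And>x. norm (g x) \<le> B"
  shows "norm (conv K g y) \<le> (\<integral>x. norm (K x) \<partial>lborel) * B"
proof -
  have Ki: "integrable lborel (\<lambda>x. norm (K (y - x)))"
    using integrable_lborel_affine[OF schwartz_integrable[OF K], of "-1" y] by auto
  have "norm (conv K g y) \<le> (\<integral>x. norm (K (y - x)) * B \<partial>lborel)"
    unfolding conv_def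
    by (rule Bochner_Integration.integral_norm_bound_integral[OF conv_integrable[OF K g] integrable_mult_left[OF Ki]])
      (auto simp: norm_mult intro!: mult_left_mono g)
  also have "\<dots> = (\<integral>x. norm (K (y - x)) \<partial>lborel) * B" by simp
  also have "(\<integral>x. norm (K (y - x)) \<partial>lborel) = (\<integral>x. norm (K x) \<partial>lborel)"
  proof -
    have "complex_of_real (\<integral>x. norm (K (y - x)) \<partial>lborel) = complex_of_real (\<integral>x. norm (K x) \<partial>lborel)"
      using integral_lborel_affine[of "\<lambda>x. complex_of_real (norm (K x))" "-1" y] schwartz_measurable[OF K]
      by simp
    then show ?thesis by (simp only: of_real_eq_iff)
  qed
  finally show ?thesis .
qed

lemma conv_measurable:
  fixes K :: "real ^ 'n::finite \<Rightarrow> complex"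
  assumes K: "K \<in> schwartz" and g: "g \<in> borel_measurable borel"
  shows "conv K g \<in> borel_measurable borel"
proof -
  have [measurable]: "K \<in> borel_measurable borel" "g \<in> borel_measurable borel"
    using schwartz_measurable[OF K] g by auto
  have "(\<lambda>y. \<integral>x. K (y - x) * g x \<partial>lborel) \<in> borel_measurable lborel" by measurable
  then show ?thesis unfolding conv_def[abs_def] by simp
qed

text \<open>Needed for \<open>pdo \<sigma> f\<close> with a general symbol, which is at first only
  known to be bounded and measurable, so that its Fourier transform exists merely as a
  distribution.\<close>

lemma multiplier_bounded:
  fixes \<eta> :: "real ^ 'n::finite \<Rightarrow> complex"
  assumes \<eta>: "\<eta> \<in> schwartz" and g: "g \<in> borel_measurable borel" "\<And>x. norm (g x) \<le> B"
  shows "represents (conv (inv_fourier \<eta>) g) (multiplier \<eta> (distr_of g))"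
proof -
  let ?K = "inv_fourier \<eta>"
  have K: "?K \<in> schwartz" by (rule inv_fourier_schwartz[OF \<eta>])
  have Km [measurable]: "?K \<in> borel_measurable borel" by (rule schwartz_measurable[OF K])
  note gm [measurable] = g(1)
  have "multiplier \<eta> (distr_of g) \<phi> = distr_of (conv ?K g) \<phi>" if \<phi>: "\<phi> \<in> schwartz" for \<phi>
  proof -
    have \<phi>m [measurable]: "\<phi> \<in> borel_measurable borel" by (rule schwartz_measurable[OF \<phi>])
    have I: "integrable (lborel \<Otimes>\<^sub>M lborel) (\<lambda>(y, x). \<phi> y * (?K (y - x) * g x))"
    proof (rule lborel_pair.Fubini_integrable)
      have B: "0 \<le> B" using g(2) norm_ge_zero order_trans by blast
      have nn: "norm (\<integral>x. norm (\<phi> y * (?K (y - x) * g x)) \<partial>lborel) \<le> norm ((\<integral>x. norm (?K x) \<partial>lborel) * B * norm (\<phi> y))" for y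
      proof -
        let ?g = "\<lambda>x. complex_of_real (norm (g x))" and ?L = "\<lambda>x. norm (?K x)"
        have i: "integrable lborel (\<lambda>x. norm (?K (y - x)) * B)"
          using integrable_lborel_affine[OF schwartz_integrable[OF K], of "-1" y] by auto
        have "(\<integral>x. norm (?K (y - x) * g x) \<partial>lborel) \<le> (\<integral>x. norm (?K (y - x)) * B \<partial>lborel)"
          by (intro integral_mono i integrable_norm conv_integrable[OF K g]) (auto simp: norm_mult intro!: mult_left_mono g)
        also have "(\<integral>x. norm (?K (y - x)) * B \<partial>lborel) = (\<integral>x. norm (?K x) \<partial>lborel) * B"
        proof -
          have "complex_of_real (\<integral>x. norm (?K (y - x)) \<partial>lborel) = complex_of_real (\<integral>x. norm (?K x) \<partial>lborel)"
            using integral_lborel_affine[of "\<lambda>x. complex_of_real (norm (?K x))" "-1" y] by simp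
          then show ?thesis by (simp only: of_real_eq_iff integral_mult_left_zero)
        qed
        finally have *: "(\<integral>x. norm (?K (y - x) * g x) \<partial>lborel) \<le> (\<integral>x. norm (?K x) \<partial>lborel) * B" .
        have "(\<integral>x. norm (\<phi> y * (?K (y - x) * g x)) \<partial>lborel) = norm (\<phi> y) * (\<integral>x. norm (?K (y - x) * g x) \<partial>lborel)"
          by (simp add: norm_mult)
        also have "\<dots> \<le> norm (\<phi> y) * ((\<integral>x. norm (?K x) \<partial>lborel) * B)"
          by (intro mult_left_mono *) auto
        finally show ?thesis using B
          by (subst (1 2) real_norm_def, subst (1 2) abs_of_nonneg) (auto intro!: integral_nonneg mult_nonneg_nonneg simp: mult_ac)
      qed
      show "integrable lborel (\<lambda>y. \<integral>x. norm (case (y, x) of (y, x) \<Rightarrow> \<phi> y * (?K (y - x) * g x)) \<partial>lborel)"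
        by (rule Bochner_Integration.integrable_bound[OF integrable_mult_right[OF integrable_norm[OF schwartz_integrable[OF \<phi>]]],
              of _ "(\<integral>x. norm (?K x) \<partial>lborel) * B"]) (use nn in auto)
      show "AE y in lborel. integrable lborel (\<lambda>x. case (y, x) of (y, x) \<Rightarrow> \<phi> y * (?K (y - x) * g x))"
        using conv_integrable[OF K g] by simp
    qed measurable
    have "multiplier \<eta> (distr_of g) \<phi> = (\<integral>x. g x * fourier (\<lambda>\<xi>. \<eta> \<xi> * inv_fourier \<phi> \<xi>) x \<partial>lborel)"
      by (simp add: multiplier_def inv_fourier_distr_def mult_distr_def fourier_distr_def distr_of_def)
    also have "\<dots> = (\<integral>x. \<integral>y. \<phi> y * (?K (y - x) * g x) \<partial>lborel \<partial>lborel)"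
    proof (intro Bochner_Integration.integral_cong refl)
      show "g x * fourier (\<lambda>\<xi>. \<eta> \<xi> * inv_fourier \<phi> \<xi>) x = (\<integral>y. \<phi> y * (?K (y - x) * g x) \<partial>lborel)" for x
        unfolding inv_fourier_kernel[OF \<eta> \<phi>] integral_mult_right_zero[symmetric]
        by (intro Bochner_Integration.integral_cong refl) (simp only: mult_ac)
    qed
    also have "\<dots> = (\<integral>y. \<integral>x. \<phi> y * (?K (y - x) * g x) \<partial>lborel \<partial>lborel)"
      by (rule lborel_pair.Fubini_integral[OF I])
    also have "\<dots> = distr_of (conv ?K g) \<phi>"
      unfolding distr_of_def conv_def by (simp add: mult.commute)
    finally show ?thesis .
  qed
  moreover have "represents (conv ?K g) (distr_of (conv ?K g))"
    by (rule represents_bounded[OF conv_measurable[OF K g(1)] conv_bounded[OF K g]])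
  ultimately show ?thesis unfolding represents_def by auto
qed

text \<open>Up to a constant the inverse transform of the reflection of f is the Fourier transform
  of f, so \<open>inv_fourier_kernel\<close> applied to the reflection yields the claim.\<close>

lemma conv_inv_fourier:
  fixes \<eta> :: "real ^ 'n::finite \<Rightarrow> complex"
  assumes \<eta>: "\<eta> \<in> schwartz" and f: "f \<in> schwartz"
  shows "conv (inv_fourier \<eta>) f y = inv_fourier (\<lambda>\<xi>. \<eta> \<xi> * fourier f \<xi>) y"
proof -
  have fm: "(\<lambda>x. f (- x)) \<in> schwartz" by (rule schwartz_uminus[OF f])
  have m: "inv_fourier \<eta> \<in> borel_measurable borel" "f \<in> borel_measurable borel"
    by (intro schwartz_measurable inv_fourier_schwartz \<eta> f)+
  let ?c = "complex_of_real (1 / (2 * pi) ^ CARD('n))"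
  have inv: "inv_fourier (\<lambda>x. f (- x)) \<xi> = ?c * fourier f \<xi>" for \<xi>
  proof -
    have [measurable]: "f \<in> borel_measurable borel" by (rule m)
    have "fourier (\<lambda>x. f (- x)) (- \<xi>) = fourier f \<xi>"
      unfolding fourier_def using integral_lborel_uminus[of "\<lambda>x. exp (- \<i> * complex_of_real (\<xi> \<bullet> x)) * f x"] by simp
    then show ?thesis unfolding inv_fourier_eq_fourier by simp
  qed
  have "fourier (\<lambda>\<xi>. \<eta> \<xi> * inv_fourier (\<lambda>x. f (- x)) \<xi>) (- y) = (\<integral>x. inv_fourier \<eta> (x + y) * f (- x) \<partial>lborel)"
    by (subst inv_fourier_kernel[OF \<eta> fm]) simp
  also have "\<dots> = conv (inv_fourier \<eta>) f y"
    unfolding conv_def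
    using integral_lborel_uminus[of "\<lambda>x. inv_fourier \<eta> (y - x) * f x"] m by (simp add: add.commute)
  finally have "conv (inv_fourier \<eta>) f y = fourier (\<lambda>\<xi>. \<eta> \<xi> * (?c * fourier f \<xi>)) (- y)"
    unfolding inv by simp
  also have "\<dots> = ?c * fourier (\<lambda>\<xi>. \<eta> \<xi> * fourier f \<xi>) (- y)"
    unfolding fourier_def mult.left_commute[of _ ?c] integral_mult_right_zero ..
  finally show ?thesis unfolding inv_fourier_eq_fourier .
qed

lemma conv_limit:
  fixes K :: "real ^ 'n::finite \<Rightarrow> complex"
  assumes K: "K \<in> schwartz" and S: "\<And>m. S m \<in> borel_measurable borel" "\<And>m x. norm (S m x) \<le> B"
    and lim: "\<And>x. (\<lambda>m. S m x) \<longlonglongrightarrow> g x"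
  shows "(\<lambda>m. conv K (S m) y) \<longlonglongrightarrow> conv K g y"
  unfolding conv_def
proof (rule integral_dominated_convergence[where w="\<lambda>x. norm (K (y - x)) * B"])
  have [measurable]: "K \<in> borel_measurable borel" by (rule schwartz_measurable[OF K])
  note S(1)[measurable]
  have [measurable]: "g \<in> borel_measurable borel"
    by (rule borel_measurable_LIMSEQ_metric[OF S(1) lim])
  show "(\<lambda>x. K (y - x) * g x) \<in> borel_measurable lborel" by measurable
  show "(\<lambda>x. K (y - x) * S m x) \<in> borel_measurable lborel" for m by measurable
  show "integrable lborel (\<lambda>x. norm (K (y - x)) * B)"
    using integrable_lborel_affine[OF schwartz_integrable[OF K], of "-1" y] by auto
  show "AE x in lborel. (\<lambda>m. K (y - x) * S m x) \<longlonglongrightarrow> K (y - x) * g x"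
    by (intro AE_I2 tendsto_intros lim)
  show "AE x in lborel. norm (K (y - x) * S m x) \<le> norm (K (y - x)) * B" for m
    by (intro AE_I2) (auto simp: norm_mult intro!: mult_left_mono S(2))
qed

subsection \<open>Geometry of the \<open>\<alpha>\<close>-covering\<close>

text \<open>For a = \<alpha> / (1 - \<alpha>) and x a lattice point, \<open>rad a x\<close> is the
  radius, up to the factor C, of a ball of the covering and \<open>ctr a x\<close> its centre. With
  x real the geometry needs no integrality.\<close>

definition rad :: "real \<Rightarrow> real ^ 'n \<Rightarrow> real" where
  "rad a x = bracket x powr a"

definition ctr :: "real \<Rightarrow> real ^ 'n \<Rightarrow> real ^ 'n" where
  "ctr a x = rad a x *\<^sub>R x"

lemma rad_pos [simp]: "0 < rad a x"
  by (simp add: rad_def)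

lemma rad_nonneg [simp]: "0 \<le> rad a x"
  by (simp add: less_imp_le)

lemma rad_nonzero [simp]: "rad a x \<noteq> 0"
  by (simp add: rad_def)

lemma rad_ge1: "0 \<le> a \<Longrightarrow> 1 \<le> rad a x"
  unfolding rad_def using bracket_ge1[of x] by (simp add: ge_one_powr_ge_zero)

lemma rad_mono: "0 \<le> a \<Longrightarrow> norm x \<le> norm y \<Longrightarrow> rad a x \<le> rad a y"
  unfolding rad_def by (intro powr_mono2) (auto simp: bracket_def)

text \<open>With radii p and q the difference of the two sides is (p - q)(p |x|^2 - q |y|^2). Both
  factors have the same sign, since the radius grows with the norm.\<close>

lemma ctr_dist_sq:
  fixes x y :: "real ^ 'n::finite"
  assumes a: "0 \<le> a"
  shows "rad a x * rad a y * (norm (x - y))\<^sup>2 \<le> (norm (ctr a x - ctr a y))\<^sup>2"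
proof -
  let ?p = "rad a x" and ?q = "rad a y"
  have "(norm (ctr a x - ctr a y))\<^sup>2 = ?p * ?q * (norm (x - y))\<^sup>2 + (?p - ?q) * (?p * (norm x)\<^sup>2 - ?q * (norm y)\<^sup>2)"
    unfolding ctr_def power2_norm_eq_inner by (simp add: inner_diff_left inner_diff_right inner_commute[of y x] algebra_simps)
  moreover have "0 \<le> (?p - ?q) * (?p * (norm x)\<^sup>2 - ?q * (norm y)\<^sup>2)"
  proof (cases "norm x \<le> norm y")
    case True
    then have "?p \<le> ?q" "?p * (norm x)\<^sup>2 \<le> ?q * (norm y)\<^sup>2"
      using rad_mono[OF a True] by (auto intro!: mult_mono power_mono)
    then show ?thesis by (simp add: mult_nonpos_nonpos)
  next
    case False
    then have "norm y \<le> norm x" by simp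
    then have "?q \<le> ?p" "?q * (norm y)\<^sup>2 \<le> ?p * (norm x)\<^sup>2"
      using rad_mono[OF a, of y x] by (auto intro!: mult_mono power_mono)
    then show ?thesis by simp
  qed
  ultimately show ?thesis by simp
qed

text \<open>Points whose brackets agree up to a factor 2 have radii that agree up to 2^a, whence the
  power of 2. The quarter is the loss when the brackets differ by more and |x| alone dominates the
  distance.\<close>

definition sepc :: "real \<Rightarrow> real" where
  "sepc a = 2 powr (- a) / 4"

lemma sepc_pos [simp]: "0 < sepc a" by (simp add: sepc_def)

lemma ctr_dist_aux:
  fixes x y :: "real ^ 'n::finite"
  assumes a: "0 \<le> a" and le: "norm y \<le> norm x"
  shows "sepc a * rad a x * norm (x - y) \<le> norm (ctr a x - ctr a y)"
proof -
  let ?p = "rad a x" and ?q = "rad a y"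
  have c1: "2 powr (- a) \<le> (1::real)" using a by (simp add: powr_minus_divide ge_one_powr_ge_zero)
  show ?thesis
  proof (cases "bracket x \<le> 2 * bracket y")
    case True
    have "?p \<le> (2 * bracket y) powr a"
      unfolding rad_def using True a by (intro powr_mono2) auto
    also have "\<dots> = 2 powr a * ?q" by (simp add: rad_def powr_mult)
    finally have q: "2 powr (- a) * ?p \<le> ?q" by (simp add: powr_minus field_simps)
    have "(sepc a * ?p * norm (x - y))\<^sup>2 = (2 powr (- a) / 16) * (?p * (2 powr (- a) * ?p) * (norm (x - y))\<^sup>2)"
      by (simp add: sepc_def power2_eq_square)
    also have "\<dots> \<le> 1 * (?p * ?q * (norm (x - y))\<^sup>2)"
      using c1 q by (intro mult_mono mult_right_mono mult_left_mono) auto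
    also have "\<dots> \<le> (norm (ctr a x - ctr a y))\<^sup>2" using ctr_dist_sq[OF a] by simp
    finally show ?thesis by (rule power2_le_imp_le) simp
  next
    case False
    have "?p * (norm x - norm y) \<le> norm (ctr a x) - norm (ctr a y)"
      using mult_right_mono[OF rad_mono[OF a le] norm_ge_zero[of y]] by (simp add: ctr_def algebra_simps)
    also have "\<dots> \<le> norm (ctr a x - ctr a y)" by (rule norm_triangle_ineq2)
    finally have 1: "?p * (norm x - norm y) \<le> norm (ctr a x - ctr a y)" .
    have "norm (x - y) \<le> norm x + norm y" by (rule norm_triangle_ineq4)
    also have "\<dots> \<le> 4 * (norm x - norm y)"
    proof -
      have "2 * (1 + norm y) < 1 + norm x" using False by (simp add: bracket_def)
      then show ?thesis using norm_ge_zero[of y] by argo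
    qed
    finally have "norm (x - y) / 4 \<le> norm x - norm y" by simp
    then have "?p * (norm (x - y) / 4) \<le> ?p * (norm x - norm y)" by (intro mult_left_mono) auto
    moreover have "sepc a * ?p * norm (x - y) \<le> ?p * (norm (x - y) / 4)"
      using mult_right_mono[OF c1, of "?p * norm (x - y) / 4"] by (simp add: sepc_def)
    ultimately show ?thesis using 1 by linarith
  qed
qed

text \<open>The larger radius stands on the left, so the estimate can be read at the scale of either
  ball. It yields both the bounded overlap of the covering and the quantitative separation of
  distant balls.\<close>

lemma ctr_dist:
  fixes x y :: "real ^ 'n::finite"
  assumes a: "0 \<le> a"
  shows "sepc a * max (rad a x) (rad a y) * norm (x - y) \<le> norm (ctr a x - ctr a y)"
proof (cases "norm y \<le> norm x")
  case True
  then show ?thesis using ctr_dist_aux[OF a True] rad_mono[OF a True] by (simp add: max_absorb1)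
next
  case False
  then have le: "norm x \<le> norm y" by simp
  then show ?thesis using ctr_dist_aux[OF a le] rad_mono[OF a le] by (simp add: max_absorb2 norm_minus_commute)
qed

definition inball :: "real \<Rightarrow> real \<Rightarrow> real ^ 'n \<Rightarrow> real ^ 'n \<Rightarrow> bool" where
  "inball a C x \<xi> \<longleftrightarrow> norm (\<xi> - ctr a x) \<le> C * rad a x"

text \<open>The slack 2 is the distance of two points of one unit ball; it lets the lemma count the
  balls that meet a bump of radius 1.\<close>

lemma inball_near:
  fixes x y :: "real ^ 'n::finite"
  assumes a: "0 \<le> a" and C: "0 \<le> C" and "inball a C x \<xi>" "inball a C y \<xi>'" "norm (\<xi> - \<xi>') \<le> 2"
  shows "norm (x - y) \<le> (2 * C + 2) / sepc a"
proof -
  let ?m = "max (rad a x) (rad a y)"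
  have m1: "1 \<le> ?m" using rad_ge1[OF a, of x] by simp
  have "sepc a * ?m * norm (x - y) \<le> norm (ctr a x - ctr a y)" by (rule ctr_dist[OF a])
  also have "ctr a x - ctr a y = (\<xi>' - ctr a y) - (\<xi> - ctr a x) + (\<xi> - \<xi>')" by simp
  also have "norm \<dots> \<le> norm (\<xi>' - ctr a y) + norm (\<xi> - ctr a x) + norm (\<xi> - \<xi>')"
    by (meson add_mono norm_triangle_ineq norm_triangle_ineq4 order_refl order_trans)
  also have "\<dots> \<le> C * ?m + C * ?m + 2 * ?m"
  proof (intro add_mono)
    show "norm (\<xi>' - ctr a y) \<le> C * ?m" using assms(4) C unfolding inball_def by (meson max.cobounded2 mult_left_mono order_trans)
    show "norm (\<xi> - ctr a x) \<le> C * ?m" using assms(3) C unfolding inball_def by (meson max.cobounded1 mult_left_mono order_trans)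
    show "norm (\<xi> - \<xi>') \<le> 2 * ?m" using assms(5) m1 by linarith
  qed
  also have "\<dots> = ?m * (2 * C + 2)" by (simp add: algebra_simps)
  finally have "?m * (sepc a * norm (x - y)) \<le> ?m * (2 * C + 2)" by (simp add: mult_ac)
  then have "sepc a * norm (x - y) \<le> 2 * C + 2" using m1 by (simp add: mult_le_cancel_left_pos)
  then show ?thesis by (simp add: pos_le_divide_eq mult.commute)
qed

text \<open>From the stated distance on, the extent C \<open>rad a x\<close> of the ball at x uses
  up at most half of the separation of the centres.\<close>

lemma inball_far:
  fixes x y :: "real ^ 'n::finite"
  assumes a: "0 \<le> a" and C: "0 \<le> C" and "inball a C x \<xi>" and far: "2 * C / sepc a \<le> norm (x - y)"
  shows "sepc a / 2 * rad a y * norm (x - y) \<le> norm (\<xi> - ctr a y)"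
proof -
  let ?m = "max (rad a x) (rad a y)"
  have "sepc a * ?m * norm (x - y) \<le> norm (ctr a x - ctr a y)" by (rule ctr_dist[OF a])
  also have "\<dots> \<le> norm (\<xi> - ctr a y) + norm (\<xi> - ctr a x)"
    using norm_triangle_ineq4[of "\<xi> - ctr a y" "\<xi> - ctr a x"] by simp
  finally have 1: "sepc a * ?m * norm (x - y) \<le> norm (\<xi> - ctr a y) + norm (\<xi> - ctr a x)" .
  have "norm (\<xi> - ctr a x) \<le> C * ?m"
    using assms(3) C unfolding inball_def by (meson max.cobounded1 mult_left_mono order_trans)
  also have "\<dots> \<le> (sepc a * norm (x - y) / 2) * ?m"
    using far by (intro mult_right_mono) (auto simp: pos_divide_le_eq mult.commute le_max_iff_disj)
  finally have "sepc a / 2 * ?m * norm (x - y) \<le> norm (\<xi> - ctr a y)"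
    using 1 by (simp add: algebra_simps)
  moreover have "sepc a / 2 * rad a y * norm (x - y) \<le> sepc a / 2 * ?m * norm (x - y)"
    by (intro mult_right_mono mult_left_mono) (auto simp: less_imp_le)
  ultimately show ?thesis by linarith
qed

lemma rad_bracket: "rad a x * bracket x = bracket x powr (1 + a)"
  by (simp add: rad_def powr_add)

lemma inball_bracket_upper:
  fixes x :: "real ^ 'n::finite"
  assumes a: "0 \<le> a" and C: "0 \<le> C" and "inball a C x \<xi>"
  shows "bracket \<xi> \<le> (1 + C) * bracket x powr (1 + a)"
proof -
  have r: "1 \<le> rad a x" by (rule rad_ge1[OF a])
  have "norm \<xi> \<le> norm (ctr a x) + norm (\<xi> - ctr a x)" by (metis norm_triangle_sub)
  also have "\<dots> \<le> rad a x * norm x + C * rad a x" using assms(3) by (simp add: inball_def ctr_def)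
  finally have "bracket \<xi> \<le> rad a x * (1 + norm x) + C * rad a x" using r by (simp add: bracket_def algebra_simps)
  also have "\<dots> \<le> (1 + C) * (rad a x * bracket x)"
    using mult_left_mono[OF bracket_ge1[of x], of "C * rad a x"] C by (simp add: algebra_simps bracket_def)
  finally show ?thesis by (simp add: rad_bracket)
qed

text \<open>For |x| > 2 C the ball stays away from the origin by a fixed fraction of |ctr a x|. The
  remaining x are bounded, which accounts for the second summand of the constant.\<close>

lemma inball_bracket_lower:
  fixes x :: "real ^ 'n::finite"
  assumes a: "0 \<le> a" and C: "1 \<le> C" and "inball a C x \<xi>"
  shows "bracket x powr (1 + a) \<le> (4 + (1 + 2 * C) powr (1 + a)) * bracket \<xi>"
proof (cases "norm x \<le> 2 * C")
  case True
  have "bracket x powr (1 + a) \<le> (1 + 2 * C) powr (1 + a)"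
    using True a by (intro powr_mono2) (auto simp: bracket_def)
  also have "\<dots> \<le> (4 + (1 + 2 * C) powr (1 + a)) * 1" by simp
  also have "\<dots> \<le> (4 + (1 + 2 * C) powr (1 + a)) * bracket \<xi>"
    by (intro mult_left_mono bracket_ge1) auto
  finally show ?thesis .
next
  case False
  have "rad a x * norm x = norm (ctr a x)" by (simp add: ctr_def)
  also have "\<dots> \<le> norm \<xi> + norm (\<xi> - ctr a x)" by (metis norm_minus_commute norm_triangle_sub)
  also have "\<dots> \<le> norm \<xi> + C * rad a x" using assms(3) by (simp add: inball_def)
  finally have 1: "rad a x * (norm x - C) \<le> norm \<xi>" by (simp add: algebra_simps)
  have "bracket x / 4 \<le> norm x - C" using False C by (simp add: bracket_def)
  then have "rad a x * (bracket x / 4) \<le> rad a x * (norm x - C)" by (intro mult_left_mono) auto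
  from order_trans[OF this 1] have "rad a x * bracket x / 4 \<le> norm \<xi>" by simp
  then have "bracket x powr (1 + a) \<le> 4 * bracket \<xi>"
    unfolding rad_bracket[symmetric] bracket_def[of \<xi>] by argo
  also have "\<dots> \<le> (4 + (1 + 2 * C) powr (1 + a)) * bracket \<xi>"
    by (intro mult_right_mono) auto
  finally show ?thesis .
qed

lemma powr_comparable:
  fixes u v :: real
  assumes "0 < u" "0 < v" "u \<le> K * v" "v \<le> K * u" "1 \<le> K"
  shows "u powr t \<le> K powr \<bar>t\<bar> * v powr t"
proof (cases "0 \<le> t")
  case True
  then have "u powr t \<le> (K * v) powr t" using assms by (intro powr_mono2) auto
  then show ?thesis using True assms by (simp add: powr_mult)
next
  case False
  have "v / K \<le> u" using assms by (simp add: field_simps)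
  then have "u powr t \<le> (v / K) powr t" using False assms by (intro powr_mono2') auto
  also have "\<dots> = v powr t * K powr (- t)" using assms by (simp add: powr_divide powr_minus_divide)
  finally show ?thesis using False by (simp add: mult.commute)
qed

text \<open>On the ball at x the bracket of \<xi> is comparable to the power 1 + a of the bracket of
  x, where 1 + a becomes 1 / (1 - \<alpha>). For t = \<alpha> this compares the radius with the
  power \<alpha> of the frequency, for t = s it does the same for the weight of the norm.\<close>

lemma inball_comparable:
  assumes a: "0 \<le> a" and C: "1 \<le> C"
  obtains K where "1 \<le> K"
    "\<And>(x :: real ^ 'n::finite) \<xi>. inball a C x \<xi> \<Longrightarrow> bracket \<xi> powr t \<le> K * bracket x powr ((1 + a) * t)"
    "\<And>(x :: real ^ 'n::finite) \<xi>. inball a C x \<xi> \<Longrightarrow> bracket x powr ((1 + a) * t) \<le> K * bracket \<xi> powr t"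
proof -
  define K where "K = max (1 + C) (4 + (1 + 2 * C) powr (1 + a))"
  have K1: "1 \<le> K" using C by (simp add: K_def)
  have 1: "bracket \<xi> \<le> K * bracket x powr (1 + a)" if "inball a C x \<xi>" for x \<xi> :: "real ^ 'n"
    using inball_bracket_upper[OF a _ that] C by (rule_tac order_trans) (auto simp: K_def intro!: mult_right_mono)
  have 2: "bracket x powr (1 + a) \<le> K * bracket \<xi>" if "inball a C x \<xi>" for x \<xi> :: "real ^ 'n"
    using inball_bracket_lower[OF a C that] by (rule order_trans) (auto simp: K_def intro!: mult_right_mono)
  show ?thesis
  proof (rule that[of "K powr \<bar>t\<bar>"])
    show "1 \<le> K powr \<bar>t\<bar>" using K1 by (simp add: ge_one_powr_ge_zero)
    show "bracket \<xi> powr t \<le> K powr \<bar>t\<bar> * bracket x powr ((1 + a) * t)" if "inball a C x \<xi>" for x \<xi> :: "real ^ 'n"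
      using powr_comparable[OF _ _ 1[OF that] 2[OF that] K1, of t] by (simp add: powr_powr)
    show "bracket x powr ((1 + a) * t) \<le> K powr \<bar>t\<bar> * bracket \<xi> powr t" if "inball a C x \<xi>" for x \<xi> :: "real ^ 'n"
      using powr_comparable[OF _ _ 2[OF that] 1[OF that] K1, of t] by (simp add: powr_powr)
  qed
qed

lemma bracket_add: "bracket (x + y) \<le> bracket x * bracket y"
proof -
  have "norm (x + y) \<le> norm x + norm y" by (rule norm_triangle_ineq)
  also have "\<dots> \<le> norm x + norm y + norm x * norm y" by simp
  finally show ?thesis by (simp add: bracket_def algebra_simps)
qed

text \<open>Peetre's inequality for exponents of either sign. It moves the weight from one index to
  another at the price of powers of their distance.\<close>

lemma bracket_powr_le: "bracket x powr t \<le> bracket y powr t * bracket (x - y) powr \<bar>t\<bar>"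
proof (cases "0 \<le> t")
  case True
  have "bracket x \<le> bracket y * bracket (x - y)" using bracket_add[of y "x - y"] by simp
  then have "bracket x powr t \<le> (bracket y * bracket (x - y)) powr t" using True by (intro powr_mono2) auto
  then show ?thesis using True by (simp add: powr_mult)
next
  case False
  have "bracket y \<le> bracket x * bracket (x - y)"
    using bracket_add[of x "y - x"] by (simp add: bracket_def norm_minus_commute)
  then have "(bracket x * bracket (x - y)) powr t \<le> bracket y powr t" using False by (intro powr_mono2') auto
  then have "bracket x powr t * bracket (x - y) powr t * bracket (x - y) powr (- t) \<le> bracket y powr t * bracket (x - y) powr (- t)"
    by (intro mult_right_mono) (auto simp: powr_mult)
  then show ?thesis using False by (simp add: powr_minus mult.assoc)
qed

subsection \<open>The integer lattice\<close>

lemma int_vec_diff: "int_vec (k - j) = int_vec k - int_vec j"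
  and int_vec_add: "int_vec (k + j) = int_vec k + int_vec j"
  and int_vec_uminus: "int_vec (- k) = - int_vec k"
  by (auto simp: int_vec_def vec_eq_iff)

definition lattice_ball :: "real \<Rightarrow> (int ^ 'n) set" where
  "lattice_ball K = {m. norm (int_vec m) \<le> K}"

lemma finite_lattice_ball: "finite (lattice_ball K :: (int ^ 'n::finite) set)"
proof (rule finite_subset)
  show "lattice_ball K \<subseteq> {m :: int ^ 'n. \<forall>i. m $ i \<in> {- \<lceil>K\<rceil>..\<lceil>K\<rceil>}}"
  proof safe
    fix m :: "int ^ 'n" and i assume "m \<in> lattice_ball K"
    then have "\<bar>real_of_int (m $ i)\<bar> \<le> K"
      using component_le_norm_cart[of "int_vec m" i] by (simp add: lattice_ball_def int_vec_def)
    then show "m $ i \<in> {- \<lceil>K\<rceil>..\<lceil>K\<rceil>}" by (auto simp: le_ceiling_iff) linarith+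
  qed
  have "{m :: int ^ 'n. \<forall>i. m $ i \<in> {- \<lceil>K\<rceil>..\<lceil>K\<rceil>}} = vec_lambda ` {f. \<forall>i. f i \<in> {- \<lceil>K\<rceil>..\<lceil>K\<rceil>}}"
    by (auto simp: image_iff intro!: exI[of _ "vec_nth _"])
  moreover have "finite {f :: 'n \<Rightarrow> int. \<forall>i. f i \<in> {- \<lceil>K\<rceil>..\<lceil>K\<rceil>}}"
    using finite_PiE[of "UNIV :: 'n set" "\<lambda>_. {- \<lceil>K\<rceil>..\<lceil>K\<rceil>}"] by (simp add: PiE_UNIV_domain Pi_def)
  ultimately show "finite {m :: int ^ 'n. \<forall>i. m $ i \<in> {- \<lceil>K\<rceil>..\<lceil>K\<rceil>}}" by simp
qed

definition lattice_floor :: "real ^ 'n \<Rightarrow> int ^ 'n" where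
  "lattice_floor x = (\<chi> i. \<lfloor>x $ i\<rfloor>)"

text \<open>Comparison with the integral: on the open unit cube at k the bracket of x is at most 1 +
  n times that of k, and \<open>lattice_floor\<close> recovers k from any point of its cube, so the
  cubes do not overlap.\<close>

lemma lattice_sum_finite:
  assumes N: "N \<ge> 2 * CARD('n)"
  shows "(\<integral>\<^sup>+k. ennreal (1 / bracket (int_vec (k :: int ^ 'n::finite)) ^ N) \<partial>count_space UNIV) < \<infinity>"
proof -
  let ?n = "real CARD('n)"
  let ?Q = "\<lambda>k :: int ^ 'n. box (int_vec k) (int_vec k + 1)"
  have cube: "emeasure lborel (?Q k) = 1" for k
  proof -
    have "(1 :: real ^ 'n) \<bullet> b = 1" if "b \<in> Basis" for b :: "real ^ 'n"
      using that by (auto simp: Basis_vec inner_axis)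
    then show ?thesis by (subst emeasure_lborel_box) (auto simp: inner_add_left)
  qed
  have le: "ennreal (1 / bracket (int_vec k) ^ N) * indicator (?Q k) x
      \<le> ennreal ((1 + ?n) ^ N * (1 / bracket x ^ N)) * indicator (?Q k) x" for k and x :: "real ^ 'n"
  proof (cases "x \<in> ?Q k")
    case True
    have "norm (x - int_vec k) \<le> (\<Sum>i\<in>UNIV. \<bar>(x - int_vec k) $ i\<bar>)" by (rule norm_le_l1_cart)
    also have "\<dots> \<le> (\<Sum>i\<in>(UNIV :: 'n set). 1)"
    proof (intro sum_mono)
      fix i
      have "int_vec k $ i < x $ i" "x $ i < int_vec k $ i + 1"
        using True by (auto simp: mem_box_cart)
      then show "\<bar>(x - int_vec k) $ i\<bar> \<le> 1" by simp
    qed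
    finally have "norm (x - int_vec k) \<le> ?n" by simp
    then have "norm x \<le> norm (int_vec k) + ?n" using norm_triangle_sub[of x "int_vec k"] by linarith
    moreover have "(1 + ?n) * bracket (int_vec k) = 1 + ?n + norm (int_vec k) + ?n * norm (int_vec k)"
      by (simp add: bracket_def algebra_simps)
    moreover have "0 \<le> ?n * norm (int_vec k)" by simp
    ultimately have "bracket x \<le> (1 + ?n) * bracket (int_vec k)"
      unfolding bracket_def[of x] by linarith
    then have "bracket x ^ N \<le> (1 + ?n) ^ N * bracket (int_vec k) ^ N"
      by (metis bracket_nonneg power_mono power_mult_distrib)
    then show ?thesis using True by (auto simp: field_simps intro!: ennreal_leI)
  qed simp
  let ?h = "\<lambda>x :: real ^ 'n. ennreal ((1 + ?n) ^ N * (1 / bracket x ^ N))"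
  have Q: "k = lattice_floor x" if "x \<in> ?Q k" for k x
    using that unfolding lattice_floor_def vec_eq_iff
    by (auto simp: mem_box_cart int_vec_def intro!: floor_unique[symmetric] less_imp_le)
  have le': "ennreal (1 / bracket (int_vec k) ^ N) * indicator (?Q k) x \<le> ?h x * indicator {lattice_floor x} k" for k x
    using le[of k x] Q[of x k] by (cases "x \<in> ?Q k") simp_all
  have "(\<integral>\<^sup>+k. ennreal (1 / bracket (int_vec (k :: int ^ 'n)) ^ N) \<partial>count_space UNIV)
      = (\<integral>\<^sup>+k. \<integral>\<^sup>+x. ennreal (1 / bracket (int_vec k) ^ N) * indicator (?Q k) x \<partial>lborel \<partial>count_space UNIV)"
    by (simp add: nn_integral_cmult_indicator cube)
  also have "\<dots> = (\<integral>\<^sup>+x. \<integral>\<^sup>+k. ennreal (1 / bracket (int_vec k) ^ N) * indicator (?Q k) x \<partial>count_space UNIV \<partial>lborel)"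
    by (rule nn_integral_count_space_nn_integral[symmetric]) auto
  also have "\<dots> \<le> (\<integral>\<^sup>+x. \<integral>\<^sup>+k. ?h x * indicator {lattice_floor x} k \<partial>count_space UNIV \<partial>lborel)"
    by (intro nn_integral_mono le')
  also have "\<dots> = (\<integral>\<^sup>+x. ?h x \<partial>lborel)"
    by (intro nn_integral_cong) (simp add: nn_integral_cmult_indicator)
  also have "\<dots> = ennreal ((1 + ?n) ^ N) * (\<integral>\<^sup>+(x::real ^ 'n). ennreal (1 / bracket x ^ N) \<partial>lborel)"
    by (subst nn_integral_cmult[symmetric]) (auto simp: ennreal_mult[symmetric])
  also have "\<dots> < \<infinity>" using nn_integral_bracket[OF N] by (simp add: ennreal_mult_less_top)
  finally show ?thesis .
qed

subsection \<open>Pseudodifferential operators with amplitudes\<close>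

lemma amplitude_mult:
  assumes "amplitude b" "amplitude b'"
  shows "amplitude (\<lambda>z. b z * b' z)"
  unfolding amplitude_def
proof
  fix N
  have "Fam (\<lambda>(_::unit) z. 1 / bracket (snd z) ^ N * (1 / bracket (snd z) ^ 0)) (\<lambda>_ _ _. 1) (\<lambda>_ z. b z * b' z)"
    by (rule Fam_mult[OF assms[unfolded amplitude_def, THEN spec]]) auto
  then show "Fam (\<lambda>(_::unit) z. 1 / bracket (snd z) ^ N) (\<lambda>_ _ _. 1) (\<lambda>_ z. b z * b' z)" by simp
qed

lemma pdo_osc:
  fixes b :: "(real ^ 'n::finite) \<times> (real ^ 'n) \<Rightarrow> complex"
  shows "pdo b f x = complex_of_real (1 / (2 * pi) ^ CARD('n)) * osc (\<lambda>z. b z * fourier f (snd z)) x"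
  by (simp add: pdo_def osc_def mult.assoc)

lemma amplitude_fourier: "amplitude b \<Longrightarrow> f \<in> schwartz \<Longrightarrow> amplitude (\<lambda>z. b z * fourier f (snd z))"
  by (intro amplitude_mult amplitude_snd fourier_schwartz)

lemma pdo_schwartz: "amplitude b \<Longrightarrow> f \<in> schwartz \<Longrightarrow> pdo b f \<in> schwartz"
  unfolding pdo_osc[abs_def] by (intro schwartz_cmult osc_schwartz amplitude_fourier)

lemma iD_slice:
  fixes b :: "'a::euclidean_space \<times> 'a \<Rightarrow> complex"
  assumes "smooth b"
  shows "iD l (\<lambda>\<xi>. b (x, \<xi>)) = (\<lambda>\<xi>. iD (map (\<lambda>v. (0, v)) l) b (x, \<xi>))"
  by (induction l) (simp_all add: iD_Cons smooth_slice(2)[OF smooth_iD[OF assms]])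

lemma amplitude_slice_schwartz:
  fixes b :: "(real ^ 'n::finite) \<times> (real ^ 'n) \<Rightarrow> complex"
  assumes b: "amplitude b"
  shows "(\<lambda>\<xi>. b (x, \<xi>)) \<in> schwartz"
  unfolding schwartz_iff
proof
  fix N
  note sm = amplitude_smooth[OF b]
  show "Fam (rapid N) (\<lambda>_ _ _. 1) (\<lambda>_::unit. \<lambda>\<xi>. b (x, \<xi>))"
  proof (rule FamI)
    fix l assume "l \<in> lists (Basis :: (real ^ 'n) set)"
    then have L: "map (\<lambda>v. (0, v)) l \<in> lists (Basis :: ((real ^ 'n) \<times> (real ^ 'n)) set)"
      by (auto simp: Basis_prod_def in_lists_conv_set)
    have F: "Fam (\<lambda>_::unit. \<lambda>z. 1 / bracket (snd z) ^ N) (\<lambda>_ _ _. 1) (\<lambda>_. b)"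
      using b by (simp add: amplitude_def)
    obtain K where K: "K \<ge> 0" "\<And>(j::unit) z. norm (iD (map (\<lambda>v. (0, v)) l) b z) \<le> K * (1 / bracket (snd z) ^ N * prod_list (map (\<lambda>v. 1) (map (\<lambda>v. (0 :: real ^ 'n, v)) l)))"
      by (rule Fam_bound_iD[OF F L]) (rule that)
    show "\<exists>C\<ge>0. \<forall>(j::unit) \<xi>. norm (iD l (\<lambda>\<xi>. b (x, \<xi>)) \<xi>) \<le> C * (1 / bracket \<xi> ^ N * prod_list (map (\<lambda>v. 1) l))"
    proof (intro exI[of _ K] conjI allI K(1))
      show "norm (iD l (\<lambda>\<xi>. b (x, \<xi>)) \<xi>) \<le> K * (1 / bracket \<xi> ^ N * prod_list (map (\<lambda>v. 1) l))" for \<xi>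
        using K(2)[where z="(x, \<xi>)"] by (simp add: iD_slice[OF sm] prod_list_const)
    qed
  qed (rule smooth_slice(1)[OF sm])
qed

text \<open>Up to the factor (2 pi)^(-n), \<open>ker b x (x - y)\<close> is the integral kernel of
  the operator at (x, y); see \<open>pdo_ker\<close>.\<close>

definition ker :: "((real ^ 'n::finite) \<times> (real ^ 'n) \<Rightarrow> complex) \<Rightarrow> real ^ 'n \<Rightarrow> real ^ 'n \<Rightarrow> complex" where
  "ker b x z = osc (\<lambda>w. b (x, snd w)) z"

lemma ker_inner_mult:
  fixes b :: "(real ^ 'n::finite) \<times> (real ^ 'n) \<Rightarrow> complex"
  assumes b: "amplitude b" and v: "v \<in> Basis"
  shows "complex_of_real (z \<bullet> v) * ker b x z = \<i> * ker (dir_deriv (0, v) b) x z"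
proof -
  note sl = amplitude_slice_schwartz[OF b, of x]
  have "complex_of_real (z \<bullet> v) * ker b x z = osc (\<lambda>w. \<i> * dir_deriv (0, v) (\<lambda>w. b (x, snd w)) w) z"
    unfolding ker_def by (rule osc_inner_mult[OF amplitude_snd[OF sl] v])
  also have "\<dots> = osc (\<lambda>w. \<i> * dir_deriv (0, v) b (x, snd w)) z"
    unfolding dir_deriv_snd[OF schwartz_smooth[OF sl]] smooth_slice(2)[OF amplitude_smooth[OF b]] ..
  also have "\<dots> = \<i> * ker (dir_deriv (0, v) b) x z"
    unfolding ker_def osc_def mult.left_commute[of _ \<i>] integral_mult_right_zero by simp
  finally show ?thesis .
qed

lemma pdo_ker:
  fixes b :: "(real ^ 'n::finite) \<times> (real ^ 'n) \<Rightarrow> complex"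
  assumes b: "amplitude b" and f: "f \<in> schwartz"
  shows "pdo b f x = complex_of_real (1 / (2 * pi) ^ CARD('n)) * (\<integral>y. ker b x (x - y) * f y \<partial>lborel)"
proof -
  let ?E = "\<lambda>z \<xi>::real ^ 'n. exp (\<i> * complex_of_real (z \<bullet> \<xi>))"
  have "(\<integral>\<xi>. (?E x \<xi> * b (x, \<xi>)) * (\<integral>y. exp (- \<i> * complex_of_real (\<xi> \<bullet> y)) * f y \<partial>lborel) \<partial>lborel)
     = (\<integral>y. f y * (\<integral>\<xi>. exp (- \<i> * complex_of_real (\<xi> \<bullet> y)) * (?E x \<xi> * b (x, \<xi>)) \<partial>lborel) \<partial>lborel)"
    using fubini_kernel[OF osc_integrable[OF b, of x x] schwartz_integrable[OF f] cis_inner_pair_measurable(2), of 1] by simp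
  also have "\<dots> = (\<integral>y. f y * ker b x (x - y) \<partial>lborel)"
  proof -
    have "exp (- \<i> * complex_of_real (\<xi> \<bullet> y)) * (?E x \<xi> * b (x, \<xi>)) = ?E (x - y) \<xi> * b (x, \<xi>)" for \<xi> y
    proof -
      have "- \<i> * complex_of_real (\<xi> \<bullet> y) + \<i> * complex_of_real (x \<bullet> \<xi>) = \<i> * complex_of_real ((x - y) \<bullet> \<xi>)"
        by (simp add: inner_diff_left inner_commute[of \<xi> y] right_diff_distrib)
      then show ?thesis unfolding mult.assoc[symmetric] exp_add[symmetric] by simp
    qed
    then show ?thesis unfolding ker_def osc_def snd_conv by (simp only:)
  qed
  finally show ?thesis unfolding pdo_def fourier_def by (simp add: mult.commute)
qed

subsection \<open>Symbols adapted to the covering\<close>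

locale alpha_setting =
  fixes \<alpha> C :: real and \<eta> :: "int ^ 'n::finite \<Rightarrow> real ^ 'n \<Rightarrow> complex"
  assumes \<alpha>0: "0 \<le> \<alpha>" and \<alpha>1: "\<alpha> < 1" and C1: "C > 1" and part: "alpha_partition \<alpha> C \<eta>"
begin

definition a :: real where "a = \<alpha> / (1 - \<alpha>)"

abbreviation r :: "int ^ 'n \<Rightarrow> real" where "r k \<equiv> rad a (int_vec k)"

abbreviation ball_at :: "int ^ 'n \<Rightarrow> real ^ 'n \<Rightarrow> bool" where "ball_at k \<equiv> inball a C (int_vec k)"

lemma a0: "0 \<le> a"
  using \<alpha>0 \<alpha>1 by (simp add: a_def)

lemma one_plus_a: "1 + a = 1 / (1 - \<alpha>)"
  using \<alpha>1 by (simp add: a_def field_simps)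

lemma C0: "0 \<le> C" and C1': "1 \<le> C"
  using C1 by auto

lemma eta_schwartz: "\<eta> k \<in> schwartz"
  using part by (simp add: alpha_partition_def)

lemma eta_closure: "closure {\<xi>. \<eta> k \<xi> \<noteq> 0} \<subseteq> Collect (ball_at k)"
proof -
  have "\<forall>k. closure {\<xi>. \<eta> k \<xi> \<noteq> 0} \<subseteq>
       {\<xi>. norm (\<xi> - bracket (int_vec k) powr (\<alpha> / (1 - \<alpha>)) *\<^sub>R int_vec k)
            \<le> C * bracket (int_vec k) powr (\<alpha> / (1 - \<alpha>))}"
    using part unfolding alpha_partition_def by (elim conjE)
  then show ?thesis unfolding inball_def ctr_def rad_def a_def by (rule spec)
qed

lemma eta_support: "\<eta> k \<xi> \<noteq> 0 \<Longrightarrow> ball_at k \<xi>"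
  using subsetD[OF subset_trans[OF closure_subset eta_closure], of \<xi> k] by simp

text \<open>The ball contains the closure of the set where \<eta>_k is nonzero, so outside the ball
  \<eta>_k vanishes in a whole neighbourhood and its derivatives vanish as well.\<close>

lemma eta_iD_support:
  assumes "\<not> ball_at k \<xi>"
  shows "iD l (\<eta> k) \<xi> = 0"
proof -
  have "iD l (\<eta> k) \<xi> = iD l (\<lambda>x. 0) \<xi>"
  proof (rule iD_local)
    show "open (- closure {\<xi>. \<eta> k \<xi> \<noteq> 0})" by auto
    show "\<xi> \<in> - closure {\<xi>. \<eta> k \<xi> \<noteq> 0}" using assms subsetD[OF eta_closure, of \<xi> k] by auto
    show "\<eta> k x = 0" if "x \<in> - closure {\<xi>. \<eta> k \<xi> \<noteq> 0}" for x
      using that subsetD[OF closure_subset, of x "{\<xi>. \<eta> k \<xi> \<noteq> 0}"] by auto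
  qed
  then show ?thesis by (simp add: iD_zero)
qed

lemma eta_Fam: "Fam (\<lambda>k \<xi>. of_bool (ball_at k \<xi>)) (\<lambda>_ k _. 1 / r k) \<eta>"
proof (rule FamI)
  show "smooth (\<eta> k)" for k by (rule schwartz_smooth[OF eta_schwartz])
  fix l assume l: "l \<in> lists (Basis :: (real ^ 'n) set)"
  have "set l \<subseteq> range (\<lambda>i. axis i (1::real))" using l by (auto simp: Basis_vec)
  from ex_mlist[OF inj_axis this] obtain \<beta> where \<beta>: "mset (mlist (\<lambda>i. axis i (1::real)) \<beta>) = mset l" by blast
  have sz: "multi_size \<beta> = length l"
    using length_mlist[of "\<lambda>i. axis i (1::real)" \<beta>] mset_eq_length[OF \<beta>] by simp
  obtain C' where C': "\<And>k \<xi>. norm (pderivs \<beta> (\<eta> k) \<xi>)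
       \<le> C' * bracket (int_vec k) powr (- real (multi_size \<beta>) * \<alpha> / (1 - \<alpha>))"
    using part unfolding alpha_partition_def by blast
  have w: "bracket (int_vec k) powr (- real (multi_size \<beta>) * \<alpha> / (1 - \<alpha>)) = (1 / r k) ^ length l" for k :: "int ^ 'n"
    by (simp add: rad_def a_def sz powr_minus powr_realpow[symmetric] powr_powr power_one_over field_simps)
  have "norm (iD l (\<eta> k) \<xi>) \<le> max 0 C' * (of_bool (ball_at k \<xi>) * (1 / r k) ^ length l)" for k \<xi>
  proof (cases "ball_at k \<xi>")
    case True
    have "iD l (\<eta> k) = pderivs \<beta> (\<eta> k)"
      unfolding pderivs_def multi_deriv_iD by (rule iD_mset[OF schwartz_smooth[OF eta_schwartz] \<beta>[symmetric]])
    then have "norm (iD l (\<eta> k) \<xi>) \<le> C' * (1 / r k) ^ length l" using C'[of k \<xi>] by (simp only: w)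
    also have "\<dots> \<le> max 0 C' * (1 / r k) ^ length l" by (intro mult_right_mono) auto
    finally show ?thesis using True by simp
  qed (simp add: eta_iD_support)
  then show "\<exists>C\<ge>0. \<forall>k \<xi>. norm (iD l (\<eta> k) \<xi>) \<le> C * (of_bool (ball_at k \<xi>) * prod_list (map (\<lambda>v. 1 / r k) l))"
    by (intro exI[of _ "max 0 C'"]) (simp add: prod_list_const)
qed

lemma eta_bounded:
  obtains K where "0 \<le> K" "\<And>k \<xi>. norm (\<eta> k \<xi>) \<le> K"
proof -
  obtain K where K: "K \<ge> 0" "\<And>k \<xi>. norm (\<eta> k \<xi>) \<le> K * of_bool (ball_at k \<xi>)"
    by (rule Fam_bound[OF eta_Fam]) (rule that)
  show ?thesis
    by (rule that[OF K(1)]) (use K in \<open>auto intro: order_trans[OF K(2)] simp: of_bool_def\<close>)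
qed

definition K0 :: real where "K0 = (2 * C + 2) / sepc a"

lemma ball_near:
  assumes "ball_at k \<xi>" "ball_at j \<xi>'" "norm (\<xi> - \<xi>') \<le> 2"
  shows "k - j \<in> lattice_ball K0"
  using inball_near[OF a0 C0 assms] by (simp add: lattice_ball_def int_vec_diff K0_def)

text \<open>Only neighbours of i overlap the support of \<eta>_i, and there they already sum to 1.
  They act as a fattened cutoff: f is localised by \<eta>_i while the symbol is localised by
  \<eta>_(i+m), and both localisations are paid for by the same identity.\<close>

lemma eta_local_sum: "\<eta> i \<xi> * (\<Sum>m\<in>lattice_ball K0. \<eta> (i + m) \<xi>) = \<eta> i \<xi>"
proof (cases "\<eta> i \<xi> = 0")
  case False
  let ?S = "(+) i ` lattice_ball K0"
  have fin: "finite ?S" using finite_lattice_ball by blast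
  have z: "\<eta> k \<xi> = 0" if "k \<notin> ?S" for k
  proof (rule ccontr)
    assume "\<eta> k \<xi> \<noteq> 0"
    then have "k - i \<in> lattice_ball K0" by (intro ball_near eta_support) (use False in auto)
    then have "k \<in> ?S" by (intro image_eqI[of _ _ "k - i"]) auto
    then show False using that by simp
  qed
  have "((\<lambda>k. \<eta> k \<xi>) has_sum 1) UNIV" using part by (simp add: alpha_partition_def)
  moreover have "((\<lambda>k. \<eta> k \<xi>) has_sum 1) UNIV \<longleftrightarrow> ((\<lambda>k. \<eta> k \<xi>) has_sum 1) ?S"
    by (rule has_sum_cong_neutral) (use z in auto)
  ultimately have "((\<lambda>k. \<eta> k \<xi>) has_sum 1) ?S" by blast
  then have "(\<Sum>k\<in>?S. \<eta> k \<xi>) = 1"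
    using has_sum_finite[OF fin] has_sum_unique by blast
  then have "(\<Sum>m\<in>lattice_ball K0. \<eta> (i + m) \<xi>) = 1"
    by (subst (asm) sum.reindex) auto
  then show ?thesis by simp
qed simp

text \<open>Under the rescaling of x by 1 / r_j and of \<xi> by r_j these become symbols with
  bounded derivatives and frequency support in a ball of fixed radius, uniformly in j.\<close>

definition loc_sym :: "(int ^ 'n \<Rightarrow> (real ^ 'n) \<times> (real ^ 'n) \<Rightarrow> complex) \<Rightarrow> bool" where
  "loc_sym b \<longleftrightarrow> Fam (\<lambda>j z. of_bool (ball_at j (snd z))) (xw (\<lambda>j _. r j) (\<lambda>j _. 1 / r j)) b"

lemma xw_nonneg: "0 \<le> xw (\<lambda>j _. r j) (\<lambda>j _. 1 / r j) b j z"
  by (simp add: xw_def)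

text \<open>For a single j the frequencies are bounded, which gives decay of any order. The
  constants depend on j, so this serves only to justify the manipulations of integrals; uniform
  estimates come from \<open>loc_sym\<close> itself.\<close>

lemma loc_sym_amplitude:
  assumes "loc_sym b"
  shows "amplitude (b j)"
  unfolding amplitude_def
proof
  fix N
  let ?Q = "(1 + C) * bracket (int_vec j) powr (1 + a)"
  have F: "Fam (\<lambda>(_::unit) z. of_bool (ball_at j (snd z))) (\<lambda>b _. xw (\<lambda>j _. r j) (\<lambda>j _. 1 / r j) b j) (\<lambda>_. b j)"
    using Fam_reindex[OF assms[unfolded loc_sym_def], of "\<lambda>_. j"] .
  show "Fam (\<lambda>_::unit. \<lambda>z. 1 / bracket (snd z) ^ N) (\<lambda>_ _ _. 1) (\<lambda>_. b j)"
  proof (rule Fam_mono[OF F, where K="max (?Q ^ N) (max (r j) (1 / r j))"])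
    fix z :: "(real ^ 'n) \<times> (real ^ 'n)"
    assume "of_bool (ball_at j (snd z)) \<noteq> (0::real)"
    then have B: "ball_at j (snd z)" by (simp add: of_bool_def split: if_splits)
    then have "bracket (snd z) \<le> ?Q" by (rule inball_bracket_upper[OF a0 C0])
    then have "bracket (snd z) ^ N \<le> ?Q ^ N" by (intro power_mono) auto
    also have "\<dots> \<le> max (?Q ^ N) (max (r j) (1 / r j))" by simp
    finally show "of_bool (ball_at j (snd z)) \<le> max (?Q ^ N) (max (r j) (1 / r j)) * (1 / bracket (snd z) ^ N)"
      using B by (simp add: pos_le_divide_eq)
  qed (auto simp: xw_def)
qed

lemma ball_measure:
  "integrable lborel (\<lambda>\<xi>. of_bool (ball_at j \<xi>) :: real)"
  "(\<integral>\<xi>. of_bool (ball_at j \<xi>) \<partial>lborel) = unit_ball_vol (real CARD('n)) * C ^ CARD('n) * r j ^ CARD('n)"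
proof -
  have eq: "(\<lambda>\<xi>. of_bool (ball_at j \<xi>) :: real) = indicator (cball (ctr a (int_vec j)) (C * r j))"
    by (auto simp: inball_def indicator_def dist_norm norm_minus_commute)
  show "integrable lborel (\<lambda>\<xi>. of_bool (ball_at j \<xi>) :: real)"
    unfolding eq by (intro integrable_real_indicator) (use emeasure_bounded_finite[OF bounded_cball] in auto)
  have "0 \<le> C * r j" using C0 by simp
  then show "(\<integral>\<xi>. of_bool (ball_at j \<xi>) \<partial>lborel) = unit_ball_vol (real CARD('n)) * C ^ CARD('n) * r j ^ CARD('n)"
    unfolding eq using content_cball[of "C * r j" "ctr a (int_vec j)"]
    by (simp add: power_mult_distrib measure_def)
qed

lemma ker_bound_0:
  assumes b: "loc_sym b"
  shows "\<exists>K\<ge>0. \<forall>j x z. norm (ker (b j) x z) \<le> K * r j ^ CARD('n)"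
proof -
  obtain K where K: "K \<ge> 0" "\<And>j z. norm (b j z) \<le> K * of_bool (ball_at j (snd z))"
    by (rule Fam_bound[OF b[unfolded loc_sym_def]]) (rule that)
  have "norm (ker (b j) x z) \<le> K * (unit_ball_vol (real CARD('n)) * C ^ CARD('n) * r j ^ CARD('n))" for j x z
  proof -
    have "norm (ker (b j) x z) \<le> (\<integral>\<xi>. K * of_bool (ball_at j \<xi>) \<partial>lborel)"
      unfolding ker_def osc_def snd_conv
      by (rule Bochner_Integration.integral_norm_bound_integral[OF osc_integrable[OF loc_sym_amplitude[OF b]]
            integrable_mult_right[OF ball_measure(1)]])
        (use K(2)[of j "(x, _)"] in \<open>simp add: norm_mult\<close>)
    then show ?thesis by (simp only: integral_mult_right_zero ball_measure(2))
  qed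
  then show ?thesis using K(1) C0
    by (intro exI[of _ "K * (unit_ball_vol (real CARD('n)) * C ^ CARD('n))"]) (auto simp: mult_ac)
qed

lemma loc_sym_deriv_snd:
  assumes b: "loc_sym b" and v: "v \<in> Basis"
  shows "loc_sym (\<lambda>j z. complex_of_real (r j) * dir_deriv (0, v) (b j) z)"
proof -
  have v0: "v \<noteq> 0" and B: "(0, v) \<in> Basis" using v by (auto simp: Basis_prod_def)
  have "Fam (\<lambda>j z. norm (complex_of_real (r j)) * (of_bool (ball_at j (snd z)) * xw (\<lambda>j _. r j) (\<lambda>j _. 1 / r j) (0, v) j z))
      (xw (\<lambda>j _. r j) (\<lambda>j _. 1 / r j)) (\<lambda>j z. complex_of_real (r j) * dir_deriv (0, v) (b j) z)"
    by (rule Fam_cmult[OF Fam_deriv[OF b[unfolded loc_sym_def] B]]) (auto simp: xw_def)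
  moreover have "norm (complex_of_real (r j)) * (of_bool (ball_at j (snd z)) * xw (\<lambda>j _. r j) (\<lambda>j _. 1 / r j) (0, v) j z) = of_bool (ball_at j (snd z))" for j and z :: "(real ^ 'n) \<times> (real ^ 'n)"
    using v0 by (simp add: xw_def)
  ultimately show ?thesis unfolding loc_sym_def by (simp only:)
qed

lemma loc_sym_deriv_fst:
  assumes b: "loc_sym b" and v: "v \<in> Basis"
  shows "loc_sym (\<lambda>j z. complex_of_real (1 / r j) * dir_deriv (v, 0) (b j) z)"
proof -
  have B: "(v, 0) \<in> Basis" using v by (auto simp: Basis_prod_def)
  have "Fam (\<lambda>j z. norm (complex_of_real (1 / r j)) * (of_bool (ball_at j (snd z)) * xw (\<lambda>j _. r j) (\<lambda>j _. 1 / r j) (v, 0) j z))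
      (xw (\<lambda>j _. r j) (\<lambda>j _. 1 / r j)) (\<lambda>j z. complex_of_real (1 / r j) * dir_deriv (v, 0) (b j) z)"
    by (rule Fam_cmult[OF Fam_deriv[OF b[unfolded loc_sym_def] B]]) (auto simp: xw_def)
  moreover have "norm (complex_of_real (1 / r j)) * (of_bool (ball_at j (snd z)) * xw (\<lambda>j _. r j) (\<lambda>j _. 1 / r j) (v, 0) j z) = of_bool (ball_at j (snd z))" for j and z :: "(real ^ 'n) \<times> (real ^ 'n)"
    by (simp add: xw_def norm_divide)
  ultimately show ?thesis unfolding loc_sym_def by (simp only:)
qed

text \<open>In the j-th ball the offset from the centre is at most C r_j, so the new factor is
  bounded by C, and a derivative of it gains r_j like those of the symbol.\<close>

lemma loc_sym_inner:
  assumes b: "loc_sym b" and v: "v \<in> Basis"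
  shows "loc_sym (\<lambda>j z. complex_of_real ((snd z - ctr a (int_vec j)) \<bullet> v / r j) * b j z)"
proof -
  let ?x = "\<lambda>j. \<lambda>\<xi>::real ^ 'n. (1 / r j) *\<^sub>R \<xi> + - ((1 / r j) *\<^sub>R ctr a (int_vec j))"
  have "Fam (\<lambda>j \<xi>. bracket (?x j \<xi>)) (\<lambda>_ j _. \<bar>1 / r j\<bar>) (\<lambda>j \<xi>. complex_of_real (?x j \<xi> \<bullet> v - 0))"
    using Fam_scaled[OF Fam_inner[of v 0], of "\<lambda>j. 1 / r j" "\<lambda>j. - ((1 / r j) *\<^sub>R ctr a (int_vec j))"] .
  moreover have "?x j \<xi> \<bullet> v - 0 = (\<xi> - ctr a (int_vec j)) \<bullet> v / r j" for j \<xi>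
    by (simp add: inner_diff_left inner_add_left diff_divide_distrib)
  ultimately have "Fam (\<lambda>j \<xi>. bracket (?x j \<xi>)) (\<lambda>_ j _. 1 / r j) (\<lambda>j \<xi>. complex_of_real ((\<xi> - ctr a (int_vec j)) \<bullet> v / r j))"
    by simp
  then have "Fam (\<lambda>j z. bracket (?x j (snd z))) (xw (\<lambda>j _. r j) (\<lambda>j _. 1 / r j))
      (\<lambda>j (z :: (real ^ 'n) \<times> (real ^ 'n)). complex_of_real ((snd z - ctr a (int_vec j)) \<bullet> v / r j))"
    by (rule Fam_snd) auto
  from Fam_mult[OF this b[unfolded loc_sym_def]]
  have F: "Fam (\<lambda>j z. bracket (?x j (snd z)) * of_bool (ball_at j (snd z))) (xw (\<lambda>j _. r j) (\<lambda>j _. 1 / r j))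
     (\<lambda>j z. complex_of_real ((snd z - ctr a (int_vec j)) \<bullet> v / r j) * b j z)"
    by (auto simp: xw_nonneg)
  show ?thesis unfolding loc_sym_def
  proof (rule Fam_mono[OF F, where K="1 + C"])
    fix j and z :: "(real ^ 'n) \<times> (real ^ 'n)"
    assume "bracket (?x j (snd z)) * of_bool (ball_at j (snd z)) \<noteq> 0"
    then have B: "ball_at j (snd z)" by (simp add: of_bool_def split: if_splits)
    have "?x j (snd z) = (1 / r j) *\<^sub>R (snd z - ctr a (int_vec j))" by (simp add: scaleR_diff_right)
    then have "norm (?x j (snd z)) = norm (snd z - ctr a (int_vec j)) / r j" by simp
    also have "\<dots> \<le> C" using B by (simp add: inball_def pos_divide_le_eq)
    finally show "bracket (?x j (snd z)) * of_bool (ball_at j (snd z)) \<le> (1 + C) * of_bool (ball_at j (snd z))"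
      using B by (simp add: bracket_def)
    show "xw (\<lambda>j _. r j) (\<lambda>j _. 1 / r j) b j z \<le> (1 + C) * xw (\<lambda>j _. r j) (\<lambda>j _. 1 / r j) b j z" for b
      using mult_right_mono[OF _ xw_nonneg, of 1 "1 + C"] C0 by simp
  qed (auto simp: xw_nonneg)
qed

text \<open>Induction on N: a factor r_j (z . v) is exchanged for r_j times a frequency derivative
  of the symbol, and the resulting family is adapted again. The volume of the ball supplies the
  power of r_j.\<close>

lemma ker_bound:
  assumes b: "loc_sym b"
  shows "\<exists>K\<ge>0. \<forall>j x z. (1 + r j * norm z) ^ N * norm (ker (b j) x z) \<le> K * r j ^ CARD('n)"
  using b
proof (induction N arbitrary: b)
  case 0
  then show ?case using ker_bound_0[OF 0] by simp
next
  case (Suc N)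
  from Suc.IH[OF Suc.prems] obtain K where
    K: "K \<ge> 0" "\<And>j x z. (1 + r j * norm z) ^ N * norm (ker (b j) x z) \<le> K * r j ^ CARD('n)" by blast
  have "\<forall>v\<in>Basis. \<exists>K'\<ge>0. \<forall>j x z. (1 + r j * norm z) ^ N *
      norm (ker (\<lambda>z. complex_of_real (r j) * dir_deriv (0, v) (b j) z) x z) \<le> K' * r j ^ CARD('n)"
    using Suc.IH[OF loc_sym_deriv_snd[OF Suc.prems]] by blast
  then obtain K' where K': "\<And>v. v \<in> Basis \<Longrightarrow> K' v \<ge> 0"
    "\<And>v j x z. v \<in> Basis \<Longrightarrow> (1 + r j * norm z) ^ N *
      norm (ker (\<lambda>z. complex_of_real (r j) * dir_deriv (0, v) (b j) z) x z) \<le> K' v * r j ^ CARD('n)" by metis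
  have "(1 + r j * norm z) ^ Suc N * norm (ker (b j) x z) \<le> (K + (\<Sum>v\<in>Basis. K' v)) * r j ^ CARD('n)" for j x z
  proof -
    let ?P = "(1 + r j * norm z) ^ N"
    have P: "0 \<le> ?P" by (intro zero_le_power add_nonneg_nonneg) auto
    have v: "?P * (r j * \<bar>z \<bullet> v\<bar> * norm (ker (b j) x z)) \<le> K' v * r j ^ CARD('n)" if "v \<in> Basis" for v
    proof -
      have "ker (\<lambda>z. complex_of_real (r j) * dir_deriv (0, v) (b j) z) x z = complex_of_real (r j) * ker (dir_deriv (0, v) (b j)) x z"
        unfolding ker_def osc_def mult.left_commute[of _ "complex_of_real (r j)"] integral_mult_right_zero ..
      then have "norm (ker (\<lambda>z. complex_of_real (r j) * dir_deriv (0, v) (b j) z) x z) = r j * norm (\<i> * ker (dir_deriv (0, v) (b j)) x z)"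
        by (simp add: norm_mult)
      also have "\<dots> = r j * \<bar>z \<bullet> v\<bar> * norm (ker (b j) x z)"
        unfolding ker_inner_mult[OF loc_sym_amplitude[OF Suc.prems] that, symmetric] by (simp add: norm_mult)
      finally show ?thesis using K'(2)[OF that, of j z x] by simp
    qed
    have "(1 + r j * norm z) ^ Suc N * norm (ker (b j) x z) = ?P * (norm (ker (b j) x z)) + ?P * (r j * norm z * norm (ker (b j) x z))"
      by (simp add: algebra_simps)
    also have "\<dots> \<le> ?P * (norm (ker (b j) x z)) + ?P * (r j * (\<Sum>v\<in>Basis. \<bar>z \<bullet> v\<bar>) * norm (ker (b j) x z))"
      by (intro add_mono mult_left_mono mult_right_mono norm_le_l1 P order_refl) auto
    also have "\<dots> = ?P * norm (ker (b j) x z) + (\<Sum>v\<in>Basis. ?P * (r j * \<bar>z \<bullet> v\<bar> * norm (ker (b j) x z)))"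
      by (simp add: sum_distrib_left sum_distrib_right mult_ac)
    also have "\<dots> \<le> K * r j ^ CARD('n) + (\<Sum>v\<in>Basis. K' v * r j ^ CARD('n))"
      by (intro add_mono sum_mono v K)
    finally show ?thesis by (simp add: distrib_right sum_distrib_right)
  qed
  then show ?case using K K' by (intro exI[of _ "K + (\<Sum>v\<in>Basis. K' v)"]) (auto intro!: add_nonneg_nonneg sum_nonneg)
qed

lemma loc_sym_l2:
  assumes b: "loc_sym b"
  shows "\<exists>K\<ge>0. \<forall>j. \<forall>f\<in>schwartz. l2 (pdo (b j) f) \<le> K * l2 f"
proof -
  let ?n = "CARD('n)"
  let ?N = "2 * CARD('n)"
  let ?c = "1 / (2 * pi) ^ CARD('n)"
  obtain K where K: "K \<ge> 0" "\<And>j x z. (1 + r j * norm z) ^ ?N * norm (ker (b j) x z) \<le> K * r j ^ ?n"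
    using ker_bound[OF b] by blast
  define I where "I = enn2real (\<integral>\<^sup>+(x::real ^ 'n). ennreal (1 / bracket x ^ ?N) \<partial>lborel)"
  have I: "(\<integral>\<^sup>+(x::real ^ 'n). ennreal (1 / bracket x ^ ?N) \<partial>lborel) = ennreal I" "0 \<le> I"
    using nn_integral_bracket[where 'n='n, of ?N] by (simp_all add: I_def less_top)
  have "l2 (pdo (b j) f) \<le> (?c * K * I) * l2 f" if f: "f \<in> schwartz" for j f
  proof -
    have bs: "amplitude (b j)" by (rule loc_sym_amplitude[OF b])
    have [measurable]: "f \<in> borel_measurable borel" by (rule schwartz_measurable[OF f])
    let ?\<Phi> = "\<lambda>z::real ^ 'n. ?c * K * (r j ^ ?n * (1 / bracket (r j *\<^sub>R z) ^ ?N))"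
    have br: "bracket (r j *\<^sub>R z) = 1 + r j * norm z" for z :: "real ^ 'n" by (simp add: bracket_def)
    have pt: "ennreal (norm (pdo (b j) f x)) \<le> (\<integral>\<^sup>+y. ennreal (?\<Phi> (x - y)) * ennreal (norm (f y)) \<partial>lborel)" for x
    proof -
      have k: "norm (ker (b j) x z) \<le> K * (r j ^ ?n * (1 / bracket (r j *\<^sub>R z) ^ ?N))" for z
        unfolding br using K(2)[of j z x] by (simp add: pos_le_divide_eq add_pos_nonneg mult.commute)
      have km: "(\<lambda>y. ker (b j) x (x - y)) \<in> schwartz"
        unfolding ker_def using schwartz_scaled[OF osc_schwartz[OF amplitude_snd[OF amplitude_slice_schwartz[OF bs]]], of "-1" x] by simp
      have int: "integrable lborel (\<lambda>y. ker (b j) x (x - y) * f y)"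
        by (intro schwartz_integrable schwartz_mult km f)
      have "ennreal (norm (pdo (b j) f x)) = ennreal ?c * ennreal (norm (\<integral>y. ker (b j) x (x - y) * f y \<partial>lborel))"
        unfolding pdo_ker[OF bs f] by (simp add: norm_mult norm_divide norm_power ennreal_mult[symmetric])
      also have "\<dots> \<le> ennreal ?c * (\<integral>\<^sup>+y. ennreal (norm (ker (b j) x (x - y) * f y)) \<partial>lborel)"
        by (intro mult_left_mono integral_norm_bound_ennreal int) auto
      also have "\<dots> \<le> ennreal ?c * (\<integral>\<^sup>+y. ennreal (K * (r j ^ ?n * (1 / bracket (r j *\<^sub>R (x - y)) ^ ?N)) * norm (f y)) \<partial>lborel)"
        unfolding norm_mult by (intro mult_left_mono nn_integral_mono ennreal_leI mult_right_mono k) auto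
      also have "\<dots> = (\<integral>\<^sup>+y. ennreal ?c * ennreal (K * (r j ^ ?n * (1 / bracket (r j *\<^sub>R (x - y)) ^ ?N)) * norm (f y)) \<partial>lborel)"
        by (rule nn_integral_cmult[symmetric]) measurable
      also have "\<dots> = (\<integral>\<^sup>+y. ennreal (?\<Phi> (x - y)) * ennreal (norm (f y)) \<partial>lborel)"
        using K(1) by (intro nn_integral_cong) (simp add: ennreal_mult[symmetric] mult_ac)
      finally show ?thesis .
    qed
    have \<Phi>: "(\<integral>\<^sup>+z. ennreal (?\<Phi> z) \<partial>lborel) = ennreal (?c * K * I)"
    proof -
      have "(\<integral>\<^sup>+z. ennreal (?\<Phi> z) \<partial>lborel) = (\<integral>\<^sup>+z. ennreal (?c * K) * (ennreal (\<bar>r j\<bar> ^ DIM(real ^ 'n)) * ennreal (1 / bracket (0 + r j *\<^sub>R (z :: real ^ 'n)) ^ ?N)) \<partial>lborel)"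
        using K(1) by (intro nn_integral_cong) (simp add: ennreal_mult[symmetric])
      also have "\<dots> = ennreal (?c * K) * (ennreal (\<bar>r j\<bar> ^ DIM(real ^ 'n)) * (\<integral>\<^sup>+z. ennreal (1 / bracket (0 + r j *\<^sub>R (z :: real ^ 'n)) ^ ?N) \<partial>lborel))"
        by (subst nn_integral_cmult, measurable, subst nn_integral_cmult, measurable)
      also have "\<dots> = ennreal (?c * K) * ennreal I"
        by (subst nn_integral_lborel_affine[symmetric]) (auto simp: I)
      finally show ?thesis using K(1) I(2) by (simp add: ennreal_mult[symmetric])
    qed
    have "ennreal ((l2 (pdo (b j) f))\<^sup>2) = (\<integral>\<^sup>+x. (ennreal (norm (pdo (b j) f x)))\<^sup>2 \<partial>lborel)"
      using nn_l2[OF pdo_schwartz[OF bs f]] by (simp add: ennreal_power)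
    also have "\<dots> \<le> (\<integral>\<^sup>+x. (\<integral>\<^sup>+y. ennreal (?\<Phi> (x - y)) * ennreal (norm (f y)) \<partial>lborel)\<^sup>2 \<partial>lborel)"
      by (intro nn_integral_mono power_mono pt) auto
    also have "\<dots> \<le> (\<integral>\<^sup>+x. ennreal (?\<Phi> x) \<partial>lborel)\<^sup>2 * (\<integral>\<^sup>+x. (ennreal (norm (f x)))\<^sup>2 \<partial>lborel)"
      by (rule young_L2) (use K(1) in auto)
    also have "\<dots> = ennreal ((?c * K * I * l2 f)\<^sup>2)"
      unfolding \<Phi> using nn_l2[OF f] K(1) I(2) by (simp add: ennreal_power ennreal_mult[symmetric] power_mult_distrib power_divide)
    finally have "(l2 (pdo (b j) f))\<^sup>2 \<le> (?c * K * I * l2 f)\<^sup>2" by simp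
    then show ?thesis by (rule power2_le_imp_le) (use K(1) I(2) in auto)
  qed
  then show ?thesis using K(1) I(2) by (intro exI[of _ "?c * K * I"]) auto
qed

text \<open>Each operator \<open>Tv v\<close> multiplies the Fourier transform of the output by
  \<open>\<i> (\<xi> - c\<^sub>j) \<bullet> v / r\<^sub>j\<close>, where \<open>c\<^sub>j\<close> and \<open>r\<^sub>j\<close> are the centre and the radius of the \<open>j\<close>-th ball,
  and keeps the symbols adapted. Iterating it shows that the output is concentrated near that ball.\<close>

definition Tv :: "real ^ 'n \<Rightarrow> (int ^ 'n \<Rightarrow> (real ^ 'n) \<times> (real ^ 'n) \<Rightarrow> complex) \<Rightarrow> int ^ 'n \<Rightarrow> (real ^ 'n) \<times> (real ^ 'n) \<Rightarrow> complex" where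
  "Tv v b j z = \<i> * (complex_of_real ((snd z - ctr a (int_vec j)) \<bullet> v / r j) * b j z) + complex_of_real (1 / r j) * dir_deriv (v, 0) (b j) z"

lemma loc_sym_Tv:
  assumes "loc_sym b" "v \<in> Basis"
  shows "loc_sym (Tv v b)"
proof -
  have "loc_sym (\<lambda>j z. \<i> * (complex_of_real ((snd z - ctr a (int_vec j)) \<bullet> v / r j) * b j z))"
    using Fam_cmult1[OF loc_sym_inner[OF assms, unfolded loc_sym_def], of \<i>] unfolding loc_sym_def by (auto simp: xw_nonneg)
  from Fam_add[OF this[unfolded loc_sym_def] loc_sym_deriv_fst[OF assms, unfolded loc_sym_def]]
  show ?thesis unfolding loc_sym_def Tv_def[abs_def] .
qed

text \<open>By the product rule for exp(i x . \<xi>) b(x, \<xi>), the symbol \<open>Tv v b j\<close>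
  belongs to the operator followed by (d_v - i c_j . v) / r_j, with d_v the derivative along v. On
  the Fourier side this is a multiplication.\<close>

lemma fourier_pdo_Tv:
  assumes b: "loc_sym b" and v: "v \<in> Basis" and f: "f \<in> schwartz"
  shows "fourier (pdo (Tv v b j) f) \<xi> = \<i> * complex_of_real ((\<xi> - ctr a (int_vec j)) \<bullet> v / r j) * fourier (pdo (b j) f) \<xi>"
proof -
  let ?c = "complex_of_real (1 / (2 * pi) ^ CARD('n))"
  let ?u = "pdo (b j) f" and ?g = "complex_of_real (1 / r j)" and ?t = "\<i> * complex_of_real (ctr a (int_vec j) \<bullet> v)"
  let ?B = "\<lambda>z. b j z * fourier f (snd z)"
  have bs: "amplitude (b j)" by (rule loc_sym_amplitude[OF b])
  have us: "?u \<in> schwartz" by (rule pdo_schwartz[OF bs f])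
  have Bs: "amplitude ?B" by (rule amplitude_fourier[OF bs f])
  have V: "(v, 0) \<in> Basis" using v by (auto simp: Basis_prod_def)
  let ?A = "\<lambda>z. \<i> * (complex_of_real (snd z \<bullet> v) * ?B z) + dir_deriv (v, 0) ?B z"
  have As: "amplitude ?A"
    using amplitude_inner[OF Bs, of v 0] by (intro amplitude_add amplitude_cmult amplitude_dir_deriv[OF Bs V]) auto
  have dB: "dir_deriv (v, 0) ?B z = dir_deriv (v, 0) (b j) z * fourier f (snd z)" for z
  proof -
    have "dir_deriv (v, 0) (\<lambda>z::(real ^ 'n) \<times> (real ^ 'n). fourier f (snd z)) = (\<lambda>z. 0)"
      unfolding dir_deriv_snd[OF schwartz_smooth[OF fourier_schwartz[OF f]]]
        dir_deriv_zero[OF schwartz_smooth[OF fourier_schwartz[OF f]]] ..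
    then show ?thesis
      by (subst dir_deriv_mult[OF amplitude_smooth[OF bs] smooth_snd[OF schwartz_smooth[OF fourier_schwartz[OF f]]]]) simp
  qed
  have "pdo (Tv v b j) f x = ?g * dir_deriv v ?u x + (- (?g * ?t)) * ?u x" for x
  proof -
    have du: "dir_deriv v ?u = (\<lambda>x. ?c * osc ?A x)"
      unfolding pdo_osc[abs_def] by (subst dir_deriv_cmult[OF schwartz_smooth[OF osc_schwartz[OF Bs]]]) (simp add: osc_dir_deriv[OF Bs])
    have pw: "Tv v b j z * fourier f (snd z) = ?g * ?A z + (- (?g * ?t)) * ?B z" for z
      unfolding Tv_def dB by (simp add: inner_diff_left algebra_simps diff_divide_distrib)
    have "osc (\<lambda>z. Tv v b j z * fourier f (snd z)) x = osc (\<lambda>z. ?g * ?A z + (- (?g * ?t)) * ?B z) x"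
      by (simp only: pw)
    also have "\<dots> = osc (\<lambda>z. ?g * ?A z) x + osc (\<lambda>z. (- (?g * ?t)) * ?B z) x"
      unfolding osc_def distrib_left[of "exp _"]
      by (rule Bochner_Integration.integral_add[OF osc_integrable[OF amplitude_cmult[OF As]] osc_integrable[OF amplitude_cmult[OF Bs]]])
    also have "\<dots> = ?g * osc ?A x + (- (?g * ?t)) * osc ?B x"
      unfolding osc_def mult.left_commute[of _ ?g] mult.left_commute[of _ "- (?g * ?t)"] integral_mult_right_zero ..
    finally have "osc (\<lambda>z. Tv v b j z * fourier f (snd z)) x = ?g * osc ?A x + (- (?g * ?t)) * osc ?B x" .
    then show ?thesis unfolding pdo_osc du by (simp only: distrib_left mult.left_commute[of ?c])
  qed
  then have "fourier (pdo (Tv v b j) f) \<xi> = fourier (\<lambda>x. ?g * dir_deriv v ?u x + (- (?g * ?t)) * ?u x) \<xi>"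
    by presburger
  also have "\<dots> = ?g * fourier (dir_deriv v ?u) \<xi> + (- (?g * ?t)) * fourier ?u \<xi>"
    unfolding fourier_add[OF schwartz_cmult[OF schwartz_dir_deriv[OF us v]] schwartz_cmult[OF us]] fourier_cmult ..
  finally show ?thesis unfolding fourier_dir_deriv[OF us v] by (simp add: inner_diff_left algebra_simps diff_divide_distrib)
qed

lemma fourier_pdo_Tv_pow:
  assumes b: "loc_sym b" and v: "v \<in> Basis" and f: "f \<in> schwartz"
  shows "loc_sym ((Tv v ^^ N) b) \<and>
    fourier (pdo ((Tv v ^^ N) b j) f) \<xi> = (\<i> * complex_of_real ((\<xi> - ctr a (int_vec j)) \<bullet> v / r j)) ^ N * fourier (pdo (b j) f) \<xi>"
proof (induction N)
  case 0
  then show ?case using b by simp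
next
  case (Suc N)
  then have l: "loc_sym ((Tv v ^^ N) b)" by blast
  show ?case using Suc fourier_pdo_Tv[OF l v f, of j \<xi>] loc_sym_Tv[OF l v] by (simp add: mult.assoc)
qed

end

subsection \<open>Convolution on \<open>\<ell>\<^sup>q\<close>\<close>

text \<open>Every term is replaced by the largest one. The index set will be the basis, so the power
  of its cardinality is a constant.\<close>

lemma sum_power_le:
  fixes t :: "'b \<Rightarrow> real"
  assumes I: "finite I" and ne: "I \<noteq> {}" and t: "\<And>i. i \<in> I \<Longrightarrow> 0 \<le> t i"
  shows "(\<Sum>i\<in>I. t i) ^ N \<le> real (card I) ^ N * (\<Sum>i\<in>I. t i ^ N)"
proof -
  obtain m where m: "m \<in> I" "\<And>i. i \<in> I \<Longrightarrow> t i \<le> t m"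
    using Max_in[of "t ` I"] Max_ge[of "t ` I"] I ne by (metis (no_types, lifting) finite_imageI image_iff image_is_empty)
  have "(\<Sum>i\<in>I. t i) \<le> real (card I) * t m"
    using sum_bounded_above[of I t "t m"] m by simp
  then have "(\<Sum>i\<in>I. t i) ^ N \<le> (real (card I) * t m) ^ N"
    by (intro power_mono sum_nonneg t)
  also have "\<dots> = real (card I) ^ N * t m ^ N" by (rule power_mult_distrib)
  also have "\<dots> \<le> real (card I) ^ N * (\<Sum>i\<in>I. t i ^ N)"
    by (intro mult_left_mono member_le_sum) (use I m t in auto)
  finally show ?thesis .
qed

text \<open>Convexity: the tangent to v^q at T lies below the curve. Young's inequality for products
  delivers it without a derivative.\<close>

lemma tangent_powr:
  fixes v T q :: real
  assumes "0 \<le> v" "0 \<le> T" "1 < q"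
  shows "q * T powr (q - 1) * v \<le> v powr q + (q - 1) * T powr q"
proof (cases "T = 0 \<or> v = 0")
  case True
  then show ?thesis using assms by auto
next
  case False
  let ?p = "q / (q - 1)"
  have "v * T powr (q - 1) \<le> v powr q / q + (T powr (q - 1)) powr ?p / ?p"
    using assms by (intro Youngs_inequality) (auto simp: field_simps)
  also have "(T powr (q - 1)) powr ?p = T powr q" using assms by (simp add: powr_powr)
  finally have "q * (v * T powr (q - 1)) \<le> q * (v powr q / q + T powr q / ?p)"
    using assms by (intro mult_left_mono) auto
  also have "\<dots> = v powr q + (q - 1) * T powr q" using assms by (simp add: field_simps)
  finally show ?thesis by (simp add: mult_ac)
qed

text \<open>The tangent inequality is summed against \<kappa>, and T is then chosen as the mean L /
  A, where it is sharpest. The total mass is only bounded by A, so \<kappa> need not be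
  normalised.\<close>

lemma jensen_powr:
  fixes \<kappa> v :: "'a \<Rightarrow> real"
  assumes q: "1 < q" and nn: "\<And>i. 0 \<le> \<kappa> i" "\<And>i. 0 \<le> v i" and A: "0 \<le> A"
    and sum: "(\<integral>\<^sup>+i. ennreal (\<kappa> i) \<partial>count_space UNIV) \<le> ennreal A"
  shows "ennreal_powr (\<integral>\<^sup>+i. ennreal (\<kappa> i * v i) \<partial>count_space UNIV) q
    \<le> ennreal (A powr (q - 1)) * (\<integral>\<^sup>+i. ennreal (\<kappa> i * v i powr q) \<partial>count_space UNIV)"
proof -
  let ?M = "count_space (UNIV :: 'a set)"
  let ?L = "\<integral>\<^sup>+i. ennreal (\<kappa> i * v i) \<partial>?M" and ?R = "\<integral>\<^sup>+i. ennreal (\<kappa> i * v i powr q) \<partial>?M"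
  have key: "ennreal (q * T powr (q - 1)) * ?L \<le> ?R + ennreal ((q - 1) * T powr q * A)" if T: "0 \<le> T" for T
  proof -
    have "ennreal (q * T powr (q - 1)) * ?L = (\<integral>\<^sup>+i. ennreal (\<kappa> i * (q * T powr (q - 1) * v i)) \<partial>?M)"
      using q nn by (subst nn_integral_cmult[symmetric]) (auto simp: ennreal_mult[symmetric] mult_ac)
    also have "\<dots> \<le> (\<integral>\<^sup>+i. ennreal (\<kappa> i * v i powr q) + ennreal ((q - 1) * T powr q) * ennreal (\<kappa> i) \<partial>?M)"
    proof (intro nn_integral_mono)
      fix i
      have "\<kappa> i * (q * T powr (q - 1) * v i) \<le> \<kappa> i * (v i powr q + (q - 1) * T powr q)"
        by (intro mult_left_mono tangent_powr nn T q)
      then show "ennreal (\<kappa> i * (q * T powr (q - 1) * v i)) \<le> ennreal (\<kappa> i * v i powr q) + ennreal ((q - 1) * T powr q) * ennreal (\<kappa> i)"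
      proof -
        have "ennreal (\<kappa> i * v i powr q) + ennreal ((q - 1) * T powr q) * ennreal (\<kappa> i) = ennreal (\<kappa> i * v i powr q + (q - 1) * T powr q * \<kappa> i)"
          using q nn by (simp add: ennreal_mult[symmetric] ennreal_plus[symmetric] del: ennreal_plus)
        moreover have "\<kappa> i * (v i powr q + (q - 1) * T powr q) = \<kappa> i * v i powr q + (q - 1) * T powr q * \<kappa> i"
          by (simp add: algebra_simps)
        ultimately show ?thesis using \<open>\<kappa> i * _ \<le> _\<close> by (simp add: ennreal_leI)
      qed
    qed
    also have "\<dots> = ?R + ennreal ((q - 1) * T powr q) * (\<integral>\<^sup>+i. ennreal (\<kappa> i) \<partial>?M)"
      by (subst nn_integral_add) (auto simp: nn_integral_cmult)
    also have "\<dots> \<le> ?R + ennreal ((q - 1) * T powr q) * ennreal A"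
      by (intro add_left_mono mult_left_mono sum) auto
    finally show ?thesis using q A by (simp add: ennreal_mult[symmetric])
  qed
  show ?thesis
  proof (cases "A = 0")
    case True
    then have "(\<integral>\<^sup>+i. ennreal (\<kappa> i) \<partial>?M) = 0" using sum by simp
    then have "AE i in ?M. ennreal (\<kappa> i) = 0" by (subst (asm) nn_integral_0_iff_AE) auto
    then have "\<kappa> i = 0" for i using nn by (auto simp: AE_count_space antisym)
    then show ?thesis by (simp add: ennreal_powr_def)
  next
    case False
    then have Apos: "0 < A" using A by simp
    show ?thesis
    proof (cases "?R = \<infinity>")
      case True
      then show ?thesis using Apos by (simp add: ennreal_mult_top)
    next
      case False
      then obtain R where R: "?R = ennreal R" "0 \<le> R" by (cases ?R) auto
      \<comment> \<open>The choice T = 1 first shows that the left side is finite; only then can the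
        mean be formed.\<close>
      have "ennreal q * ?L < \<infinity>" using key[of 1] R q by (simp add: order_le_less_trans ennreal_plus[symmetric] del: ennreal_plus)
      then have "?L \<noteq> \<infinity>" using q by (auto simp: ennreal_mult_less_top)
      then obtain L where L: "?L = ennreal L" "0 \<le> L" by (cases ?L) auto
      define T where "T = L / A"
      have T: "0 \<le> T" "L = T * A" using L Apos by (auto simp: T_def)
      have "ennreal (q * T powr (q - 1) * L) \<le> ennreal (R + (q - 1) * T powr q * A)"
        using key[OF T(1)] L R q A by (simp add: ennreal_mult[symmetric] ennreal_plus[symmetric] del: ennreal_plus)
      then have "q * T powr (q - 1) * L \<le> R + (q - 1) * T powr q * A"
        using R q A by (subst (asm) ennreal_le_iff) auto
      moreover have "T powr (q - 1) * L = T powr q * A"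
        using T by (cases "T = 0") (auto simp: powr_diff)
      ultimately have "q * (T powr q * A) \<le> R + (q - 1) * T powr q * A" by (simp only: mult.assoc)
      then have "T powr q * A \<le> R" by (simp add: algebra_simps)
      then have "A powr (q - 1) * (T powr q * A) \<le> A powr (q - 1) * R" by (intro mult_left_mono) auto
      moreover have "A powr (q - 1) * (T powr q * A) = L powr q"
        using Apos T by (simp add: powr_diff powr_mult)
      ultimately have "ennreal (L powr q) \<le> ennreal (A powr (q - 1) * R)" by (intro ennreal_leI) simp
      then show ?thesis unfolding L(1) R(1) using L(2) R(2) by (simp add: ennreal_powr_ennreal ennreal_mult[symmetric])
    qed
  qed
qed

text \<open>The sequence u is extended-valued and merely dominated by the convolution, since the
  pieces of the output are not known to be finite beforehand.\<close>

lemma young_lq: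
  fixes \<kappa> v :: "int ^ 'n::finite \<Rightarrow> real"
  assumes q: "1 < q" and nn: "\<And>i. 0 \<le> \<kappa> i" "\<And>i. 0 \<le> v i" and A: "0 \<le> A"
    and sum: "(\<integral>\<^sup>+i. ennreal (\<kappa> i) \<partial>count_space UNIV) \<le> ennreal A"
    and u: "\<And>k. u k \<le> (\<integral>\<^sup>+i. ennreal (\<kappa> (k - i) * v i) \<partial>count_space UNIV)"
  shows "(\<integral>\<^sup>+k. ennreal_powr (u k) q \<partial>count_space UNIV) \<le> ennreal (A powr q) * (\<integral>\<^sup>+i. ennreal (v i powr q) \<partial>count_space UNIV)"
proof -
  let ?M = "count_space (UNIV :: (int ^ 'n) set)"
  have reindex: "(\<integral>\<^sup>+i. ennreal (\<kappa> (k - i)) \<partial>?M) \<le> ennreal A" "(\<integral>\<^sup>+i. ennreal (\<kappa> (i - k)) \<partial>?M) \<le> ennreal A" for k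
  proof -
    have "bij_betw (\<lambda>i. k - i) UNIV UNIV" by (rule bij_betw_byWitness[where f'="\<lambda>i. k - i"]) auto
    from nn_integral_bij_count_space[OF this, of "\<lambda>i. ennreal (\<kappa> i)"] sum
    show "(\<integral>\<^sup>+i. ennreal (\<kappa> (k - i)) \<partial>?M) \<le> ennreal A" by simp
    have "bij_betw (\<lambda>i. i - k) UNIV UNIV" by (rule bij_betw_byWitness[where f'="\<lambda>i. i + k"]) auto
    from nn_integral_bij_count_space[OF this, of "\<lambda>i. ennreal (\<kappa> i)"] sum
    show "(\<integral>\<^sup>+i. ennreal (\<kappa> (i - k)) \<partial>?M) \<le> ennreal A" by simp
  qed
  have "(\<integral>\<^sup>+k. ennreal_powr (u k) q \<partial>?M) \<le> (\<integral>\<^sup>+k. ennreal (A powr (q - 1)) * (\<integral>\<^sup>+i. ennreal (\<kappa> (k - i) * v i powr q) \<partial>?M) \<partial>?M)"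
  proof (intro nn_integral_mono)
    fix k
    have "ennreal_powr (u k) q \<le> ennreal_powr (\<integral>\<^sup>+i. ennreal (\<kappa> (k - i) * v i) \<partial>?M) q"
      using q by (intro ennreal_powr_mono u) auto
    also have "\<dots> \<le> ennreal (A powr (q - 1)) * (\<integral>\<^sup>+i. ennreal (\<kappa> (k - i) * v i powr q) \<partial>?M)"
      by (rule jensen_powr[OF q]) (use nn A reindex in auto)
    finally show "ennreal_powr (u k) q \<le> ennreal (A powr (q - 1)) * (\<integral>\<^sup>+i. ennreal (\<kappa> (k - i) * v i powr q) \<partial>?M)" .
  qed
  also have "\<dots> = ennreal (A powr (q - 1)) * (\<integral>\<^sup>+k. \<integral>\<^sup>+i. ennreal (\<kappa> (k - i) * v i powr q) \<partial>?M \<partial>?M)"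
    by (rule nn_integral_cmult) simp
  also have "(\<integral>\<^sup>+k. \<integral>\<^sup>+i. ennreal (\<kappa> (k - i) * v i powr q) \<partial>?M \<partial>?M) = (\<integral>\<^sup>+i. \<integral>\<^sup>+k. ennreal (\<kappa> (k - i) * v i powr q) \<partial>?M \<partial>?M)"
    by (rule nn_integral_count_space_nn_integral) auto
  also have "\<dots> = (\<integral>\<^sup>+i. ennreal (v i powr q) * (\<integral>\<^sup>+k. ennreal (\<kappa> (k - i)) \<partial>?M) \<partial>?M)"
    by (intro nn_integral_cong) (subst nn_integral_cmult[symmetric], auto simp: ennreal_mult[symmetric] nn mult.commute)
  also have "\<dots> \<le> (\<integral>\<^sup>+i. ennreal (v i powr q) * ennreal A \<partial>?M)"
    by (intro nn_integral_mono mult_left_mono reindex) auto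
  also have "\<dots> = (\<integral>\<^sup>+i. ennreal (v i powr q) \<partial>?M) * ennreal A"
    by (rule nn_integral_multc) simp
  finally have "(\<integral>\<^sup>+k. ennreal_powr (u k) q \<partial>?M) \<le> ennreal (A powr (q - 1)) * ((\<integral>\<^sup>+i. ennreal (v i powr q) \<partial>?M) * ennreal A)"
    by (simp add: mult_left_mono)
  also have "\<dots> = ennreal (A powr q) * (\<integral>\<^sup>+i. ennreal (v i powr q) \<partial>?M)"
    using A by (cases "A = 0") (auto simp: powr_diff ennreal_mult[symmetric] mult.left_commute mult.commute[of _ "ennreal A"] mult.assoc[symmetric])
  finally show ?thesis .
qed

context alpha_setting
begin

subsection \<open>Almost orthogonality\<close>

text \<open>For distant indices the vector (\<xi> - c_j) / r_j is at least of the size |k - j| on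
  the support of \<eta>_k, up to a constant. Hence the N-th powers of its coordinates, which
  \<open>Tv\<close> realises as adapted symbols, dominate the N-th power of the bracket. For the
  remaining indices the uniform L^2 bound is enough.\<close>

lemma near_orth:
  assumes b: "loc_sym b"
  shows "\<exists>K\<ge>0. \<forall>k j. \<forall>f\<in>schwartz.
    l2 (\<lambda>\<xi>. \<eta> k \<xi> * fourier (pdo (b j) f) \<xi>) * bracket (int_vec (k - j)) ^ N \<le> K * l2 f"
proof -
  let ?B = "Basis :: (real ^ 'n) set"
  let ?p = "sqrt ((2 * pi) ^ CARD('n))"
  obtain E where E: "0 \<le> E" "\<And>k \<xi>. norm (\<eta> k \<xi>) \<le> E" by (rule eta_bounded) (rule that)
  obtain L0 where L0: "0 \<le> L0" "\<And>j f. f \<in> schwartz \<Longrightarrow> l2 (pdo (b j) f) \<le> L0 * l2 f"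
    using loc_sym_l2[OF b] by blast
  have "\<forall>v\<in>?B. \<exists>K\<ge>0. \<forall>j. \<forall>f\<in>schwartz. l2 (pdo ((Tv v ^^ N) b j) f) \<le> K * l2 f"
    using loc_sym_l2 fourier_pdo_Tv_pow[OF b _ schwartz_zero] by blast
  then obtain L where L: "\<And>v. v \<in> ?B \<Longrightarrow> 0 \<le> L v" "\<And>v j f. v \<in> ?B \<Longrightarrow> f \<in> schwartz \<Longrightarrow> l2 (pdo ((Tv v ^^ N) b j) f) \<le> L v * l2 f"
    by metis
  define R where "R = 2 * C / sepc a"
  have R: "0 < R" using C1 by (simp add: R_def)
  \<comment> \<open>For R \<le> |k - j| the factor 1 / R + 1 turns |k - j| into a bound for 1 + |k -
    j|, and 2 / \<open>sepc a\<close> is the constant of \<open>inball_far\<close>.\<close>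
  define Q where "Q = (1 / R + 1) * (2 / sepc a)"
  have Q: "0 \<le> Q" unfolding Q_def using R
    by (intro mult_nonneg_nonneg add_nonneg_nonneg divide_nonneg_nonneg) (auto simp: less_imp_le)
  define K1 where "K1 = E * (Q ^ N * real (card ?B) ^ N)"
  have K1: "0 \<le> K1" using E Q by (simp add: K1_def)
  define K where "K = (1 + R) ^ N * (E * (?p * L0)) + K1 * (\<Sum>v\<in>?B. ?p * L v)"
  have K: "0 \<le> K" unfolding K_def using R E L0 K1 L(1) by (intro add_nonneg_nonneg mult_nonneg_nonneg sum_nonneg) auto
  have "l2 (\<lambda>\<xi>. \<eta> k \<xi> * fourier (pdo (b j) f) \<xi>) * bracket (int_vec (k - j)) ^ N \<le> K * l2 f"
    if f: "f \<in> schwartz" for k j f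
  proof -
    let ?u = "pdo (b j) f" and ?d = "norm (int_vec k - int_vec j)"
    have us: "?u \<in> schwartz" by (intro pdo_schwartz loc_sym_amplitude b f)
    have hs: "(\<lambda>\<xi>. \<eta> k \<xi> * fourier ?u \<xi>) \<in> schwartz" by (intro schwartz_mult eta_schwartz fourier_schwartz us)
    have br: "bracket (int_vec (k - j)) = 1 + ?d" by (simp add: bracket_def int_vec_diff)
    show ?thesis
    proof (cases "R \<le> ?d")
      case False
      have "l2 (\<lambda>\<xi>. \<eta> k \<xi> * fourier ?u \<xi>) \<le> E * l2 (fourier ?u)"
        using E by (intro l2_mono_cmult hs fourier_schwartz us) (auto simp: norm_mult intro: mult_right_mono)
      also have "\<dots> \<le> E * (?p * (L0 * l2 f))"
        unfolding plancherel_l2[OF us] using E L0(2)[OF f] by (intro mult_left_mono) auto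
      finally have "l2 (\<lambda>\<xi>. \<eta> k \<xi> * fourier ?u \<xi>) \<le> E * (?p * L0) * l2 f" by (simp add: mult_ac)
      moreover have "bracket (int_vec (k - j)) ^ N \<le> (1 + R) ^ N"
        unfolding br using False by (intro power_mono) auto
      ultimately have "l2 (\<lambda>\<xi>. \<eta> k \<xi> * fourier ?u \<xi>) * bracket (int_vec (k - j)) ^ N \<le> (E * (?p * L0) * l2 f) * (1 + R) ^ N"
        using E L0 by (intro mult_mono) auto
      also have "\<dots> \<le> K * l2 f"
        unfolding K_def distrib_right using K1 L(1)
        by (simp add: mult_ac) (intro mult_nonneg_nonneg sum_nonneg, auto)
      finally show ?thesis .
    next
      case True
      let ?t = "\<lambda>v \<xi>. \<bar>(\<xi> - ctr a (int_vec j)) \<bullet> v / r j\<bar>"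
      let ?g = "\<lambda>v \<xi>. fourier (pdo ((Tv v ^^ N) b j) f) \<xi>"
      have gs: "?g v \<in> schwartz" if "v \<in> ?B" for v
        using fourier_pdo_Tv_pow[OF b that f, of N] by (intro fourier_schwartz pdo_schwartz loc_sym_amplitude f) auto
      have gn: "norm (?g v \<xi>) = ?t v \<xi> ^ N * norm (fourier ?u \<xi>)" if "v \<in> ?B" for v \<xi>
        using fourier_pdo_Tv_pow[OF b that f, of N j \<xi>] by (simp add: norm_mult norm_power norm_divide)
      let ?K1 = "complex_of_real K1"
      have pt: "norm (complex_of_real (bracket (int_vec (k - j)) ^ N) * (\<eta> k \<xi> * fourier ?u \<xi>)) \<le> (\<Sum>v\<in>?B. norm (?K1 * ?g v \<xi>))" for \<xi>
      proof (cases "\<eta> k \<xi> = 0")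
        case True
        then show ?thesis by (simp add: sum_nonneg)
      next
        case False
        then have "ball_at k \<xi>" by (rule eta_support)
        from inball_far[OF a0 C0 this, of "int_vec j"] \<open>R \<le> ?d\<close>
        have "sepc a / 2 * r j * ?d \<le> norm (\<xi> - ctr a (int_vec j))" by (simp add: R_def)
        also have "\<dots> \<le> (\<Sum>v\<in>?B. \<bar>(\<xi> - ctr a (int_vec j)) \<bullet> v\<bar>)" by (rule norm_le_l1)
        also have "\<dots> = r j * (\<Sum>v\<in>?B. ?t v \<xi>)"
          by (simp add: sum_distrib_left abs_divide)
        finally have "r j * (sepc a / 2 * ?d) \<le> r j * (\<Sum>v\<in>?B. ?t v \<xi>)" by (simp add: mult_ac)
        then have 1: "?d \<le> 2 / sepc a * (\<Sum>v\<in>?B. ?t v \<xi>)" by (simp add: field_simps)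
        have "bracket (int_vec (k - j)) \<le> (1 / R + 1) * ?d"
          unfolding br using \<open>R \<le> ?d\<close> R by (simp add: field_simps)
        also have "\<dots> \<le> (1 / R + 1) * (2 / sepc a * (\<Sum>v\<in>?B. ?t v \<xi>))"
          using R by (intro mult_left_mono 1) auto
        finally have "bracket (int_vec (k - j)) \<le> Q * (\<Sum>v\<in>?B. ?t v \<xi>)" by (simp only: Q_def mult.assoc)
        then have "bracket (int_vec (k - j)) ^ N \<le> (Q * (\<Sum>v\<in>?B. ?t v \<xi>)) ^ N" by (intro power_mono) auto
        also have "\<dots> = Q ^ N * (\<Sum>v\<in>?B. ?t v \<xi>) ^ N" by (rule power_mult_distrib)
        also have "\<dots> \<le> Q ^ N * (real (card ?B) ^ N * (\<Sum>v\<in>?B. ?t v \<xi> ^ N))"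
          using Q by (intro mult_left_mono sum_power_le) auto
        finally have 2: "bracket (int_vec (k - j)) ^ N \<le> Q ^ N * (real (card ?B) ^ N * (\<Sum>v\<in>?B. ?t v \<xi> ^ N))" .
        have "norm (complex_of_real (bracket (int_vec (k - j)) ^ N) * (\<eta> k \<xi> * fourier ?u \<xi>))
            = bracket (int_vec (k - j)) ^ N * (norm (\<eta> k \<xi>) * norm (fourier ?u \<xi>))"
          by (simp add: norm_mult norm_power)
        also have "\<dots> \<le> (Q ^ N * (real (card ?B) ^ N * (\<Sum>v\<in>?B. ?t v \<xi> ^ N))) * (E * norm (fourier ?u \<xi>))"
        proof (rule mult_mono[OF 2])
          show "norm (\<eta> k \<xi>) * norm (fourier ?u \<xi>) \<le> E * norm (fourier ?u \<xi>)"
            by (intro mult_right_mono E) auto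
          show "0 \<le> Q ^ N * (real (card ?B) ^ N * (\<Sum>v\<in>?B. ?t v \<xi> ^ N))"
            by (intro mult_nonneg_nonneg sum_nonneg zero_le_power Q) auto
        qed auto
        also have "\<dots> = (\<Sum>v\<in>?B. K1 * (?t v \<xi> ^ N * norm (fourier ?u \<xi>)))"
          by (simp add: K1_def sum_distrib_left sum_distrib_right mult_ac)
        also have "\<dots> = (\<Sum>v\<in>?B. norm (?K1 * ?g v \<xi>))"
          unfolding norm_mult using K1 by (intro sum.cong refl) (simp add: gn)
        finally show ?thesis .
      qed
      have "l2 (\<lambda>\<xi>. \<eta> k \<xi> * fourier ?u \<xi>) * bracket (int_vec (k - j)) ^ N = l2 (\<lambda>\<xi>. complex_of_real (bracket (int_vec (k - j)) ^ N) * (\<eta> k \<xi> * fourier ?u \<xi>))"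
        unfolding l2_cmult by (simp add: norm_power)
      also have "\<dots> \<le> (\<Sum>v\<in>?B. l2 (\<lambda>\<xi>. ?K1 * ?g v \<xi>))"
        by (rule l2_dominated_sum[OF _ schwartz_cmult[OF hs] schwartz_cmult[OF gs] pt]) auto
      also have "\<dots> \<le> (\<Sum>v\<in>?B. K1 * (?p * (L v * l2 f)))"
      proof (intro sum_mono)
        fix v assume v: "v \<in> ?B"
        have s: "pdo ((Tv v ^^ N) b j) f \<in> schwartz"
          using fourier_pdo_Tv_pow[OF b v f, of N] by (intro pdo_schwartz loc_sym_amplitude f) auto
        show "l2 (\<lambda>\<xi>. ?K1 * ?g v \<xi>) \<le> K1 * (?p * (L v * l2 f))"
          unfolding l2_cmult plancherel_l2[OF s] using K1 L(2)[OF v f] by (simp add: mult_left_mono)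
      qed
      also have "\<dots> = K1 * (\<Sum>v\<in>?B. ?p * L v) * l2 f" by (simp add: sum_distrib_left sum_distrib_right mult_ac)
      also have "\<dots> \<le> K * l2 f"
        unfolding K_def using R E L0 by (intro mult_right_mono) auto
      finally show ?thesis .
    qed
  qed
  then show ?thesis using K by blast
qed

text \<open>Here \<delta> \<le> \<alpha> \<le> \<rho> enters. It replaces both exponents of the
  symbol class by \<alpha>, and on the j-th ball the power \<alpha> of the bracket of \<xi> is
  comparable to r_j, by \<open>inball_comparable\<close> with (1 + a) \<alpha> = a.\<close>

lemma symbol_loc_sym:
  assumes \<sigma>: "\<sigma> \<in> symbol_class 0 \<rho> \<delta>" and le: "\<delta> \<le> \<alpha>" "\<alpha> \<le> \<rho>"
  shows "loc_sym (\<lambda>j z. \<sigma> z * \<eta> j (snd z))"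
proof -
  let ?m = "xw (\<lambda>(_::int ^ 'n) z. bracket (snd z) powr \<alpha>) (\<lambda>_ z. bracket (snd z) powr (- \<alpha>))"
  have mn: "0 \<le> ?m b j z" for b j z by (simp add: xw_def)
  have al: "(1 + a) * \<alpha> = a" unfolding one_plus_a by (simp add: a_def)
  have F1: "Fam (\<lambda>_ _. 1) ?m (\<lambda>_. \<sigma>)"
  proof (rule Fam_mono[OF Fam_reindex[OF \<sigma>[unfolded symbol_class_Fam], of "\<lambda>_. ()"], where K=1])
    show "xw (\<lambda>_ z. bracket (snd z) powr \<delta>) (\<lambda>_ z. bracket (snd z) powr (- \<rho>)) b () z \<le> 1 * ?m b j z" for b j z
      using le bracket_ge1[of "snd z"] by (auto simp: xw_def intro!: powr_mono)
  qed (auto simp: xw_def)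
  obtain K where K: "1 \<le> K" "\<And>(x :: real ^ 'n) \<xi>. inball a C x \<xi> \<Longrightarrow> bracket \<xi> powr \<alpha> \<le> K * bracket x powr ((1 + a) * \<alpha>)"
    using inball_comparable[OF a0 C1', of \<alpha>, where 'n='n] by metis
  obtain K' where K': "1 \<le> K'" "\<And>(x :: real ^ 'n) \<xi>. inball a C x \<xi> \<Longrightarrow> bracket \<xi> powr (- \<alpha>) \<le> K' * bracket x powr ((1 + a) * - \<alpha>)"
     "\<And>(x :: real ^ 'n) \<xi>. inball a C x \<xi> \<Longrightarrow> bracket x powr ((1 + a) * - \<alpha>) \<le> K' * bracket \<xi> powr (- \<alpha>)"
    using inball_comparable[OF a0 C1', of "- \<alpha>", where 'n='n] by metis
  have e: "bracket (int_vec j) powr ((1 + a) * \<alpha>) = r j" "bracket (int_vec j) powr ((1 + a) * - \<alpha>) = 1 / r j" for j :: "int ^ 'n"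
    using al by (simp_all add: rad_def powr_minus_divide)
  have "Fam (\<lambda>k \<xi>. of_bool (ball_at k \<xi>)) (\<lambda>_ k \<xi>. bracket \<xi> powr (- \<alpha>)) \<eta>"
  proof (rule Fam_mono[OF eta_Fam, where K=K'])
    fix k and \<xi> :: "real ^ 'n" assume "of_bool (ball_at k \<xi>) \<noteq> (0::real)"
    then have "ball_at k \<xi>" by (simp add: of_bool_def split: if_splits)
    from K'(3)[OF this] show "1 / r k \<le> K' * bracket \<xi> powr (- \<alpha>)" unfolding e .
  qed (use K' in \<open>auto simp: of_bool_def\<close>)
  then have F2: "Fam (\<lambda>k z. of_bool (ball_at k (snd z))) ?m (\<lambda>k z. \<eta> k (snd z))"
    by (rule Fam_snd) auto
  have F3: "Fam (\<lambda>j z. 1 * of_bool (ball_at j (snd z))) ?m (\<lambda>j z. \<sigma> z * \<eta> j (snd z))"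
    by (rule Fam_mult[OF F1 F2]) (auto simp: mn)
  show ?thesis unfolding loc_sym_def
  proof (rule Fam_mono[OF F3, where K="max K K'"])
    fix b j and z :: "(real ^ 'n) \<times> (real ^ 'n)"
    assume "1 * of_bool (ball_at j (snd z)) \<noteq> (0::real)"
    then have B: "ball_at j (snd z)" by (simp add: of_bool_def split: if_splits)
    have "bracket (snd z) powr \<alpha> \<le> max K K' * r j"
      using K(2)[OF B] unfolding e by (rule order_trans) (intro mult_right_mono, auto)
    moreover have "bracket (snd z) powr (- \<alpha>) \<le> max K K' * (1 / r j)"
      using K'(2)[OF B] unfolding e by (rule order_trans) (intro mult_right_mono, auto)
    ultimately show "?m b j z \<le> max K K' * xw (\<lambda>j _. r j) (\<lambda>j _. 1 / r j) b j z"
      by (simp add: xw_def)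
  qed (use K in \<open>auto simp: xw_nonneg mn of_bool_def\<close>)
qed

subsection \<open>Frequency pieces\<close>

text \<open>Bounded overlap limits the number of nonzero terms at a point. This supplies the
  dominating function for the passage to the limit.\<close>

lemma eta_partial_bounded:
  obtains B where "0 \<le> B" "\<And>J \<xi>. finite J \<Longrightarrow> norm (\<Sum>i\<in>J. \<eta> i \<xi>) \<le> B"
proof -
  obtain E where E: "0 \<le> E" "\<And>k \<xi>. norm (\<eta> k \<xi>) \<le> E" by (rule eta_bounded) (rule that)
  let ?L = "lattice_ball K0 :: (int ^ 'n) set"
  have "norm (\<Sum>i\<in>J. \<eta> i \<xi>) \<le> real (card ?L) * E" if J: "finite J" for J \<xi>
  proof -
    let ?J = "{i \<in> J. \<eta> i \<xi> \<noteq> 0}"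
    have card: "card ?J \<le> card ?L"
    proof (cases "?J = {}")
      case False
      then obtain i0 where i0: "\<eta> i0 \<xi> \<noteq> 0" by auto
      have "?J \<subseteq> (+) i0 ` ?L"
      proof
        fix i assume "i \<in> ?J"
        then have "i - i0 \<in> ?L" using i0 by (intro ball_near eta_support) auto
        then show "i \<in> (+) i0 ` ?L" by (intro image_eqI[of _ _ "i - i0"]) auto
      qed
      then have "card ?J \<le> card ((+) i0 ` ?L)" by (intro card_mono) (simp_all add: finite_lattice_ball)
      also have "\<dots> = card ?L" by (rule card_image) simp
      finally show ?thesis .
    next
      case True
      then show ?thesis by (simp only: card.empty le0)
    qed
    have "norm (\<Sum>i\<in>J. \<eta> i \<xi>) = norm (\<Sum>i\<in>?J. \<eta> i \<xi>)"
      by (rule arg_cong[where f=norm], rule sum.mono_neutral_right[OF J]) auto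
    also have "\<dots> \<le> (\<Sum>i\<in>?J. E)" by (rule order_trans[OF norm_sum sum_mono]) (rule E)
    also have "\<dots> = real (card ?J) * E" by simp
    also have "\<dots> \<le> real (card ?L) * E" using card E by (intro mult_right_mono) auto
    finally show ?thesis .
  qed
  then show ?thesis using E by (intro that[of "real (card ?L) * E"]) auto
qed

definition piece :: "(real ^ 'n \<Rightarrow> complex) \<Rightarrow> int ^ 'n \<Rightarrow> real ^ 'n \<Rightarrow> complex" where
  "piece f i = inv_fourier (\<lambda>\<xi>. \<eta> i \<xi> * fourier f \<xi>)"

lemma piece_schwartz: "f \<in> schwartz \<Longrightarrow> piece f i \<in> schwartz"
  unfolding piece_def by (intro inv_fourier_schwartz schwartz_mult eta_schwartz fourier_schwartz)

lemma fourier_piece: "f \<in> schwartz \<Longrightarrow> fourier (piece f i) \<xi> = \<eta> i \<xi> * fourier f \<xi>"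
  unfolding piece_def by (rule fourier_inv_fourier) (intro schwartz_mult eta_schwartz fourier_schwartz)

lemma multiplier_piece: "f \<in> schwartz \<Longrightarrow> distr_Lp_norm 2 (multiplier (\<eta> i) (distr_of f)) = ennreal (l2 (piece f i))"
  unfolding distr_Lp_norm_multiplier[OF eta_schwartz] piece_def
  by (subst l2_inv_fourier) (auto intro!: schwartz_mult eta_schwartz fourier_schwartz)

lemma symbol_bounded:
  assumes "\<sigma> \<in> symbol_class 0 \<rho> \<delta>"
  obtains K where "0 \<le> K" "\<And>z :: (real ^ 'n) \<times> (real ^ 'n). norm (\<sigma> z) \<le> K"
proof -
  obtain K where K: "K \<ge> 0" "\<And>(j::unit) z. norm (\<sigma> z) \<le> K * bracket (snd z) powr 0"
    by (rule Fam_bound[OF assms[unfolded symbol_class_Fam]]) (rule that)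
  then show ?thesis by (intro that[of K]) auto
qed

text \<open>The partition sums to 1 along the net of finite sets, whereas dominated convergence and
  Fatou's lemma want a sequence; the lattice points in growing balls provide it.\<close>

definition lattice_exhaust :: "nat \<Rightarrow> (int ^ 'n) set" where
  "lattice_exhaust m = lattice_ball (real m)"

lemma eta_exhaust: "(\<lambda>m. \<Sum>i\<in>lattice_exhaust m. \<eta> i \<xi>) \<longlonglongrightarrow> 1"
proof -
  have "filterlim lattice_exhaust (finite_subsets_at_top UNIV) sequentially"
    unfolding filterlim_finite_subsets_at_top
  proof (intro allI impI)
    fix X :: "(int ^ 'n) set" assume X: "finite X \<and> X \<subseteq> UNIV"
    define M where "M = Max (insert 0 ((\<lambda>k. norm (int_vec k)) ` X))"
    have M: "norm (int_vec k) \<le> M" if "k \<in> X" for k using X that by (auto simp: M_def)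
    have "\<forall>\<^sub>F m in sequentially. M \<le> real m"
      using filterlim_real_sequentially by (auto simp: filterlim_at_top)
    then show "\<forall>\<^sub>F m in sequentially. finite (lattice_exhaust m) \<and> X \<subseteq> lattice_exhaust m \<and> lattice_exhaust m \<subseteq> UNIV"
    proof eventually_elim
      case (elim m)
      then show ?case using M by (auto simp: lattice_exhaust_def finite_lattice_ball) (force simp: lattice_ball_def intro: order_trans)
    qed
  qed
  moreover have "((\<lambda>k. \<eta> k \<xi>) has_sum 1) UNIV" using part by (simp add: alpha_partition_def)
  ultimately show ?thesis unfolding has_sum_def by (rule filterlim_compose[rotated])
qed

context
  fixes \<sigma> :: "(real ^ 'n) \<times> (real ^ 'n) \<Rightarrow> complex" and \<rho> \<delta> :: real
  assumes \<sigma>: "\<sigma> \<in> symbol_class 0 \<rho> \<delta>" and \<delta>\<alpha>: "\<delta> \<le> \<alpha>" and \<alpha>\<rho>: "\<alpha> \<le> \<rho>"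
begin

abbreviation bs :: "int ^ 'n \<Rightarrow> (real ^ 'n) \<times> (real ^ 'n) \<Rightarrow> complex" where
  "bs \<equiv> \<lambda>j z. \<sigma> z * \<eta> j (snd z)"

text \<open>The i-th piece of f is fed only to symbols localised near the i-th ball. By
  \<open>eta_local_sum\<close> these act on it like \<sigma>, so \<open>psum\<close> is
  \<sigma>(X,D) applied to a finite part of f, written through adapted symbols.\<close>

definition psum :: "(real ^ 'n \<Rightarrow> complex) \<Rightarrow> (int ^ 'n) set \<Rightarrow> real ^ 'n \<Rightarrow> complex" where
  "psum f J x = (\<Sum>i\<in>J. \<Sum>m\<in>lattice_ball K0. pdo (bs (i + m)) (piece f i) x)"

lemma bs_amplitude: "amplitude (bs j)"
  by (rule loc_sym_amplitude[OF symbol_loc_sym[OF \<sigma> \<delta>\<alpha> \<alpha>\<rho>]])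

lemma psum_schwartz: "f \<in> schwartz \<Longrightarrow> finite J \<Longrightarrow> psum f J \<in> schwartz"
  unfolding psum_def[abs_def]
  by (intro schwartz_sum pdo_schwartz bs_amplitude piece_schwartz finite_lattice_ball)

lemma psum_eq:
  assumes f: "f \<in> schwartz" and J: "finite J"
  shows "psum f J x = complex_of_real (1 / (2 * pi) ^ CARD('n)) *
    (\<integral>\<xi>. exp (\<i> * complex_of_real (x \<bullet> \<xi>)) * \<sigma> (x, \<xi>) * ((\<Sum>i\<in>J. \<eta> i \<xi>) * fourier f \<xi>) \<partial>lborel)"
proof -
  let ?c = "complex_of_real (1 / (2 * pi) ^ CARD('n))"
  let ?M = "lattice_ball K0 :: (int ^ 'n) set"
  let ?h = "\<lambda>i m \<xi>. exp (\<i> * complex_of_real (x \<bullet> \<xi>)) * bs (i + m) (x, \<xi>) * fourier (piece f i) \<xi>"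
  have int: "integrable lborel (?h i m)" for i m
    using osc_integrable[OF amplitude_fourier[OF bs_amplitude[of "i + m"] piece_schwartz[OF f, of i]], of x x] by (simp add: mult.assoc)
  have "psum f J x = ?c * (\<Sum>i\<in>J. \<Sum>m\<in>?M. \<integral>\<xi>. ?h i m \<xi> \<partial>lborel)"
    unfolding psum_def pdo_def by (simp add: sum_distrib_left)
  also have "(\<Sum>i\<in>J. \<Sum>m\<in>?M. \<integral>\<xi>. ?h i m \<xi> \<partial>lborel) = (\<Sum>i\<in>J. \<integral>\<xi>. (\<Sum>m\<in>?M. ?h i m \<xi>) \<partial>lborel)"
    by (intro sum.cong refl Bochner_Integration.integral_sum[symmetric] int)
  also have "\<dots> = (\<integral>\<xi>. (\<Sum>i\<in>J. \<Sum>m\<in>?M. ?h i m \<xi>) \<partial>lborel)"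
    by (intro Bochner_Integration.integral_sum[symmetric] Bochner_Integration.integrable_sum int)
  also have "\<dots> = (\<integral>\<xi>. exp (\<i> * complex_of_real (x \<bullet> \<xi>)) * \<sigma> (x, \<xi>) * ((\<Sum>i\<in>J. \<eta> i \<xi>) * fourier f \<xi>) \<partial>lborel)"
  proof (intro Bochner_Integration.integral_cong refl)
    fix \<xi>
    let ?E = "exp (\<i> * complex_of_real (x \<bullet> \<xi>)) * \<sigma> (x, \<xi>)"
    have "(\<Sum>i\<in>J. \<Sum>m\<in>?M. ?h i m \<xi>) = (\<Sum>i\<in>J. ?E * ((\<eta> i \<xi> * (\<Sum>m\<in>?M. \<eta> (i + m) \<xi>)) * fourier f \<xi>))"
      by (intro sum.cong refl) (simp add: fourier_piece[OF f] sum_distrib_left sum_distrib_right mult_ac)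
    also have "\<dots> = ?E * ((\<Sum>i\<in>J. \<eta> i \<xi>) * fourier f \<xi>)"
      unfolding eta_local_sum by (simp add: sum_distrib_left sum_distrib_right)
    finally show "(\<Sum>i\<in>J. \<Sum>m\<in>?M. ?h i m \<xi>) = ?E * ((\<Sum>i\<in>J. \<eta> i \<xi>) * fourier f \<xi>)" .
  qed
  finally show ?thesis .
qed

text \<open>Dominated convergence in the frequency integral: the symbol and the partial sums of the
  partition are bounded, and the Fourier transform of f is integrable.\<close>

lemma psum_bounded_limit:
  assumes f: "f \<in> schwartz"
  obtains B where "\<And>m x. norm (psum f (lattice_exhaust m) x) \<le> B"
    "\<And>x. (\<lambda>m. psum f (lattice_exhaust m) x) \<longlonglongrightarrow> pdo \<sigma> f x"
proof -
  let ?c = "complex_of_real (1 / (2 * pi) ^ CARD('n))"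
  obtain K where K: "0 \<le> K" "\<And>z. norm (\<sigma> z) \<le> K" by (rule symbol_bounded[OF \<sigma>]) (rule that)
  obtain B where B: "0 \<le> B" "\<And>J \<xi>. finite J \<Longrightarrow> norm (\<Sum>i\<in>J. \<eta> i \<xi>) \<le> B" by (rule eta_partial_bounded) (rule that)
  have fin: "finite (lattice_exhaust m)" for m by (simp add: lattice_exhaust_def finite_lattice_ball)
  have Ff: "fourier f \<in> schwartz" by (rule fourier_schwartz[OF f])
  have [measurable]: "fourier f \<in> borel_measurable borel" "\<eta> i \<in> borel_measurable borel" for i
    by (intro schwartz_measurable Ff eta_schwartz)+
  have sm: "smooth \<sigma>" using \<sigma> by (simp add: symbol_class_def)
  have [measurable]: "(\<lambda>\<xi>. \<sigma> (x, \<xi>)) \<in> borel_measurable borel" for x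
    by (intro smooth_measurable smooth_slice sm)
  let ?w = "\<lambda>\<xi>. K * (B * norm (fourier f \<xi>))"
  have w: "integrable lborel ?w" using schwartz_integrable[OF Ff] by auto
  let ?s = "\<lambda>x m \<xi>. exp (\<i> * complex_of_real (x \<bullet> \<xi>)) * \<sigma> (x, \<xi>) * ((\<Sum>i\<in>lattice_exhaust m. \<eta> i \<xi>) * fourier f \<xi>)"
  have sb: "norm (?s x m \<xi>) \<le> ?w \<xi>" for x m \<xi>
    unfolding norm_mult using K B(1) by (intro mult_mono B(2)[OF fin]) auto
  have mm [measurable]: "?s x m \<in> borel_measurable borel" for x m by measurable
  show ?thesis
  proof (rule that[of "norm ?c * (\<integral>\<xi>. ?w \<xi> \<partial>lborel)"])
    show "norm (psum f (lattice_exhaust m) x) \<le> norm ?c * (\<integral>\<xi>. ?w \<xi> \<partial>lborel)" for m x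
      unfolding psum_eq[OF f fin] norm_mult
    proof (intro mult_left_mono)
      have "integrable lborel (?s x m)"
        by (rule Bochner_Integration.integrable_bound[OF w]) (use order_trans[OF sb abs_ge_self] in auto)
      then show "norm (\<integral>\<xi>. ?s x m \<xi> \<partial>lborel) \<le> (\<integral>\<xi>. ?w \<xi> \<partial>lborel)"
        by (rule Bochner_Integration.integral_norm_bound_integral[OF _ w]) (rule sb)
    qed simp
    show "(\<lambda>m. psum f (lattice_exhaust m) x) \<longlonglongrightarrow> pdo \<sigma> f x" for x
      unfolding psum_eq[OF f fin] pdo_def
    proof (intro tendsto_mult tendsto_const)
      show "(\<lambda>m. \<integral>\<xi>. ?s x m \<xi> \<partial>lborel) \<longlonglongrightarrow> (\<integral>\<xi>. exp (\<i> * complex_of_real (x \<bullet> \<xi>)) * \<sigma> (x, \<xi>) * fourier f \<xi> \<partial>lborel)"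
      proof (rule integral_dominated_convergence[where w="?w"])
        show "AE \<xi> in lborel. (\<lambda>m. ?s x m \<xi>) \<longlonglongrightarrow> exp (\<i> * complex_of_real (x \<bullet> \<xi>)) * \<sigma> (x, \<xi>) * fourier f \<xi>"
        proof (rule AE_I2)
          fix \<xi>
          have "(\<lambda>m. ?s x m \<xi>) \<longlonglongrightarrow> exp (\<i> * complex_of_real (x \<bullet> \<xi>)) * \<sigma> (x, \<xi>) * (1 * fourier f \<xi>)"
            by (intro tendsto_mult tendsto_const eta_exhaust)
          then show "(\<lambda>m. ?s x m \<xi>) \<longlonglongrightarrow> exp (\<i> * complex_of_real (x \<bullet> \<xi>)) * \<sigma> (x, \<xi>) * fourier f \<xi>" by simp
        qed
        show "AE \<xi> in lborel. norm (?s x m \<xi>) \<le> ?w \<xi>" for m by (intro AE_I2 sb)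
        show "integrable lborel ?w" by (rule w)
      qed (use mm in measurable)
    qed
  qed
qed

text \<open>Each partial sum obeys the bound with the full lattice sum on the right, so the bound
  survives the limit. The bounded shifts m of \<open>psum\<close> and their number are absorbed into
  K.\<close>

lemma piece_bound:
  obtains K where "0 \<le> K" "\<And>k f. f \<in> schwartz \<Longrightarrow>
    distr_Lp_norm 2 (multiplier (\<eta> k) (distr_of (pdo \<sigma> f))) \<le>
      (\<integral>\<^sup>+i. ennreal (K / bracket (int_vec (k - i)) ^ N * l2 (piece f i)) \<partial>count_space UNIV)"
    "\<And>f. f \<in> schwartz \<Longrightarrow> distr_of (pdo \<sigma> f) \<in> tempered"
proof -
  let ?M = "lattice_ball K0 :: (int ^ 'n) set"
  let ?p = "pl TYPE('n)"
  obtain K1 where K1: "0 \<le> K1" "\<And>k j f. f \<in> schwartz \<Longrightarrow>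
      l2 (\<lambda>\<xi>. \<eta> k \<xi> * fourier (pdo (bs j) f) \<xi>) * bracket (int_vec (k - j)) ^ N \<le> K1 * l2 f"
    using near_orth[OF symbol_loc_sym[OF \<sigma> \<delta>\<alpha> \<alpha>\<rho>], of N] by blast
  have K0: "0 \<le> K0" using C0 by (auto simp: K0_def less_imp_le)
  define K where "K = ?p * (real (card ?M) * (K1 * (1 + K0) ^ N))"
  have K: "0 \<le> K" using K1 K0 by (auto simp: K_def less_imp_le)
  have single: "l2 (\<lambda>\<xi>. \<eta> k \<xi> * fourier (pdo (bs (i + m)) (piece f i)) \<xi>) \<le> K1 * (1 + K0) ^ N / bracket (int_vec (k - i)) ^ N * l2 (piece f i)"
    if f: "f \<in> schwartz" and m: "m \<in> ?M" for k i m f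
  proof -
    \<comment> \<open>Replacing the index i + m by i costs the bracket of m, which is at most 1 +
      K0.\<close>
    have "bracket (int_vec (k - i)) \<le> bracket (int_vec (k - (i + m))) * bracket (int_vec m)"
      using bracket_add[of "int_vec (k - (i + m))" "int_vec m"] by (simp add: int_vec_add[symmetric])
    also have "\<dots> \<le> bracket (int_vec (k - (i + m))) * (1 + K0)"
      using m by (intro mult_left_mono) (auto simp: lattice_ball_def bracket_def[of "int_vec m"])
    finally have "bracket (int_vec (k - i)) ^ N \<le> (bracket (int_vec (k - (i + m))) * (1 + K0)) ^ N" by (intro power_mono) auto
    then have "l2 (\<lambda>\<xi>. \<eta> k \<xi> * fourier (pdo (bs (i + m)) (piece f i)) \<xi>) * bracket (int_vec (k - i)) ^ N
      \<le> l2 (\<lambda>\<xi>. \<eta> k \<xi> * fourier (pdo (bs (i + m)) (piece f i)) \<xi>) * (bracket (int_vec (k - (i + m))) ^ N * (1 + K0) ^ N)"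
      by (intro mult_left_mono) (auto simp: power_mult_distrib)
    also have "\<dots> \<le> K1 * l2 (piece f i) * (1 + K0) ^ N"
      using mult_right_mono[OF K1(2)[OF piece_schwartz[OF f], where k=k and j="i + m"], of "(1 + K0) ^ N"] K0 by (simp add: mult.assoc)
    finally show ?thesis by (simp add: pos_le_divide_eq mult_ac)
  qed
  have pb: "distr_Lp_norm 2 (multiplier (\<eta> k) (distr_of (pdo \<sigma> f))) \<le>
      (\<integral>\<^sup>+i. ennreal (K / bracket (int_vec (k - i)) ^ N * l2 (piece f i)) \<partial>count_space UNIV) \<and> distr_of (pdo \<sigma> f) \<in> tempered"
    if f: "f \<in> schwartz" for k f
  proof -
    let ?T = "\<integral>\<^sup>+i. ennreal (K / bracket (int_vec (k - i)) ^ N * l2 (piece f i)) \<partial>count_space UNIV"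
    obtain B where B: "\<And>m x. norm (psum f (lattice_exhaust m) x) \<le> B"
      and lim: "\<And>x. (\<lambda>m. psum f (lattice_exhaust m) x) \<longlonglongrightarrow> pdo \<sigma> f x"
      by (rule psum_bounded_limit[OF f]) (rule that)
    have fin: "finite (lattice_exhaust m)" for m by (simp add: lattice_exhaust_def finite_lattice_ball)
    have ps: "psum f (lattice_exhaust m) \<in> schwartz" for m by (rule psum_schwartz[OF f fin])
    note psm = schwartz_measurable[OF ps]
    have gm: "pdo \<sigma> f \<in> borel_measurable borel" by (rule borel_measurable_LIMSEQ_metric[OF psm lim])
    have gb: "norm (pdo \<sigma> f x) \<le> B" for x
      by (rule tendsto_upperbound[OF tendsto_norm[OF lim]]) (intro always_eventually allI B, simp)
    let ?K = "inv_fourier (\<eta> k)"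
    have Ks: "?K \<in> schwartz" by (rule inv_fourier_schwartz[OF eta_schwartz])
    have cl: "(\<lambda>m. conv ?K (psum f (lattice_exhaust m)) y) \<longlonglongrightarrow> conv ?K (pdo \<sigma> f) y" for y
      by (rule conv_limit[OF Ks psm B lim])
    have cm: "conv ?K g \<in> borel_measurable borel" if "g \<in> borel_measurable borel" for g
      by (rule conv_measurable[OF Ks that])
    have each: "(\<integral>\<^sup>+y. ennreal ((norm (conv ?K (psum f (lattice_exhaust m)) y))\<^sup>2) \<partial>lborel) \<le> ?T\<^sup>2" for m
    proof -
      let ?J = "lattice_exhaust m"
      let ?h = "\<lambda>i n \<xi>. \<eta> k \<xi> * fourier (pdo (bs (i + n)) (piece f i)) \<xi>"
      have hs: "?h i n \<in> schwartz" for i n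
        by (intro schwartz_mult eta_schwartz fourier_schwartz pdo_schwartz bs_amplitude piece_schwartz f)
      have hsum: "(\<lambda>\<xi>. \<Sum>n\<in>?M. ?h i n \<xi>) \<in> schwartz" for i
        by (intro schwartz_sum finite_lattice_ball hs)
      have ft: "fourier (psum f ?J) \<xi> = (\<Sum>i\<in>?J. \<Sum>n\<in>?M. fourier (pdo (bs (i + n)) (piece f i)) \<xi>)" for \<xi>
      proof -
        have s: "pdo (bs (i + n)) (piece f i) \<in> schwartz" for i n by (intro pdo_schwartz bs_amplitude piece_schwartz f)
        have "fourier (psum f ?J) \<xi> = (\<Sum>i\<in>?J. fourier (\<lambda>x. \<Sum>n\<in>?M. pdo (bs (i + n)) (piece f i) x) \<xi>)"
          unfolding psum_def[abs_def] by (rule fourier_sum[OF fin]) (intro schwartz_sum finite_lattice_ball s)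
        also have "\<dots> = (\<Sum>i\<in>?J. \<Sum>n\<in>?M. fourier (pdo (bs (i + n)) (piece f i)) \<xi>)"
          by (intro sum.cong refl fourier_sum finite_lattice_ball s)
        finally show ?thesis .
      qed
      have cs: "conv ?K (psum f ?J) = inv_fourier (\<lambda>\<xi>. \<eta> k \<xi> * fourier (psum f ?J) \<xi>)"
        using conv_inv_fourier[OF eta_schwartz ps] by auto
      have s0: "(\<lambda>\<xi>. \<eta> k \<xi> * fourier (psum f ?J) \<xi>) \<in> schwartz"
        by (intro schwartz_mult eta_schwartz fourier_schwartz ps)
      have eqf: "(\<lambda>\<xi>. \<eta> k \<xi> * fourier (psum f ?J) \<xi>) = (\<lambda>\<xi>. \<Sum>i\<in>?J. \<Sum>n\<in>?M. ?h i n \<xi>)"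
        unfolding ft by (simp add: sum_distrib_left)
      have "l2 (conv ?K (psum f ?J)) = ?p * l2 (\<lambda>\<xi>. \<Sum>i\<in>?J. \<Sum>n\<in>?M. ?h i n \<xi>)"
        unfolding cs eqf[symmetric] by (rule l2_inv_fourier[OF s0])
      also have "\<dots> \<le> ?p * (\<Sum>i\<in>?J. \<Sum>n\<in>?M. K1 * (1 + K0) ^ N / bracket (int_vec (k - i)) ^ N * l2 (piece f i))"
      proof (intro mult_left_mono)
        have "l2 (\<lambda>\<xi>. \<Sum>i\<in>?J. \<Sum>n\<in>?M. ?h i n \<xi>) \<le> (\<Sum>i\<in>?J. l2 (\<lambda>\<xi>. \<Sum>n\<in>?M. ?h i n \<xi>))"
          by (rule l2_sum[OF fin hsum])
        also have "\<dots> \<le> (\<Sum>i\<in>?J. \<Sum>n\<in>?M. l2 (?h i n))"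
          by (intro sum_mono l2_sum finite_lattice_ball hs)
        also have "\<dots> \<le> (\<Sum>i\<in>?J. \<Sum>n\<in>?M. K1 * (1 + K0) ^ N / bracket (int_vec (k - i)) ^ N * l2 (piece f i))"
          by (intro sum_mono single f)
        finally show "l2 (\<lambda>\<xi>. \<Sum>i\<in>?J. \<Sum>n\<in>?M. ?h i n \<xi>) \<le> (\<Sum>i\<in>?J. \<Sum>n\<in>?M. K1 * (1 + K0) ^ N / bracket (int_vec (k - i)) ^ N * l2 (piece f i))" .
      qed (simp add: less_imp_le)
      also have "\<dots> = (\<Sum>i\<in>?J. K / bracket (int_vec (k - i)) ^ N * l2 (piece f i))"
        unfolding K_def by (simp add: sum_distrib_left mult_ac)
      finally have le: "l2 (conv ?K (psum f ?J)) \<le> (\<Sum>i\<in>?J. K / bracket (int_vec (k - i)) ^ N * l2 (piece f i))" .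
      have "ennreal (l2 (conv ?K (psum f ?J))) \<le> (\<Sum>i\<in>?J. ennreal (K / bracket (int_vec (k - i)) ^ N * l2 (piece f i)))"
        using le K by (subst sum_ennreal) (auto intro!: ennreal_leI)
      also have "\<dots> = (\<integral>\<^sup>+i. ennreal (K / bracket (int_vec (k - i)) ^ N * l2 (piece f i)) \<partial>count_space ?J)"
        by (rule nn_integral_count_space_finite[OF fin, symmetric])
      also have "\<dots> \<le> ?T"
        by (subst nn_integral_count_space_indicator) (auto intro!: nn_integral_mono simp: indicator_def)
      finally have "(ennreal (l2 (conv ?K (psum f ?J))))\<^sup>2 \<le> ?T\<^sup>2" by (intro power_mono) auto
      moreover have "conv ?K (psum f ?J) \<in> schwartz" unfolding cs by (rule inv_fourier_schwartz[OF s0])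
      ultimately show ?thesis by (simp add: nn_l2 ennreal_power)
    qed
    have "(\<integral>\<^sup>+y. ennreal ((norm (conv ?K (pdo \<sigma> f) y))\<^sup>2) \<partial>lborel)
      = (\<integral>\<^sup>+y. liminf (\<lambda>m. ennreal ((norm (conv ?K (psum f (lattice_exhaust m)) y))\<^sup>2)) \<partial>lborel)"
    proof (intro nn_integral_cong)
      fix y
      have "(\<lambda>m. ennreal ((norm (conv ?K (psum f (lattice_exhaust m)) y))\<^sup>2)) \<longlonglongrightarrow> ennreal ((norm (conv ?K (pdo \<sigma> f) y))\<^sup>2)"
        by (intro tendsto_ennrealI tendsto_power tendsto_norm cl)
      then show "ennreal ((norm (conv ?K (pdo \<sigma> f) y))\<^sup>2) = liminf (\<lambda>m. ennreal ((norm (conv ?K (psum f (lattice_exhaust m)) y))\<^sup>2))"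
        using lim_imp_Liminf[OF trivial_limit_sequentially] by metis
    qed
    \<comment> \<open>Fatou's lemma; \<open>each\<close> bounds all partial sums by the same
      quantity.\<close>
    also have "\<dots> \<le> liminf (\<lambda>m. \<integral>\<^sup>+y. ennreal ((norm (conv ?K (psum f (lattice_exhaust m)) y))\<^sup>2) \<partial>lborel)"
      by (rule nn_integral_liminf) (use cm[OF psm] in auto)
    also have "\<dots> \<le> liminf (\<lambda>m::nat. ?T\<^sup>2)"
      by (intro Liminf_mono always_eventually allI each)
    also have "\<dots> = ?T\<^sup>2" by (simp add: Liminf_const)
    finally have "Lp_norm lborel 2 (\<lambda>y. ennreal (norm (conv ?K (pdo \<sigma> f) y))) \<le> ?T"
      by (rule Lp_norm_2_bound_ennreal)
    moreover have "represents (conv ?K (pdo \<sigma> f)) (multiplier (\<eta> k) (distr_of (pdo \<sigma> f)))"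
      by (rule multiplier_bounded[OF eta_schwartz gm gb])
    ultimately have "distr_Lp_norm 2 (multiplier (\<eta> k) (distr_of (pdo \<sigma> f))) \<le> ?T"
      unfolding distr_Lp_norm_def by (intro INF_lower2[of "conv ?K (pdo \<sigma> f)"]) auto
    moreover have "distr_of (pdo \<sigma> f) \<in> tempered" by (rule tempered_bounded[OF gm gb])
    ultimately show ?thesis by blast
  qed
  show ?thesis by (rule that[OF K]) (use pb in auto)
qed

end

section \<open>The modulation norm of Schwartz functions and the positive direction\<close>

definition wt :: "real \<Rightarrow> int ^ 'n \<Rightarrow> real" where
  "wt s k = bracket (int_vec k) powr (s / (1 - \<alpha>))"

lemma wt_pos [simp]: "0 < wt s k" "0 \<le> wt s k"
  by (simp_all add: wt_def)

lemma alpha_mod_norm_schwartz: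
  assumes f: "f \<in> schwartz" and q: "0 < q"
  shows "alpha_mod_norm \<eta> \<alpha> 2 (ennreal q) s (distr_of f) =
    ennreal_powr (\<integral>\<^sup>+k. ennreal ((wt s k * l2 (piece f k)) powr q) \<partial>count_space UNIV) (1 / q)"
  unfolding alpha_mod_norm_def multiplier_piece[OF f] wt_def[symmetric] Lp_norm_real[OF q]
  using tempered_schwartz[OF f] by (simp add: ennreal_mult[symmetric] ennreal_powr_ennreal)

lemma sufficiency:
  assumes q: "1 < q" and \<sigma>: "\<sigma> \<in> symbol_class 0 \<rho> \<delta>" and \<delta>\<alpha>: "\<delta> \<le> \<alpha>" and \<alpha>\<rho>: "\<alpha> \<le> \<rho>"
  shows "pdo_bounded \<eta> \<alpha> 2 (ennreal q) s \<sigma>"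
proof -
  let ?n2 = "2 * CARD('n)"
  let ?M = "count_space (UNIV :: (int ^ 'n) set)"
  define t where "t = s / (1 - \<alpha>)"
  \<comment> \<open>N' powers of the distance compensate for the ratio of the weights at k and at i;
    2n further powers remain for summability.\<close>
  define N' where "N' = nat \<lceil>\<bar>t\<bar>\<rceil>"
  have N': "\<bar>t\<bar> \<le> real N'" unfolding N'_def by linarith
  obtain K where K: "0 \<le> K" "\<And>k f. f \<in> schwartz \<Longrightarrow>
    distr_Lp_norm 2 (multiplier (\<eta> k) (distr_of (pdo \<sigma> f))) \<le>
      (\<integral>\<^sup>+i. ennreal (K / bracket (int_vec (k - i)) ^ (?n2 + N') * l2 (piece f i)) \<partial>?M)"
    "\<And>f. f \<in> schwartz \<Longrightarrow> distr_of (pdo \<sigma> f) \<in> tempered"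
    by (rule piece_bound[OF \<sigma> \<delta>\<alpha> \<alpha>\<rho>, of "?n2 + N'"]) (rule that)
  define \<kappa> where "\<kappa> m = K * (1 / bracket (int_vec m) ^ ?n2)" for m :: "int ^ 'n"
  have \<kappa>0: "0 \<le> \<kappa> m" for m using K(1) by (simp add: \<kappa>_def)
  define S where "S = (\<integral>\<^sup>+m. ennreal (1 / bracket (int_vec (m :: int ^ 'n)) ^ ?n2) \<partial>?M)"
  have S: "S < \<infinity>" unfolding S_def by (rule lattice_sum_finite) simp
  \<comment> \<open>The summand 1 makes A positive, as \<open>ennreal_powr_cmult\<close>
    requires.\<close>
  define A where "A = K * enn2real S + 1"
  have A: "0 < A" using K(1) by (simp add: A_def add_nonneg_pos)
  have \<kappa>A: "(\<integral>\<^sup>+m. ennreal (\<kappa> m) \<partial>?M) \<le> ennreal A"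
  proof -
    have "(\<integral>\<^sup>+m. ennreal (\<kappa> m) \<partial>?M) = ennreal K * S"
      unfolding \<kappa>_def S_def using K(1) by (subst nn_integral_cmult[symmetric]) (auto simp: ennreal_mult[symmetric])
    also have "\<dots> = ennreal (K * enn2real S)"
      using S K(1) by (cases S) (auto simp: ennreal_mult)
    also have "\<dots> \<le> ennreal A" by (intro ennreal_leI) (simp add: A_def)
    finally show ?thesis .
  qed
  have bnd: "alpha_mod_norm \<eta> \<alpha> 2 (ennreal q) s (distr_of (pdo \<sigma> f)) \<le> ennreal A * alpha_mod_norm \<eta> \<alpha> 2 (ennreal q) s (distr_of f)"
    if f: "f \<in> schwartz" for f
  proof -
    let ?X = "\<lambda>k. distr_Lp_norm 2 (multiplier (\<eta> k) (distr_of (pdo \<sigma> f)))"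
    let ?v = "\<lambda>i. wt s i * l2 (piece f i)"
    have wle: "wt s k * (K / bracket (int_vec (k - i)) ^ (?n2 + N') * l2 (piece f i)) \<le> \<kappa> (k - i) * ?v i" for k i
    proof -
      let ?b = "bracket (int_vec (k - i))"
      have "wt s k \<le> wt s i * ?b powr \<bar>t\<bar>"
        unfolding wt_def t_def[symmetric] int_vec_diff by (rule bracket_powr_le)
      also have "\<dots> \<le> wt s i * ?b ^ N'"
        using powr_mono[OF N' bracket_ge1[of "int_vec (k - i)"]] by (intro mult_left_mono) (simp_all add: powr_realpow)
      finally have "wt s k * (K / ?b ^ (?n2 + N') * l2 (piece f i)) \<le> (wt s i * ?b ^ N') * (K / ?b ^ (?n2 + N') * l2 (piece f i))"
        using K(1) by (intro mult_right_mono) auto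
      also have "\<dots> = \<kappa> (k - i) * ?v i" by (simp add: \<kappa>_def power_add)
      finally show ?thesis .
    qed
    have u: "ennreal (wt s k) * ?X k \<le> (\<integral>\<^sup>+i. ennreal (\<kappa> (k - i) * ?v i) \<partial>?M)" for k
    proof -
      have "ennreal (wt s k) * ?X k \<le> ennreal (wt s k) * (\<integral>\<^sup>+i. ennreal (K / bracket (int_vec (k - i)) ^ (?n2 + N') * l2 (piece f i)) \<partial>?M)"
        by (intro mult_left_mono K(2)[OF f]) auto
      also have "\<dots> = (\<integral>\<^sup>+i. ennreal (wt s k * (K / bracket (int_vec (k - i)) ^ (?n2 + N') * l2 (piece f i))) \<partial>?M)"
        using K(1) by (subst nn_integral_cmult[symmetric]) (auto simp: ennreal_mult[symmetric])
      also have "\<dots> \<le> (\<integral>\<^sup>+i. ennreal (\<kappa> (k - i) * ?v i) \<partial>?M)"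
        by (intro nn_integral_mono ennreal_leI wle)
      finally show ?thesis .
    qed
    have "(\<integral>\<^sup>+k. ennreal_powr (ennreal (wt s k) * ?X k) q \<partial>?M) \<le> ennreal (A powr q) * (\<integral>\<^sup>+i. ennreal (?v i powr q) \<partial>?M)"
      by (rule young_lq[OF q \<kappa>0 _ _ \<kappa>A u]) (use A in auto)
    then have "ennreal_powr (\<integral>\<^sup>+k. ennreal_powr (ennreal (wt s k) * ?X k) q \<partial>?M) (1 / q)
        \<le> ennreal_powr (ennreal (A powr q) * (\<integral>\<^sup>+i. ennreal (?v i powr q) \<partial>?M)) (1 / q)"
      using q by (intro ennreal_powr_mono) auto
    also have "\<dots> = ennreal A * ennreal_powr (\<integral>\<^sup>+i. ennreal (?v i powr q) \<partial>?M) (1 / q)"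
      using A q by (intro ennreal_powr_cmult) auto
    also have "\<dots> = ennreal A * alpha_mod_norm \<eta> \<alpha> 2 (ennreal q) s (distr_of f)"
      using q by (subst alpha_mod_norm_schwartz[OF f]) auto
    finally show ?thesis
      unfolding alpha_mod_norm_def[of _ _ _ _ _ "distr_of (pdo \<sigma> f)"] using K(3)[OF f] q
      by (simp add: Lp_norm_real wt_def)
  qed
  then show ?thesis unfolding pdo_bounded_def by blast
qed

end

subsection \<open>Rudin--Shapiro polynomials\<close>

text \<open>On the indices below \<open>2 ^ p\<close> these are the coefficients of the
  Rudin-Shapiro pair, which arises by the step (P, Q) -> (P + z^M Q, P - z^M Q) with M =
  \<open>2 ^ p\<close>.\<close>

primrec rs :: "nat \<Rightarrow> (nat \<Rightarrow> complex) \<times> (nat \<Rightarrow> complex)" where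
  "rs 0 = (\<lambda>_. 1, \<lambda>_. 1)"
| "rs (Suc p) = (\<lambda>m. if m < 2 ^ p then fst (rs p) m else snd (rs p) (m - 2 ^ p),
                 \<lambda>m. if m < 2 ^ p then fst (rs p) m else - snd (rs p) (m - 2 ^ p))"

lemma rs_norm: "norm (fst (rs p) m) = 1" "norm (snd (rs p) m) = 1"
  by (induction p arbitrary: m) auto

text \<open>Up to the factor i^b this is the b-th derivative in t of the polynomial with
  coefficients \<epsilon>.\<close>

definition trig :: "(nat \<Rightarrow> complex) \<Rightarrow> nat \<Rightarrow> nat \<Rightarrow> real \<Rightarrow> complex" where
  "trig \<epsilon> p b t = (\<Sum>m<2 ^ p. \<epsilon> m * of_nat m ^ b * exp (\<i> * complex_of_real (real m * t)))"

lemma sum_split_double: "(\<Sum>m<2 ^ Suc p. g m) = (\<Sum>m<2 ^ p. g m) + (\<Sum>m<2 ^ p. g (m + 2 ^ p))" for g :: "nat \<Rightarrow> complex"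
proof -
  have "{..<2 ^ Suc p} = {..<2 ^ p} \<union> {2 ^ p..<2 ^ p + (2::nat) ^ p}" by auto
  moreover have "{2 ^ p..<2 ^ p + (2::nat) ^ p} = (\<lambda>m. m + 2 ^ p) ` {..<2 ^ p}"
    unfolding lessThan_atLeast0 image_add_atLeastLessThan' by simp
  ultimately have "(\<Sum>m<2 ^ Suc p. g m) = (\<Sum>m<2 ^ p. g m) + (\<Sum>m\<in>(\<lambda>m. m + 2 ^ p) ` {..<2 ^ p}. g m)"
    by (subst sum.union_disjoint[symmetric]) auto
  then show ?thesis by (subst (asm) sum.reindex) (auto simp: inj_on_def)
qed

text \<open>The binomial theorem for (m + 2^p)^b expresses the upper half of a derivative through
  derivatives of the shorter polynomial of order at most b.\<close>

lemma trig_shift: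
  "(\<Sum>m<2 ^ p. \<epsilon> m * of_nat (m + 2 ^ p) ^ b * exp (\<i> * complex_of_real (real (m + 2 ^ p) * t)))
    = exp (\<i> * complex_of_real (2 ^ p * t)) * (\<Sum>c\<le>b. of_nat (b choose c) * 2 ^ (p * c) * trig \<epsilon> p (b - c) t)"
proof -
  let ?e = "\<lambda>m. exp (\<i> * complex_of_real (real m * t))"
  have "\<epsilon> m * of_nat (m + 2 ^ p) ^ b * exp (\<i> * complex_of_real (real (m + 2 ^ p) * t))
      = (\<Sum>c\<le>b. exp (\<i> * complex_of_real (2 ^ p * t)) * (of_nat (b choose c) * 2 ^ (p * c) * (\<epsilon> m * of_nat m ^ (b - c) * ?e m)))" for m
  proof -
    have "exp (\<i> * complex_of_real (real (m + 2 ^ p) * t)) = ?e m * exp (\<i> * complex_of_real (2 ^ p * t))"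
      unfolding exp_add[symmetric] by (simp add: algebra_simps)
    moreover have "(of_nat (m + 2 ^ p) :: complex) ^ b = (\<Sum>c\<le>b. of_nat (b choose c) * 2 ^ (p * c) * of_nat m ^ (b - c))"
      using binomial_ring[of "2 ^ p" "of_nat m :: complex" b] by (simp add: power_mult add.commute)
    ultimately show ?thesis by (simp add: sum_distrib_left sum_distrib_right mult_ac)
  qed
  then have "(\<Sum>m<2 ^ p. \<epsilon> m * of_nat (m + 2 ^ p) ^ b * exp (\<i> * complex_of_real (real (m + 2 ^ p) * t)))
      = (\<Sum>c\<le>b. \<Sum>m<2 ^ p. exp (\<i> * complex_of_real (2 ^ p * t)) * (of_nat (b choose c) * 2 ^ (p * c) * (\<epsilon> m * of_nat m ^ (b - c) * ?e m)))"
    by (simp only: sum.swap[of _ "{..b}"])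
  then show ?thesis unfolding trig_def sum_distrib_left by simp
qed

lemma trig_Suc:
  fixes p b t
  defines "W \<equiv> exp (\<i> * complex_of_real (2 ^ p * t)) * (\<Sum>c\<le>b. of_nat (b choose c) * 2 ^ (p * c) * trig (snd (rs p)) p (b - c) t)"
  shows "trig (fst (rs (Suc p))) (Suc p) b t = trig (fst (rs p)) p b t + W"
    "trig (snd (rs (Suc p))) (Suc p) b t = trig (fst (rs p)) p b t - W"
  unfolding trig_def[of "fst (rs (Suc p))"] trig_def[of "snd (rs (Suc p))"] sum_split_double W_def trig_shift[symmetric]
  by (simp_all add: trig_def sum_negf)

text \<open>By the parallelogram law the sum of the two squares doubles at each step, for every t.
  Hence each polynomial is at most \<open>sqrt 2\<close> times the square root of its
  length.\<close>

lemma rs_parallelogram: "(norm (trig (fst (rs p)) p 0 t))\<^sup>2 + (norm (trig (snd (rs p)) p 0 t))\<^sup>2 = 2 ^ Suc p"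
proof (induction p)
  case 0
  then show ?case by (simp add: trig_def)
next
  case (Suc p)
  let ?P = "trig (fst (rs p)) p 0 t" and ?Q = "exp (\<i> * complex_of_real (2 ^ p * t)) * trig (snd (rs p)) p 0 t"
  have "(norm (u + w))\<^sup>2 + (norm (u - w))\<^sup>2 = 2 * ((norm u)\<^sup>2 + (norm w)\<^sup>2)" for u w :: complex
    unfolding cmod_power2 by (simp add: power2_eq_square algebra_simps)
  then have "(norm (?P + ?Q))\<^sup>2 + (norm (?P - ?Q))\<^sup>2 = 2 * ((norm ?P)\<^sup>2 + (norm ?Q)\<^sup>2)" .
  also have "norm ?Q = norm (trig (snd (rs p)) p 0 t)"
    unfolding norm_mult by simp
  finally show ?case unfolding trig_Suc using Suc by simp
qed

text \<open>Derivatives inherit the flatness, as Bernstein's inequality suggests. The elementary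
  proof is a strong induction on b with an induction on p inside: one step at most doubles the main
  term and adds lower derivatives, while the claimed bound grows by \<open>sqrt 2 * 2 ^ b\<close>,
  which exceeds 2 once b \<ge> 1. The case b = 0 is \<open>rs_parallelogram\<close>.\<close>

lemma rs_bound:
  "\<exists>K\<ge>0. \<forall>p t. norm (trig (fst (rs p)) p b t) \<le> K * (sqrt 2 ^ p * 2 ^ (p * b)) \<and>
     norm (trig (snd (rs p)) p b t) \<le> K * (sqrt 2 ^ p * 2 ^ (p * b))"
proof (induction b rule: less_induct)
  case (less b)
  show ?case
  proof (cases "b = 0")
    case True
    have "norm (trig (fst (rs p)) p 0 t) \<le> sqrt 2 * sqrt 2 ^ p \<and> norm (trig (snd (rs p)) p 0 t) \<le> sqrt 2 * sqrt 2 ^ p" for p t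
    proof -
      have "(sqrt 2 * sqrt 2 ^ p)\<^sup>2 = 2 ^ Suc p"
      proof -
        have "(sqrt 2 * sqrt 2 ^ p)\<^sup>2 = ((sqrt 2)\<^sup>2) ^ Suc p"
          by (simp only: power_Suc[symmetric] power_mult[symmetric] mult.commute)
        then show ?thesis by simp
      qed
      then have "(norm (trig (fst (rs p)) p 0 t))\<^sup>2 \<le> (sqrt 2 * sqrt 2 ^ p)\<^sup>2" "(norm (trig (snd (rs p)) p 0 t))\<^sup>2 \<le> (sqrt 2 * sqrt 2 ^ p)\<^sup>2"
        using rs_parallelogram[of p t] zero_le_power2[of "norm (trig (fst (rs p)) p 0 t)"] zero_le_power2[of "norm (trig (snd (rs p)) p 0 t)"]
        by linarith+
      then show ?thesis by (auto intro!: power2_le_imp_le)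
    qed
    then show ?thesis using True by (intro exI[of _ "sqrt 2"]) simp
  next
    case False
    have "\<forall>c. \<exists>K\<ge>0. c < b \<longrightarrow> (\<forall>p t. norm (trig (snd (rs p)) p c t) \<le> K * (sqrt 2 ^ p * 2 ^ (p * c)))"
      using less by (metis order_refl)
    then obtain K where K: "\<And>c. K c \<ge> 0" "\<And>c p t. c < b \<Longrightarrow> norm (trig (snd (rs p)) p c t) \<le> K c * (sqrt 2 ^ p * 2 ^ (p * c))"
      by metis
    define S where "S = (\<Sum>c\<in>{1..b}. of_nat (b choose c) * K (b - c))"
    have S: "0 \<le> S" unfolding S_def by (intro sum_nonneg mult_nonneg_nonneg K) auto
    \<comment> \<open>Chosen so that S \<le> D / 2: the lower derivatives then contribute at most
      half of the bound.\<close>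
    define D where "D = 2 * S + 1"
    have W: "norm (exp (\<i> * complex_of_real (2 ^ p * t)) * (\<Sum>c\<le>b. of_nat (b choose c) * 2 ^ (p * c) * trig (snd (rs p)) p (b - c) t))
      \<le> norm (trig (snd (rs p)) p b t) + S * (sqrt 2 ^ p * 2 ^ (p * b))" for p t
    proof -
      have "{..b} = insert 0 {1..b}" by auto
      then have eq: "(\<Sum>c\<le>b. of_nat (b choose c) * 2 ^ (p * c) * trig (snd (rs p)) p (b - c) t)
        = trig (snd (rs p)) p b t + (\<Sum>c\<in>{1..b}. of_nat (b choose c) * 2 ^ (p * c) * trig (snd (rs p)) p (b - c) t)" by simp
      have "norm (\<Sum>c\<le>b. of_nat (b choose c) * 2 ^ (p * c) * trig (snd (rs p)) p (b - c) t) \<le> norm (trig (snd (rs p)) p b t) + (\<Sum>c\<in>{1..b}. of_nat (b choose c) * 2 ^ (p * c) * (K (b - c) * (sqrt 2 ^ p * 2 ^ (p * (b - c)))))"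
        unfolding eq
      proof (rule order_trans[OF norm_triangle_ineq add_left_mono], rule order_trans[OF norm_sum sum_mono])
        fix c assume "c \<in> {1..b}"
        then have "b - c < b" using False by auto
        from mult_left_mono[OF K(2)[OF this, of p t], of "of_nat (b choose c) * 2 ^ (p * c)"]
        show "norm (of_nat (b choose c) * 2 ^ (p * c) * trig (snd (rs p)) p (b - c) t)
          \<le> of_nat (b choose c) * 2 ^ (p * c) * (K (b - c) * (sqrt 2 ^ p * 2 ^ (p * (b - c))))"
          by (simp add: norm_mult norm_power)
      qed
      also have "(\<Sum>c\<in>{1..b}. of_nat (b choose c) * 2 ^ (p * c) * (K (b - c) * (sqrt 2 ^ p * 2 ^ (p * (b - c))))) = S * (sqrt 2 ^ p * 2 ^ (p * b))"
        unfolding S_def sum_distrib_right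
      proof (intro sum.cong refl)
        fix c assume c: "c \<in> {1..b}"
        have "(2::real) ^ (p * c) * 2 ^ (p * (b - c)) = 2 ^ (p * b)"
          using c by (simp add: power_add[symmetric] add_mult_distrib2[symmetric])
        then show "of_nat (b choose c) * 2 ^ (p * c) * (K (b - c) * (sqrt 2 ^ p * 2 ^ (p * (b - c)))) = of_nat (b choose c) * K (b - c) * (sqrt 2 ^ p * 2 ^ (p * b))"
          by (metis (no_types, lifting) mult.assoc mult.commute mult.left_commute)
      qed
      finally show ?thesis unfolding norm_mult by simp
    qed
    have "norm (trig (fst (rs p)) p b t) \<le> D * (sqrt 2 ^ p * 2 ^ (p * b)) \<and> norm (trig (snd (rs p)) p b t) \<le> D * (sqrt 2 ^ p * 2 ^ (p * b))" for p t
    proof (induction p)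
      case 0
      then show ?case using False S by (simp add: trig_def D_def power_0_left)
    next
      case (Suc p)
      let ?X = "sqrt 2 ^ p * 2 ^ (p * b) :: real"
      have X: "0 \<le> ?X" by simp
      \<comment> \<open>The bound grows by at least 5/4 * 2 = 5/2 per step, exactly the room for two
        main terms D and the half that comes from the lower derivatives.\<close>
      have s2: "5 / 4 \<le> sqrt (2::real)" by (rule real_le_rsqrt) (simp add: power2_eq_square)
      have b2: "(2::real) \<le> 2 ^ b" using False by (cases b) auto
      have "5 / 2 \<le> sqrt 2 * (2::real) ^ b" using mult_mono[OF s2 b2] by simp
      then have "D * ?X * (5 / 2) \<le> D * ?X * (sqrt 2 * 2 ^ b)" using S by (intro mult_left_mono) (auto simp: D_def)
      also have "\<dots> = D * (sqrt 2 ^ Suc p * 2 ^ (Suc p * b))" by (simp add: power_add mult_ac)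
      finally have grow: "D * ?X * (5 / 2) \<le> D * (sqrt 2 ^ Suc p * 2 ^ (Suc p * b))" .
      have "S * ?X \<le> D / 2 * ?X" using X by (intro mult_right_mono) (auto simp: D_def)
      moreover have "D / 2 * ?X = D * ?X / 2" "D * ?X * (5 / 2) = D * ?X + D * ?X + D * ?X / 2" by simp_all
      moreover note conjunct1[OF Suc] conjunct2[OF Suc] W[of p t]
      ultimately have "norm (trig (fst (rs p)) p b t) +
        norm (exp (\<i> * complex_of_real (2 ^ p * t)) * (\<Sum>c\<le>b. of_nat (b choose c) * 2 ^ (p * c) * trig (snd (rs p)) p (b - c) t)) \<le> D * ?X * (5 / 2)"
        by linarith
      with grow show ?case unfolding trig_Suc
        by (meson norm_triangle_ineq norm_triangle_ineq4 order_trans)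
    qed
    then show ?thesis using S by (intro exI[of _ D]) (auto simp: D_def)
  qed
qed

lemma iD_trig_sum:
  fixes e :: "'a::euclidean_space"
  assumes I: "finite I"
  shows "iD l (\<lambda>x. \<Sum>m\<in>I. c m * exp (\<i> * complex_of_real (x \<bullet> (\<theta> m *\<^sub>R e))))
    = (\<lambda>x. prod_list (map (\<lambda>v. complex_of_real (v \<bullet> e)) l) * (\<Sum>m\<in>I. c m * (\<i> * complex_of_real (\<theta> m)) ^ length l * exp (\<i> * complex_of_real (x \<bullet> (\<theta> m *\<^sub>R e)))))"
proof (induction l)
  case Nil
  then show ?case by simp
next
  case (Cons v l)
  let ?P = "prod_list (map (\<lambda>v. complex_of_real (v \<bullet> e)) l)"
  let ?E = "\<lambda>m x::'a. exp (\<i> * complex_of_real (x \<bullet> (\<theta> m *\<^sub>R e)))"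
  let ?c = "\<lambda>m. c m * (\<i> * complex_of_real (\<theta> m)) ^ length l"
  have "((\<lambda>x. ?P * (\<Sum>m\<in>I. ?c m * ?E m x)) has_derivative
     (\<lambda>w. ?P * (\<Sum>m\<in>I. ?c m * (\<i> * complex_of_real (w \<bullet> (\<theta> m *\<^sub>R e)) * ?E m x)))) (at x)" for x
    by (intro has_derivative_mult_right has_derivative_sum has_derivative_cis_inner)
  then have "dir_deriv v (\<lambda>x. ?P * (\<Sum>m\<in>I. ?c m * ?E m x)) = (\<lambda>x. ?P * (\<Sum>m\<in>I. ?c m * (\<i> * complex_of_real (v \<bullet> (\<theta> m *\<^sub>R e)) * ?E m x)))"
    by (rule dir_deriv_eqI)
  then show ?case unfolding iD_Cons Cons by (simp add: sum_distrib_left mult_ac)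
qed

lemma smooth_trig_sum:
  fixes e :: "'a::euclidean_space"
  assumes "finite I"
  shows "smooth (\<lambda>x. \<Sum>m\<in>I. c m * exp (\<i> * complex_of_real (x \<bullet> (\<theta> m *\<^sub>R e))))"
  by (intro smooth_sum assms smooth_cmult smooth_cis_inner)

section \<open>Rudin-Shapiro functions on Euclidean space\<close>

definition rs_fun :: "real ^ 'n \<Rightarrow> nat \<Rightarrow> real \<Rightarrow> real ^ 'n \<Rightarrow> complex" where
  "rs_fun e p L x = (\<Sum>m<2 ^ p. (fst (rs p) m / complex_of_real (sqrt 2 ^ p)) * exp (\<i> * complex_of_real (x \<bullet> ((real m * L) *\<^sub>R e))))"

text \<open>The normalisation cancels the factor \<open>sqrt 2 ^ p\<close> of
  \<open>rs_bound\<close>, so a derivative costs only the highest frequency L 2^p, up to constants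
  that depend neither on p nor on L.\<close>

lemma rs_fun_Fam:
  fixes e :: "real ^ 'n::finite" and p :: "'j \<Rightarrow> nat" and L Y :: "'j \<Rightarrow> real"
  assumes e: "norm e = 1" and L: "\<And>j. 0 \<le> L j" and Y: "\<And>j. L j * 2 ^ p j \<le> \<kappa> * Y j" and \<kappa>: "0 \<le> \<kappa>" and Y0: "\<And>j. 0 \<le> Y j"
  shows "Fam (\<lambda>_ _. 1) (\<lambda>_ j _. Y j) (\<lambda>j. rs_fun e (p j) (L j))"
proof (rule FamI)
  show "smooth (rs_fun e (p j) (L j))" for j unfolding rs_fun_def[abs_def] by (rule smooth_trig_sum) simp
  fix l assume l: "l \<in> lists (Basis :: (real ^ 'n) set)"
  let ?b = "length l"
  obtain K where K: "0 \<le> K" "\<And>p t. norm (trig (fst (rs p)) p ?b t) \<le> K * (sqrt 2 ^ p * 2 ^ (p * ?b))"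
    using rs_bound[of ?b] by blast
  have prod1: "norm (prod_list (map (\<lambda>v. complex_of_real (v \<bullet> e)) l)) \<le> 1"
    using l
  proof (induction l)
    case (Cons v l)
    then have "\<bar>e \<bullet> v\<bar> \<le> norm e" by (intro Basis_le_norm) auto
    then show ?case using Cons e by (simp add: norm_mult inner_commute[of v e] mult_le_one)
  qed simp
  have "norm (iD l (rs_fun e (p j) (L j)) x) \<le> (K * \<kappa> ^ ?b) * (1 * prod_list (map (\<lambda>v. Y j) l))" for j x
  proof -
    let ?t = "L j * (x \<bullet> e)"
    let ?s = "sqrt 2 ^ p j :: real"
    have "(\<Sum>m<2 ^ p j. (fst (rs (p j)) m / complex_of_real ?s) * (\<i> * complex_of_real (real m * L j)) ^ ?b * exp (\<i> * complex_of_real (x \<bullet> ((real m * L j) *\<^sub>R e))))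
      = (\<i> * complex_of_real (L j)) ^ ?b / complex_of_real ?s * trig (fst (rs (p j))) (p j) ?b ?t"
      unfolding trig_def sum_distrib_left
      by (intro sum.cong refl) (simp add: power_mult_distrib mult_ac)
    then have "iD l (rs_fun e (p j) (L j)) x = prod_list (map (\<lambda>v. complex_of_real (v \<bullet> e)) l) * ((\<i> * complex_of_real (L j)) ^ ?b / complex_of_real ?s * trig (fst (rs (p j))) (p j) ?b ?t)"
      unfolding rs_fun_def[abs_def] iD_trig_sum[OF finite_lessThan] by simp
    then have "norm (iD l (rs_fun e (p j) (L j)) x) = norm (prod_list (map (\<lambda>v. complex_of_real (v \<bullet> e)) l)) *
        norm ((\<i> * complex_of_real (L j)) ^ ?b / complex_of_real ?s * trig (fst (rs (p j))) (p j) ?b ?t)"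
      by (simp only: norm_mult[of "prod_list _"])
    also have "\<dots> \<le> 1 * norm ((\<i> * complex_of_real (L j)) ^ ?b / complex_of_real ?s * trig (fst (rs (p j))) (p j) ?b ?t)"
      by (intro mult_right_mono prod1 norm_ge_zero)
    also have "\<dots> = L j ^ ?b / ?s * norm (trig (fst (rs (p j))) (p j) ?b ?t)"
      using L[of j] by (simp add: norm_mult norm_divide norm_power)
    also have "\<dots> \<le> L j ^ ?b / ?s * (K * (?s * 2 ^ (p j * ?b)))"
      using L[of j] K(2) by (intro mult_left_mono) auto
    also have "\<dots> = K * (L j * 2 ^ p j) ^ ?b" by (simp add: power_mult_distrib power_mult)
    also have "\<dots> \<le> K * (\<kappa> * Y j) ^ ?b" using K L[of j] Y by (intro mult_left_mono power_mono) auto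
    finally show ?thesis by (simp add: prod_list_const power_mult_distrib mult_ac)
  qed
  then show "\<exists>C\<ge>0. \<forall>j x. norm (iD l (rs_fun e (p j) (L j)) x) \<le> C * (1 * prod_list (map (\<lambda>v. Y j) l))"
    using K \<kappa> by (intro exI[of _ "K * \<kappa> ^ ?b"]) simp
qed

section \<open>Coefficients and autocorrelation\<close>

definition rs_coeff :: "nat \<Rightarrow> int \<Rightarrow> complex" where
  "rs_coeff p m = fst (rs p) (nat m) / complex_of_real (sqrt 2 ^ p)"

text \<open>The coefficient of the frequency j L in the squared modulus of \<open>rs_fun\<close>.
  Negative j occur, which is why the coefficients are indexed by integers.\<close>

definition autocorr :: "nat \<Rightarrow> int \<Rightarrow> complex" where
  "autocorr p j = (\<Sum>y\<in>{y \<in> {..<2 ^ p} \<times> {..<2 ^ p}. int (fst y) - int (snd y) = j}. rs_coeff p (int (fst y)) * cnj (rs_coeff p (int (snd y))))"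

lemma norm_rs_coeff: "norm (rs_coeff p m) = (2 ^ p) powr (- (1 / 2))"
proof -
  have "(sqrt 2 :: real) ^ p = (2 ^ p) powr (1 / 2)" by (simp add: real_sqrt_power powr_half_sqrt)
  then show ?thesis by (simp add: rs_coeff_def norm_divide rs_norm norm_power powr_minus_divide del: of_real_power)
qed

lemma rs_coeff_sum:
  assumes q: "0 < q"
  shows "(\<Sum>m\<in>int ` {..<2 ^ p}. norm (rs_coeff p m) powr q) powr (1 / q) = (2 ^ p) powr (1 / q - 1 / 2)"
proof -
  have "(\<Sum>m\<in>int ` {..<2 ^ p}. norm (rs_coeff p m) powr q) = 2 ^ p * (2 ^ p) powr (- (q / 2))"
    by (simp add: norm_rs_coeff powr_powr card_image)
  also have "\<dots> = (2 ^ p) powr (1 - q / 2)" by (simp add: powr_mult_base)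
  also have "\<dots> powr (1 / q) = (2 ^ p) powr (1 / q - 1 / 2)" using q by (simp add: powr_powr field_simps)
  finally show ?thesis .
qed

lemma autocorr_0: "autocorr p 0 = 1"
proof -
  have "autocorr p 0 = (\<Sum>y\<in>(\<lambda>m. (m, m)) ` {..<2 ^ p}. rs_coeff p (int (fst y)) * cnj (rs_coeff p (int (snd y))))"
    unfolding autocorr_def by (rule sum.cong) auto
  also have "\<dots> = (\<Sum>m<2 ^ p. rs_coeff p (int m) * cnj (rs_coeff p (int m)))"
    by (subst sum.reindex) (auto simp: inj_on_def)
  also have "\<dots> = (\<Sum>m<(2::nat) ^ p. complex_of_real (1 / 2 ^ p))"
  proof (rule sum.cong[OF refl])
    fix m :: nat
    have "(norm (rs_coeff p (int m)))\<^sup>2 = 1 / 2 ^ p"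
      by (simp add: norm_rs_coeff powr_minus_divide power_divide powr_half_sqrt)
    then show "rs_coeff p (int m) * cnj (rs_coeff p (int m)) = complex_of_real (1 / 2 ^ p)"
      by (simp only: complex_norm_square[symmetric])
  qed
  also have "\<dots> = 1" by simp
  finally show ?thesis .
qed

lemma rs_fun_coeff:
  "rs_fun e p L x = (\<Sum>m<2 ^ p. rs_coeff p (int m) * exp (\<i> * complex_of_real (x \<bullet> ((real m * L) *\<^sub>R e))))"
  by (simp add: rs_fun_def rs_coeff_def)

lemma exp_inner_mult:
  "exp (\<i> * complex_of_real (x \<bullet> (s *\<^sub>R e))) * exp (\<i> * complex_of_real (x \<bullet> (t *\<^sub>R e))) = exp (\<i> * complex_of_real (x \<bullet> ((s + t) *\<^sub>R e)))"
  by (simp add: exp_add[symmetric] algebra_simps)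

lemma rs_fun_shift:
  "rs_fun e p L x * exp (\<i> * complex_of_real (x \<bullet> (R *\<^sub>R e)))
    = (\<Sum>m\<in>int ` {..<2 ^ p}. rs_coeff p m * exp (\<i> * complex_of_real (x \<bullet> ((R + real_of_int m * L) *\<^sub>R e))))"
proof -
  have "rs_fun e p L x * exp (\<i> * complex_of_real (x \<bullet> (R *\<^sub>R e)))
      = (\<Sum>m<2 ^ p. rs_coeff p (int m) * exp (\<i> * complex_of_real (x \<bullet> ((R + real m * L) *\<^sub>R e))))"
    unfolding rs_fun_coeff sum_distrib_right mult.assoc exp_inner_mult by (simp only: add.commute)
  also have "\<dots> = (\<Sum>m\<in>int ` {..<2 ^ p}. rs_coeff p m * exp (\<i> * complex_of_real (x \<bullet> ((R + real_of_int m * L) *\<^sub>R e))))"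
    by (subst sum.reindex) (auto simp: inj_on_def)
  finally show ?thesis .
qed

text \<open>The pairs of frequencies are sorted by their difference j. The differences
  \<open>- (2 ^ p)\<close> and \<open>2 ^ p\<close> are not attained and contribute empty
  sums.\<close>

lemma rs_fun_cnj:
  "cnj (rs_fun e p L x) * (\<Sum>m\<in>int ` {..<2 ^ p}. rs_coeff p m * exp (\<i> * complex_of_real (x \<bullet> ((R + real_of_int m * L) *\<^sub>R e))))
    = (\<Sum>j\<in>{- (2 ^ p)..2 ^ p}. autocorr p j * exp (\<i> * complex_of_real (x \<bullet> ((R + real_of_int j * L) *\<^sub>R e))))"
proof -
  let ?E = "\<lambda>t. exp (\<i> * complex_of_real (x \<bullet> (t *\<^sub>R e)))"
  let ?P = "{..<2 ^ p} \<times> {..<2 ^ p} :: (nat \<times> nat) set"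
  let ?g = "\<lambda>y. int (fst y) - int (snd y)"
  let ?c = "\<lambda>y. rs_coeff p (int (fst y)) * cnj (rs_coeff p (int (snd y)))"
  have cE: "cnj (?E t) = ?E (- t)" for t by (simp add: exp_cnj)
  have "cnj (rs_fun e p L x) * (\<Sum>m\<in>int ` {..<2 ^ p}. rs_coeff p m * ?E (R + real_of_int m * L))
      = (\<Sum>m<2 ^ p. rs_coeff p (int m) * ?E (R + real m * L)) * (\<Sum>m'<2 ^ p. cnj (rs_coeff p (int m')) * ?E (- (real m' * L)))"
    unfolding rs_fun_coeff cnj_sum complex_cnj_mult cE
    by (subst sum.reindex) (auto simp: inj_on_def mult.commute)
  also have "\<dots> = (\<Sum>y\<in>?P. ?c y * ?E (R + real_of_int (?g y) * L))"
    unfolding sum_product sum.cartesian_product case_prod_beta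
  proof (rule sum.cong[OF refl])
    fix y :: "nat \<times> nat"
    have arg: "R + real (fst y) * L + - (real (snd y) * L) = R + real_of_int (?g y) * L" by (simp add: left_diff_distrib)
    have swap: "u * v * (u' * v') = u * u' * (v * v')" for u v u' v' :: complex by (simp only: mult_ac)
    show "rs_coeff p (int (fst y)) * ?E (R + real (fst y) * L) * (cnj (rs_coeff p (int (snd y))) * ?E (- (real (snd y) * L)))
        = ?c y * ?E (R + real_of_int (?g y) * L)"
      unfolding swap exp_inner_mult arg ..
  qed
  also have "\<dots> = (\<Sum>j\<in>{- (2 ^ p)..2 ^ p}. \<Sum>y\<in>{y \<in> ?P. ?g y = j}. ?c y * ?E (R + real_of_int (?g y) * L))"
  proof (rule sum.group[symmetric])
    show "?g ` ?P \<subseteq> {- (2 ^ p)..2 ^ p}"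
    proof
      fix j assume "j \<in> ?g ` ?P"
      then obtain m m' :: nat where m: "m < 2 ^ p" "m' < 2 ^ p" "j = int m - int m'" by auto
      have "int m < int (2 ^ p)" "int m' < int (2 ^ p)" using m(1,2) by (simp_all only: of_nat_less_iff)
      then have "int m < 2 ^ p" "int m' < 2 ^ p" by simp_all
      then show "j \<in> {- (2 ^ p)..2 ^ p}" unfolding m(3) atLeastAtMost_iff by linarith
    qed
  qed auto
  also have "\<dots> = (\<Sum>j\<in>{- (2 ^ p)..2 ^ p}. autocorr p j * ?E (R + real_of_int j * L))"
    unfolding autocorr_def sum_distrib_right by (intro sum.cong refl) auto
  finally show ?thesis .
qed

section \<open>Unit balls, the covering, and plateau functions\<close>

context alpha_setting
begin

text \<open>The only indices k for which \<eta>_k can be nonzero somewhere on a bump of radius 1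
  centred at z.\<close>

definition hit :: "real ^ 'n \<Rightarrow> (int ^ 'n) set" where
  "hit z = {k. \<exists>\<xi>. norm (\<xi> - z) \<le> 1 \<and> ball_at k \<xi>}"

lemma hit_subset:
  assumes "k0 \<in> hit z" shows "hit z \<subseteq> (+) k0 ` lattice_ball K0"
proof
  fix k assume "k \<in> hit z"
  then obtain \<xi> where \<xi>: "norm (\<xi> - z) \<le> 1" "ball_at k \<xi>" by (auto simp: hit_def)
  obtain \<xi>0 where \<xi>0: "norm (\<xi>0 - z) \<le> 1" "ball_at k0 \<xi>0" using assms by (auto simp: hit_def)
  have "norm (\<xi> - \<xi>0) \<le> 2" using norm_triangle_ineq4[of "\<xi> - z" "\<xi>0 - z"] \<xi>(1) \<xi>0(1) by simp
  from ball_near[OF \<xi>(2) \<xi>0(2) this] show "k \<in> (+) k0 ` lattice_ball K0"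
    by (intro image_eqI[of _ _ "k - k0"]) auto
qed

lemma finite_hit: "finite (hit z)"
proof (cases "hit z = {}")
  case False
  then obtain k0 where "k0 \<in> hit z" by auto
  then show ?thesis by (rule finite_subset[OF hit_subset]) (simp add: finite_lattice_ball)
qed simp

lemma card_hit: "card (hit z) \<le> card (lattice_ball K0 :: (int ^ 'n) set)"
proof (cases "hit z = {}")
  case False
  then obtain k0 where "k0 \<in> hit z" by auto
  then have "card (hit z) \<le> card ((+) k0 ` (lattice_ball K0 :: (int ^ 'n) set))"
    by (intro card_mono hit_subset finite_imageI finite_lattice_ball)
  then show ?thesis by (simp add: card_image)
qed simp

lemma sum_hit: assumes "norm (\<xi> - z) \<le> 1" shows "(\<Sum>k\<in>hit z. \<eta> k \<xi>) = 1"
proof -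
  have "((\<lambda>k. \<eta> k \<xi>) has_sum 1) UNIV" using part by (simp add: alpha_partition_def)
  moreover have "((\<lambda>k. \<eta> k \<xi>) has_sum 1) UNIV \<longleftrightarrow> ((\<lambda>k. \<eta> k \<xi>) has_sum 1) (hit z)"
    by (rule has_sum_cong_neutral) (use eta_support assms in \<open>auto simp: hit_def\<close>)
  ultimately show ?thesis using has_sum_finite[OF finite_hit] has_sum_unique by blast
qed

text \<open>A plateau function is a finite partial sum of the partition of unity.\<close>

lemma plateau:
  obtains \<theta> :: "real ^ 'n \<Rightarrow> complex" and B :: real where "\<theta> \<in> schwartz" "1 \<le> B"
    "\<And>\<xi>. norm \<xi> \<le> 1 \<Longrightarrow> \<theta> \<xi> = 1" "\<And>\<xi>. B < norm \<xi> \<Longrightarrow> \<theta> \<xi> = 0"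
proof -
  define \<theta> where "\<theta> \<xi> = (\<Sum>k\<in>hit 0. \<eta> k \<xi>)" for \<xi>
  define B where "B = Max (insert 1 ((\<lambda>k. norm (ctr a (int_vec k)) + C * r k) ` hit 0))"
  have B: "1 \<le> B" "\<And>k. k \<in> hit 0 \<Longrightarrow> norm (ctr a (int_vec k)) + C * r k \<le> B" using finite_hit by (auto simp: B_def)
  show ?thesis
  proof (rule that[of \<theta> B])
    show "\<theta> \<in> schwartz" unfolding \<theta>_def[abs_def] by (intro schwartz_sum finite_hit eta_schwartz)
    show "\<theta> \<xi> = 1" if "norm \<xi> \<le> 1" for \<xi> unfolding \<theta>_def by (rule sum_hit) (use that in simp)
    show "\<theta> \<xi> = 0" if "B < norm \<xi>" for \<xi>
      unfolding \<theta>_def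
    proof (intro sum.neutral ballI, rule ccontr)
      fix k assume k: "k \<in> hit 0" and "\<eta> k \<xi> \<noteq> 0"
      then have "norm (\<xi> - ctr a (int_vec k)) \<le> C * r k" using eta_support by (simp add: inball_def)
      then have "norm \<xi> \<le> norm (ctr a (int_vec k)) + C * r k" using norm_triangle_sub[of \<xi> "ctr a (int_vec k)"] by linarith
      then show False using B(2)[OF k] that by linarith
    qed
  qed (rule B)
qed

end

lemma plateau_Fam:
  fixes \<theta> :: "real ^ 'n::finite \<Rightarrow> complex"
  assumes \<theta>: "\<theta> \<in> schwartz" and supp: "\<And>\<xi>. B < norm \<xi> \<Longrightarrow> \<theta> \<xi> = 0"
  shows "Fam (\<lambda>_::unit. \<lambda>\<xi>. of_bool (norm \<xi> \<le> B)) (\<lambda>_ _ _. 1) (\<lambda>_. \<theta>)"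
proof (rule FamI)
  fix l assume l: "l \<in> lists (Basis :: (real ^ 'n) set)"
  obtain K where K: "K \<ge> 0" "\<And>(j::unit) \<xi>. norm (iD l \<theta> \<xi>) \<le> K * (rapid 0 j \<xi> * prod_list (map (\<lambda>v. 1) l))"
    by (rule Fam_bound_iD[OF schwartz_Fam[OF \<theta>, of 0] l]) (rule that)
  have z: "iD l \<theta> \<xi> = 0" if "B < norm \<xi>" for \<xi>
  proof -
    have "iD l \<theta> \<xi> = iD l (\<lambda>x. 0) \<xi>"
      by (rule iD_local[of "- cball 0 B"]) (use that supp in auto)
    then show ?thesis by (simp add: iD_zero)
  qed
  show "\<exists>C\<ge>0. \<forall>(j::unit) \<xi>. norm (iD l \<theta> \<xi>) \<le> C * (of_bool (norm \<xi> \<le> B) * prod_list (map (\<lambda>v. 1) l))"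
  proof (intro exI[of _ K] conjI allI K(1))
    show "norm (iD l \<theta> \<xi>) \<le> K * (of_bool (norm \<xi> \<le> B) * prod_list (map (\<lambda>v. 1) l))" for \<xi>
      using K(2)[where \<xi>=\<xi>] z[of \<xi>] by (cases "norm \<xi> \<le> B") (auto simp: prod_list_const)
  qed
qed (rule schwartz_smooth[OF \<theta>])

lemma iD_sum:
  assumes "finite I" "\<And>i. i \<in> I \<Longrightarrow> smooth (f i)"
  shows "iD l (\<lambda>x. \<Sum>i\<in>I. f i x) = (\<lambda>x. \<Sum>i\<in>I. iD l (f i) x)"
  using assms by (induction I rule: finite_induct) (simp_all add: iD_zero iD_add smooth_sum)

subsection \<open>Symbols with lacunary frequency support\<close>

text \<open>The amplitudes \<open>am\<close> stay abstract, so that one construction covers both the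
  polynomial and its conjugate. The plateau \<theta> is a parameter because it is built from the
  given partition.\<close>

locale lacunary =
  fixes e :: "real ^ 'n::finite" and l0 :: nat
    and \<theta> :: "real ^ 'n \<Rightarrow> complex" and B :: real
    and \<rho> \<delta> :: real and am :: "nat \<Rightarrow> real ^ 'n \<Rightarrow> complex"
  assumes e: "norm e = 1" and \<theta>: "\<theta> \<in> schwartz" and B: "1 \<le> B"
    and \<theta>1: "\<And>\<xi>. norm \<xi> \<le> 1 \<Longrightarrow> \<theta> \<xi> = 1" and \<theta>0: "\<And>\<xi>. B < norm \<xi> \<Longrightarrow> \<theta> \<xi> = 0"
    and \<rho>: "\<rho> \<le> 1" and \<delta>0: "0 \<le> \<delta>"
    and am: "Fam (\<lambda>_ _. 1) (\<lambda>_ l _. (4 ^ (l + l0)) powr \<delta>) am"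
begin

definition R :: "nat \<Rightarrow> real" where "R l = 4 ^ (l + l0)"

lemma R_ge1: "1 \<le> R l" and R_pos [simp]: "0 < R l" and R_nonneg [simp]: "0 \<le> R l"
  by (simp_all add: R_def)

definition near :: "nat \<Rightarrow> real ^ 'n \<Rightarrow> bool" where "near l \<xi> \<longleftrightarrow> norm (\<xi> - R l *\<^sub>R e) \<le> R l / 4"

lemma near_norm: assumes "near l \<xi>" shows "3 / 4 * R l \<le> norm \<xi>" "norm \<xi> \<le> 5 / 4 * R l"
proof -
  have n: "norm (R l *\<^sub>R e) = R l" using e by simp
  have nr: "norm (\<xi> - R l *\<^sub>R e) \<le> R l / 4" using assms by (simp add: near_def)
  have "norm (R l *\<^sub>R e) \<le> norm \<xi> + norm (\<xi> - R l *\<^sub>R e)" by (metis norm_minus_commute norm_triangle_sub)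
  then show "3 / 4 * R l \<le> norm \<xi>" using nr unfolding n by argo
  have "norm \<xi> \<le> norm (R l *\<^sub>R e) + norm (\<xi> - R l *\<^sub>R e)" by (rule norm_triangle_sub)
  then show "norm \<xi> \<le> 5 / 4 * R l" using nr unfolding n by argo
qed

text \<open>The norm of \<xi> lies between 3/4 and 5/4 of R_l. Consecutive R_l differ by the factor
  4, which exceeds 5/3, so these shells are disjoint.\<close>

lemma near_unique: assumes "near l \<xi>" "near l' \<xi>" shows "l = l'"
proof -
  have *: "\<not> l < l'" if "near l \<xi>" "near l' \<xi>" for l l'
  proof
    assume "l < l'"
    then have "4 * R l \<le> R l'"
      unfolding R_def using power_increasing[of "Suc (l + l0)" "l' + l0" "4::real"] by simp
    moreover have "3 / 4 * R l' \<le> 5 / 4 * R l" using near_norm(1)[OF that(2)] near_norm(2)[OF that(1)] by linarith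
    ultimately show False using R_pos[of l] by linarith
  qed
  then show ?thesis using assms by (meson linorder_neqE_nat)
qed

text \<open>A cutoff about R_l e that is 1 up to the distance R_l / (4 B) and 0 beyond R_l / 4. The
  argument is spelt out as an affine map to match \<open>Fam_scaled\<close>.\<close>

definition \<psi> :: "nat \<Rightarrow> real ^ 'n \<Rightarrow> complex" where
  "\<psi> l \<xi> = \<theta> ((4 * B / R l) *\<^sub>R \<xi> + - ((4 * B / R l) *\<^sub>R (R l *\<^sub>R e)))"

lemma psi_arg: "norm ((4 * B / R l) *\<^sub>R \<xi> + - ((4 * B / R l) *\<^sub>R (R l *\<^sub>R e))) = 4 * B / R l * norm (\<xi> - R l *\<^sub>R e)"
proof -
  have "(4 * B / R l) *\<^sub>R \<xi> + - ((4 * B / R l) *\<^sub>R (R l *\<^sub>R e)) = (4 * B / R l) *\<^sub>R (\<xi> - R l *\<^sub>R e)"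
    by (simp add: scaleR_diff_right)
  then show ?thesis using B R_pos[of l] by simp
qed

lemma psi_1:
  assumes "norm (\<xi> - R l *\<^sub>R e) \<le> R l / (4 * B)" shows "\<psi> l \<xi> = 1"
  unfolding \<psi>_def
  by (rule \<theta>1, unfold psi_arg) (use assms B R_pos[of l] in \<open>simp add: field_simps\<close>)

lemma psi_0:
  assumes "\<not> near l \<xi>" shows "\<psi> l \<xi> = 0"
  unfolding \<psi>_def
  by (rule \<theta>0, unfold psi_arg) (use assms B R_pos[of l] in \<open>simp add: near_def field_simps\<close>)

lemma psi_Fam: "Fam (\<lambda>l \<xi>. of_bool (near l \<xi>)) (\<lambda>_ l _. 4 * B / R l) \<psi>"
proof -
  have "Fam (\<lambda>l \<xi>. of_bool (norm ((4 * B / R l) *\<^sub>R \<xi> + - ((4 * B / R l) *\<^sub>R (R l *\<^sub>R e))) \<le> B)) (\<lambda>_ l _. \<bar>4 * B / R l\<bar>) \<psi>"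
    unfolding \<psi>_def[abs_def] by (rule Fam_scaled[OF plateau_Fam[OF \<theta> \<theta>0]])
  moreover have "norm ((4 * B / R l) *\<^sub>R \<xi> + - ((4 * B / R l) *\<^sub>R (R l *\<^sub>R e))) \<le> B \<longleftrightarrow> near l \<xi>" for l \<xi>
    unfolding psi_arg near_def using B R_pos[of l] by (simp add: field_simps)
  moreover have "\<bar>4 * B / R l\<bar> = 4 * B / R l" for l using B by (simp add: abs_of_nonneg)
  ultimately show ?thesis by (simp only:)
qed

definition bl :: "nat \<Rightarrow> (real ^ 'n) \<times> (real ^ 'n) \<Rightarrow> complex" where
  "bl l z = am l (fst z) * \<psi> l (snd z)"

abbreviation mw :: "(real ^ 'n) \<times> (real ^ 'n) \<Rightarrow> 'j \<Rightarrow> (real ^ 'n) \<times> (real ^ 'n) \<Rightarrow> real" where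
  "mw \<equiv> xw (\<lambda>_ z. bracket (snd z) powr \<delta>) (\<lambda>_ z. bracket (snd z) powr (- \<rho>))"

lemma mw_nonneg: "0 \<le> mw b j z"
  by (simp add: xw_def)

text \<open>On the support |\<xi>| is of the size R_l. Thus R_l^\<delta> is an admissible cost in x,
  and the gain 1 / R_l in the frequency is at least as good as the power - \<rho>, since \<rho>
  \<le> 1. The constants come from R_l \<le> 4/3 times the bracket and the bracket \<le> 3
  R_l.\<close>

lemma bl_Fam: "Fam (\<lambda>l z. of_bool (near l (snd z))) mw bl"
proof -
  let ?m = "xw (\<lambda>l (_::(real ^ 'n) \<times> (real ^ 'n)). R l powr \<delta>) (\<lambda>l _. 4 * B / R l)"
  have mn: "0 \<le> ?m b j z" for b j z using B by (simp add: xw_def)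
  have "Fam (\<lambda>_ _. 1) (\<lambda>_ l _. R l powr \<delta>) am" using am by (simp add: R_def)
  then have F1: "Fam (\<lambda>_ _. 1) ?m (\<lambda>l z. am l (fst z))"
    by (rule Fam_fst) (use B in auto)
  have F2: "Fam (\<lambda>l z. of_bool (near l (snd z))) ?m (\<lambda>l z. \<psi> l (snd z))"
    by (rule Fam_snd[OF psi_Fam]) (use B in auto)
  have F3: "Fam (\<lambda>l z. 1 * of_bool (near l (snd z))) ?m bl"
    unfolding bl_def[abs_def] by (rule Fam_mult[OF F1 F2]) (auto simp: mn)
  let ?K = "max ((4 / 3) powr \<delta>) (12 * B)"
  show ?thesis
  proof (rule Fam_mono[OF F3, where K="?K"])
    fix b l and z :: "(real ^ 'n) \<times> (real ^ 'n)"
    assume "1 * of_bool (near l (snd z)) \<noteq> (0::real)"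
    then have nr: "near l (snd z)" by (simp add: of_bool_def split: if_splits)
    note nn = near_norm[OF nr]
    have br: "R l \<le> 4 / 3 * bracket (snd z)" using nn(1) by (simp add: bracket_def)
    have "R l powr \<delta> \<le> (4 / 3 * bracket (snd z)) powr \<delta>" using br \<delta>0 R_pos[of l] by (intro powr_mono2) auto
    also have "\<dots> = (4 / 3) powr \<delta> * bracket (snd z) powr \<delta>" by (rule powr_mult)
    also have "\<dots> \<le> ?K * bracket (snd z) powr \<delta>" by (intro mult_right_mono) auto
    finally have x: "R l powr \<delta> \<le> ?K * bracket (snd z) powr \<delta>" .
    have br2: "bracket (snd z) \<le> 3 * R l" using nn(2) R_ge1[of l] by (simp add: bracket_def)
    have "1 / R l \<le> 3 * (1 / bracket (snd z))" using br2 by (simp add: field_simps)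
    also have "1 / bracket (snd z) \<le> bracket (snd z) powr (- \<rho>)"
      using powr_mono[of "-1" "- \<rho>" "bracket (snd z)"] \<rho> bracket_ge1[of "snd z"] by (simp add: powr_minus_divide)
    finally have "1 / R l \<le> 3 * bracket (snd z) powr (- \<rho>)" by simp
    then have "4 * B * (1 / R l) \<le> 4 * B * (3 * bracket (snd z) powr (- \<rho>))" using B by (intro mult_left_mono) auto
    also have "\<dots> = 12 * B * bracket (snd z) powr (- \<rho>)" by simp
    also have "\<dots> \<le> ?K * bracket (snd z) powr (- \<rho>)" by (intro mult_right_mono) auto
    finally have \<xi>: "4 * B / R l \<le> ?K * bracket (snd z) powr (- \<rho>)" by simp
    show "?m b l z \<le> ?K * mw b l z" using x \<xi> by (simp add: xw_def)
    show "1 * of_bool (near l (snd z)) \<le> ?K * of_bool (near l (snd z))" using B by (auto simp: of_bool_def)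
  qed (auto simp: mn mw_nonneg)
qed

text \<open>The index set has at most one element and is empty away from all scales, so no infinite
  series arises although the symbol contains infinitely many pieces.\<close>

definition sym :: "(real ^ 'n) \<times> (real ^ 'n) \<Rightarrow> complex" where
  "sym z = (\<Sum>l\<in>{l. near l (snd z)}. bl l z)"

lemma near_set: "near l \<xi> \<Longrightarrow> {l. near l \<xi>} = {l}"
  using near_unique by auto

lemma sym_near: "near l (snd z) \<Longrightarrow> sym z = bl l z"
  unfolding sym_def by (simp add: near_set)

lemma near_bound: "near l \<xi> \<Longrightarrow> real l \<le> 2 * norm \<xi>"
proof -
  assume n: "near l \<xi>"
  have "real l \<le> R l"
  proof -
    have "real l < 2 ^ l" by (rule of_nat_less_two_power)
    also have "(2::real) ^ l \<le> 4 ^ l" by (rule power_mono) auto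
    also have "(4::real) ^ l \<le> R l" unfolding R_def by (rule power_increasing) auto
    finally show ?thesis by simp
  qed
  then show ?thesis using near_norm(1)[OF n] norm_ge_zero[of \<xi>] by linarith
qed

text \<open>Bounded frequencies are near only finitely many R_l. Smoothness and derivatives are
  therefore read off from a finite sum.\<close>

lemma sym_local:
  fixes z0 :: "(real ^ 'n) \<times> (real ^ 'n)"
  obtains U N where "open U" "z0 \<in> U" "\<And>z. z \<in> U \<Longrightarrow> sym z = (\<Sum>l<N. bl l z)"
proof -
  let ?U = "{z :: (real ^ 'n) \<times> (real ^ 'n). norm (snd z) < norm (snd z0) + 1}"
  obtain N where N: "2 * (norm (snd z0) + 1) < real N" using reals_Archimedean2 by blast
  show ?thesis
  proof (rule that[of ?U N])
    show "open ?U" by (intro open_Collect_less continuous_intros)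
    show "z0 \<in> ?U" by simp
    fix z assume "z \<in> ?U"
    then have sub: "{l. near l (snd z)} \<subseteq> {..<N}" using near_bound[of _ "snd z"] N by fastforce
    show "sym z = (\<Sum>l<N. bl l z)"
      unfolding sym_def by (rule sum.mono_neutral_left[OF _ sub]) (auto simp: bl_def psi_0)
  qed
qed

lemma bl_smooth: "smooth (bl l)"
  by (rule Fam_smooth[OF bl_Fam])

lemma sym_symbol: "sym \<in> symbol_class 0 \<rho> \<delta>"
  unfolding symbol_class_Fam
proof (rule FamI)
  show "smooth sym"
  proof (rule smooth_local)
    fix z0
    obtain U N where U: "open U" "z0 \<in> U" "\<And>z. z \<in> U \<Longrightarrow> sym z = (\<Sum>l<N. bl l z)" by (rule sym_local) (rule that)
    then show "\<exists>U g. open U \<and> z0 \<in> U \<and> smooth g \<and> (\<forall>y\<in>U. sym y = g y)"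
      by (intro exI[of _ U] exI[of _ "\<lambda>z. \<Sum>l<N. bl l z"]) (auto intro!: smooth_sum bl_smooth)
  qed
  fix ds assume ds: "ds \<in> lists (Basis :: ((real ^ 'n) \<times> (real ^ 'n)) set)"
  obtain K where K: "K \<ge> 0" "\<And>l z. norm (iD ds (bl l) z) \<le> K * (of_bool (near l (snd z)) * prod_list (map (\<lambda>v. mw v l z) ds))"
    by (rule Fam_bound_iD[OF bl_Fam ds]) (rule that)
  have pn: "0 \<le> prod_list (map (\<lambda>v. mw v j z) ds)" for j :: 'j and z
    by (induction ds) (auto intro: mult_nonneg_nonneg mw_nonneg)
  have "norm (iD ds sym z0) \<le> K * (bracket (snd z0) powr 0 * prod_list (map (\<lambda>v. mw v () z0) ds))" for z0
  proof -
    obtain U N where U: "open U" "z0 \<in> U" "\<And>z. z \<in> U \<Longrightarrow> sym z = (\<Sum>l<N. bl l z)" by (rule sym_local) (rule that)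
    have pj: "prod_list (map (\<lambda>v. mw v l z0) ds) = prod_list (map (\<lambda>v. mw v () z0) ds)" for l :: nat
      by (simp add: xw_def)
    have "iD ds sym z0 = iD ds (\<lambda>z. \<Sum>l<N. bl l z) z0" by (rule iD_local[OF U(1,3,2)])
    also have "\<dots> = (\<Sum>l<N. iD ds (bl l) z0)" by (subst iD_sum) (auto simp: bl_smooth)
    also have "norm \<dots> \<le> (\<Sum>l<N. K * (of_bool (near l (snd z0)) * prod_list (map (\<lambda>v. mw v l z0) ds)))"
      by (rule order_trans[OF norm_sum sum_mono]) (rule K(2))
    also have "\<dots> = (\<Sum>l<N. K * (of_bool (near l (snd z0)) * prod_list (map (\<lambda>v. mw v () z0) ds)))"
      by (simp only: pj)
    also have "\<dots> = (\<Sum>l<N. of_bool (near l (snd z0))) * (K * prod_list (map (\<lambda>v. mw v () z0) ds))"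
      unfolding sum_distrib_right by (simp only: mult_ac)
    \<comment> \<open>At most one scale is near the given frequency, so the bound does not grow with
      N, which depends on \<open>z0\<close>.\<close>
    also have "\<dots> \<le> 1 * (K * prod_list (map (\<lambda>v. mw v () z0) ds))"
    proof (intro mult_right_mono mult_nonneg_nonneg K pn)
      have "(\<Sum>l<N. of_bool (near l (snd z0))) = real (card {l\<in>{..<N}. near l (snd z0)})"
        by (simp add: of_bool_def sum.If_cases Int_def)
      also have "card {l\<in>{..<N}. near l (snd z0)} \<le> 1"
        by (rule card_le_Suc0_iff_eq[THEN iffD2, unfolded One_nat_def[symmetric]]) (auto dest: near_unique)
      finally show "(\<Sum>l<N. of_bool (near l (snd z0))) \<le> (1::real)" by simp
    qed
    finally show ?thesis by simp
  qed
  then show "\<exists>C\<ge>0. \<forall>(j::unit) z. norm (iD ds sym z) \<le> C * (bracket (snd z) powr 0 * prod_list (map (\<lambda>v. mw v j z) ds))"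
    using K(1) by (intro exI[of _ K]) simp
qed

text \<open>Where the cutoff is 1 the symbol does not depend on the frequency, so the operator acts
  on such functions as a plain multiplication.\<close>

lemma pdo_sym:
  assumes g: "g \<in> schwartz" and supp: "\<And>\<xi>. g \<xi> \<noteq> 0 \<Longrightarrow> norm (\<xi> - R l *\<^sub>R e) \<le> R l / (4 * B)"
  shows "pdo sym (inv_fourier g) x = am l x * inv_fourier g x"
proof -
  have "sym (x, \<xi>) * g \<xi> = am l x * g \<xi>" for \<xi>
  proof (cases "g \<xi> = 0")
    case False
    then have s: "norm (\<xi> - R l *\<^sub>R e) \<le> R l / (4 * B)" by (rule supp)
    also have "\<dots> \<le> R l / 4" using B R_pos[of l] by (intro divide_left_mono) auto
    finally have "near l (snd (x, \<xi>))" by (simp add: near_def)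
    then show ?thesis using psi_1[OF s] by (simp add: sym_near bl_def)
  qed simp
  then have "exp (\<i> * complex_of_real (x \<bullet> \<xi>)) * sym (x, \<xi>) * g \<xi> = am l x * (exp (\<i> * complex_of_real (x \<bullet> \<xi>)) * g \<xi>)" for \<xi>
    by (simp add: mult.assoc mult.left_commute)
  then show ?thesis
    unfolding pdo_def inv_fourier_def[of g] fourier_inv_fourier[OF g] by (simp only:) simp
qed

end

subsection \<open>Sums of separated bumps\<close>

definition bsum :: "(real ^ 'n \<Rightarrow> complex) \<Rightarrow> ('i \<Rightarrow> real ^ 'n) \<Rightarrow> 'i set \<Rightarrow> ('i \<Rightarrow> complex) \<Rightarrow> real ^ 'n \<Rightarrow> complex" where
  "bsum h z I c \<xi> = (\<Sum>m\<in>I. c m * h (\<xi> - z m))"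

lemma bsum_schwartz: "h \<in> schwartz \<Longrightarrow> finite I \<Longrightarrow> bsum h z I c \<in> schwartz"
  unfolding bsum_def[abs_def] by (intro schwartz_sum schwartz_cmult schwartz_shift)

lemma inv_fourier_shift:
  fixes h :: "real ^ 'n::finite \<Rightarrow> complex"
  assumes h: "h \<in> schwartz"
  shows "inv_fourier (\<lambda>\<xi>. h (\<xi> - p)) x = exp (\<i> * complex_of_real (x \<bullet> p)) * inv_fourier h x"
proof -
  have [measurable]: "h \<in> borel_measurable borel" by (rule schwartz_measurable[OF h])
  let ?g = "\<lambda>\<xi>. exp (\<i> * complex_of_real (x \<bullet> (\<xi> + p))) * h \<xi>"
  have "(\<integral>\<xi>. exp (\<i> * complex_of_real (x \<bullet> \<xi>)) * h (\<xi> - p) \<partial>lborel) = (\<integral>\<xi>. ?g (\<xi> - p) \<partial>lborel)" by simp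
  also have "\<dots> = (\<integral>\<xi>. ?g \<xi> \<partial>lborel)" using integral_lborel_shift[of ?g "- p"] by simp
  also have "\<dots> = (\<integral>\<xi>. exp (\<i> * complex_of_real (x \<bullet> p)) * (exp (\<i> * complex_of_real (x \<bullet> \<xi>)) * h \<xi>) \<partial>lborel)"
    by (simp add: inner_add_right distrib_left exp_add mult_ac)
  finally show ?thesis by (simp add: inv_fourier_def)
qed

lemma inv_fourier_bsum:
  fixes h :: "real ^ 'n::finite \<Rightarrow> complex"
  assumes h: "h \<in> schwartz" and I: "finite I"
  shows "inv_fourier (bsum h z I c) x = (\<Sum>m\<in>I. c m * exp (\<i> * complex_of_real (x \<bullet> z m))) * inv_fourier h x"
proof -
  have "inv_fourier (bsum h z I c) x = (\<Sum>m\<in>I. c m * inv_fourier (\<lambda>\<xi>. h (\<xi> - z m)) x)"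
    unfolding inv_fourier_eq_fourier bsum_def[abs_def]
    by (subst fourier_sum[OF I]) (auto intro!: schwartz_cmult schwartz_shift h simp: fourier_cmult sum_distrib_left mult_ac)
  then show ?thesis unfolding inv_fourier_shift[OF h] sum_distrib_right by (simp only: mult_ac)
qed

context alpha_setting
begin

text \<open>No ball sees two of the bumps, and each bump is seen by a bounded number of balls with
  nearly the same weight. The norm is therefore w times the \<ell>^q norm of the coefficients, up to
  a constant A that depends neither on the number of bumps nor on their positions.\<close>

lemma bump_norm:
  assumes h: "h \<in> schwartz" and supp: "\<And>\<xi>. h \<xi> \<noteq> 0 \<Longrightarrow> norm \<xi> \<le> 1" and pos: "0 < l2 h"
    and q: "1 < q" and K: "1 \<le> K"
  obtains A where "1 \<le> A"
    "\<And>(I :: 'i set) z c w. finite I \<Longrightarrow> (\<And>m m'. m \<in> I \<Longrightarrow> m' \<in> I \<Longrightarrow> m \<noteq> m' \<Longrightarrow> hit (z m) \<inter> hit (z m') = {}) \<Longrightarrow>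
       0 < w \<Longrightarrow> (\<And>m k. m \<in> I \<Longrightarrow> k \<in> hit (z m) \<Longrightarrow> w \<le> K * wt s k \<and> wt s k \<le> K * w) \<Longrightarrow>
       alpha_mod_norm \<eta> \<alpha> 2 (ennreal q) s (distr_of (inv_fourier (bsum h z I c)))
         \<le> ennreal (A * w * (\<Sum>m\<in>I. norm (c m) powr q) powr (1 / q)) \<and>
       ennreal (w / A * (\<Sum>m\<in>I. norm (c m) powr q) powr (1 / q))
         \<le> alpha_mod_norm \<eta> \<alpha> 2 (ennreal q) s (distr_of (inv_fourier (bsum h z I c)))"
proof -
  let ?P = "pl TYPE('n)"
  obtain H where H: "0 \<le> H" "\<And>k \<xi>. norm (\<eta> k \<xi>) \<le> H" by (rule eta_bounded) (rule that)
  \<comment> \<open>A bound for the number of balls that see one bump; the summand 1 makes it safe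
    to divide by.\<close>
  define N1 where "N1 = real (card (lattice_ball K0 :: (int ^ 'n) set)) + 1"
  have N1: "1 \<le> N1" "real (card (hit z)) \<le> N1" for z using card_hit[of z] by (simp_all add: N1_def)
  define U where "U = K * ?P * (H * l2 h)"
  define L where "L = ?P * l2 h / (K * N1)"
  have U: "0 \<le> U" and L: "0 < L" using H K pos N1 by (auto simp: U_def L_def intro!: mult_nonneg_nonneg less_imp_le[OF pl_pos] mult_pos_pos divide_pos_pos)
  define A where "A = max 1 (max (N1 powr (1 / q) * U) (1 / L))"
  have A: "1 \<le> A" "N1 powr (1 / q) * U \<le> A" "1 / L \<le> A" by (auto simp: A_def)
  then have A3: "1 / A \<le> L" using L by (simp add: field_simps)
  show ?thesis
  proof (rule that[OF A(1)])
    fix I :: "'i set" and z c w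
    assume I: "finite I" and sep: "\<And>m m'. m \<in> I \<Longrightarrow> m' \<in> I \<Longrightarrow> m \<noteq> m' \<Longrightarrow> hit (z m) \<inter> hit (z m') = {}"
      and w: "0 < w" and W: "\<And>m k. m \<in> I \<Longrightarrow> k \<in> hit (z m) \<Longrightarrow> w \<le> K * wt s k \<and> wt s k \<le> K * w"
    let ?F = "bsum h z I c"
    have F: "?F \<in> schwartz" by (rule bsum_schwartz[OF h I])
    define T where "T k = wt s k * l2 (piece (inv_fourier ?F) k)" for k
    have T0: "0 \<le> T k" for k by (simp add: T_def)
    have T: "T k = wt s k * (?P * l2 (\<lambda>\<xi>. \<eta> k \<xi> * ?F \<xi>))" for k
    proof -
      have "fourier (inv_fourier ?F) = ?F" using fourier_inv_fourier[OF F] by auto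
      then show ?thesis unfolding T_def piece_def by (simp add: l2_inv_fourier schwartz_mult eta_schwartz F)
    qed
    have nrm: "alpha_mod_norm \<eta> \<alpha> 2 (ennreal q) s (distr_of (inv_fourier ?F))
        = ennreal_powr (\<integral>\<^sup>+k. ennreal (T k powr q) \<partial>count_space UNIV) (1 / q)"
      unfolding T_def by (rule alpha_mod_norm_schwartz) (use F q in \<open>auto intro: inv_fourier_schwartz\<close>)
    have hit: "k \<in> hit (z m)" if "\<eta> k \<xi> \<noteq> 0" "h (\<xi> - z m) \<noteq> 0" for k \<xi> m
      using supp[OF that(2)] eta_support[OF that(1)] by (auto simp: hit_def)
    \<comment> \<open>By the separation only the m-th bump is visible in a ball that it
      hits.\<close>
    have Tm: "T k = wt s k * (?P * (norm (c m) * l2 (\<lambda>\<xi>. \<eta> k \<xi> * h (\<xi> - z m))))" if "m \<in> I" "k \<in> hit (z m)" for k m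
    proof -
      have "\<eta> k \<xi> * ?F \<xi> = c m * (\<eta> k \<xi> * h (\<xi> - z m))" for \<xi>
      proof -
        have "\<eta> k \<xi> * ?F \<xi> = (\<Sum>m'\<in>I. if m' = m then c m * (\<eta> k \<xi> * h (\<xi> - z m)) else 0)"
          unfolding bsum_def sum_distrib_left
          by (intro sum.cong refl) (use hit[of k \<xi>] sep that in \<open>fastforce simp: mult_ac\<close>)
        then show ?thesis using I that by (simp add: sum.delta)
      qed
      then show ?thesis unfolding T by (simp only: l2_cmult)
    qed
    have Tz: "T k = 0" if "\<And>m. m \<in> I \<Longrightarrow> k \<notin> hit (z m)" for k
    proof -
      have "\<eta> k \<xi> * ?F \<xi> = 0" for \<xi>
        unfolding bsum_def sum_distrib_left by (intro sum.neutral) (use hit[of k \<xi>] that in auto)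
      then show ?thesis unfolding T by (simp only: l2_def) simp
    qed
    have up: "T k \<le> U * w * norm (c m)" if "m \<in> I" "k \<in> hit (z m)" for k m
    proof -
      have "l2 (\<lambda>\<xi>. \<eta> k \<xi> * h (\<xi> - z m)) \<le> H * l2 (\<lambda>\<xi>. h (\<xi> - z m))"
        by (rule l2_mono_cmult) (auto intro!: schwartz_mult eta_schwartz schwartz_shift h H mult_right_mono simp: norm_mult)
      also have "\<dots> = H * l2 h" by (simp only: l2_shift[OF h])
      finally have 1: "l2 (\<lambda>\<xi>. \<eta> k \<xi> * h (\<xi> - z m)) \<le> H * l2 h" .
      have "T k \<le> (K * w) * (?P * (norm (c m) * (H * l2 h)))"
        unfolding Tm[OF that]
        by (intro mult_mono mult_left_mono 1 mult_nonneg_nonneg) (use W[OF that] K w in \<open>auto intro: less_imp_le\<close>)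
      then show ?thesis by (simp add: U_def mult_ac)
    qed
    define Q where "Q = (\<Sum>m\<in>I. norm (c m) powr q)"
    have Q0: "0 \<le> Q" unfolding Q_def by (intro sum_nonneg) auto
    have "(\<integral>\<^sup>+k. ennreal (T k powr q) \<partial>count_space UNIV)
        \<le> (\<integral>\<^sup>+k. (\<Sum>m\<in>I. ennreal ((U * w * norm (c m)) powr q) * indicator (hit (z m)) k) \<partial>count_space UNIV)"
    proof (rule nn_integral_mono)
      fix k
      show "ennreal (T k powr q) \<le> (\<Sum>m\<in>I. ennreal ((U * w * norm (c m)) powr q) * indicator (hit (z m)) k)"
      proof (cases "\<exists>m\<in>I. k \<in> hit (z m)")
        case True
        then obtain m where m: "m \<in> I" "k \<in> hit (z m)" by auto
        have "ennreal (T k powr q) \<le> ennreal ((U * w * norm (c m)) powr q) * indicator (hit (z m)) k"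
          using up[OF m] T0[of k] q m by (auto intro!: ennreal_leI powr_mono2)
        also have "\<dots> \<le> (\<Sum>m\<in>I. ennreal ((U * w * norm (c m)) powr q) * indicator (hit (z m)) k)"
          by (rule member_le_sum[OF m(1) _ I]) simp
        finally show ?thesis .
      qed (use Tz[of k] in auto)
    qed
    also have "\<dots> = (\<Sum>m\<in>I. ennreal ((U * w * norm (c m)) powr q) * ennreal (real (card (hit (z m)))))"
      by (simp add: nn_integral_sum nn_integral_cmult finite_hit ennreal_of_nat_eq_real_of_nat)
    also have "\<dots> \<le> (\<Sum>m\<in>I. ennreal ((U * w) powr q * N1 * norm (c m) powr q))"
    proof (rule sum_mono)
      fix m
      have "(U * w * norm (c m)) powr q * real (card (hit (z m))) \<le> (U * w * norm (c m)) powr q * N1"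
        by (intro mult_left_mono N1) auto
      also have "(U * w * norm (c m)) powr q = (U * w) powr q * norm (c m) powr q" by (rule powr_mult)
      finally show "ennreal ((U * w * norm (c m)) powr q) * ennreal (real (card (hit (z m)))) \<le> ennreal ((U * w) powr q * N1 * norm (c m) powr q)"
        by (simp add: ennreal_mult[symmetric] ennreal_leI mult_ac powr_mult)
    qed
    also have "\<dots> = ennreal ((U * w) powr q * N1 * Q)"
      unfolding Q_def sum_distrib_left by (rule sum_ennreal) (use N1 in auto)
    finally have "ennreal_powr (\<integral>\<^sup>+k. ennreal (T k powr q) \<partial>count_space UNIV) (1 / q)
        \<le> ennreal_powr (ennreal ((U * w) powr q * N1 * Q)) (1 / q)"
      by (rule ennreal_powr_mono) (use q in simp)
    also have "\<dots> = ennreal (N1 powr (1 / q) * U * w * Q powr (1 / q))"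
      using q U w N1 Q0 by (simp add: ennreal_powr_ennreal powr_mult powr_powr mult_ac)
    also have "\<dots> \<le> ennreal (A * w * Q powr (1 / q))"
      using A(2) w by (intro ennreal_leI mult_right_mono) auto
    finally have upper: "alpha_mod_norm \<eta> \<alpha> 2 (ennreal q) s (distr_of (inv_fourier ?F)) \<le> ennreal (A * w * Q powr (1 / q))"
      unfolding nrm .
    \<comment> \<open>Pigeonhole: the bump is the sum of at most N1 localised parts, so one of them
      carries at least the fraction 1 / N1 of its norm.\<close>
    have ex: "\<exists>k\<in>hit (z m). l2 h \<le> N1 * l2 (\<lambda>\<xi>. \<eta> k \<xi> * h (\<xi> - z m))" for m
    proof (rule ccontr)
      assume "\<not> ?thesis"
      then have less: "N1 * l2 (\<lambda>\<xi>. \<eta> k \<xi> * h (\<xi> - z m)) < l2 h" if "k \<in> hit (z m)" for k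
        using that by (auto simp: not_le)
      have eq: "h (\<xi> - z m) = (\<Sum>k\<in>hit (z m). \<eta> k \<xi> * h (\<xi> - z m))" for \<xi>
        using sum_hit[of \<xi> "z m"] supp[of "\<xi> - z m"] by (cases "h (\<xi> - z m) = 0") (auto simp flip: sum_distrib_right)
      have "l2 h = l2 (\<lambda>\<xi>. h (\<xi> - z m))" by (simp only: l2_shift[OF h])
      also have "\<dots> = l2 (\<lambda>\<xi>. \<Sum>k\<in>hit (z m). \<eta> k \<xi> * h (\<xi> - z m))" by (simp only: eq[symmetric])
      also have "\<dots> \<le> (\<Sum>k\<in>hit (z m). l2 (\<lambda>\<xi>. \<eta> k \<xi> * h (\<xi> - z m)))"
        by (intro l2_sum finite_hit schwartz_mult eta_schwartz schwartz_shift h)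
      finally have le: "l2 h \<le> (\<Sum>k\<in>hit (z m). l2 (\<lambda>\<xi>. \<eta> k \<xi> * h (\<xi> - z m)))" .
      with pos have ne: "hit (z m) \<noteq> {}" by auto
      have "(\<Sum>k\<in>hit (z m). l2 (\<lambda>\<xi>. \<eta> k \<xi> * h (\<xi> - z m))) < (\<Sum>k\<in>hit (z m). l2 h / N1)"
        by (rule sum_strict_mono[OF finite_hit ne]) (use less N1 in \<open>auto simp: field_simps\<close>)
      also have "\<dots> \<le> l2 h" using N1(2)[of "z m"] N1(1) pos by (simp add: field_simps)
      finally show False using le by simp
    qed
    then obtain kk where kk: "\<And>m. kk m \<in> hit (z m)" "\<And>m. l2 h \<le> N1 * l2 (\<lambda>\<xi>. \<eta> (kk m) \<xi> * h (\<xi> - z m))" by metis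
    have inj: "inj_on kk I"
    proof (rule inj_onI, rule ccontr)
      fix m m' assume "m \<in> I" "m' \<in> I" "kk m = kk m'" "m \<noteq> m'"
      then show False using sep[of m m'] kk(1)[of m] kk(1)[of m'] by auto
    qed
    have low: "L * w * norm (c m) \<le> T (kk m)" if "m \<in> I" for m
    proof -
      have 1: "w / K \<le> wt s (kk m)" using W[OF that kk(1)] K by (simp add: field_simps)
      have 2: "l2 h / N1 \<le> l2 (\<lambda>\<xi>. \<eta> (kk m) \<xi> * h (\<xi> - z m))" using kk(2)[of m] N1(1) by (simp add: field_simps)
      have "w / K * (?P * (norm (c m) * (l2 h / N1))) \<le> T (kk m)"
        unfolding Tm[OF that kk(1)]
        by (intro mult_mono mult_left_mono 1 2 mult_nonneg_nonneg) (use N1(1) w K in \<open>auto intro: less_imp_le\<close>)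
      then show ?thesis by (simp add: L_def field_simps)
    qed
    have "ennreal ((L * w) powr q * Q) = (\<Sum>m\<in>I. ennreal ((L * w) powr q * norm (c m) powr q))"
      unfolding Q_def sum_distrib_left by (rule sum_ennreal[symmetric]) auto
    also have "\<dots> \<le> (\<Sum>m\<in>I. ennreal (T (kk m) powr q))"
    proof (intro sum_mono ennreal_leI)
      fix m assume m: "m \<in> I"
      have "(L * w) powr q * norm (c m) powr q = (L * w * norm (c m)) powr q" by (rule powr_mult[symmetric])
      also have "\<dots> \<le> T (kk m) powr q" using low[OF m] L w q by (intro powr_mono2) auto
      finally show "(L * w) powr q * norm (c m) powr q \<le> T (kk m) powr q" .
    qed
    also have "\<dots> = (\<Sum>k\<in>kk ` I. ennreal (T k powr q))" by (simp add: sum.reindex[OF inj])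
    also have "\<dots> \<le> (\<integral>\<^sup>+k. ennreal (T k powr q) \<partial>count_space UNIV)"
      by (rule sum_le_nn_integral_count_space) (use I in simp)
    finally have "ennreal_powr (ennreal ((L * w) powr q * Q)) (1 / q)
        \<le> ennreal_powr (\<integral>\<^sup>+k. ennreal (T k powr q) \<partial>count_space UNIV) (1 / q)"
      by (rule ennreal_powr_mono) (use q in simp)
    moreover have "ennreal_powr (ennreal ((L * w) powr q * Q)) (1 / q) = ennreal (L * w * Q powr (1 / q))"
      using q L w Q0 by (simp add: ennreal_powr_ennreal powr_mult powr_powr)
    moreover have "ennreal (w / A * Q powr (1 / q)) \<le> ennreal (L * w * Q powr (1 / q))"
    proof (intro ennreal_leI mult_right_mono)
      show "w / A \<le> L * w" using mult_right_mono[OF A3, of w] w by simp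
    qed auto
    ultimately have lower: "ennreal (w / A * Q powr (1 / q)) \<le> alpha_mod_norm \<eta> \<alpha> 2 (ennreal q) s (distr_of (inv_fourier ?F))"
      unfolding nrm by simp
    show "alpha_mod_norm \<eta> \<alpha> 2 (ennreal q) s (distr_of (inv_fourier ?F))
         \<le> ennreal (A * w * (\<Sum>m\<in>I. norm (c m) powr q) powr (1 / q)) \<and>
       ennreal (w / A * (\<Sum>m\<in>I. norm (c m) powr q) powr (1 / q))
         \<le> alpha_mod_norm \<eta> \<alpha> 2 (ennreal q) s (distr_of (inv_fourier ?F))"
      using upper lower unfolding Q_def by blast
  qed
qed

text \<open>A ball that meets the unit ball about z with |z| < 2 R has radius of order at most
  R^\<alpha>, so it cannot reach a point at a large multiple of that distance.\<close>

lemma separation: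
  obtains \<kappa> where "1 \<le> \<kappa>"
    "\<And>R z z'. 1 \<le> R \<Longrightarrow> \<kappa> * R powr \<alpha> \<le> norm (z - z') \<Longrightarrow> norm z + 1 \<le> 2 * R \<Longrightarrow> hit z \<inter> hit z' = {}"
proof -
  obtain K where K: "1 \<le> K"
    "\<And>(x :: real ^ 'n) \<xi>. inball a C x \<xi> \<Longrightarrow> bracket \<xi> powr \<alpha> \<le> K * bracket x powr ((1 + a) * \<alpha>)"
    "\<And>(x :: real ^ 'n) \<xi>. inball a C x \<xi> \<Longrightarrow> bracket x powr ((1 + a) * \<alpha>) \<le> K * bracket \<xi> powr \<alpha>"
    by (rule inball_comparable[OF a0 C1', of \<alpha>]) (rule that)
  have a: "(1 + a) * \<alpha> = a" unfolding one_plus_a by (simp add: a_def)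
  show ?thesis
  \<comment> \<open>The first term bounds the diameter of such a ball, with 3 R a bound for the
    bracket of \<xi>. The two unit displacements add 2, and 3 in place of 2 makes the inequality
    strict.\<close>
  proof (rule that[of "2 * C * K * 3 powr \<alpha> + 3"])
    show "1 \<le> 2 * C * K * 3 powr \<alpha> + 3" using C0 K(1) by simp
    fix R :: real and z z' :: "real ^ 'n"
    assume R: "1 \<le> R" and far: "(2 * C * K * 3 powr \<alpha> + 3) * R powr \<alpha> \<le> norm (z - z')" and z: "norm z + 1 \<le> 2 * R"
    have R\<alpha>: "1 \<le> R powr \<alpha>" using R \<alpha>0 by (simp add: ge_one_powr_ge_zero)
    show "hit z \<inter> hit z' = {}"
    proof (rule equals0I)
      fix k assume "k \<in> hit z \<inter> hit z'"
      then obtain \<xi> \<xi>' where \<xi>: "norm (\<xi> - z) \<le> 1" "ball_at k \<xi>" and \<xi>': "norm (\<xi>' - z') \<le> 1" "ball_at k \<xi>'"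
        by (auto simp: hit_def)
      have "bracket \<xi> \<le> 3 * R" using norm_triangle_sub[of \<xi> z] \<xi>(1) z R unfolding bracket_def by argo
      then have "bracket \<xi> powr \<alpha> \<le> (3 * R) powr \<alpha>" using \<alpha>0 by (intro powr_mono2) auto
      also have "\<dots> = 3 powr \<alpha> * R powr \<alpha>" by (rule powr_mult)
      finally have "K * bracket \<xi> powr \<alpha> \<le> K * (3 powr \<alpha> * R powr \<alpha>)" using K(1) by (intro mult_left_mono) auto
      with K(3)[OF \<xi>(2)] have "r k \<le> K * (3 powr \<alpha> * R powr \<alpha>)" unfolding a rad_def by linarith
      then have rk: "C * r k \<le> C * (K * (3 powr \<alpha> * R powr \<alpha>))" using C0 by (intro mult_left_mono) auto
      have "norm (z - z') = norm ((\<xi> - ctr a (int_vec k)) - (\<xi>' - ctr a (int_vec k)) - (\<xi> - z) + (\<xi>' - z'))" by simp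
      also have "\<dots> \<le> norm (\<xi> - ctr a (int_vec k)) + norm (\<xi>' - ctr a (int_vec k)) + norm (\<xi> - z) + norm (\<xi>' - z')"
        by (intro order_trans[OF norm_triangle_ineq] order_trans[OF norm_triangle_ineq4] add_mono order_refl)
      also have "\<dots> \<le> C * r k + C * r k + 1 + 1" using \<xi> \<xi>' by (intro add_mono) (auto simp: inball_def)
      also have "\<dots> \<le> 2 * C * K * 3 powr \<alpha> * R powr \<alpha> + 2" using rk by (simp add: mult_ac)
      also have "\<dots> < (2 * C * K * 3 powr \<alpha> + 3) * R powr \<alpha>" using R\<alpha> by (simp add: distrib_right)
      finally show False using far by simp
    qed
  qed
qed

text \<open>A point within distance 1 of z has a bracket that agrees with R up to a factor 3 in both
  directions, for either sign of s.\<close>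

lemma weight_comparable:
  obtains K where "1 \<le> K"
    "\<And>R z k. 1 \<le> R \<Longrightarrow> R \<le> 2 * norm z \<Longrightarrow> norm z + 1 \<le> 2 * R \<Longrightarrow> k \<in> hit z \<Longrightarrow> R powr s \<le> K * wt s k \<and> wt s k \<le> K * R powr s"
proof -
  obtain K where K: "1 \<le> K"
    "\<And>(x :: real ^ 'n) \<xi>. inball a C x \<xi> \<Longrightarrow> bracket \<xi> powr s \<le> K * bracket x powr ((1 + a) * s)"
    "\<And>(x :: real ^ 'n) \<xi>. inball a C x \<xi> \<Longrightarrow> bracket x powr ((1 + a) * s) \<le> K * bracket \<xi> powr s"
    by (rule inball_comparable[OF a0 C1', of s]) (rule that)
  have a: "bracket (int_vec k) powr ((1 + a) * s) = wt s k" for k :: "int ^ 'n" unfolding one_plus_a wt_def by simp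
  let ?K = "3 powr \<bar>s\<bar>"
  have K1: "1 \<le> K * ?K" using mult_mono[OF K(1), of 1 ?K] K(1) by (simp add: ge_one_powr_ge_zero)
  show ?thesis
  proof (rule that[OF K1])
    fix R z k assume R: "1 \<le> R" and z: "R \<le> 2 * norm z" "norm z + 1 \<le> 2 * R" and "k \<in> hit z"
    then obtain \<xi> where \<xi>: "norm (\<xi> - z) \<le> 1" "ball_at k \<xi>" by (auto simp: hit_def)
    have u: "bracket \<xi> \<le> 3 * R" using norm_triangle_sub[of \<xi> z] \<xi>(1) z R unfolding bracket_def by argo
    have "norm z \<le> norm \<xi> + norm (\<xi> - z)" by (metis norm_minus_commute norm_triangle_sub)
    then have l: "R \<le> 3 * bracket \<xi>" using \<xi>(1) z norm_ge_zero[of \<xi>] unfolding bracket_def by argo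
    have "R powr s \<le> ?K * bracket \<xi> powr s" by (rule powr_comparable[OF _ _ l u]) (use R in auto)
    also have "\<dots> \<le> ?K * (K * wt s k)" using K(2)[OF \<xi>(2)] by (intro mult_left_mono) (auto simp: a)
    finally have 1: "R powr s \<le> K * ?K * wt s k" by (simp add: mult_ac)
    have "wt s k \<le> K * bracket \<xi> powr s" using K(3)[OF \<xi>(2)] by (simp add: a)
    also have "\<dots> \<le> K * (?K * R powr s)" using powr_comparable[OF _ _ u l, of s] R K(1) by (intro mult_left_mono) auto
    finally have 2: "wt s k \<le> K * ?K * R powr s" by (simp add: mult_ac)
    from 1 2 show "R powr s \<le> K * ?K * wt s k \<and> wt s k \<le> K * ?K * R powr s" by blast
  qed
qed

subsection \<open>The exact range of \<open>\<delta>\<close>\<close>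

lemma necessity:
  assumes q: "1 < q" "q \<noteq> 2" and \<delta>: "\<alpha> < \<delta>" "\<delta> < 1" and \<rho>: "\<rho> \<le> 1"
    and bdd: "\<And>\<sigma>. \<sigma> \<in> symbol_class 0 \<rho> \<delta> \<Longrightarrow> pdo_bounded \<eta> \<alpha> 2 (ennreal q) s \<sigma>"
  shows False
proof -
  let ?nrm = "\<lambda>f. alpha_mod_norm \<eta> \<alpha> 2 (ennreal q) s (distr_of f)"
  obtain \<theta> :: "real ^ 'n \<Rightarrow> complex" and B where \<theta>: "\<theta> \<in> schwartz" and B: "1 \<le> B"
    and \<theta>1: "\<And>\<xi>. norm \<xi> \<le> 1 \<Longrightarrow> \<theta> \<xi> = 1" and \<theta>0: "\<And>\<xi>. B < norm \<xi> \<Longrightarrow> \<theta> \<xi> = 0"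
    by (rule plateau) (rule that)
  obtain \<kappa> where \<kappa>: "1 \<le> \<kappa>"
    "\<And>R z z'. 1 \<le> R \<Longrightarrow> \<kappa> * R powr \<alpha> \<le> norm (z - z') \<Longrightarrow> norm z + 1 \<le> 2 * R \<Longrightarrow> hit z \<inter> hit z' = {}"
    by (rule separation) (rule that)
  obtain K where K: "1 \<le> K"
    "\<And>R z k. 1 \<le> R \<Longrightarrow> R \<le> 2 * norm z \<Longrightarrow> norm z + 1 \<le> 2 * R \<Longrightarrow> k \<in> hit z \<Longrightarrow> R powr s \<le> K * wt s k \<and> wt s k \<le> K * R powr s"
    by (rule weight_comparable[of s]) (rule that)
  \<comment> \<open>The dilation by B shrinks the support of the plateau into the unit ball, as
    \<open>bump_norm\<close> demands.\<close>
  define h where "h \<xi> = \<theta> (B *\<^sub>R \<xi> + 0)" for \<xi>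
  have h: "h \<in> schwartz" unfolding h_def[abs_def] by (rule schwartz_scaled[OF \<theta>]) (use B in simp)
  have supp: "norm \<xi> \<le> 1" if "h \<xi> \<noteq> 0" for \<xi>
  proof -
    have "norm (B *\<^sub>R \<xi> + 0) \<le> B" using \<theta>0[of "B *\<^sub>R \<xi> + 0"] that unfolding h_def by fastforce
    then show ?thesis using B by simp
  qed
  have hpos: "0 < l2 h"
  proof (rule l2_pos[OF h, of "1 / B"])
    show "h \<xi> = 1" if "norm \<xi> \<le> 1 / B" for \<xi>
      unfolding h_def by (rule \<theta>1) (use that B in \<open>simp add: field_simps\<close>)
  qed (use B in simp)
  obtain A where A: "1 \<le> A" and bump:
    "\<And>(I :: int set) z c w. finite I \<Longrightarrow> (\<And>m m'. m \<in> I \<Longrightarrow> m' \<in> I \<Longrightarrow> m \<noteq> m' \<Longrightarrow> hit (z m) \<inter> hit (z m') = {}) \<Longrightarrow>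
       0 < w \<Longrightarrow> (\<And>m k. m \<in> I \<Longrightarrow> k \<in> hit (z m) \<Longrightarrow> w \<le> K * wt s k \<and> wt s k \<le> K * w) \<Longrightarrow>
       ?nrm (inv_fourier (bsum h z I c)) \<le> ennreal (A * w * (\<Sum>m\<in>I. norm (c m) powr q) powr (1 / q)) \<and>
       ennreal (w / A * (\<Sum>m\<in>I. norm (c m) powr q) powr (1 / q)) \<le> ?nrm (inv_fourier (bsum h z I c))"
  proof (rule bump_norm[where 'i=int and s=s, OF h _ hpos q(1) K(1)], goal_cases)
    case (1 \<xi>)
    show ?case by (rule supp[OF 1(2)])
  next
    case (2 A)
    show ?case by (rule 2(1)) (fact 2)+
  qed
  \<comment> \<open>The scales start so high that the spread \<kappa> R^\<delta> of the bumps, plus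
    their radius 1, fits into the region where the cutoff is 1; see \<open>gap\<close>. This is
    possible because \<delta> < 1.\<close>
  obtain l0 where l0: "(4 * B * (\<kappa> + 1)) powr (1 / (1 - \<delta>)) < 4 ^ l0" using real_arch_pow[of 4] by auto
  define R :: "nat \<Rightarrow> real" where "R l = 4 ^ (l + l0)" for l
  have R: "1 \<le> R l" "0 < R l" for l by (simp_all add: R_def)
  have gap: "\<kappa> * R l powr \<delta> + 1 \<le> R l / (4 * B)" for l
  proof -
    have "(4::real) ^ l0 \<le> R l" unfolding R_def by (rule power_increasing) auto
    then have "(4 * B * (\<kappa> + 1)) powr (1 / (1 - \<delta>)) \<le> R l" using l0 by linarith
    then have "((4 * B * (\<kappa> + 1)) powr (1 / (1 - \<delta>))) powr (1 - \<delta>) \<le> R l powr (1 - \<delta>)" using \<delta> by (intro powr_mono2) auto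
    moreover have "((4 * B * (\<kappa> + 1)) powr (1 / (1 - \<delta>))) powr (1 - \<delta>) = 4 * B * (\<kappa> + 1)"
      using \<delta> B \<kappa>(1) by (simp add: powr_powr)
    ultimately have "4 * B * (\<kappa> + 1) \<le> R l powr (1 - \<delta>)" by simp
    then have "4 * B * (\<kappa> + 1) * R l powr \<delta> \<le> R l powr (1 - \<delta>) * R l powr \<delta>" by (intro mult_right_mono) auto
    also have "\<dots> = R l" using R(2)[of l] by (simp add: powr_add[symmetric])
    finally have "(\<kappa> + 1) * R l powr \<delta> \<le> R l / (4 * B)" using B by (simp add: field_simps)
    moreover have "1 \<le> R l powr \<delta>" using R \<delta> \<alpha>0 by (simp add: ge_one_powr_ge_zero)
    ultimately show ?thesis by (simp add: distrib_right)
  qed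
  \<comment> \<open>The number M of bumps is the largest power of two below R^(\<delta> - \<alpha>).
    Spaced by \<kappa> R^\<alpha> they spread over at most \<kappa> R^\<delta>, while M is unbounded
    in l.\<close>
  have "\<exists>p. 2 ^ p \<le> R l powr (\<delta> - \<alpha>) \<and> R l powr (\<delta> - \<alpha>) < 2 * 2 ^ p" for l
  proof -
    let ?x = "R l powr (\<delta> - \<alpha>)"
    have x: "1 \<le> ?x" using R \<delta> by (simp add: ge_one_powr_ge_zero)
    then have fl: "1 \<le> \<lfloor>?x\<rfloor>" by simp
    then have "1 \<le> nat \<lfloor>?x\<rfloor>" by linarith
    then obtain p where p: "2 ^ p \<le> nat \<lfloor>?x\<rfloor>" "nat \<lfloor>?x\<rfloor> < 2 ^ (p + 1)" using ex_power_ivl1[of 2 "nat \<lfloor>?x\<rfloor>"] by auto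
    have "real (2 ^ p) \<le> real (nat \<lfloor>?x\<rfloor>)" "real (nat \<lfloor>?x\<rfloor>) + 1 \<le> real (2 ^ (p + 1))"
      using p by linarith+
    moreover have "real (nat \<lfloor>?x\<rfloor>) = of_int \<lfloor>?x\<rfloor>" using fl by simp
    moreover have "of_int \<lfloor>?x\<rfloor> \<le> ?x" "?x < of_int \<lfloor>?x\<rfloor> + 1" by linarith+
    ultimately have "real (2 ^ p) \<le> ?x" "?x < real (2 ^ (p + 1))" by linarith+
    then show ?thesis by (intro exI[of _ p]) simp
  qed
  then obtain p where p: "\<And>l. 2 ^ p l \<le> R l powr (\<delta> - \<alpha>)" "\<And>l. R l powr (\<delta> - \<alpha>) < 2 * 2 ^ p l" by metis
  define L where "L l = \<kappa> * R l powr \<alpha>" for l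
  have L0: "0 \<le> L l" for l using \<kappa>(1) by (simp add: L_def)
  have L: "L l * 2 ^ p l \<le> \<kappa> * R l powr \<delta>" for l
  proof -
    have "L l * 2 ^ p l \<le> L l * R l powr (\<delta> - \<alpha>)" by (rule mult_left_mono[OF p(1) L0])
    also have "\<dots> = \<kappa> * R l powr \<delta>" unfolding L_def mult.assoc powr_add[symmetric] by simp
    finally show ?thesis .
  qed
  \<comment> \<open>Some coordinate direction; which one is immaterial.\<close>
  define e :: "real ^ 'n" where "e = axis undefined 1"
  have e: "norm e = 1" by (simp add: e_def)
  define am where "am l x = (if q < 2 then rs_fun e (p l) (L l) x else cnj (rs_fun e (p l) (L l) x))" for l x
  have am: "Fam (\<lambda>_ _. 1) (\<lambda>_ l _. (4 ^ (l + l0)) powr \<delta>) am"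
  proof -
    have F: "Fam (\<lambda>_ _. 1) (\<lambda>_ l _. (4 ^ (l + l0)) powr \<delta>) (\<lambda>l. rs_fun e (p l) (L l))"
      by (rule rs_fun_Fam[OF e L0]) (use L \<kappa>(1) in \<open>auto simp: R_def\<close>)
    show ?thesis
    proof (cases "q < 2")
      case True
      then show ?thesis using F by (simp add: am_def[abs_def])
    next
      case False
      then show ?thesis using Fam_bounded_linear[OF F bounded_linear_cnj] by (simp add: am_def[abs_def])
    qed
  qed
  have \<delta>0: "0 \<le> \<delta>" using \<delta> \<alpha>0 by simp
  interpret lac: lacunary e l0 \<theta> B \<rho> \<delta> am by unfold_locales (rule e \<theta> B \<theta>1 \<theta>0 \<rho> \<delta>0 am | assumption)+
  have lacR: "lac.R l = R l" for l by (simp add: lac.R_def R_def)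
  \<comment> \<open>The constant does not depend on l, because \<open>lac.sym\<close> contains all
    the scales.\<close>
  obtain C' where C': "\<And>f. f \<in> schwartz \<Longrightarrow> ?nrm (pdo lac.sym f) \<le> ennreal C' * ?nrm f"
    using bdd[OF lac.sym_symbol] unfolding pdo_bounded_def by blast
  define z where "z l m = (R l + real_of_int m * L l) *\<^sub>R e" for l and m :: int
  have z_near: "norm (z l m - R l *\<^sub>R e) \<le> \<kappa> * R l powr \<delta>" if "\<bar>m\<bar> \<le> 2 ^ p l" for l m
  proof -
    have "norm (z l m - R l *\<^sub>R e) = \<bar>real_of_int m\<bar> * L l" using e L0[of l] by (simp add: z_def scaleR_add_left abs_mult)
    also have "\<bar>real_of_int m\<bar> = real_of_int \<bar>m\<bar>" by simp
    also have "real_of_int \<bar>m\<bar> \<le> real_of_int (2 ^ p l)" using that by (simp only: of_int_le_iff)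
    finally have "norm (z l m - R l *\<^sub>R e) \<le> L l * 2 ^ p l" using L0[of l] by (simp add: mult.commute mult_right_mono)
    then show ?thesis using L[of l] by linarith
  qed
  have gap4: "R l / (4 * B) \<le> R l / 4" for l using B R[of l] by (intro divide_left_mono) auto
  have z_norm: "R l \<le> 2 * norm (z l m)" "norm (z l m) + 1 \<le> 2 * R l" if "\<bar>m\<bar> \<le> 2 ^ p l" for l m
  proof -
    have n: "norm (R l *\<^sub>R e) = R l" using e R(2)[of l] by simp
    have "norm (z l m - R l *\<^sub>R e) + 1 \<le> R l / 4" using z_near[OF that] gap[of l] gap4[of l] by linarith
    moreover have "norm (z l m) \<le> norm (R l *\<^sub>R e) + norm (z l m - R l *\<^sub>R e)" by (rule norm_triangle_sub)
    moreover have "norm (R l *\<^sub>R e) \<le> norm (z l m) + norm (z l m - R l *\<^sub>R e)" by (metis norm_minus_commute norm_triangle_sub)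
    ultimately show "R l \<le> 2 * norm (z l m)" "norm (z l m) + 1 \<le> 2 * R l" using R[of l] unfolding n by argo+
  qed
  have sep: "hit (z l m) \<inter> hit (z l m') = {}" if "\<bar>m\<bar> \<le> 2 ^ p l" "m \<noteq> m'" for l m m'
  proof (rule \<kappa>(2)[OF R(1) _ z_norm(2)[OF that(1)]])
    have "z l m - z l m' = (real_of_int (m - m') * L l) *\<^sub>R e" by (simp add: z_def scaleR_diff_left[symmetric] left_diff_distrib)
    then have "norm (z l m - z l m') = real_of_int \<bar>m - m'\<bar> * L l" using e L0[of l] by (simp add: abs_mult)
    moreover have "1 \<le> \<bar>m - m'\<bar>" using that(2) by linarith
    then have "1 \<le> real_of_int \<bar>m - m'\<bar>" by linarith
    then have "1 * L l \<le> real_of_int \<bar>m - m'\<bar> * L l" using L0 by (intro mult_right_mono)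
    ultimately show "\<kappa> * R l powr \<alpha> \<le> norm (z l m - z l m')" by (simp add: L_def)
  qed
  have bump_bounds:
    "?nrm (inv_fourier (bsum h (z l) I c)) \<le> ennreal (A * R l powr s * (\<Sum>m\<in>I. norm (c m) powr q) powr (1 / q))"
    "ennreal (R l powr s / A * (\<Sum>m\<in>I. norm (c m) powr q) powr (1 / q)) \<le> ?nrm (inv_fourier (bsum h (z l) I c))"
    if "I \<subseteq> {- (2 ^ p l)..2 ^ p l}" for l I c
  proof -
    have ab: "\<bar>m\<bar> \<le> 2 ^ p l" if "m \<in> I" for m using that \<open>I \<subseteq> _\<close> by force
    have fin: "finite I" by (rule finite_subset[OF that]) simp
    have wK: "R l powr s \<le> K * wt s k \<and> wt s k \<le> K * R l powr s" if "m \<in> I" "k \<in> hit (z l m)" for m k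
      by (rule K(2)[OF R(1) z_norm[OF ab[OF that(1)]] that(2)])
    have "0 < R l powr s" using R(2)[of l] by simp
    note b = bump[of I "z l" "R l powr s" c, OF fin sep[OF ab] this wK]
    show "?nrm (inv_fourier (bsum h (z l) I c)) \<le> ennreal (A * R l powr s * (\<Sum>m\<in>I. norm (c m) powr q) powr (1 / q))"
      by (rule conjunct1[OF b])
    show "ennreal (R l powr s / A * (\<Sum>m\<in>I. norm (c m) powr q) powr (1 / q)) \<le> ?nrm (inv_fourier (bsum h (z l) I c))"
      by (rule conjunct2[OF b])
  qed
  have pdo_eq: "pdo lac.sym (inv_fourier (bsum h (z l) I c)) x
      = am l x * (\<Sum>m\<in>I. c m * exp (\<i> * complex_of_real (x \<bullet> z l m))) * inv_fourier h x"
    if "I \<subseteq> {- (2 ^ p l)..2 ^ p l}" for l I c x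
  proof -
    have fin: "finite I" by (rule finite_subset[OF that]) simp
    have "norm (\<xi> - lac.R l *\<^sub>R e) \<le> lac.R l / (4 * B)" if "bsum h (z l) I c \<xi> \<noteq> 0" for \<xi>
    proof -
      have "\<exists>m\<in>I. h (\<xi> - z l m) \<noteq> 0" using that unfolding bsum_def by (metis (no_types, lifting) mult_zero_right sum.neutral)
      then obtain m where m: "m \<in> I" "h (\<xi> - z l m) \<noteq> 0" by auto
      have ab: "\<bar>m\<bar> \<le> 2 ^ p l" using m(1) \<open>I \<subseteq> _\<close> by force
      have "norm (\<xi> - R l *\<^sub>R e) \<le> norm (\<xi> - z l m) + norm (z l m - R l *\<^sub>R e)"
        using norm_triangle_ineq[of "\<xi> - z l m" "z l m - R l *\<^sub>R e"] by simp
      then show ?thesis using supp[OF m(2)] z_near[OF ab] gap[of l] unfolding lacR by linarith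
    qed
    from lac.pdo_sym[OF bsum_schwartz[OF h fin] this] show ?thesis
      unfolding inv_fourier_bsum[OF h fin] by (simp add: mult.assoc)
  qed
  \<comment> \<open>If multiplication by \<open>am l\<close> turns the bumps with coefficients c
    into bumps with coefficients d, boundedness of the operator compares two \<ell>^q norms of
    coefficients; the weights R^s cancel later.\<close>
  have transfer: "R l powr s / A * (\<Sum>m\<in>J. norm (d m) powr q) powr (1 / q)
      \<le> max 1 C' * (A * R l powr s * (\<Sum>m\<in>I. norm (c m) powr q) powr (1 / q))"
    if I: "I \<subseteq> {- (2 ^ p l)..2 ^ p l}" and J: "J \<subseteq> {- (2 ^ p l)..2 ^ p l}"
      and eq: "\<And>x. am l x * (\<Sum>m\<in>I. c m * exp (\<i> * complex_of_real (x \<bullet> z l m))) = (\<Sum>m\<in>J. d m * exp (\<i> * complex_of_real (x \<bullet> z l m)))"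
    for l I J c d
  proof -
    have fin: "finite I" "finite J" using I J by (auto intro: finite_subset)
    have out: "pdo lac.sym (inv_fourier (bsum h (z l) I c)) = inv_fourier (bsum h (z l) J d)"
      unfolding pdo_eq[OF I] eq inv_fourier_bsum[OF h fin(2)] ..
    have "ennreal (R l powr s / A * (\<Sum>m\<in>J. norm (d m) powr q) powr (1 / q)) \<le> ?nrm (inv_fourier (bsum h (z l) J d))"
      by (rule bump_bounds[OF J])
    also have "\<dots> \<le> ennreal C' * ?nrm (inv_fourier (bsum h (z l) I c))"
      unfolding out[symmetric] by (intro C' inv_fourier_schwartz bsum_schwartz h fin)
    \<comment> \<open>C' may be negative, and \<open>ennreal\<close> then truncates it; the maximum
      allows a return to real numbers.\<close>
    also have "\<dots> \<le> ennreal (max 1 C') * ennreal (A * R l powr s * (\<Sum>m\<in>I. norm (c m) powr q) powr (1 / q))"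
      by (intro mult_mono ennreal_leI bump_bounds[OF I]) auto
    also have "\<dots> = ennreal (max 1 C' * (A * R l powr s * (\<Sum>m\<in>I. norm (c m) powr q) powr (1 / q)))"
      by (rule ennreal_mult[symmetric]) (use A in auto)
    finally show ?thesis by (subst (asm) ennreal_le_iff) (use A in auto)
  qed
  define \<gamma> where "\<gamma> = \<bar>1 / q - 1 / 2\<bar>"
  have \<gamma>: "0 < \<gamma>" using q by (auto simp: \<gamma>_def field_simps)
  define D where "D = max 1 C' * A * A"
  have D: "1 \<le> D" unfolding D_def using mult_mono[OF mult_mono[of 1 "max 1 C'" 1 A] A] A by simp
  have growth: "(2 ^ p l) powr \<gamma> \<le> D" for l
  proof -
    have subs: "{0} \<subseteq> {- (2 ^ p l)..(2 ^ p l :: int)}" "int ` {..<2 ^ p l} \<subseteq> {- (2 ^ p l)..2 ^ p l}"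
    proof -
      have "int m \<le> 2 ^ p l" if "m < 2 ^ p l" for m
      proof -
        have "int m < int (2 ^ p l)" using that by (simp only: of_nat_less_iff)
        then show ?thesis by simp
      qed
      moreover have "- (2 ^ p l) \<le> int m" for m by (rule order_trans[of _ 0]) simp_all
      ultimately show "int ` {..<2 ^ p l} \<subseteq> {- (2 ^ p l)..2 ^ p l}" by auto
    qed simp
    have Rs: "0 < R l powr s" using R(2)[of l] by simp
    show ?thesis
    proof (cases "q < 2")
      case True
      have "R l powr s / A * (\<Sum>m\<in>int ` {..<2 ^ p l}. norm (rs_coeff (p l) m) powr q) powr (1 / q)
          \<le> max 1 C' * (A * R l powr s * (\<Sum>m\<in>{0::int}. norm (1 :: complex) powr q) powr (1 / q))"
        by (rule transfer[OF subs]) (use True in \<open>simp add: am_def z_def rs_fun_shift[of e _ _ _ "R l", simplified]\<close>)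
      then have "(2 ^ p l) powr (1 / q - 1 / 2) \<le> D"
        using Rs A q by (simp add: rs_coeff_sum D_def field_simps)
      moreover have "\<gamma> = 1 / q - 1 / 2" using True q by (simp add: \<gamma>_def field_simps)
      ultimately show ?thesis by simp
    next
      case False
      have "R l powr s / A * (\<Sum>j\<in>{- (2 ^ p l)..2 ^ p l}. norm (autocorr (p l) j) powr q) powr (1 / q)
          \<le> max 1 C' * (A * R l powr s * (\<Sum>m\<in>int ` {..<2 ^ p l}. norm (rs_coeff (p l) m) powr q) powr (1 / q))"
        by (rule transfer[OF subs(2) order_refl]) (use False in \<open>simp only: am_def z_def rs_fun_cnj if_False\<close>)
      \<comment> \<open>Of the output only the central bump j = 0 is kept; its coefficient is 1 by
        \<open>autocorr_0\<close>, and the other terms are nonnegative.\<close>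
      moreover have "1 \<le> (\<Sum>j\<in>{- (2 ^ p l)..2 ^ p l}. norm (autocorr (p l) j) powr q)"
        using member_le_sum[of 0 "{- (2 ^ p l)..2 ^ p l :: int}" "\<lambda>j. norm (autocorr (p l) j) powr q"] by (simp add: autocorr_0)
      then have "1 \<le> (\<Sum>j\<in>{- (2 ^ p l)..2 ^ p l}. norm (autocorr (p l) j) powr q) powr (1 / q)"
        using q by (intro ge_one_powr_ge_zero) auto
      then have "R l powr s / A * 1 \<le> R l powr s / A * (\<Sum>j\<in>{- (2 ^ p l)..2 ^ p l}. norm (autocorr (p l) j) powr q) powr (1 / q)"
        using Rs A by (intro mult_left_mono) auto
      ultimately have "R l powr s / A \<le> max 1 C' * (A * R l powr s * (2 ^ p l) powr (1 / q - 1 / 2))"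
        using q by (simp add: rs_coeff_sum)
      then have "1 \<le> D * (2 ^ p l) powr (1 / q - 1 / 2)" using Rs A by (simp add: D_def field_simps)
      also have "1 / q - 1 / 2 = - \<gamma>" using False q by (simp add: \<gamma>_def field_simps)
      finally show ?thesis by (simp add: powr_minus_divide field_simps)
    qed
  qed
  \<comment> \<open>The scale is chosen so that R^(\<delta> - \<alpha>) exceeds 2 (D +
    1)^(1/\<gamma>). As M is more than half of that power, M^\<gamma> is at least D + 1, against
    \<open>growth\<close>.\<close>
  obtain l where "(2 * (D + 1) powr (1 / \<gamma>)) powr (1 / (\<delta> - \<alpha>)) < 4 ^ l" using real_arch_pow[of 4] by auto
  also have "(4::real) ^ l \<le> R l" unfolding R_def by (rule power_increasing) auto
  finally have "((2 * (D + 1) powr (1 / \<gamma>)) powr (1 / (\<delta> - \<alpha>))) powr (\<delta> - \<alpha>) \<le> R l powr (\<delta> - \<alpha>)"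
    using \<delta> by (intro powr_mono2) auto
  also have "\<dots> < 2 * 2 ^ p l" by (rule p)
  finally have "(D + 1) powr (1 / \<gamma>) \<le> 2 ^ p l" using \<delta> by (simp add: powr_powr)
  then have "((D + 1) powr (1 / \<gamma>)) powr \<gamma> \<le> (2 ^ p l) powr \<gamma>" using \<gamma> by (intro powr_mono2) auto
  then have "D + 1 \<le> D" using \<gamma> D growth[of l] by (simp add: powr_powr)
  then show False by simp
qed

end

theorem corollary1p4:
  fixes q :: ennreal and s \<alpha> \<delta> \<rho> C :: real
    and \<eta> :: "int ^ 'n::finite \<Rightarrow> real ^ 'n \<Rightarrow> complex"
  assumes "1 < q" "q < \<infinity>" "q \<noteq> 2"
    and "0 \<le> \<delta>" "\<delta> \<le> \<rho>" "\<rho> \<le> 1" "\<delta> < 1"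
    and "0 \<le> \<alpha>" "\<alpha> < 1" "\<alpha> \<le> \<rho>"
    and "C > 1" "alpha_partition \<alpha> C \<eta>"
  shows "(\<forall>\<sigma>\<in>symbol_class 0 \<rho> \<delta>. pdo_bounded \<eta> \<alpha> 2 q s \<sigma>) \<longleftrightarrow> \<delta> \<le> \<alpha>"
proof -
  interpret alpha_setting \<alpha> C \<eta> by unfold_locales (rule assms)+
  obtain q' where q: "q = ennreal q'" "0 \<le> q'" using assms(2) by (cases q) auto
  have "ennreal 1 < ennreal q'" using assms(1) q by simp
  then have "1 < q'" by (subst (asm) ennreal_less_iff) auto
  moreover have "q' \<noteq> 2" using assms(3) q by auto
  ultimately show ?thesis
    unfolding q(1) using sufficiency[of q' _ \<rho> \<delta> s] necessity[of q' \<delta> \<rho> s] assms by (meson linorder_not_less)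
qed

end
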